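(* Let $\alpha\in(0,1)$. For every $\lambda_0\in(0,1)$ there exists $\ell_0=\ell_0(\lambda_0)\in\mathbb{N}$ with the property that for every $\ell\in\mathbb{N}$ with $\ell\ge\ell_0$ there exist $\varepsilon>0$ and a smooth curve $$(-\varepsilon,\varepsilon)\to(0,+\infty)\times(0,\lambda_0)\times\mathcal{P}^{2,\alpha}_{S^2}(\mathbb{R}),\qquad s\mapsto(\mu_s,\xi_s,h_s)$$ with $$h_s(x)=\xi_s+s\cos(\ell x)+o(s)\qquad\text{as } s\to0\text{ uniformly on }\mathbb{R}$$ and the property that the overdetermined boundary value problem $$\Delta w+\mu w=0\ \text{ in }\widetilde\Omega_h,\qquad w=1\ \text{ on }\partial\widetilde\Omega_h,\qquad |\nabla w|=0\ \text{ on }\partial\widetilde\Omega_h$$ with $\mu=\mu_s$, $h=h_s$ admits, for every $s\in(-\varepsilon,\varepsilon)$, a classical solution. Here $\Delta$ denotes the Laplace-Beltrami operator on the unit sphere $S^2$ with respect to the standard round metric.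
   Context: $C^{2,\alpha}_p(\mathbb{R})$ denotes the Banach space of $2\pi$-periodic and even $C^{2,\alpha}$-functions on $\mathbb{R}$, and $$\mathcal{P}^{2,\alpha}_{S^2}(\mathbb{R}):=\bigl\{h\in C^{2,\alpha}_p(\mathbb{R}):\ 0<h<\tfrac{\pi}{2}\ \text{on }\mathbb{R}\bigr\}.$$ For $h\in\mathcal{P}^{2,\alpha}_{S^2}(\mathbb{R})$, $$\widetilde\Omega_h:=\bigl\{\bigl(\cos x\cos(h(x)t),\ \sin x\cos(h(x)t),\ \sin(h(x)t)\bigr)\in S^2:\ |t|<1,\ x\in\mathbb{R}\bigr\},$$ an open neighborhood of the equator $S^1\times\{0\}\subset S^2$ bounded by the two curves $x\mapsto(\cos x\cos h(x),\sin x\cos h(x),\sin(\pm h(x)))$. *)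

theory Defs
  imports "HOL-Analysis.Analysis"
begin

section \<open>The space of even, periodic Hoelder functions\<close>

text \<open>For a periodic function, the global Hoelder condition on the second derivative is
  equivalent to the local one, so the norm below is finite on this space and makes it a
  Banach space.\<close>

definition C2_Hoelder_per_even :: "real \<Rightarrow> (real \<Rightarrow> real) set" where
  "C2_Hoelder_per_even \<alpha> =
    {h. (\<forall>x. h (x + 2 * pi) = h x) \<and> (\<forall>x. h (- x) = h x) \<and>
        (\<forall>x. h differentiable (at x)) \<and> (\<forall>x. deriv h differentiable (at x)) \<and>
        (\<exists>C. \<forall>x y. \<bar>deriv (deriv h) x - deriv (deriv h) y\<bar> \<le> C * \<bar>x - y\<bar> powr \<alpha>)}"

definition sup_norm :: "(real \<Rightarrow> real) \<Rightarrow> real" where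
  "sup_norm f = (SUP x. \<bar>f x\<bar>)"

definition Hoelder_seminorm :: "real \<Rightarrow> (real \<Rightarrow> real) \<Rightarrow> real" where
  "Hoelder_seminorm \<alpha> f = (SUP (x, y) \<in> {(x, y). x \<noteq> y}. \<bar>f x - f y\<bar> / \<bar>x - y\<bar> powr \<alpha>)"

definition C2_Hoelder_norm :: "real \<Rightarrow> (real \<Rightarrow> real) \<Rightarrow> real" where
  "C2_Hoelder_norm \<alpha> h = sup_norm h + sup_norm (deriv h) + sup_norm (deriv (deriv h))
     + Hoelder_seminorm \<alpha> (deriv (deriv h))"

definition P_sphere :: "real \<Rightarrow> (real \<Rightarrow> real) set" where
  "P_sphere \<alpha> = {h \<in> C2_Hoelder_per_even \<alpha>. \<forall>x. 0 < h x \<and> h x < pi / 2}"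


section \<open>Smooth curves\<close>

text \<open>Differentiability of a curve \<open>c\<close> into the Banach space above: convergence of
  the difference quotients in the \<open>C2_Hoelder_norm\<close>, not merely pointwise.\<close>

definition has_C2_Hoelder_derivative ::
    "real \<Rightarrow> (real \<Rightarrow> real \<Rightarrow> real) \<Rightarrow> (real \<Rightarrow> real) \<Rightarrow> real \<Rightarrow> bool" where
  "has_C2_Hoelder_derivative \<alpha> c v s \<longleftrightarrow>
    v \<in> C2_Hoelder_per_even \<alpha> \<and>
    ((\<lambda>k. C2_Hoelder_norm \<alpha> (\<lambda>x. (c (s + k) x - c s x) / k - v x)) \<longlongrightarrow> 0) (at 0)"

text \<open>Here \<open>D n\<close> is the \<open>n\<close>-th derivative of the curve \<open>c\<close>;
  \<open>I\<close> is meant to be an open interval.\<close>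

definition smooth_C2_Hoelder_curve ::
    "real \<Rightarrow> real set \<Rightarrow> (real \<Rightarrow> real \<Rightarrow> real) \<Rightarrow> bool" where
  "smooth_C2_Hoelder_curve \<alpha> I c \<longleftrightarrow>
    (\<forall>s\<in>I. c s \<in> C2_Hoelder_per_even \<alpha>) \<and>
    (\<exists>D :: nat \<Rightarrow> real \<Rightarrow> real \<Rightarrow> real.
      (\<forall>s\<in>I. D 0 s = c s) \<and>
      (\<forall>n. \<forall>s\<in>I. has_C2_Hoelder_derivative \<alpha> (D n) (D (Suc n) s) s))"

definition smooth_real_curve :: "real set \<Rightarrow> (real \<Rightarrow> real) \<Rightarrow> bool" where
  "smooth_real_curve I f \<longleftrightarrow> (\<forall>n. (deriv ^^ n) f differentiable_on I)"

text \<open>A curve into the product of two copies of the reals and the Hoelder space is smooth iff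
  its three components are.\<close>

definition smooth_product_curve ::
    "real \<Rightarrow> real set \<Rightarrow> (real \<Rightarrow> real \<times> real \<times> (real \<Rightarrow> real)) \<Rightarrow> bool" where
  "smooth_product_curve \<alpha> I c \<longleftrightarrow>
    smooth_real_curve I (\<lambda>s. fst (c s)) \<and>
    smooth_real_curve I (\<lambda>s. fst (snd (c s))) \<and>
    smooth_C2_Hoelder_curve \<alpha> I (\<lambda>s. snd (snd (c s)))"


section \<open>Gradient, divergence and Laplace--Beltrami operator on the unit sphere\<close>

abbreviation S2 :: "(real ^ 3) set" where
  "S2 \<equiv> sphere 0 1"

text \<open>Orthogonal projection onto the tangent plane of the sphere at \<open>p\<close>.\<close>

definition tangent_proj :: "real ^ 3 \<Rightarrow> real ^ 3 \<Rightarrow> real ^ 3" where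
  "tangent_proj p v = v - (v \<bullet> p) *\<^sub>R p"

text \<open>The Riemannian gradient of \<open>w\<close> at \<open>p\<close>: the tangent vector \<open>g\<close>
  that represents the differential of \<open>w\<close> with respect to the round metric. The derivative
  is taken within a subset \<open>A\<close> of the sphere, so no extension of \<open>w\<close> off the
  sphere is involved; if \<open>A\<close> is the closure of a domain and \<open>p\<close> is a boundary
  point, it is the one-sided derivative.\<close>

definition has_sphere_gradient ::
    "(real ^ 3) set \<Rightarrow> (real ^ 3 \<Rightarrow> real) \<Rightarrow> real ^ 3 \<Rightarrow> real ^ 3 \<Rightarrow> bool" where
  "has_sphere_gradient A w p g \<longleftrightarrow>
    g \<bullet> p = 0 \<and> (w has_derivative (\<lambda>v. g \<bullet> v)) (at p within A)"

text \<open>Let \<open>D\<close> be a derivative at \<open>p\<close>, within the sphere, of a tangent field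
  \<open>X\<close>. Its restriction to the tangent plane is unique, its value on the normal direction
  is arbitrary. The Levi-Civita connection of the round metric is \<open>v \<mapsto> tangent_proj p (D v)\<close>
  for tangent \<open>v\<close>, and the divergence of \<open>X\<close> at \<open>p\<close> is the trace of this
  endomorphism of the tangent plane. It is written here as the trace of an endomorphism of
  the ambient space that vanishes on the normal line.\<close>

definition sphere_divergence :: "real ^ 3 \<Rightarrow> (real ^ 3 \<Rightarrow> real ^ 3) \<Rightarrow> real" where
  "sphere_divergence p D = trace (matrix (\<lambda>v. tangent_proj p (D (tangent_proj p v))))"


section \<open>The overdetermined problem\<close>

definition sphere_domain :: "(real \<Rightarrow> real) \<Rightarrow> (real ^ 3) set" where
  "sphere_domain h =
    {vector [cos x * cos (h x * t), sin x * cos (h x * t), sin (h x * t)] | x t. \<bar>t\<bar> < 1}"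

definition sphere_boundary :: "(real ^ 3) set \<Rightarrow> (real ^ 3) set" where
  "sphere_boundary \<Omega> = (top_of_set S2) frontier_of \<Omega>"

text \<open>A classical solution is of class \<open>C\<^sup>2\<close> in the (relatively open) domain and
  of class \<open>C\<^sup>1\<close> up to the boundary. \<open>G\<close> is the gradient field of
  \<open>w\<close> and \<open>DG\<close> a continuous derivative of it, so that
  \<open>sphere_divergence p (DG p)\<close> is the divergence of the gradient, i.e. the
  Laplace--Beltrami operator applied to \<open>w\<close>.\<close>

definition classical_solution ::
    "real \<Rightarrow> (real ^ 3) set \<Rightarrow> (real ^ 3 \<Rightarrow> real) \<Rightarrow> bool" where
  "classical_solution \<mu> \<Omega> w \<longleftrightarrow>
    (\<exists>(G :: real ^ 3 \<Rightarrow> real ^ 3) (DG :: real ^ 3 \<Rightarrow> ((real ^ 3) \<Rightarrow>\<^sub>L (real ^ 3))).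
      (\<forall>p \<in> closure \<Omega>. has_sphere_gradient (closure \<Omega>) w p (G p)) \<and>
      continuous_on (closure \<Omega>) G \<and>
      (\<forall>p\<in>\<Omega>. (G has_derivative blinfun_apply (DG p)) (at p within \<Omega>)) \<and>
      continuous_on \<Omega> DG \<and>
      (\<forall>p\<in>\<Omega>. sphere_divergence p (blinfun_apply (DG p)) + \<mu> * w p = 0) \<and>
      (\<forall>p \<in> sphere_boundary \<Omega>. w p = 1 \<and> norm (G p) = 0))"

end

theory Submission
  imports Defs
begin

text \<open>On the sphere without the poles, let \<open>x\<close> be the longitude and let \<open>y\<close> be defined by
  latitude \<open>= arctan (sinh y)\<close>. The round metric is \<open>(dx\<^sup>2 + dy\<^sup>2) / cosh\<^sup>2 y\<close>, so that the equation
  becomes \<open>w\<^bsub>xx\<^esub> + w\<^bsub>yy\<^esub> + \<mu> w / cosh\<^sup>2 y = 0\<close>. After scaling by \<open>l\<close> the weight is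
  \<open>1 / cosh\<^sup>2 (y / l)\<close>, a perturbation of size \<open>\<epsilon> = 1 / l\<^sup>2\<close> of the constant 1, for which \<open>- cos (2 \<theta>)\<close> solves
  the problem on the flat strip \<open>\<bar>\<theta>\<bar> \<le> \<pi>/2\<close>.

  The unknown domain is parametrised over this fixed strip by a map that is conformal up to
  a dilation \<open>om\<close>. The map, the transplanted solution, \<open>om\<^sup>2 = 3 (1 + Lam)\<close> and \<open>\<mu> = 4 l\<^sup>2 (1 + N) / om\<^sup>2\<close>
  are expanded in double power series in \<open>u = s e\<^sup>i\<^sup>\<xi>\<close> and \<open>v = s e\<^sup>-\<^sup>i\<^sup>\<xi>\<close>. The coefficient of \<open>u\<^sup>i v\<^sup>j\<close> solves
  a linear boundary value problem in \<open>\<theta>\<close> that depends only on the wave number \<open>k = i - j\<close>; it is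
  uniquely solvable except for \<open>k = 0\<close>, where \<open>N\<close> is adjusted, and \<open>\<bar>k\<bar> = 1\<close>, where \<open>Lam\<close> is adjusted.
  Powers of \<open>\<kappa>\<close> are split off such that the resulting fixed point equation is \<open>x = \<kappa> \<Psi> x\<close> with
  \<open>\<Psi>\<close> uniformly Lipschitz on the unit ball of a Banach algebra of coefficient families, so that
  the contraction principle applies for small \<open>\<kappa>\<close>. The tangential derivatives in \<open>\<xi>\<close>, which make
  the problem lose derivatives, only multiply coefficients by \<open>k\<close> and are absorbed by the mode solvers.

  All series converge for \<open>\<bar>s\<bar> \<le> 1/2\<close> and are smooth in \<open>(s, \<xi>)\<close>, so that the boundary curves,
  obtained by inverting the first component of the map on the boundary, are smooth in the parameter.
  Since \<open>Lam\<close> and \<open>N\<close> are even in \<open>s\<close>, the first order term of the boundary is a multiple of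
  \<open>cos (l x)\<close>, and the parameter is rescaled such that this multiple is 1.\<close>

text \<open>Why 3: in wave number \<open>k\<close> the linear equation is
  \<open>V'' = (3 k^2 - 4) V + g\<close> with \<open>V'(0) = 0\<close> and
  \<open>V(pi/2) = 0\<close>, and 3 is the value of \<open>om^2\<close> for which
  \<open>|k| = 1\<close> has the kernel \<open>cos \<theta>\<close>, from which the domains
  bifurcate. For the other modes the vanishing gradient on the boundary is no further restriction:
  it reads \<open>V' = 4 Y\<close> at \<open>pi/2\<close> and determines the displacement
  \<open>Y\<close>. For \<open>k = 0\<close> the displacement is 0, one condition is left over, and
  \<open>N\<close> pays for it.

  A fixed point argument in a Banach algebra wants products only. The weight
  \<open>1 / cosh^2\<close> is therefore not expanded but written as \<open>1 - E T^2\<close>, where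
  \<open>T\<close> is a further unknown governed by a Riccati equation.

  Series in \<open>u\<close> and \<open>v\<close> rather than Fourier series in \<xi> separate two
  demands: the norm needs only the quadratic weights that make convolution bounded, while
  \<open>s^(i+j)\<close> with \<open>|s| \<le> 1/2\<close> beats every power of \<open>k\<close>, so
  that smoothness is free. \<open>L\<close> and \<open>N\<close> live on \<open>i = j\<close>; they
  are series in \<open>u v = s^2\<close>, constant in \<xi> as \<open>om\<close> and \<mu> must
  be.\<close>

text \<open>The coefficients of an element \<open>a\<close> are the quotients \<open>a (n, \<theta>) / wt n\<close>; the weight is chosen such
  that convolution in \<open>n\<close> is bounded. The variable \<open>\<theta>\<close> ranges over all reals because
  coefficients are extended constantly from \<open>{0..pi/2}\<close>.\<close>

type_synonym alg = "((nat \<times> nat) \<times> real) \<Rightarrow>\<^sub>C real"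

section \<open>The weighted Banach algebra of coefficient families\<close>

definition wt1 :: "nat \<Rightarrow> real" where "wt1 i = (real i + 1)^2"

definition wt :: "nat \<times> nat \<Rightarrow> real" where "wt n = wt1 (fst n) * wt1 (snd n)"

lemma wt1_pos [simp]: "wt1 i > 0" and wt1_ge1: "wt1 i \<ge> 1" and wt1_nz [simp]: "wt1 i \<noteq> 0"
proof -
  have "1 \<le> (real i + 1)^2" by (rule one_le_power) simp
  then show "wt1 i \<ge> 1" by (simp add: wt1_def)
  then show "wt1 i > 0" "wt1 i \<noteq> 0" by auto
qed

lemma wt_pos [simp]: "wt n > 0" and wt_nz [simp]: "wt n \<noteq> 0"
  by (simp_all add: wt_def)

lemma wt_ge1: "wt n \<ge> 1"
  unfolding wt_def using mult_mono[OF wt1_ge1 wt1_ge1, of "fst n" "snd n"] by (simp add: less_imp_le)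

definition cf :: "alg \<Rightarrow> nat \<times> nat \<Rightarrow> real \<Rightarrow> real" where
  "cf a n \<theta> = apply_bcontfun a (n, \<theta>) / wt n"

lemma apply_cf: "apply_bcontfun a (n, \<theta>) = wt n * cf a n \<theta>"
  by (simp add: cf_def)

lemma cf_add [simp]: "cf (a + b) n \<theta> = cf a n \<theta> + cf b n \<theta>"
  and cf_diff [simp]: "cf (a - b) n \<theta> = cf a n \<theta> - cf b n \<theta>"
  and cf_minus [simp]: "cf (- a) n \<theta> = - cf a n \<theta>"
  and cf_scaleR [simp]: "cf (r *\<^sub>R a) n \<theta> = r * cf a n \<theta>"
  by (simp_all add: cf_def add_divide_distrib diff_divide_distrib)

lemma alg_eqI: "(\<And>n \<theta>. cf a n \<theta> = cf b n \<theta>) \<Longrightarrow> a = b"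
  by (rule bcontfun_eqI) (metis apply_cf surj_pair)

lemma cf_bound: "\<bar>cf a n \<theta>\<bar> \<le> norm a / wt n"
  using norm_bounded[of a "(n, \<theta>)"] by (simp add: cf_def divide_right_mono less_imp_le)

lemma cf_cont [continuous_intros]:
  assumes "continuous_on S f" shows "continuous_on S (\<lambda>x. cf a n (f x))"
proof -
  have "continuous_on UNIV (\<lambda>\<theta>. apply_bcontfun a (n, \<theta>))"
    by (rule continuous_on_compose2[OF continuous_on_apply_bcontfun[of UNIV a]])
      (auto intro!: continuous_intros)
  then show ?thesis unfolding cf_def
    by (intro continuous_intros assms continuous_on_compose2[of UNIV "\<lambda>\<theta>. apply_bcontfun a (n, \<theta>)" S f]) auto
qed

text \<open>The index set is discrete, so the product is a disjoint union of open slices, and joint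
  continuity is continuity on each slice.\<close>

lemma continuous_on_discrete_fst:
  fixes f :: "((nat \<times> nat) \<times> real) \<Rightarrow> real"
  assumes "\<And>n. continuous_on UNIV (\<lambda>\<theta>. f (n, \<theta>))"
  shows "continuous_on UNIV f"
proof -
  have op: "open ({n} :: (nat \<times> nat) set)" for n
  proof -
    have "{n} = {fst n} \<times> {snd n}" by auto
    then show ?thesis by (simp only:) (intro open_Times open_discrete)
  qed
  have "continuous_on (\<Union>n. {n} \<times> UNIV) f"
  proof (rule continuous_on_open_UN)
    fix n :: "nat \<times> nat"
    show "open ({n} \<times> (UNIV :: real set))" by (intro open_Times op) auto
    have "continuous_on ({n} \<times> UNIV) (\<lambda>x. f (n, snd x))"
      by (rule continuous_on_compose2[OF assms[of n]]) (auto intro!: continuous_intros)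
    then show "continuous_on ({n} \<times> UNIV) f"
      by (rule continuous_on_eq) auto
  qed
  moreover have "(\<Union>n. {n} \<times> UNIV) = (UNIV :: ((nat \<times> nat) \<times> real) set)" by auto
  ultimately show ?thesis by simp
qed

text \<open>\<open>Bcontfun\<close> says nothing about arguments that are not bounded and
  continuous, so every use of \<open>mk\<close> passes through \<open>cf_mk\<close>, whose decay
  hypothesis is boundedness after multiplication by \<open>wt\<close>.\<close>

definition mk :: "(nat \<times> nat \<Rightarrow> real \<Rightarrow> real) \<Rightarrow> alg" where
  "mk c = Bcontfun (\<lambda>(n, \<theta>). wt n * c n \<theta>)"

lemma
  assumes "\<And>n. continuous_on UNIV (c n)" and "\<And>n \<theta>. \<bar>c n \<theta>\<bar> \<le> C / wt n"
  shows cf_mk: "cf (mk c) n \<theta> = c n \<theta>" and norm_mk: "norm (mk c) \<le> C"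
proof -
  let ?f = "\<lambda>(n, \<theta>). wt n * c n \<theta>"
  have b: "\<bar>?f x\<bar> \<le> C" for x
    using assms(2)[of "fst x" "snd x"] by (simp add: case_prod_beta abs_mult field_simps less_imp_le)
  have "?f \<in> bcontfun"
    by (rule bcontfun_normI[where b=C])
      (use b in \<open>auto intro!: continuous_on_discrete_fst continuous_intros assms(1)\<close>)
  then have *: "apply_bcontfun (mk c) = ?f" unfolding mk_def by (rule Bcontfun_inverse)
  show "cf (mk c) n \<theta> = c n \<theta>" by (simp add: cf_def *)
  show "norm (mk c) \<le> C" by (rule norm_bound) (use b * in simp)
qed

lemma mk_bounded_linear:
  assumes cont: "\<And>a n. continuous_on UNIV (c a n)"
    and bd: "\<And>a n \<theta>. \<bar>c a n \<theta>\<bar> \<le> C * norm a / wt n"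
    and add: "\<And>a b n \<theta>. c (a + b) n \<theta> = c a n \<theta> + c b n \<theta>"
    and sc: "\<And>a r n \<theta>. c (r *\<^sub>R a) n \<theta> = r * c a n \<theta>"
  shows "bounded_linear (\<lambda>a. mk (c a))"
proof (rule bounded_linear_intro[where K=C])
  have cfm: "cf (mk (c a)) n \<theta> = c a n \<theta>" for a n \<theta>
    by (rule cf_mk[OF cont bd])
  show "mk (c (a + b)) = mk (c a) + mk (c b)" for a b
    by (rule alg_eqI) (simp add: cfm add)
  show "mk (c (r *\<^sub>R a)) = r *\<^sub>R mk (c a)" for a r
    by (rule alg_eqI) (simp add: cfm sc)
  show "norm (mk (c a)) \<le> norm a * C" for a
    using norm_mk[OF cont bd] by (simp add: mult.commute)
qed

subsection \<open>Convolution\<close>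

text \<open>With \<open>p = i + 1\<close> and \<open>q = n - i + 1\<close> one has
  \<open>(n+1)^2 \<le> (p+q)^2 \<le> 2 p^2 + 2 q^2\<close>, which splits each term into single
  reciprocals over \<open>wt1 n\<close>. Their sums are at most 2 by telescoping; 8 is
  \<open>2 * 2 + 2 * 2\<close>. This makes convolution bounded.\<close>

lemma wt1_conv: "(\<Sum>i\<le>n. 1 / (wt1 i * wt1 (n - i))) \<le> 8 / wt1 n"
proof -
  have s2: "(\<Sum>i\<le>n. 1 / wt1 i) \<le> 2 - 1 / (real n + 1)" for n
  proof (induction n)
    case (Suc n)
    have "1 / (real n + 2)^2 \<le> 1 / (real n + 1) - 1 / (real n + 2)"
      by (simp add: divide_simps) (simp add: field_simps power2_eq_square)
    with Suc show ?case by (simp add: wt1_def add_ac)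
  qed (simp add: wt1_def)
  then have s: "(\<Sum>i\<le>n. 1 / wt1 i) \<le> 2" by (rule order_trans) simp
  have p: "1 / (wt1 i * wt1 (n - i)) \<le> (2 / wt1 i + 2 / wt1 (n - i)) / wt1 n" if "i \<le> n" for i
  proof -
    define p q where "p = real i + 1" and "q = real (n - i) + 1"
    have pq: "p > 0" "q > 0" "p + q = real n + 2" using that by (auto simp: p_def q_def)
    have "wt1 n \<le> (p + q)^2" unfolding pq(3) wt1_def by (intro power_mono) auto
    also have "\<dots> \<le> 2 * p^2 + 2 * q^2" using sum_squares_bound[of p q] by (simp add: power2_sum)
    finally have "wt1 n \<le> 2 * p^2 + 2 * q^2" .
    then have "wt1 n / (p^2*q^2) \<le> (2 * p^2 + 2 * q^2) / (p^2*q^2)"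
      by (intro divide_right_mono) auto
    also have "\<dots> = 2 / p^2 + 2 / q^2" using pq by (simp add: field_simps)
    finally show ?thesis
      by (simp add: field_simps wt1_def[of i] wt1_def[of "n - i"] p_def q_def)
  qed
  have "(\<Sum>i\<le>n. 1 / (wt1 i * wt1 (n - i))) \<le> (\<Sum>i\<le>n. (2 / wt1 i + 2 / wt1 (n - i)) / wt1 n)"
    by (intro sum_mono p) auto
  also have "\<dots> = (2 * (\<Sum>i\<le>n. 1 / wt1 i) + 2 * (\<Sum>i\<le>n. 1 / wt1 (n - i))) / wt1 n"
    by (simp add: sum.distrib sum_distrib_left flip: sum_divide_distrib)
  also have "(\<Sum>i\<le>n. 1 / wt1 (n - i)) = (\<Sum>i\<le>n. 1 / wt1 i)"
    by (rule sum.nat_diff_reindex[of "\<lambda>i. 1 / wt1 i" "Suc n", unfolded lessThan_Suc_atMost, simplified])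
  also have "(2 * (\<Sum>i\<le>n. 1 / wt1 i) + 2 * (\<Sum>i\<le>n. 1 / wt1 i)) / wt1 n \<le> 8 / wt1 n"
    using s by (intro divide_right_mono) (auto simp: less_imp_le)
  finally show ?thesis .
qed

definition ccf :: "alg \<Rightarrow> alg \<Rightarrow> nat \<times> nat \<Rightarrow> real \<Rightarrow> real" where
  "ccf a b n \<theta> = (\<Sum>p\<le>fst n. \<Sum>q\<le>snd n. cf a (p, q) \<theta> * cf b (fst n - p, snd n - q) \<theta>)"

definition conv :: "alg \<Rightarrow> alg \<Rightarrow> alg" (infixl \<open>\<star>\<close> 70) where
  "a \<star> b = mk (ccf a b)"

lemma ccf_bound: "\<bar>ccf a b n \<theta>\<bar> \<le> (64 * norm a * norm b) / wt n"
proof -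
  have "\<bar>ccf a b n \<theta>\<bar> \<le> (\<Sum>p\<le>fst n. \<Sum>q\<le>snd n. \<bar>cf a (p, q) \<theta> * cf b (fst n - p, snd n - q) \<theta>\<bar>)"
    unfolding ccf_def by (intro order_trans[OF sum_abs] sum_mono order_refl)
  also have "\<dots> \<le> (\<Sum>p\<le>fst n. \<Sum>q\<le>snd n. (norm a * norm b) *
      (1 / (wt1 p * wt1 (fst n - p)) * (1 / (wt1 q * wt1 (snd n - q)))))"
  proof (intro sum_mono)
    fix p q
    have "\<bar>cf a (p, q) \<theta> * cf b (fst n - p, snd n - q) \<theta>\<bar>
        \<le> (norm a / wt (p, q)) * (norm b / wt (fst n - p, snd n - q))"
      unfolding abs_mult by (intro mult_mono cf_bound) (auto simp: less_imp_le)
    then show "\<bar>cf a (p, q) \<theta> * cf b (fst n - p, snd n - q) \<theta>\<bar> \<le> (norm a * norm b) *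
      (1 / (wt1 p * wt1 (fst n - p)) * (1 / (wt1 q * wt1 (snd n - q))))"
      by (simp add: wt_def field_simps)
  qed
  also have "\<dots> = norm a * norm b * ((\<Sum>p\<le>fst n. 1 / (wt1 p * wt1 (fst n - p)))
      * (\<Sum>q\<le>snd n. 1 / (wt1 q * wt1 (snd n - q))))"
    unfolding sum_product by (simp add: sum_distrib_left)
  also have "\<dots> \<le> norm a * norm b * ((8 / wt1 (fst n)) * (8 / wt1 (snd n)))"
    by (intro mult_left_mono mult_mono wt1_conv) (auto intro!: sum_nonneg simp: less_imp_le)
  finally show ?thesis by (simp add: wt_def mult_ac)
qed

lemma ccf_cont: "continuous_on UNIV (ccf a b n)"
  unfolding ccf_def by (intro continuous_intros)

lemma cf_conv: "cf (a \<star> b) n \<theta> = ccf a b n \<theta>"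
  unfolding conv_def by (rule cf_mk[OF ccf_cont ccf_bound])

lemma norm_conv: "norm (a \<star> b) \<le> 64 * norm a * norm b"
  unfolding conv_def by (rule norm_mk[OF ccf_cont ccf_bound])

lemma bounded_bilinear_conv: "bounded_bilinear conv"
proof
  show "(a + a') \<star> b = a \<star> b + a' \<star> b" for a a' b
    by (rule alg_eqI) (simp add: cf_conv ccf_def algebra_simps sum.distrib)
  show "a \<star> (b + b') = a \<star> b + a \<star> b'" for a b b'
    by (rule alg_eqI) (simp add: cf_conv ccf_def algebra_simps sum.distrib)
  show "(r *\<^sub>R a) \<star> b = r *\<^sub>R (a \<star> b)" for r a b
    by (rule alg_eqI) (simp add: cf_conv ccf_def sum_distrib_left mult_ac)
  show "a \<star> (r *\<^sub>R b) = r *\<^sub>R (a \<star> b)" for r a b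
    by (rule alg_eqI) (simp add: cf_conv ccf_def sum_distrib_left mult_ac)
  show "\<exists>K. \<forall>a b. norm (a \<star> b) \<le> norm a * norm b * K"
    by (rule exI[of _ 64]) (use norm_conv in \<open>simp add: mult_ac\<close>)
qed

subsection \<open>Elementary operators\<close>

definition cl :: "real \<Rightarrow> real" where "cl \<theta> = max 0 (min (pi/2) \<theta>)"

lemma cl_range [simp]: "0 \<le> cl \<theta>" "cl \<theta> \<le> pi/2" "cl \<theta> * 2 \<le> pi" and cl_id: "0 \<le> \<theta> \<Longrightarrow> \<theta> \<le> pi/2 \<Longrightarrow> cl \<theta> = \<theta>"
  using pi_gt_zero by (auto simp: cl_def max_def min_def)

lemma cl_cont: "continuous_on S cl"
  unfolding cl_def by (intro continuous_intros)

text \<open>All kernels in use are separable: a function of \<theta> times the integral of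
  \<open>q a\<close> over the part left of \<theta>, the part right of \<theta>, or the whole
  interval. \<open>j\<close> selects which one.\<close>

definition jset :: "nat \<Rightarrow> real \<Rightarrow> real set" where
  "jset j \<theta> = (if j = 0 then {0..\<theta>} else if j = 1 then {\<theta>..pi/2} else {0..pi/2})"

definition eopc :: "nat \<Rightarrow> (nat \<times> nat \<Rightarrow> real \<Rightarrow> real) \<Rightarrow> (nat \<times> nat \<Rightarrow> real \<Rightarrow> real) \<Rightarrow> alg \<Rightarrow>
    nat \<times> nat \<Rightarrow> real \<Rightarrow> real" where
  "eopc j p q a n \<theta> = p n (cl \<theta>) * integral (jset j (cl \<theta>)) (\<lambda>t. q n t * cf a n t)"

definition eop where "eop j p q a = mk (eopc j p q a)"

text \<open>The bound, uniform in the mode, is the operator bound in the sup norm. A gain of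
  derivatives is expressed by putting a factor such as \<open>1 + k^2\<close> into \<open>p\<close>
  and still having this bound.\<close>

definition eop_ok :: "nat \<Rightarrow> (nat \<times> nat \<Rightarrow> real \<Rightarrow> real) \<Rightarrow> (nat \<times> nat \<Rightarrow> real \<Rightarrow> real) \<Rightarrow> bool" where
  "eop_ok j p q \<longleftrightarrow> (\<forall>n. continuous_on UNIV (p n)) \<and> (\<forall>n. continuous_on UNIV (q n)) \<and>
     (\<exists>C. \<forall>n. \<forall>\<theta>\<in>{0..pi/2}. \<bar>p n \<theta>\<bar> * integral (jset j \<theta>) (\<lambda>t. \<bar>q n t\<bar>) \<le> C)"

lemma jset_integrable:
  fixes f :: "real \<Rightarrow> real"
  assumes "continuous_on UNIV f" shows "f integrable_on jset j \<theta>"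
  unfolding jset_def by (auto intro!: integrable_continuous_real continuous_on_subset[OF assms])

lemma
  assumes "eop_ok j p q"
  shows bounded_linear_eop: "bounded_linear (eop j p q)"
    and cf_eop: "cf (eop j p q a) n \<theta> = eopc j p q a n \<theta>"
proof -
  from assms obtain C where pc: "\<And>n. continuous_on UNIV (p n)" and qc: "\<And>n. continuous_on UNIV (q n)"
    and C: "\<And>n \<theta>. \<theta> \<in> {0..pi/2} \<Longrightarrow> \<bar>p n \<theta>\<bar> * integral (jset j \<theta>) (\<lambda>t. \<bar>q n t\<bar>) \<le> C"
    unfolding eop_ok_def by blast
  have fc: "continuous_on UNIV (\<lambda>t. q n t * cf a n t)" for a n
    by (intro continuous_intros qc)
  have int: "(\<lambda>t. q n t * cf a n t) integrable_on jset j \<theta>" for a n \<theta>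
    by (rule jset_integrable[OF fc])
  have cont: "continuous_on UNIV (eopc j p q a n)" for a n
  proof -
    have "continuous_on {0..pi/2} (\<lambda>\<theta>. integral (jset j \<theta>) (\<lambda>t. q n t * cf a n t))"
      unfolding jset_def
      using indefinite_integral_continuous_1[of "\<lambda>t. q n t * cf a n t" 0 "pi/2"]
        indefinite_integral_continuous_1'[of "\<lambda>t. q n t * cf a n t" 0 "pi/2"]
        integrable_continuous_real[OF continuous_on_subset[OF fc subset_UNIV]]
      by (cases "j = 0"; cases "j = 1") simp_all
    then have "continuous_on UNIV (\<lambda>\<theta>. integral (jset j (cl \<theta>)) (\<lambda>t. q n t * cf a n t))"
      by (rule continuous_on_compose2[OF _ cl_cont]) auto
    moreover have "continuous_on UNIV (\<lambda>\<theta>. p n (cl \<theta>))"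
      by (rule continuous_on_compose2[OF pc cl_cont]) auto
    ultimately show ?thesis unfolding eopc_def by (intro continuous_intros)
  qed
  have bd: "\<bar>eopc j p q a n \<theta>\<bar> \<le> C * norm a / wt n" for a n \<theta>
  proof -
    have iq: "(\<lambda>t. \<bar>q n t\<bar>) integrable_on jset j (cl \<theta>)"
      by (rule jset_integrable) (intro continuous_intros qc)
    have "norm (integral (jset j (cl \<theta>)) (\<lambda>t. q n t * cf a n t))
        \<le> integral (jset j (cl \<theta>)) (\<lambda>t. \<bar>q n t\<bar> * (norm a / wt n))"
    proof (rule integral_norm_bound_integral[OF int])
      show "(\<lambda>t. \<bar>q n t\<bar> * (norm a / wt n)) integrable_on jset j (cl \<theta>)"
        using integrable_on_mult_left[OF iq] by simp
      show "norm (q n t * cf a n t) \<le> \<bar>q n t\<bar> * (norm a / wt n)" for t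
        using mult_left_mono[OF cf_bound[of a n t], of "\<bar>q n t\<bar>"] by (simp add: abs_mult)
    qed
    also have "\<dots> = integral (jset j (cl \<theta>)) (\<lambda>t. \<bar>q n t\<bar>) * (norm a / wt n)"
      by (simp only: integral_mult_left)
    finally have "\<bar>eopc j p q a n \<theta>\<bar> \<le> \<bar>p n (cl \<theta>)\<bar> * (integral (jset j (cl \<theta>)) (\<lambda>t. \<bar>q n t\<bar>) * (norm a / wt n))"
      unfolding eopc_def abs_mult by (intro mult_left_mono) auto
    also have "\<dots> \<le> C * (norm a / wt n)"
      using mult_right_mono[OF C[of "cl \<theta>" n], of "norm a / wt n"]
      by (simp add: mult.assoc less_imp_le)
    finally show ?thesis by simp
  qed
  show "bounded_linear (eop j p q)" unfolding eop_def
  proof (rule mk_bounded_linear[OF cont bd])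
    fix a b n \<theta> r
    show "eopc j p q (a + b) n \<theta> = eopc j p q a n \<theta> + eopc j p q b n \<theta>"
      unfolding eopc_def using integral_add[OF int[of n a "cl \<theta>"] int[of n b "cl \<theta>"]] by (simp add: algebra_simps)
    show "eopc j p q (r *\<^sub>R a) n \<theta> = r * eopc j p q a n \<theta>"
      unfolding eopc_def by (simp add: mult.left_commute[of _ r])
  qed
  show "cf (eop j p q a) n \<theta> = eopc j p q a n \<theta>"
    unfolding eop_def by (rule cf_mk[OF cont bd])
qed

definition mulop :: "(nat \<times> nat \<Rightarrow> real \<Rightarrow> real) \<Rightarrow> alg \<Rightarrow> alg" where
  "mulop m a = mk (\<lambda>n \<theta>. m n (cl \<theta>) * cf a n \<theta>)"

lemma
  assumes c: "\<And>n. continuous_on UNIV (m n)" and b: "\<And>n \<theta>. \<theta> \<in> {0..pi/2} \<Longrightarrow> \<bar>m n \<theta>\<bar> \<le> C"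
  shows bounded_linear_mulop: "bounded_linear (mulop m)"
    and cf_mulop: "cf (mulop m a) n \<theta> = m n (cl \<theta>) * cf a n \<theta>"
proof -
  have cont: "continuous_on UNIV (\<lambda>\<theta>. m n (cl \<theta>) * cf a n \<theta>)" for n a
    by (intro continuous_intros continuous_on_compose2[OF c cl_cont]) auto
  have bd: "\<bar>m n (cl \<theta>) * cf a n \<theta>\<bar> \<le> C * norm a / wt n" for n a \<theta>
    unfolding abs_mult using mult_mono[OF b[of "cl \<theta>" n] cf_bound[of a n \<theta>]] b[of "cl \<theta>" n] by simp
  show "bounded_linear (mulop m)" unfolding mulop_def
    by (rule mk_bounded_linear[OF cont bd]) (auto simp: algebra_simps)
  show "cf (mulop m a) n \<theta> = m n (cl \<theta>) * cf a n \<theta>"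
    unfolding mulop_def by (rule cf_mk[OF cont bd])
qed

text \<open>Solvability at the mode \<open>(j+1, j)\<close>, of wave number 1, is what fixes the
  coefficient of \<open>L\<close> at \<open>(j, j)\<close>; the shift transports the one to the
  other and is bounded because \<open>wt\<close> increases.\<close>

definition shop :: "alg \<Rightarrow> alg" where
  "shop a = mk (\<lambda>n \<theta>. if fst n = snd n then cf a (Suc (fst n), snd n) \<theta> else 0)"

lemma bounded_linear_shop: "bounded_linear shop"
  and cf_shop: "cf (shop a) n \<theta> = (if fst n = snd n then cf a (Suc (fst n), snd n) \<theta> else 0)"
proof -
  have cont: "continuous_on UNIV (\<lambda>\<theta>. if fst n = snd n then cf a (Suc (fst n), snd n) \<theta> else 0)" for n a
    by (cases "fst n = snd n") (auto intro!: continuous_intros)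
  have bd: "\<bar>if fst n = snd n then cf a (Suc (fst n), snd n) \<theta> else 0\<bar> \<le> 1 * norm a / wt n" for n a \<theta>
  proof -
    have "wt1 (fst n) \<le> wt1 (Suc (fst n))" unfolding wt1_def by (intro power_mono) auto
    then have "wt n \<le> wt (Suc (fst n), snd n)" by (simp add: wt_def less_imp_le)
    then have "norm a / wt (Suc (fst n), snd n) \<le> norm a / wt n"
      by (intro divide_left_mono) (auto simp: wt_pos)
    then show ?thesis using cf_bound[of a "(Suc (fst n), snd n)" \<theta>]
      by (auto simp: less_imp_le)
  qed
  show "bounded_linear shop" unfolding shop_def
    by (rule mk_bounded_linear[OF cont bd]) (auto simp: algebra_simps)
  show "cf (shop a) n \<theta> = (if fst n = snd n then cf a (Suc (fst n), snd n) \<theta> else 0)"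
    unfolding shop_def by (rule cf_mk[OF cont bd])
qed

text \<open>Exchanging \<open>u\<close> and \<open>v\<close> is the reflection of \<xi>: invariant
  families evaluate to cosine series, anti-invariant ones to sine series.\<close>

definition swop :: "alg \<Rightarrow> alg" where
  "swop a = mk (\<lambda>n \<theta>. cf a (snd n, fst n) \<theta>)"

lemma bounded_linear_swop: "bounded_linear swop"
  and cf_swop: "cf (swop a) n \<theta> = cf a (snd n, fst n) \<theta>"
proof -
  have cont: "continuous_on UNIV (\<lambda>\<theta>. cf a (snd n, fst n) \<theta>)" for n a
    by (auto intro!: continuous_intros)
  have bd: "\<bar>cf a (snd n, fst n) \<theta>\<bar> \<le> 1 * norm a / wt n" for n a \<theta>
    using cf_bound[of a "(snd n, fst n)" \<theta>] by (simp add: wt_def mult.commute)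
  show "bounded_linear swop" unfolding swop_def
    by (rule mk_bounded_linear[OF cont bd]) (auto simp: algebra_simps)
  show "cf (swop a) n \<theta> = cf a (snd n, fst n) \<theta>"
    unfolding swop_def by (rule cf_mk[OF cont bd])
qed

lemma norm_swop: "norm (swop a) \<le> norm a"
  unfolding swop_def
proof (rule norm_mk)
  show "continuous_on UNIV (\<lambda>\<theta>. cf a (snd n, fst n) \<theta>)" for n by (intro continuous_intros)
  show "\<bar>cf a (snd n, fst n) \<theta>\<bar> \<le> norm a / wt n" for n \<theta>
    using cf_bound[of a "(snd n, fst n)" \<theta>] by (simp add: wt_def mult.commute)
qed

lemma swop_conv: "swop (a \<star> b) = swop a \<star> swop b"
  by (rule alg_eqI) (simp add: cf_swop cf_conv ccf_def, subst sum.swap, rule refl)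

definition cst :: "(nat \<times> nat) set \<Rightarrow> (real \<Rightarrow> real) \<Rightarrow> alg" where
  "cst S m = mk (\<lambda>n \<theta>. if n \<in> S then m (cl \<theta>) else 0)"

lemma cf_cst:
  assumes "finite S" "continuous_on UNIV m"
  shows "cf (cst S m) n \<theta> = (if n \<in> S then m (cl \<theta>) else 0)"
proof -
  have "compact (m ` {0..pi/2})"
    by (intro compact_continuous_image continuous_on_subset[OF assms(2)]) auto
  then obtain B where B: "\<And>\<theta>. \<theta> \<in> {0..pi/2} \<Longrightarrow> \<bar>m \<theta>\<bar> \<le> B"
    using compact_imp_bounded[THEN bounded_iff[THEN iffD1]] by (metis imageI real_norm_def)
  have B0: "B \<ge> 0" using B[of 0] by auto
  define C where "C = B * (\<Sum>n\<in>S. wt n)"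
  show ?thesis unfolding cst_def
  proof (rule cf_mk[where C=C])
    show "continuous_on UNIV (\<lambda>\<theta>. if n \<in> S then m (cl \<theta>) else 0)" for n
      by (cases "n \<in> S") (auto intro!: continuous_on_compose2[OF assms(2) cl_cont])
    fix n \<theta>
    show "\<bar>if n \<in> S then m (cl \<theta>) else 0\<bar> \<le> C / wt n"
    proof (cases "n \<in> S")
      case True
      have "wt n \<le> (\<Sum>n\<in>S. wt n)" using True assms(1) by (intro member_le_sum) (auto simp: less_imp_le)
      then have "B * wt n \<le> C" unfolding C_def using B0 by (intro mult_left_mono)
      then have "B \<le> C / wt n" by (simp add: field_simps)
      with True B[of "cl \<theta>"] show ?thesis by auto
    next
      case False
      have "0 \<le> C / wt n" unfolding C_def using B0
        by (intro divide_nonneg_pos mult_nonneg_nonneg sum_nonneg) (auto simp: less_imp_le)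
      with False show ?thesis by simp
    qed
  qed
qed

subsection \<open>Solution operators of the mode equations\<close>

text \<open>Addition theorems with a nonnegative summand dropped, together with
  \<open>cosh B - 1 \<le> sinh B\<close>. They bound the integrated Green kernels uniformly in the
  exponent.\<close>

lemma hyp_ineqs:
  fixes A B :: real
  assumes "A \<ge> 0" "B \<ge> 0"
  shows "sinh A * sinh B \<le> cosh (A + B)" "cosh A * sinh B \<le> sinh (A + B)"
    "sinh A * cosh B \<le> sinh (A + B)" "cosh A * (cosh B - 1) \<le> sinh (A + B)"
    "sinh A * (cosh B - 1) \<le> sinh (A + B)"
proof -
  have p: "cosh A \<ge> 0" "cosh B \<ge> 0" "sinh A \<ge> 0" "sinh B \<ge> 0" using assms by auto
  show "sinh A * sinh B \<le> cosh (A + B)" using p by (simp add: cosh_add)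
  show *: "cosh A * sinh B \<le> sinh (A + B)" using p by (simp add: sinh_add)
  show "sinh A * cosh B \<le> sinh (A + B)" using p by (simp add: sinh_add)
  have "cosh B - sinh B = exp (- B)" by (simp add: cosh_minus_sinh)
  then have "cosh B - 1 \<le> sinh B" using assms by (smt (verit) exp_le_one_iff)
  then have "cosh A * (cosh B - 1) \<le> cosh A * sinh B" using p by (intro mult_left_mono)
  with * show "cosh A * (cosh B - 1) \<le> sinh (A + B)" by linarith
  have "sinh A * (cosh B - 1) \<le> sinh A * cosh B" using p by (intro mult_left_mono) auto
  also have "\<dots> \<le> sinh (A + B)" using p by (simp add: sinh_add)
  finally show "sinh A * (cosh B - 1) \<le> sinh (A + B)" .
qed

lemma hyp_frac:
  fixes A B C :: real
  assumes "0 \<le> A" "0 \<le> B" "A + B = C" "0 < C"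
  shows "cosh A * (cosh B - 1) / sinh C \<le> 1" "0 \<le> cosh A * (cosh B - 1) / sinh C"
    "sinh A * (cosh B - 1) / sinh C \<le> 1" "0 \<le> sinh A * (cosh B - 1) / sinh C"
  using hyp_ineqs(4,5)[OF assms(1,2)] assms
  by (auto simp: divide_le_eq_1 cosh_real_ge_1 intro!: divide_nonneg_pos mult_nonneg_nonneg)

lemma integral_cosh: "0 \<le> (\<theta>::real) \<Longrightarrow> K > 0 \<Longrightarrow> integral {0..\<theta>} (\<lambda>t. cosh (K * t)) = sinh (K * \<theta>) / K"
proof -
  assume a: "0 \<le> \<theta>" "K > 0"
  have "((\<lambda>t. cosh (K * t)) has_integral (sinh (K * \<theta>) / K - sinh (K * 0) / K)) {0..\<theta>}"
    by (rule fundamental_theorem_of_calculus[of 0 \<theta> "\<lambda>t. sinh (K * t) / K"]) (use a in \<open>auto intro!: derivative_eq_intros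
        simp: has_real_derivative_iff_has_vector_derivative[symmetric]\<close>)
  then show ?thesis by (simp add: integral_unique)
qed

lemma integral_sinh: 
  assumes a: "0 \<le> (\<theta>::real)" "K > 0"
  shows "integral {0..\<theta>} (\<lambda>t. \<bar>sinh (K * t)\<bar>) = (cosh (K * \<theta>) - 1) / K"
proof -
  have "((\<lambda>t. sinh (K * t)) has_integral (cosh (K * \<theta>) / K - cosh (K * 0) / K)) {0..\<theta>}"
    by (rule fundamental_theorem_of_calculus[of 0 \<theta> "\<lambda>t. cosh (K * t) / K"]) (use a in \<open>auto intro!: derivative_eq_intros
        simp: has_real_derivative_iff_has_vector_derivative[symmetric]\<close>)
  moreover have "integral {0..\<theta>} (\<lambda>t. \<bar>sinh (K * t)\<bar>) = integral {0..\<theta>} (\<lambda>t. sinh (K * t))"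
    by (rule Henstock_Kurzweil_Integration.integral_cong) (use a in auto)
  ultimately show ?thesis by (simp add: integral_unique diff_divide_distrib)
qed

lemma integral_sinh': 
  assumes a: "\<theta> \<le> (c::real)" "K > 0"
  shows "integral {\<theta>..c} (\<lambda>t. \<bar>sinh (K * (c - t))\<bar>) = (cosh (K * (c - \<theta>)) - 1) / K"
proof -
  have "((\<lambda>t. sinh (K * (c - t))) has_integral (- cosh (K * (c - c)) / K - - cosh (K * (c - \<theta>)) / K)) {\<theta>..c}"
    by (rule fundamental_theorem_of_calculus[of \<theta> c "\<lambda>t. - cosh (K * (c - t)) / K"]) (use a in \<open>auto intro!: derivative_eq_intros
        simp: has_real_derivative_iff_has_vector_derivative[symmetric]\<close>)
  moreover have "integral {\<theta>..c} (\<lambda>t. \<bar>sinh (K * (c - t))\<bar>) = integral {\<theta>..c} (\<lambda>t. sinh (K * (c - t)))"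
    by (rule Henstock_Kurzweil_Integration.integral_cong) (use a in auto)
  ultimately show ?thesis by (simp add: integral_unique diff_divide_distrib)
qed

definition kd :: "nat \<times> nat \<Rightarrow> real" where "kd n = real (fst n) - real (snd n)"

definition big :: "nat \<times> nat \<Rightarrow> bool" where "big n \<longleftrightarrow> 2 \<le> \<bar>kd n\<bar>"

text \<open>The exponent of \<open>V'' = (3 k^2 - 4) V\<close>, real for \<open>|k| \<ge> 2\<close>.
  For \<open>|k| \<le> 1\<close> the equation oscillates with frequency \<open>mm\<close>, which is
  2 or 1. Correspondingly \<open>lam\<close> is the exponent of
  \<open>Y'' = 3 k^2 Y\<close>.\<close>

definition kp :: "nat \<times> nat \<Rightarrow> real" where "kp n = sqrt (3 * (kd n)\<^sup>2 - 4)"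

definition mm :: "nat \<times> nat \<Rightarrow> real" where "mm n = (if kd n = 0 then 2 else 1)"

definition lam :: "nat \<times> nat \<Rightarrow> real" where "lam n = sqrt 3 * \<bar>kd n\<bar>"

lemma kd_cases: "kd n = 0 \<or> \<bar>kd n\<bar> = 1 \<or> big n"
proof -
  have "\<bar>int (fst n) - int (snd n)\<bar> = 0 \<or> \<bar>int (fst n) - int (snd n)\<bar> = 1 \<or> 2 \<le> \<bar>int (fst n) - int (snd n)\<bar>"
    by presburger
  moreover have "\<bar>kd n\<bar> = real_of_int \<bar>int (fst n) - int (snd n)\<bar>" by (simp add: kd_def)
  ultimately show ?thesis unfolding big_def by linarith
qed

lemma kd_ge1: "kd n \<noteq> 0 \<Longrightarrow> 1 \<le> \<bar>kd n\<bar>"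
  using kd_cases[of n] by (auto simp: big_def)

lemma
  assumes "big n"
  shows kp_sq: "(kp n)\<^sup>2 = 3 * (kd n)\<^sup>2 - 4" and kp_ge: "\<bar>kd n\<bar> \<le> kp n" and kp_pos: "kp n > 0"
    and kp_bound: "(1 + (kd n)\<^sup>2) / (kp n)\<^sup>2 \<le> 2" and kp_bound1: "(1 + \<bar>kd n\<bar>) / kp n \<le> 2"
proof -
  have "2^2 \<le> \<bar>kd n\<bar>^2" using assms unfolding big_def by (intro power_mono) auto
  then have k4: "4 \<le> (kd n)\<^sup>2" by simp
  show 1: "(kp n)\<^sup>2 = 3 * (kd n)\<^sup>2 - 4" unfolding kp_def using k4 by simp
  show 2: "\<bar>kd n\<bar> \<le> kp n" unfolding kp_def using k4 by (intro real_le_rsqrt) auto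
  with assms show 3: "kp n > 0" unfolding big_def by linarith
  show "(1 + (kd n)\<^sup>2) / (kp n)\<^sup>2 \<le> 2" unfolding 1 using k4 by (simp add: divide_simps)
  show "(1 + \<bar>kd n\<bar>) / kp n \<le> 2" using 2 3 assms by (simp add: divide_simps big_def)
qed

lemma big_nz: "big n \<Longrightarrow> kd n \<noteq> 0" "big n \<Longrightarrow> kp n \<noteq> 0"
  using kp_pos[of n] by (auto simp: big_def)

lemma lam_pos: "kd n \<noteq> 0 \<Longrightarrow> lam n > 0" and lam_sq: "(lam n)\<^sup>2 = 3 * (kd n)\<^sup>2"
  by (simp_all add: lam_def power_mult_distrib)

text \<open>For \<open>big n\<close> these are the factors of the Green function of
  \<open>V'' = kp^2 V + f\<close>, \<open>V'(0) = 0\<close>, \<open>V(pi/2) = 0\<close>. Otherwise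
  \<open>pVR\<close> and \<open>pVS\<close> combine to the kernel
  \<open>sin (mm (t - \<theta>)) / mm\<close> on \<open>t > \<theta>\<close>, the solution with zero
  Cauchy data at \<open>pi/2\<close>; then \<open>V'(0) = 0\<close> remains as a condition on
  \<open>f\<close>.\<close>

definition pVL where "pVL n \<theta> = (if big n then - 1 / (kp n * cosh (kp n * (pi/2))) else 0) * sinh (kp n * (pi/2 - \<theta>))"
definition qVL where "qVL n t = cosh (kp n * t)"
definition pVR where "pVR n \<theta> = (if big n then - 1 / (kp n * cosh (kp n * (pi/2))) * cosh (kp n * \<theta>)
    else - sin (mm n * \<theta>) / mm n)"
definition qVR where "qVR n t = (if big n then sinh (kp n * (pi/2 - t)) else cos (mm n * t))"
definition pVS where "pVS n \<theta> = (if big n then 0 else cos (mm n * \<theta>) / mm n)"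
definition qVS where "qVS n t = sin (mm n * t)"

text \<open>Boundedness of the kernel with this factor means a gain of two derivatives in \<xi>. For
  \<open>Y\<close> only one is claimed (\<open>w1\<close>), since the source of its equation already
  contains a factor \<open>k\<close>.\<close>

definition w2 :: "(nat \<times> nat \<Rightarrow> real \<Rightarrow> real) \<Rightarrow> nat \<times> nat \<Rightarrow> real \<Rightarrow> real" where
  "w2 p n \<theta> = (1 + (kd n)\<^sup>2) * p n \<theta>"
definition w1 :: "(nat \<times> nat \<Rightarrow> real \<Rightarrow> real) \<Rightarrow> nat \<times> nat \<Rightarrow> real \<Rightarrow> real" where
  "w1 p n \<theta> = (1 + \<bar>kd n\<bar>) * p n \<theta>"

definition vsol :: "nat \<times> nat \<Rightarrow> (real \<Rightarrow> real) \<Rightarrow> real \<Rightarrow> real" where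
  "vsol n f \<theta> = pVL n \<theta> * integral {0..\<theta>} (\<lambda>t. qVL n t * f t)
    + pVR n \<theta> * integral {\<theta>..pi/2} (\<lambda>t. qVR n t * f t)
    + pVS n \<theta> * integral {\<theta>..pi/2} (\<lambda>t. qVS n t * f t)"

text \<open>The homogeneous solution that carries the boundary value \<open>V'(pi/2) / 4\<close>:
  the integral of \<open>cosh (kp t) g\<close> over \<open>cosh (kp pi/2)\<close> is
  \<open>V'(pi/2)\<close>.\<close>

definition pYG where "pYG n \<theta> = (if big n then 1 / (4 * cosh (kp n * (pi/2)) * sinh (sqrt 3 * kd n * (pi/2))) else 0)
    * sinh (sqrt 3 * kd n * \<theta>)"
definition pYG1 where "pYG1 n \<theta> = (if big n then 1 / (4 * cosh (kp n * (pi/2)) * sinh (sqrt 3 * kd n * (pi/2))) else 0)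
    * (sqrt 3 * kd n * cosh (sqrt 3 * kd n * \<theta>))"
text \<open>The Dirichlet Green function with the factor \<open>3 k\<close> of the source
  \<open>3 k f\<close> built in. It is odd in \<open>k\<close>, so an antisymmetric \<open>f\<close>
  produces a symmetric \<open>Y\<close>.\<close>

definition cY where "cY n = (if kd n = 0 then 0 else - (3 * kd n) / (lam n * sinh (lam n * (pi/2))))"
definition pYL where "pYL n \<theta> = cY n * sinh (lam n * (pi/2 - \<theta>))"
definition pYL1 where "pYL1 n \<theta> = cY n * (- (lam n * cosh (lam n * (pi/2 - \<theta>))))"
definition qYL where "qYL n t = sinh (lam n * t)"
definition pYR where "pYR n \<theta> = cY n * sinh (lam n * \<theta>)"
definition pYR1 where "pYR1 n \<theta> = cY n * (lam n * cosh (lam n * \<theta>))"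
definition qYR where "qYR n t = sinh (lam n * (pi/2 - t))"

definition ysol :: "nat \<times> nat \<Rightarrow> (real \<Rightarrow> real) \<Rightarrow> (real \<Rightarrow> real) \<Rightarrow> real \<Rightarrow> real" where
  "ysol n g f \<theta> = pYG n \<theta> * integral {0..pi/2} (\<lambda>t. qVL n t * g t)
    + pYL n \<theta> * integral {0..\<theta>} (\<lambda>t. qYL n t * f t)
    + pYR n \<theta> * integral {\<theta>..pi/2} (\<lambda>t. qYR n t * f t)"

definition ysol1 :: "nat \<times> nat \<Rightarrow> (real \<Rightarrow> real) \<Rightarrow> (real \<Rightarrow> real) \<Rightarrow> real \<Rightarrow> real" where
  "ysol1 n g f \<theta> = pYG1 n \<theta> * integral {0..pi/2} (\<lambda>t. qVL n t * g t)
    + pYL1 n \<theta> * integral {0..\<theta>} (\<lambda>t. qYL n t * f t)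
    + pYR1 n \<theta> * integral {\<theta>..pi/2} (\<lambda>t. qYR n t * f t)"

lemma eop_okI:
  assumes "\<And>n. continuous_on UNIV (p n)" "\<And>n. continuous_on UNIV (q n)"
    and "\<And>n \<theta>. 0 \<le> \<theta> \<Longrightarrow> \<theta> \<le> pi/2 \<Longrightarrow> \<bar>p n \<theta>\<bar> * integral (jset j \<theta>) (\<lambda>t. \<bar>q n t\<bar>) \<le> C"
  shows "eop_ok j p q"
  unfolding eop_ok_def using assms by (intro conjI allI exI[of _ C] ballI) simp_all

lemma integral_abs_le:
  fixes f :: "real \<Rightarrow> real"
  assumes "continuous_on UNIV f" "\<And>t. \<bar>f t\<bar> \<le> 1" "0 \<le> a" "a \<le> b" "b \<le> pi/2"
  shows "integral {a..b} (\<lambda>t. \<bar>f t\<bar>) \<le> 2"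
proof -
  have "integral {a..b} (\<lambda>t. \<bar>f t\<bar>) \<le> integral {a..b} (\<lambda>t. 1)"
    by (rule integral_le) (auto intro!: integrable_continuous_real continuous_intros assms continuous_on_subset[OF assms(1)])
  also have "\<dots> \<le> 2" using assms pi_less_4 by simp
  finally show ?thesis .
qed

lemma integral_abs_nonneg: "0 \<le> integral S (\<lambda>t. \<bar>f t\<bar> :: real)"
  by (cases "(\<lambda>t. \<bar>f t\<bar>) integrable_on S") (auto intro: integral_nonneg simp: not_integrable_integral)

lemma small_bound:
  assumes "\<not> big n" "\<bar>x\<bar> \<le> 1" shows "\<bar>(1 + (kd n)\<^sup>2) * (x / mm n)\<bar> \<le> 2"
proof -
  have "mm n \<ge> 1" by (simp add: mm_def)
  then have "\<bar>x / mm n\<bar> \<le> 1" using assms by (simp add: abs_div divide_simps)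
  moreover have "\<bar>1 + (kd n)\<^sup>2\<bar> \<le> 2"
  proof -
    have "kd n = 0 \<or> \<bar>kd n\<bar> = 1" using assms kd_cases by blast
    then have "(kd n)\<^sup>2 \<le> 1" by (auto simp: abs_square_le_1)
    then show ?thesis by simp
  qed
  ultimately show ?thesis unfolding abs_mult using mult_mono[of "\<bar>1 + (kd n)\<^sup>2\<bar>" 2 "\<bar>x / mm n\<bar>" 1] by simp
qed

text \<open>The integrated kernel is \<open>(1 + k^2) / kp^2 \<le> 2\<close> times a hyperbolic
  quotient that is at most 1; the other bounds for large modes follow the same pattern.\<close>

lemma okVL: "eop_ok 0 (w2 pVL) qVL"
proof (rule eop_okI)
  fix n \<theta> assume t: "0 \<le> \<theta>" "\<theta> \<le> pi/2"
  show "\<bar>w2 pVL n \<theta>\<bar> * integral (jset 0 \<theta>) (\<lambda>t. \<bar>qVL n t\<bar>) \<le> 2"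
  proof (cases "big n")
    case True
    note K = kp_pos[OF True]
    have nn: "sinh (kp n * (pi/2 - \<theta>)) \<ge> 0" using K t by simp
    have "\<bar>w2 pVL n \<theta>\<bar> * integral (jset 0 \<theta>) (\<lambda>t. \<bar>qVL n t\<bar>)
      = (1 + (kd n)\<^sup>2) / (kp n)\<^sup>2 * (sinh (kp n * (pi/2 - \<theta>)) * sinh (kp n * \<theta>) / cosh (kp n * (pi/2)))"
      using True K nn t by ((simp add: w2_def pVL_def qVL_def jset_def integral_cosh abs_mult power2_eq_square cosh_real_ge_1), (simp add: mult_ac)?)
    also have "\<dots> \<le> 2 * 1"
      using kp_bound[OF True] K t hyp_ineqs(1)[of "kp n * (pi/2 - \<theta>)" "kp n * \<theta>"]
      by (intro mult_mono) (auto simp: algebra_simps)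
    finally show ?thesis by simp
  qed (simp add: w2_def pVL_def)
qed (auto simp: w2_def pVL_def qVL_def dest: big_nz intro!: continuous_intros)

lemma okVR: "eop_ok 1 (w2 pVR) qVR"
proof (rule eop_okI)
  fix n \<theta> assume t: "0 \<le> \<theta>" "\<theta> \<le> pi/2"
  show "\<bar>w2 pVR n \<theta>\<bar> * integral (jset 1 \<theta>) (\<lambda>t. \<bar>qVR n t\<bar>) \<le> 4"
  proof (cases "big n")
    case True
    note K = kp_pos[OF True]
    have nn: "cosh (kp n * (pi/2 - \<theta>)) - 1 \<ge> 0" by (simp add: cosh_real_ge_1)
    have "\<bar>w2 pVR n \<theta>\<bar> * integral (jset 1 \<theta>) (\<lambda>t. \<bar>qVR n t\<bar>)
      = (1 + (kd n)\<^sup>2) / (kp n)\<^sup>2 * (cosh (kp n * \<theta>) * (cosh (kp n * (pi/2 - \<theta>)) - 1) / cosh (kp n * (pi/2)))"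
      using True K t by ((simp add: w2_def pVR_def qVR_def jset_def integral_sinh' abs_mult power2_eq_square cosh_real_ge_1), (simp add: mult_ac)?)
    also have "\<dots> \<le> 2 * 1"
    proof -
      have "cosh (kp n * \<theta>) * (cosh (kp n * (pi/2 - \<theta>)) - 1) \<le> sinh (kp n * \<theta> + kp n * (pi/2 - \<theta>))"
        using K t by (intro hyp_ineqs(4)) auto
      also have "\<dots> \<le> cosh (kp n * (pi/2))" using sinh_le_cosh_real by (simp add: algebra_simps)
      finally show ?thesis
      using kp_bound[OF True] by (intro mult_mono) (auto intro!: divide_nonneg_pos mult_nonneg_nonneg simp: cosh_real_ge_1)
    qed
    finally show ?thesis by simp
  next
    case False
    have "\<bar>w2 pVR n \<theta>\<bar> \<le> 2" using False small_bound[OF False, of "- sin (mm n * \<theta>)"] by (simp add: w2_def pVR_def)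
    moreover have "integral (jset 1 \<theta>) (\<lambda>t. \<bar>qVR n t\<bar>) \<le> 2"
      using False integral_abs_le[of "\<lambda>t. cos (mm n * t)" \<theta> "pi/2"] t by (simp add: qVR_def jset_def continuous_intros)
    ultimately show ?thesis
      using mult_mono[of "\<bar>w2 pVR n \<theta>\<bar>" 2 "integral (jset 1 \<theta>) (\<lambda>t. \<bar>qVR n t\<bar>)" 2]
      by (simp add: integral_abs_nonneg)
  qed
next
  show "continuous_on UNIV (w2 pVR n)" for n
    by (cases "big n") (auto simp: w2_def pVR_def mm_def dest: big_nz intro!: continuous_intros)
  show "continuous_on UNIV (qVR n)" for n
    by (cases "big n") (auto simp: qVR_def dest: big_nz intro!: continuous_intros)
qed

lemma okVS: "eop_ok 1 (w2 pVS) qVS"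
proof (rule eop_okI)
  fix n \<theta> assume t: "0 \<le> \<theta>" "\<theta> \<le> pi/2"
  show "\<bar>w2 pVS n \<theta>\<bar> * integral (jset 1 \<theta>) (\<lambda>t. \<bar>qVS n t\<bar>) \<le> 4"
  proof (cases "big n")
    case False
    have "\<bar>w2 pVS n \<theta>\<bar> \<le> 2" using False small_bound[OF False, of "cos (mm n * \<theta>)"] by (simp add: w2_def pVS_def)
    moreover have "integral (jset 1 \<theta>) (\<lambda>t. \<bar>qVS n t\<bar>) \<le> 2"
      using False integral_abs_le[of "\<lambda>t. sin (mm n * t)" \<theta> "pi/2"] t by (simp add: qVS_def jset_def continuous_intros)
    ultimately show ?thesis
      using mult_mono[of "\<bar>w2 pVS n \<theta>\<bar>" 2 "integral (jset 1 \<theta>) (\<lambda>t. \<bar>qVS n t\<bar>)" 2]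
      by (simp add: integral_abs_nonneg)
  qed (simp add: w2_def pVS_def)
next
  show "continuous_on UNIV (w2 pVS n)" for n
    by (cases "big n") (auto simp: w2_def pVS_def mm_def dest: big_nz intro!: continuous_intros)
  show "continuous_on UNIV (qVS n)" for n
    by (auto simp: qVS_def dest: big_nz intro!: continuous_intros)
qed

lemma sinh_abs_arg:
  assumes "t \<ge> 0"
  shows "\<bar>sinh (sqrt 3 * kd n * t)\<bar> = sinh (lam n * t)" "cosh (sqrt 3 * kd n * t) = cosh (lam n * t)"
proof -
  have e: "lam n * t = \<bar>sqrt 3 * kd n * t\<bar>" using assms by (simp add: lam_def abs_mult)
  show "\<bar>sinh (sqrt 3 * kd n * t)\<bar> = sinh (lam n * t)" unfolding e by (rule sinh_real_abs[symmetric])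
  show "cosh (sqrt 3 * kd n * t) = cosh (lam n * t)" unfolding e by (rule cosh_real_abs[symmetric])
qed

text \<open>The \<theta>-derivative of the boundary part of \<open>Y\<close> has \<open>cosh\<close>
  over \<open>sinh\<close>; \<open>lamc_ge1\<close> keeps the argument away from 0, so the quotient
  is at most 2.\<close>

lemma sinh_ge_half_cosh: "x \<ge> 1 \<Longrightarrow> cosh x \<le> 2 * sinh (x::real)"
proof -
  assume x: "x \<ge> 1"
  have "exp (- x) * 3 \<le> exp x"
  proof -
    have "3 \<le> 1 + 2 * x" using x by simp
    also have "\<dots> \<le> exp (2 * x)" by (rule exp_ge_add_one_self)
    finally have "exp (- x) * 3 \<le> exp (- x) * exp (2 * x)" by simp
    also have "\<dots> = exp x" by (simp flip: exp_add)
    finally show ?thesis .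
  qed
  then show ?thesis by (simp add: cosh_def sinh_def)
qed

lemma lamc_ge1: "kd n \<noteq> 0 \<Longrightarrow> 1 \<le> lam n * (pi/2)"
proof -
  assume "kd n \<noteq> 0"
  from kd_ge1[OF this] have "1 * 1 \<le> lam n" unfolding lam_def by (intro mult_mono) auto
  then have "1 * 1 \<le> lam n * (pi/2)" using pi_gt3 by (intro mult_mono) auto
  then show ?thesis by simp
qed

lemma okYG: "eop_ok 2 (w1 pYG) qVL"
proof (rule eop_okI)
  fix n \<theta> assume t: "0 \<le> \<theta>" "\<theta> \<le> pi/2"
  show "\<bar>w1 pYG n \<theta>\<bar> * integral (jset 2 \<theta>) (\<lambda>t. \<bar>qVL n t\<bar>) \<le> 1"
  proof (cases "big n")
    case True
    note K = kp_pos[OF True]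
    have k0: "kd n \<noteq> 0" using True by (auto simp: big_def)
    have "\<bar>w1 pYG n \<theta>\<bar> * integral (jset 2 \<theta>) (\<lambda>t. \<bar>qVL n t\<bar>)
      = (1 + \<bar>kd n\<bar>) / kp n / 4 * ((sinh (lam n * \<theta>) / sinh (lam n * (pi/2))) * (sinh (kp n * (pi/2)) / cosh (kp n * (pi/2))))"
      using True K t k0 integral_cosh[of "pi/2" "kp n"] sinh_abs_arg(1)[of "pi/2" n] sinh_abs_arg(1)[OF t(1), of n]
      by ((simp add: w1_def pYG_def qVL_def jset_def abs_mult abs_divide cosh_real_ge_1), (simp add: mult_ac)?)
    also have "\<dots> \<le> 2 / 4 * (1 * 1)"
      using kp_bound1[OF True] K t lam_pos[OF k0] sinh_le_cosh_real
      by (intro mult_mono divide_right_mono) (auto simp: divide_le_eq_1)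
    finally show ?thesis by simp
  qed (simp add: w1_def pYG_def)
qed (auto simp: w1_def pYG_def qVL_def dest: big_nz intro!: continuous_intros)

lemma okYG1: "eop_ok 2 pYG1 qVL"
proof (rule eop_okI)
  fix n \<theta> assume t: "0 \<le> \<theta>" "\<theta> \<le> pi/2"
  show "\<bar>pYG1 n \<theta>\<bar> * integral (jset 2 \<theta>) (\<lambda>t. \<bar>qVL n t\<bar>) \<le> 1"
  proof (cases "big n")
    case True
    note K = kp_pos[OF True]
    have k0: "kd n \<noteq> 0" using True by (auto simp: big_def)
    have "\<bar>pYG1 n \<theta>\<bar> * integral (jset 2 \<theta>) (\<lambda>t. \<bar>qVL n t\<bar>)
      = \<bar>kd n\<bar> / kp n * (sqrt 3 / 4) * ((cosh (lam n * \<theta>) / sinh (lam n * (pi/2))) * (sinh (kp n * (pi/2)) / cosh (kp n * (pi/2))))"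
      using True K t k0 integral_cosh[of "pi/2" "kp n"] sinh_abs_arg(1)[of "pi/2" n] sinh_abs_arg(2)[OF t(1), of n]
      by ((simp add: pYG1_def qVL_def jset_def abs_mult abs_divide cosh_real_ge_1), (simp add: mult_ac)?)
    also have "\<dots> \<le> 1 * (2 / 4) * (2 * 1)"
    proof -
      have "cosh (lam n * \<theta>) \<le> cosh (lam n * (pi/2))" using t lam_pos[OF k0]
        by (subst cosh_real_nonneg_le_iff) auto
      also have "\<dots> \<le> 2 * sinh (lam n * (pi/2))" by (rule sinh_ge_half_cosh[OF lamc_ge1[OF k0]])
      finally have "cosh (lam n * \<theta>) / sinh (lam n * (pi/2)) \<le> 2"
        using lam_pos[OF k0] by (simp add: divide_le_eq)
      moreover have "sqrt 3 \<le> 2" by (rule real_le_lsqrt) auto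
      ultimately show ?thesis
      using kp_ge[OF True] K t lam_pos[OF k0] sinh_le_cosh_real
      by (intro mult_mono divide_right_mono) (auto simp: divide_le_eq_1)
    qed
    finally show ?thesis by simp
  qed (simp add: pYG1_def)
qed (auto simp: pYG1_def qVL_def dest: big_nz intro!: continuous_intros)

lemma cY_abs: "kd n \<noteq> 0 \<Longrightarrow> \<bar>cY n\<bar> = 3 * \<bar>kd n\<bar> / (lam n * sinh (lam n * (pi/2)))"
  using lam_pos[of n] by (simp add: cY_def abs_mult abs_divide mult_ac)

lemma yb: "kd n \<noteq> 0 \<Longrightarrow> (1 + \<bar>kd n\<bar>) * (3 * \<bar>kd n\<bar>) / (lam n)\<^sup>2 \<le> 2"
proof -
  assume k: "kd n \<noteq> 0"
  have "(lam n)\<^sup>2 = 3 * (\<bar>kd n\<bar> * \<bar>kd n\<bar>)" unfolding lam_sq by (simp add: power2_eq_square)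
  then have "(1 + \<bar>kd n\<bar>) * (3 * \<bar>kd n\<bar>) / (lam n)\<^sup>2 = (1 + \<bar>kd n\<bar>) / \<bar>kd n\<bar>"
    using k by (simp del: abs_mult_self_eq)
  also have "\<dots> \<le> 2" using kd_ge1[OF k] by (simp add: divide_le_eq)
  finally show ?thesis .
qed

lemma okYL: "eop_ok 0 (w1 pYL) qYL"
proof (rule eop_okI)
  fix n \<theta> assume t: "0 \<le> \<theta>" "\<theta> \<le> pi/2"
  show "\<bar>w1 pYL n \<theta>\<bar> * integral (jset 0 \<theta>) (\<lambda>t. \<bar>qYL n t\<bar>) \<le> 2"
  proof (cases "kd n = 0")
    case False
    note L = lam_pos[OF False]
    have nn: "sinh (lam n * (pi/2 - \<theta>)) \<ge> 0" using L t by simp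
    have "\<bar>w1 pYL n \<theta>\<bar> * integral (jset 0 \<theta>) (\<lambda>t. \<bar>qYL n t\<bar>)
      = (1 + \<bar>kd n\<bar>) * (3 * \<bar>kd n\<bar>) / (lam n)\<^sup>2 * (sinh (lam n * (pi/2 - \<theta>)) * (cosh (lam n * \<theta>) - 1) / sinh (lam n * (pi/2)))"
      using False L nn t by ((simp add: w1_def pYL_def qYL_def jset_def integral_sinh abs_mult power2_eq_square cY_abs cosh_real_ge_1), (simp add: mult_ac)?)
    also have "\<dots> \<le> 2 * 1"
      using L t by (intro mult_mono yb[OF False] hyp_frac(3,4)) (auto simp: right_diff_distrib)
    finally show ?thesis by simp
  qed (simp add: w1_def pYL_def cY_def)
qed (auto simp: w1_def pYL_def qYL_def dest: big_nz intro!: continuous_intros)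

lemma okYR: "eop_ok 1 (w1 pYR) qYR"
proof (rule eop_okI)
  fix n \<theta> assume t: "0 \<le> \<theta>" "\<theta> \<le> pi/2"
  show "\<bar>w1 pYR n \<theta>\<bar> * integral (jset 1 \<theta>) (\<lambda>t. \<bar>qYR n t\<bar>) \<le> 2"
  proof (cases "kd n = 0")
    case False
    note L = lam_pos[OF False]
    have nn: "sinh (lam n * \<theta>) \<ge> 0" using L t by simp
    have "\<bar>w1 pYR n \<theta>\<bar> * integral (jset 1 \<theta>) (\<lambda>t. \<bar>qYR n t\<bar>)
      = (1 + \<bar>kd n\<bar>) * (3 * \<bar>kd n\<bar>) / (lam n)\<^sup>2 * (sinh (lam n * \<theta>) * (cosh (lam n * (pi/2 - \<theta>)) - 1) / sinh (lam n * (pi/2)))"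
      using False L nn t by ((simp add: w1_def pYR_def qYR_def jset_def integral_sinh' abs_mult power2_eq_square cY_abs cosh_real_ge_1), (simp add: mult_ac)?)
    also have "\<dots> \<le> 2 * 1"
      using L t by (intro mult_mono yb[OF False] hyp_frac(3,4)) (auto simp: right_diff_distrib)
    finally show ?thesis by simp
  qed (simp add: w1_def pYR_def cY_def)
qed (auto simp: w1_def pYR_def qYR_def dest: big_nz intro!: continuous_intros)

lemma yb1: "kd n \<noteq> 0 \<Longrightarrow> 3 * \<bar>kd n\<bar> / lam n \<le> 2"
proof -
  assume "kd n \<noteq> 0"
  have "3 = sqrt 3 * sqrt 3" by simp
  also have "\<dots> \<le> sqrt 3 * 2" by (intro mult_left_mono real_le_lsqrt) auto
  finally show ?thesis using \<open>kd n \<noteq> 0\<close> by (simp add: lam_def divide_simps)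
qed

lemma okYL1: "eop_ok 0 pYL1 qYL"
proof (rule eop_okI)
  fix n \<theta> assume t: "0 \<le> \<theta>" "\<theta> \<le> pi/2"
  show "\<bar>pYL1 n \<theta>\<bar> * integral (jset 0 \<theta>) (\<lambda>t. \<bar>qYL n t\<bar>) \<le> 2"
  proof (cases "kd n = 0")
    case False
    note L = lam_pos[OF False]
    have "\<bar>pYL1 n \<theta>\<bar> * integral (jset 0 \<theta>) (\<lambda>t. \<bar>qYL n t\<bar>)
      = (3 * \<bar>kd n\<bar>) / lam n * (cosh (lam n * (pi/2 - \<theta>)) * (cosh (lam n * \<theta>) - 1) / sinh (lam n * (pi/2)))"
      using False L t by ((simp add: pYL1_def qYL_def jset_def integral_sinh abs_mult cY_abs cosh_real_ge_1), (simp add: mult_ac)?)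
    also have "\<dots> \<le> 2 * 1"
      using L t by (intro mult_mono yb1[OF False] hyp_frac(1,2)) (auto simp: right_diff_distrib)
    finally show ?thesis by simp
  qed (simp add: pYL1_def cY_def)
qed (auto simp: pYL1_def qYL_def dest: big_nz intro!: continuous_intros)

lemma okYR1: "eop_ok 1 pYR1 qYR"
proof (rule eop_okI)
  fix n \<theta> assume t: "0 \<le> \<theta>" "\<theta> \<le> pi/2"
  show "\<bar>pYR1 n \<theta>\<bar> * integral (jset 1 \<theta>) (\<lambda>t. \<bar>qYR n t\<bar>) \<le> 2"
  proof (cases "kd n = 0")
    case False
    note L = lam_pos[OF False]
    have "\<bar>pYR1 n \<theta>\<bar> * integral (jset 1 \<theta>) (\<lambda>t. \<bar>qYR n t\<bar>)
      = (3 * \<bar>kd n\<bar>) / lam n * (cosh (lam n * \<theta>) * (cosh (lam n * (pi/2 - \<theta>)) - 1) / sinh (lam n * (pi/2)))"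
      using False L t by ((simp add: pYR1_def qYR_def jset_def integral_sinh' abs_mult cY_abs cosh_real_ge_1), (simp add: mult_ac)?)
    also have "\<dots> \<le> 2 * 1"
      using L t by (intro mult_mono yb1[OF False] hyp_frac(1,2)) (auto simp: right_diff_distrib)
    finally show ?thesis by simp
  qed (simp add: pYR1_def cY_def)
qed (auto simp: pYR1_def qYR_def dest: big_nz intro!: continuous_intros)

text \<open>The operators with index 2 produce \<open>(1 + k^2) V\<close> and
  \<open>(1 + |k|) Y\<close>. Bounded multipliers then recover \<open>V\<close>,
  \<open>k^2 V\<close>, \<open>Y\<close> and \<open>k Y\<close>, so that tangential derivatives
  never appear as unbounded operators.\<close>

definition V2op where "V2op a = eop 0 (w2 pVL) qVL a + eop 1 (w2 pVR) qVR a + eop 1 (w2 pVS) qVS a"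
definition Vop where "Vop a = mulop (\<lambda>n _. 1 / (1 + (kd n)\<^sup>2)) (V2op a)"
definition KVop where "KVop a = mulop (\<lambda>n _. (kd n)\<^sup>2 / (1 + (kd n)\<^sup>2)) (V2op a)"
definition Y2op where "Y2op g r = eop 2 (w1 pYG) qVL g + eop 0 (w1 pYL) qYL r + eop 1 (w1 pYR) qYR r"
definition Yop where "Yop g r = mulop (\<lambda>n _. 1 / (1 + \<bar>kd n\<bar>)) (Y2op g r)"
definition KYop where "KYop g r = mulop (\<lambda>n _. kd n / (1 + \<bar>kd n\<bar>)) (Y2op g r)"
definition Y1op where "Y1op g r = eop 2 pYG1 qVL g + eop 0 pYL1 qYL r + eop 1 pYR1 qYR r"
definition W0mul where "W0mul a = mulop (\<lambda>n t. 2 * sin (2 * t)) a"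

lemma kfrac:
  "1 / (1 + (kd n)\<^sup>2) \<le> 1" "(kd n)\<^sup>2 / (1 + (kd n)\<^sup>2) \<le> 1" "1 / (1 + \<bar>kd n\<bar>) \<le> 1" "\<bar>kd n / (1 + \<bar>kd n\<bar>)\<bar> \<le> 1"
  "1 + (kd n)\<^sup>2 \<noteq> 0" "1 + \<bar>kd n\<bar> \<noteq> 0"
proof -
  have "1 + (kd n)\<^sup>2 > 0" by (simp add: add_pos_nonneg)
  then show "1 + (kd n)\<^sup>2 \<noteq> 0" "1 / (1 + (kd n)\<^sup>2) \<le> 1" "(kd n)\<^sup>2 / (1 + (kd n)\<^sup>2) \<le> 1"
    by (simp_all add: divide_le_eq_1)
  have "1 + \<bar>kd n\<bar> > 0" by (simp add: add_pos_nonneg)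
  then show "1 + \<bar>kd n\<bar> \<noteq> 0" "1 / (1 + \<bar>kd n\<bar>) \<le> 1" "\<bar>kd n / (1 + \<bar>kd n\<bar>)\<bar> \<le> 1"
    by (simp_all add: abs_divide divide_le_eq_1)
qed

lemma V2op_lin: "bounded_linear V2op"
  unfolding V2op_def[abs_def] by (intro bounded_linear_add bounded_linear_eop okVL okVR okVS)

lemma cf_V2op: "cf (V2op a) n \<theta> = (1 + (kd n)\<^sup>2) * vsol n (cf a n) (cl \<theta>)"
  unfolding V2op_def
  by (simp add: cf_eop okVL okVR[simplified] okVS[simplified] eopc_def w2_def vsol_def jset_def algebra_simps)

lemma Vop_lin: "bounded_linear Vop"
  unfolding Vop_def[abs_def]
  by (rule bounded_linear_compose[OF bounded_linear_mulop[where C=1] V2op_lin]) (use kfrac in \<open>auto intro: continuous_intros\<close>)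

lemma KVop_lin: "bounded_linear KVop"
  unfolding KVop_def[abs_def]
  by (rule bounded_linear_compose[OF bounded_linear_mulop[where C=1] V2op_lin]) (use kfrac in \<open>auto intro: continuous_intros\<close>)

lemma cf_Vop: "cf (Vop a) n \<theta> = vsol n (cf a n) (cl \<theta>)"
proof -
  have "cf (Vop a) n \<theta> = 1 / (1 + (kd n)\<^sup>2) * cf (V2op a) n \<theta>"
    unfolding Vop_def by (rule cf_mulop[where C=1]) (use kfrac in \<open>auto intro: continuous_intros\<close>)
  then show ?thesis using kfrac(5)[of n] by (simp add: cf_V2op)
qed

lemma cf_KVop: "cf (KVop a) n \<theta> = (kd n)\<^sup>2 * vsol n (cf a n) (cl \<theta>)"
proof -
  have "cf (KVop a) n \<theta> = (kd n)\<^sup>2 / (1 + (kd n)\<^sup>2) * cf (V2op a) n \<theta>"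
    unfolding KVop_def by (rule cf_mulop[where C=1]) (use kfrac in \<open>auto intro: continuous_intros\<close>)
  then show ?thesis using kfrac(5)[of n] by (simp add: cf_V2op)
qed

lemma Y2op_lin: 
  "bounded_linear f \<Longrightarrow> bounded_linear h \<Longrightarrow> bounded_linear (\<lambda>x. Y2op (f x) (h x))"
  unfolding Y2op_def[abs_def]
  by (intro bounded_linear_add bounded_linear_compose[OF bounded_linear_eop] okYG okYL okYR)

lemma cf_Y2op: "cf (Y2op g r) n \<theta> = (1 + \<bar>kd n\<bar>) * ysol n (cf g n) (cf r n) (cl \<theta>)"
  unfolding Y2op_def
  by (simp add: cf_eop okYG okYL okYR[simplified] eopc_def w1_def ysol_def jset_def algebra_simps)

lemma Yop_lin: 
  "bounded_linear f \<Longrightarrow> bounded_linear h \<Longrightarrow> bounded_linear (\<lambda>x. Yop (f x) (h x))"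
  unfolding Yop_def[abs_def]
  by (rule bounded_linear_compose[OF bounded_linear_mulop[where C=1] Y2op_lin]) (use kfrac in \<open>auto intro: continuous_intros\<close>)

lemma KYop_lin: 
  "bounded_linear f \<Longrightarrow> bounded_linear h \<Longrightarrow> bounded_linear (\<lambda>x. KYop (f x) (h x))"
  unfolding KYop_def[abs_def]
  by (rule bounded_linear_compose[OF bounded_linear_mulop[where C=1] Y2op_lin]) (use kfrac in \<open>auto intro: continuous_intros\<close>)

lemma cf_Yop: "cf (Yop g r) n \<theta> = ysol n (cf g n) (cf r n) (cl \<theta>)"
proof -
  have "cf (Yop g r) n \<theta> = 1 / (1 + \<bar>kd n\<bar>) * cf (Y2op g r) n \<theta>"
    unfolding Yop_def by (rule cf_mulop[where C=1]) (use kfrac in \<open>auto intro: continuous_intros\<close>)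
  then show ?thesis using kfrac(6)[of n] by (simp add: cf_Y2op)
qed

lemma cf_KYop: "cf (KYop g r) n \<theta> = kd n * ysol n (cf g n) (cf r n) (cl \<theta>)"
proof -
  have "cf (KYop g r) n \<theta> = kd n / (1 + \<bar>kd n\<bar>) * cf (Y2op g r) n \<theta>"
    unfolding KYop_def by (rule cf_mulop[where C=1]) (use kfrac in \<open>auto intro: continuous_intros\<close>)
  then show ?thesis using kfrac(6)[of n] by (simp add: cf_Y2op)
qed

lemma Y1op_lin: 
  "bounded_linear f \<Longrightarrow> bounded_linear h \<Longrightarrow> bounded_linear (\<lambda>x. Y1op (f x) (h x))"
  unfolding Y1op_def[abs_def]
  by (intro bounded_linear_add bounded_linear_compose[OF bounded_linear_eop] okYG1 okYL1 okYR1)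

lemma cf_Y1op: "cf (Y1op g r) n \<theta> = ysol1 n (cf g n) (cf r n) (cl \<theta>)"
  unfolding Y1op_def
  by (simp add: cf_eop okYG1 okYL1 okYR1[simplified] eopc_def ysol1_def jset_def algebra_simps)

lemma W0mul_lin: "bounded_linear W0mul"
  unfolding W0mul_def[abs_def] by (rule bounded_linear_mulop[where C=2])
    (auto intro!: continuous_intros simp: abs_mult)

lemma cf_W0mul: "cf (W0mul a) n \<theta> = 2 * sin (2 * cl \<theta>) * cf a n \<theta>"
  unfolding W0mul_def by (rule cf_mulop[where C=2]) (auto intro!: continuous_intros simp: abs_mult)

text \<open>The projection that fixes \<open>N\<close>: testing \<open>4 N cos (2 \<theta>)\<close>
  against \<open>cos (2 \<theta>)\<close> gives \<open>4 N pi/4\<close>, hence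
  \<open>1 / pi\<close>; the two minus signs cancel. \<open>Cop\<close> tests against the kernel
  \<open>cos \<theta>\<close> of wave number 1.\<close>

definition Nop where "Nop = eop 2 (\<lambda>n _. if fst n = snd n then - 1 / pi else 0) (\<lambda>n t. - cos (2 * t))"
definition Iop where "Iop = eop 0 (\<lambda>n _. 1) (\<lambda>n t. 1)"
definition Cop where "Cop = eop 2 (\<lambda>n _. 1) (\<lambda>n t. cos t)"

lemma okN: "eop_ok 2 (\<lambda>n _. if fst n = snd n then - 1 / pi else 0) (\<lambda>n t. - cos (2 * t))"
proof (rule eop_okI)
  fix n :: "nat \<times> nat" and \<theta> :: real
  have "integral {0..pi/2} (\<lambda>t. \<bar>- cos (2 * t)\<bar>) \<le> 2"
    by (rule integral_abs_le) (auto intro!: continuous_intros)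
  moreover have "\<bar>if fst n = snd n then - 1 / pi else 0\<bar> \<le> 1" using pi_gt3 by (simp add: divide_le_eq_1)
  ultimately show "\<bar>if fst n = snd n then - 1 / pi else 0\<bar> * integral (jset 2 \<theta>) (\<lambda>t. \<bar>- cos (2 * t)\<bar>) \<le> 1 * 2"
    unfolding jset_def by (intro mult_mono) (auto intro: integral_abs_nonneg)
qed (auto intro!: continuous_intros)

lemma okI: "eop_ok 0 (\<lambda>n _. 1) (\<lambda>n t. 1)"
proof (rule eop_okI)
  fix n :: "nat \<times> nat" and \<theta> :: real
  assume "0 \<le> \<theta>" "\<theta> \<le> pi/2"
  then show "\<bar>1\<bar> * integral (jset 0 \<theta>) (\<lambda>t. \<bar>1\<bar>) \<le> pi / 2"
    unfolding jset_def by simp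
qed (auto intro!: continuous_intros)

lemma okC: "eop_ok 2 (\<lambda>n _. 1) (\<lambda>n t. cos t)"
proof (rule eop_okI)
  fix n :: "nat \<times> nat" and \<theta> :: real
  have "integral {0..pi/2} (\<lambda>t. \<bar>cos t\<bar>) \<le> 2"
    by (rule integral_abs_le) (auto intro!: continuous_intros)
  then show "\<bar>1\<bar> * integral (jset 2 \<theta>) (\<lambda>t. \<bar>cos t\<bar>) \<le> 2"
    unfolding jset_def by simp
qed (auto intro!: continuous_intros)

lemma Nop_lin: "bounded_linear Nop" and Iop_lin: "bounded_linear Iop" and Cop_lin: "bounded_linear Cop"
  unfolding Nop_def Iop_def Cop_def by (intro bounded_linear_eop okN okI okC)+

lemma cf_Nop: "cf (Nop a) n \<theta> = (if fst n = snd n then (1 / pi) * integral {0..pi/2} (\<lambda>t. cos (2 * t) * cf a n t) else 0)"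
  unfolding Nop_def by (simp add: cf_eop okN eopc_def jset_def)

lemma cf_Iop: "cf (Iop a) n \<theta> = integral {0..cl \<theta>} (cf a n)"
  unfolding Iop_def by (simp add: cf_eop okI eopc_def jset_def)

lemma cf_Cop: "cf (Cop a) n \<theta> = integral {0..pi/2} (\<lambda>t. cos t * cf a n t)"
  unfolding Cop_def by (simp add: cf_eop okC eopc_def jset_def)

subsection \<open>The fixed point map\<close>

definition oneA where "oneA = cst {(0,0)} (\<lambda>_. 1)"
definition thA where "thA = cst {(0,0)} (\<lambda>t. t)"
definition W0A where "W0A = cst {(0,0)} (\<lambda>t. - cos (2 * t))"
text \<open>The kernel element of the linearised problem: \<open>-4 cos \<theta>\<close> has slope 4
  at \<open>pi/2\<close>, which matches the boundary displacement \<open>ybf (pi/2) = 1\<close>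
  through \<open>V' = 4 Y\<close>. \<open>ybf\<close> solves \<open>Y'' = 3 Y\<close>,
  \<open>Y(0) = 0\<close>.\<close>

definition VbA where "VbA = cst {(1,0),(0,1)} (\<lambda>t. - 4 * cos t)"
definition ybf :: "real \<Rightarrow> real" where "ybf t = sinh (sqrt 3 * t) / sinh (sqrt 3 * (pi/2))"
definition yb1f :: "real \<Rightarrow> real" where "yb1f t = sqrt 3 * cosh (sqrt 3 * t) / sinh (sqrt 3 * (pi/2))"
definition YbA where "YbA = cst {(1,0),(0,1)} ybf"
definition KYbA where "KYbA = cst {(1,0)} ybf - cst {(0,1)} ybf"
definition Y1bA where "Y1bA = cst {(1,0),(0,1)} yb1f"

lemma sinh_b_pos: "sinh (sqrt 3 * (pi/2)) > 0" by simp

lemma ybf_cont: "continuous_on UNIV ybf" "continuous_on UNIV yb1f"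
  using sinh_b_pos unfolding ybf_def[abs_def] yb1f_def[abs_def] by (auto intro!: continuous_intros)

lemma cf_consts:
  "cf oneA n \<theta> = (if n = (0,0) then 1 else 0)"
  "cf thA n \<theta> = (if n = (0,0) then cl \<theta> else 0)"
  "cf W0A n \<theta> = (if n = (0,0) then - cos (2 * cl \<theta>) else 0)"
  "cf VbA n \<theta> = (if n \<in> {(1,0),(0,1)} then - 4 * cos (cl \<theta>) else 0)"
  "cf YbA n \<theta> = (if n \<in> {(1,0),(0,1)} then ybf (cl \<theta>) else 0)"
  "cf Y1bA n \<theta> = (if n \<in> {(1,0),(0,1)} then yb1f (cl \<theta>) else 0)"
  "cf KYbA n \<theta> = kd n * cf YbA n \<theta>"
  unfolding oneA_def thA_def W0A_def VbA_def YbA_def Y1bA_def KYbA_def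
  by (simp_all add: cf_cst continuous_intros ybf_cont kd_def)

text \<open>A state consists of rescaled versions of \<open>g\<close>, \<open>r\<close>, \<open>T - \<theta>\<close>, \<open>N\<close>, \<open>L\<close>: the actual quantities
  are \<open>g = \<kappa>\<^sup>4 sg\<close>, \<open>r = \<kappa>\<^sup>4 sr\<close>, \<open>N = \<kappa>\<^sup>4 sN\<close>, \<open>L = \<kappa>\<^sup>2 sL\<close> and \<open>\<epsilon> = \<kappa>\<^sup>6 e\<close>, and then \<open>V = \<kappa>\<^sup>3 hv\<close> and \<open>Y = \<kappa>\<^sup>3 hy\<close>,
  where \<open>VbA\<close> and \<open>YbA\<close> are the first order terms of the bifurcating solution.\<close>

type_synonym state = "alg \<times> alg \<times> alg \<times> alg \<times> alg"

definition sg :: "state \<Rightarrow> alg" where "sg x = fst x"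
definition sr :: "state \<Rightarrow> alg" where "sr x = fst (snd x)"
definition sT :: "state \<Rightarrow> alg" where "sT x = fst (snd (snd x))"
definition sN :: "state \<Rightarrow> alg" where "sN x = fst (snd (snd (snd x)))"
definition sL :: "state \<Rightarrow> alg" where "sL x = snd (snd (snd (snd x)))"

lemma s_lin: "bounded_linear sg" "bounded_linear sr" "bounded_linear sT" "bounded_linear sN" "bounded_linear sL"
  unfolding sg_def[abs_def] sr_def[abs_def] sT_def[abs_def] sN_def[abs_def] sL_def[abs_def]
  by (intro bounded_linear_fst bounded_linear_snd bounded_linear_fst_comp bounded_linear_snd_comp)+

definition hv where "hv \<kappa> x = VbA + \<kappa> *\<^sub>R Vop (sg x)"
definition hkv where "hkv \<kappa> x = VbA + \<kappa> *\<^sub>R KVop (sg x)"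
definition hy where "hy \<kappa> x = YbA + \<kappa> *\<^sub>R Yop (sg x) (sr x)"
definition hky where "hky \<kappa> x = KYbA + \<kappa> *\<^sub>R KYop (sg x) (sr x)"
definition hy1 where "hy1 \<kappa> x = Y1bA + \<kappa> *\<^sub>R Y1op (sg x) (sr x)"
definition hw where "hw \<kappa> x = hv \<kappa> x + W0mul (hy \<kappa> x)"
definition Wf where "Wf \<kappa> x = W0A + \<kappa>^3 *\<^sub>R hw \<kappa> x"
definition L1 where "L1 \<kappa> x = oneA + \<kappa>^2 *\<^sub>R sL x"
definition N1 where "N1 \<kappa> x = oneA + \<kappa>^4 *\<^sub>R sN x"
definition Tf where "Tf x = thA + sT x"
text \<open>\<open>Qf\<close> is the conformal factor \<open>a^2 + om^2 b^2\<close> with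
  \<open>a = 1 + Y1\<close>. The minus sign in \<open>q2\<close> is correct because
  \<open>hky\<close> is antisymmetric: its square evaluates to minus the square of a sine
  series.\<close>

definition q2 where "q2 \<kappa> x = hy1 \<kappa> x \<star> hy1 \<kappa> x - 3 *\<^sub>R (L1 \<kappa> x \<star> (hky \<kappa> x \<star> hky \<kappa> x))"
definition Qf where "Qf \<kappa> x = oneA + (2 * \<kappa>^3) *\<^sub>R hy1 \<kappa> x + \<kappa>^6 *\<^sub>R q2 \<kappa> x"
text \<open>What remains of the equation for \<open>V\<close> after the linear part and the two
  adjusting terms \<open>3 L k^2 V\<close> and \<open>4 N W0\<close>. In the original variables each
  remaining term has order \<open>\<kappa>^6\<close> or smaller, which dictates the scale of
  \<epsilon>.\<close>

definition Rh where "Rh \<kappa> e x = 4 *\<^sub>R (\<kappa> *\<^sub>R (sN x \<star> (hw \<kappa> x + 2 *\<^sub>R (hy1 \<kappa> x \<star> W0A)))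
   + N1 \<kappa> x \<star> (2 *\<^sub>R (hy1 \<kappa> x \<star> hw \<kappa> x) + q2 \<kappa> x \<star> Wf \<kappa> x)
   - (3 * e) *\<^sub>R ((N1 \<kappa> x \<star> (Qf \<kappa> x \<star> Wf \<kappa> x)) \<star> (L1 \<kappa> x \<star> (Tf x \<star> Tf x))))"
text \<open>In the last component \<open>6 * pi\<close> is twice \<open>3 * pi\<close>: testing
  \<open>3 L (-4 cos \<theta>)\<close> against \<open>cos \<theta>\<close> gives
  \<open>12 * pi/4\<close>, and averaging with \<open>swop\<close> doubles the numerator. The
  averaging keeps the map equivariant under reflection.\<close>

definition Psi :: "real \<Rightarrow> real \<Rightarrow> state \<Rightarrow> state" where
  "Psi \<kappa> e x =
    (3 *\<^sub>R (sL x \<star> hkv \<kappa> x) - \<kappa> *\<^sub>R Rh \<kappa> e x - (4 * \<kappa>) *\<^sub>R (Nop (Rh \<kappa> e x) \<star> W0A),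
     sL x \<star> hky \<kappa> x,
     Iop (\<kappa>^2 *\<^sub>R hy1 \<kappa> x - (3 * \<kappa>^5 * e) *\<^sub>R ((L1 \<kappa> x \<star> (Tf x \<star> Tf x)) \<star> (oneA + \<kappa>^3 *\<^sub>R hy1 \<kappa> x))),
     \<kappa> *\<^sub>R Nop (Rh \<kappa> e x),
     (1 / (6 * pi)) *\<^sub>R shop (Cop (3 *\<^sub>R (sL x \<star> KVop (sg x)) - Rh \<kappa> e x)
       + swop (Cop (3 *\<^sub>R (sL x \<star> KVop (sg x)) - Rh \<kappa> e x))))"

subsection \<open>Uniformly Lipschitz families\<close>

text \<open>One constant for size and Lipschitz bound, uniform in the parameters
  \<open>(\<kappa>, e)\<close>. The notion is stable under sums, products and bounded linear maps,
  so the contraction estimate follows from the shape of \<open>Psi\<close> without computing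
  constants.\<close>

definition UL :: "(real \<times> real \<Rightarrow> state \<Rightarrow> 'b::real_normed_vector) \<Rightarrow> bool" where
  "UL f \<longleftrightarrow> (\<exists>B\<ge>0. \<forall>p\<in>{0..1}\<times>{0..1}. \<forall>x\<in>cball 0 1. norm (f p x) \<le> B \<and>
     (\<forall>y\<in>cball 0 1. norm (f p x - f p y) \<le> B * norm (x - y)))"

lemma UL_I:
  assumes "B \<ge> 0" "B' \<ge> 0" "\<And>p x. p \<in> {0..1}\<times>{0..1} \<Longrightarrow> x \<in> cball 0 1 \<Longrightarrow> norm (f p x) \<le> B"
    "\<And>p x y. p \<in> {0..1}\<times>{0..1} \<Longrightarrow> x \<in> cball 0 1 \<Longrightarrow> y \<in> cball 0 1 \<Longrightarrow> norm (f p x - f p y) \<le> B' * norm (x - y)"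
  shows "UL f"
  unfolding UL_def
proof (intro exI[of _ "max B B'"] conjI ballI)
  fix p x y assume *: "p \<in> {0..1::real}\<times>{0..1::real}" "x \<in> cball (0::state) 1" "y \<in> cball (0::state) 1"
  show "norm (f p x - f p y) \<le> max B B' * norm (x - y)"
    by (rule order_trans[OF assms(4)[OF *]]) (intro mult_right_mono, auto)
qed (use assms in \<open>auto simp: le_max_iff_disj\<close>)

lemma UL_E:
  assumes "UL f"
  obtains B where "B \<ge> 0" "\<And>p x. p \<in> {0..1}\<times>{0..1} \<Longrightarrow> x \<in> cball 0 1 \<Longrightarrow> norm (f p x) \<le> B"
    "\<And>p x y. p \<in> {0..1}\<times>{0..1} \<Longrightarrow> x \<in> cball 0 1 \<Longrightarrow> y \<in> cball 0 1 \<Longrightarrow> norm (f p x - f p y) \<le> B * norm (x - y)"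
proof -
  from assms obtain B where "B \<ge> 0" and B: "\<forall>p\<in>{0..1}\<times>{0..1}. \<forall>x\<in>cball 0 1. norm (f p x) \<le> B \<and>
     (\<forall>y\<in>cball 0 1. norm (f p x - f p y) \<le> B * norm (x - y))" unfolding UL_def by (elim exE conjE)
  show ?thesis
    by (rule that[OF \<open>B \<ge> 0\<close>]) (use bspec[OF bspec[OF B]] in \<open>auto simp del: mem_cball\<close>)
qed

lemma UL_const: "UL (\<lambda>p x. c)"
  by (rule UL_I[of "norm c" 0]) auto

lemma UL_lin:
  assumes "bounded_linear L" "UL f" shows "UL (\<lambda>p x. L (f p x))"
proof -
  interpret bounded_linear L by fact
  obtain K where K: "K \<ge> 0" "\<And>x. norm (L x) \<le> norm x * K" using nonneg_bounded by blast
  obtain B where B: "B \<ge> 0" "\<And>p x. p \<in> {0..1}\<times>{0..1} \<Longrightarrow> x \<in> cball 0 1 \<Longrightarrow> norm (f p x) \<le> B"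
    "\<And>p x y. p \<in> {0..1}\<times>{0..1} \<Longrightarrow> x \<in> cball 0 1 \<Longrightarrow> y \<in> cball 0 1 \<Longrightarrow> norm (f p x - f p y) \<le> B * norm (x - y)"
    by (rule UL_E[OF assms(2)], rule that)
  show ?thesis
  proof (rule UL_I[of "B * K" "B * K"])
    fix p x assume "p \<in> {0..1::real}\<times>{0..1::real}" "x \<in> cball (0::state) 1"
    from mult_right_mono[OF B(2)[OF this] K(1)] K(2)[of "f p x"]
    show "norm (L (f p x)) \<le> B * K" by linarith
  next
    fix p x y assume "p \<in> {0..1::real}\<times>{0..1::real}" "x \<in> cball (0::state) 1" "y \<in> cball (0::state) 1"
    from mult_right_mono[OF B(3)[OF this] K(1)] K(2)[of "f p x - f p y"]
    show "norm (L (f p x) - L (f p y)) \<le> B * K * norm (x - y)" by (simp add: diff mult_ac)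
  qed (use B(1) K(1) in auto)
qed

lemma UL_id: "UL (\<lambda>p x. x)"
  by (rule UL_I[of 1 1]) auto

lemma UL_lin': "bounded_linear L \<Longrightarrow> UL (\<lambda>p x. L x)"
  by (rule UL_lin[OF _ UL_id])

lemma UL_add:
  assumes "UL f" "UL g" shows "UL (\<lambda>p x. f p x + g p x)"
proof -
  obtain B where B: "B \<ge> 0" "\<And>p x. p \<in> {0..1}\<times>{0..1} \<Longrightarrow> x \<in> cball 0 1 \<Longrightarrow> norm (f p x) \<le> B"
    "\<And>p x y. p \<in> {0..1}\<times>{0..1} \<Longrightarrow> x \<in> cball 0 1 \<Longrightarrow> y \<in> cball 0 1 \<Longrightarrow> norm (f p x - f p y) \<le> B * norm (x - y)"
    by (rule UL_E[OF assms(1)], rule that)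
  obtain C where C: "C \<ge> 0" "\<And>p x. p \<in> {0..1}\<times>{0..1} \<Longrightarrow> x \<in> cball 0 1 \<Longrightarrow> norm (g p x) \<le> C"
    "\<And>p x y. p \<in> {0..1}\<times>{0..1} \<Longrightarrow> x \<in> cball 0 1 \<Longrightarrow> y \<in> cball 0 1 \<Longrightarrow> norm (g p x - g p y) \<le> C * norm (x - y)"
    by (rule UL_E[OF assms(2)], rule that)
  show ?thesis
  proof (rule UL_I[of "B + C" "B + C"])
    fix p x assume *: "p \<in> {0..1::real}\<times>{0..1::real}" "x \<in> cball (0::state) 1"
    show "norm (f p x + g p x) \<le> B + C"
      by (rule norm_triangle_le[OF add_mono[OF B(2)[OF *] C(2)[OF *]]])
    fix y assume **: "y \<in> cball (0::state) 1"
    have "norm (f p x + g p x - (f p y + g p y)) \<le> norm (f p x - f p y) + norm (g p x - g p y)"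
      unfolding add_diff_add by (rule norm_triangle_ineq)
    with B(3)[OF * **] C(3)[OF * **]
    show "norm (f p x + g p x - (f p y + g p y)) \<le> (B + C) * norm (x - y)"
      by (simp add: algebra_simps)
  qed (use B(1) C(1) in auto)
qed

lemma UL_scale:
  assumes "UL f" "\<And>p. p \<in> {0..1}\<times>{0..1} \<Longrightarrow> \<bar>c p\<bar> \<le> K" shows "UL (\<lambda>p x. c p *\<^sub>R f p x)"
proof -
  obtain B where B: "B \<ge> 0" "\<And>p x. p \<in> {0..1}\<times>{0..1} \<Longrightarrow> x \<in> cball 0 1 \<Longrightarrow> norm (f p x) \<le> B"
    "\<And>p x y. p \<in> {0..1}\<times>{0..1} \<Longrightarrow> x \<in> cball 0 1 \<Longrightarrow> y \<in> cball 0 1 \<Longrightarrow> norm (f p x - f p y) \<le> B * norm (x - y)"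
    by (rule UL_E[OF assms(1)], rule that)
  have K: "K \<ge> 0" using assms(2)[of "(0,0)"] by auto
  show ?thesis
  proof (rule UL_I[of "K * B" "K * B"])
    fix p x assume *: "p \<in> {0..1::real}\<times>{0..1::real}" "x \<in> cball (0::state) 1"
    show "norm (c p *\<^sub>R f p x) \<le> K * B" using mult_mono[OF assms(2) B(2)] * K by simp
    fix y assume **: "y \<in> cball (0::state) 1"
    have "norm (c p *\<^sub>R f p x - c p *\<^sub>R f p y) = \<bar>c p\<bar> * norm (f p x - f p y)"
      by (simp flip: scaleR_diff_right)
    also have "\<dots> \<le> K * (B * norm (x - y))" using mult_mono[OF assms(2) B(3)] * ** K by simp
    finally show "norm (c p *\<^sub>R f p x - c p *\<^sub>R f p y) \<le> K * B * norm (x - y)" by simp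
  qed (use B(1) K in auto)
qed

lemma UL_diff: "UL f \<Longrightarrow> UL g \<Longrightarrow> UL (\<lambda>p x. f p x - g p x)"
  using UL_add[of f "\<lambda>p x. (-1) *\<^sub>R g p x"] UL_scale[of g "\<lambda>_. -1" 1] by simp

lemma UL_conv:
  assumes "UL f" "UL g" shows "UL (\<lambda>p x. f p x \<star> g p x)"
proof -
  interpret bounded_bilinear conv by (rule bounded_bilinear_conv)
  obtain K where K: "K \<ge> 0" "\<And>x y. norm (x \<star> y) \<le> norm x * norm y * K" using nonneg_bounded by blast
  obtain B where B: "B \<ge> 0" "\<And>p x. p \<in> {0..1}\<times>{0..1} \<Longrightarrow> x \<in> cball 0 1 \<Longrightarrow> norm (f p x) \<le> B"
    "\<And>p x y. p \<in> {0..1}\<times>{0..1} \<Longrightarrow> x \<in> cball 0 1 \<Longrightarrow> y \<in> cball 0 1 \<Longrightarrow> norm (f p x - f p y) \<le> B * norm (x - y)"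
    by (rule UL_E[OF assms(1)], rule that)
  obtain C where C: "C \<ge> 0" "\<And>p x. p \<in> {0..1}\<times>{0..1} \<Longrightarrow> x \<in> cball 0 1 \<Longrightarrow> norm (g p x) \<le> C"
    "\<And>p x y. p \<in> {0..1}\<times>{0..1} \<Longrightarrow> x \<in> cball 0 1 \<Longrightarrow> y \<in> cball 0 1 \<Longrightarrow> norm (g p x - g p y) \<le> C * norm (x - y)"
    by (rule UL_E[OF assms(2)], rule that)
  show ?thesis
  proof (rule UL_I[of "B * C * K" "2 * (B * C * K)"])
    fix p x assume *: "p \<in> {0..1::real}\<times>{0..1::real}" "x \<in> cball (0::state) 1"
    show "norm (f p x \<star> g p x) \<le> B * C * K"
      by (rule order_trans[OF K(2)]) (intro mult_mono B(2) C(2) *, use B C K in auto)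
    fix y assume **: "y \<in> cball (0::state) 1"
    have "f p x \<star> g p x - f p y \<star> g p y = (f p x - f p y) \<star> g p x + f p y \<star> (g p x - g p y)"
      by (simp add: diff_left diff_right)
    then have "norm (f p x \<star> g p x - f p y \<star> g p y) \<le>
        norm ((f p x - f p y) \<star> g p x) + norm (f p y \<star> (g p x - g p y))"
      by (simp add: norm_triangle_ineq)
    also have "\<dots> \<le> (B * norm (x - y)) * C * K + B * (C * norm (x - y)) * K"
      by (intro add_mono order_trans[OF K(2)] mult_mono B C * ** ) (use B C K in auto)
    finally show "norm (f p x \<star> g p x - f p y \<star> g p y) \<le> 2 * (B * C * K) * norm (x - y)"
      by (simp add: algebra_simps)
  qed (use B(1) C(1) K in auto)
qed

lemma UL_Pair:
  assumes "UL f" "UL g" shows "UL (\<lambda>p x. (f p x, g p x))"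
proof -
  have "UL (\<lambda>p x. (f p x, 0) + (0, g p x))"
    by (intro UL_add UL_lin[OF _ assms(1)] UL_lin[OF _ assms(2)] bounded_linear_Pair bounded_linear_ident bounded_linear_zero)
  then show ?thesis by simp
qed

lemma pw01: "0 \<le> (a::real) \<Longrightarrow> a \<le> 1 \<Longrightarrow> \<bar>a ^ n\<bar> \<le> 1" by (simp add: power_le_one)

lemma UL_k: 
  assumes "UL f"
  shows "UL (\<lambda>p x. fst p *\<^sub>R f p x)" "UL (\<lambda>p x. fst p ^ n *\<^sub>R f p x)"
    "UL (\<lambda>p x. c *\<^sub>R f p x)" "UL (\<lambda>p x. (c * fst p ^ n) *\<^sub>R f p x)" "UL (\<lambda>p x. (c * fst p) *\<^sub>R f p x)"
    "UL (\<lambda>p x. (c * snd p) *\<^sub>R f p x)" "UL (\<lambda>p x. (c * fst p ^ n * snd p) *\<^sub>R f p x)"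
proof -
  have u: "\<bar>fst p\<bar> \<le> 1" "\<bar>snd p\<bar> \<le> 1" "\<bar>fst p ^ n\<bar> \<le> 1" "\<bar>fst p ^ n * snd p\<bar> \<le> 1"
    if "p \<in> {0..1::real} \<times> {0..1::real}" for p
    using that pw01[of "fst p" n] mult_mono[of "\<bar>fst p ^ n\<bar>" 1 "\<bar>snd p\<bar>" 1] by (auto simp: abs_mult)
  have c: "\<bar>c * a\<bar> \<le> \<bar>c\<bar>" if "\<bar>a\<bar> \<le> 1" for a
    using that mult_left_mono[of "\<bar>a\<bar>" 1 "\<bar>c\<bar>"] by (simp add: abs_mult)
  show "UL (\<lambda>p x. fst p *\<^sub>R f p x)" by (rule UL_scale[OF assms u(1)])
  show "UL (\<lambda>p x. fst p ^ n *\<^sub>R f p x)" by (rule UL_scale[OF assms u(3)])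
  show "UL (\<lambda>p x. c *\<^sub>R f p x)" by (rule UL_scale[OF assms order_refl])
  show "UL (\<lambda>p x. (c * fst p) *\<^sub>R f p x)" by (rule UL_scale[OF assms c[OF u(1)]])
  show "UL (\<lambda>p x. (c * snd p) *\<^sub>R f p x)" by (rule UL_scale[OF assms c[OF u(2)]])
  show "UL (\<lambda>p x. (c * fst p ^ n) *\<^sub>R f p x)" by (rule UL_scale[OF assms c[OF u(3)]])
  show "UL (\<lambda>p x. (c * fst p ^ n * snd p) *\<^sub>R f p x)" unfolding mult.assoc by (rule UL_scale[OF assms c[OF u(4)]])
qed

lemmas UL_ops = UL_const UL_conv UL_Pair UL_k UL_add UL_diff UL_lin'[OF s_lin(1)] UL_lin'[OF s_lin(2)]
  UL_lin'[OF s_lin(3)] UL_lin'[OF s_lin(4)] UL_lin'[OF s_lin(5)]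
  UL_lin[OF Nop_lin] UL_lin[OF Iop_lin] UL_lin[OF Cop_lin] UL_lin[OF bounded_linear_shop] UL_lin[OF bounded_linear_swop] UL_lin[OF W0mul_lin]
  UL_lin[OF Vop_lin] UL_lin[OF KVop_lin] UL_lin'[OF Yop_lin[OF s_lin(1,2)]] UL_lin'[OF KYop_lin[OF s_lin(1,2)]]
  UL_lin'[OF Y1op_lin[OF s_lin(1,2)]]

lemma UL_h: "UL (\<lambda>p x. hv (fst p) x)" "UL (\<lambda>p x. hkv (fst p) x)" "UL (\<lambda>p x. hy (fst p) x)"
  "UL (\<lambda>p x. hky (fst p) x)" "UL (\<lambda>p x. hy1 (fst p) x)" "UL (\<lambda>p x. L1 (fst p) x)" "UL (\<lambda>p x. N1 (fst p) x)"
  "UL (\<lambda>p x. Tf x)"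
  unfolding hv_def hkv_def hy_def hky_def hy1_def L1_def N1_def Tf_def
  by (intro UL_ops)+

lemma UL_hw: "UL (\<lambda>p x. hw (fst p) x)" unfolding hw_def by (intro UL_h UL_ops)
lemma UL_Wf: "UL (\<lambda>p x. Wf (fst p) x)" unfolding Wf_def by (intro UL_hw UL_ops)
lemma UL_q2: "UL (\<lambda>p x. q2 (fst p) x)" unfolding q2_def by (intro UL_h UL_ops)
lemma UL_Qf: "UL (\<lambda>p x. Qf (fst p) x)" unfolding Qf_def by (intro UL_h UL_q2 UL_ops)
lemma UL_Rh: "UL (\<lambda>p x. Rh (fst p) (snd p) x)" unfolding Rh_def
  by (intro UL_h UL_q2 UL_hw UL_Wf UL_Qf UL_ops)
lemma UL_Psi: "UL (\<lambda>p x. Psi (fst p) (snd p) x)" unfolding Psi_def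
  by (intro UL_h UL_q2 UL_hw UL_Wf UL_Qf UL_Rh UL_ops)

text \<open>The library only provides completeness for bounded continuous functions on a metric
  space, and \<^typ>\<open>nat\<close> is not an instance of that class.\<close>

lemma complete_alg: "complete (UNIV :: alg set)"
proof (rule completeI)
  fix f :: "nat \<Rightarrow> alg"
  assume "Cauchy f"
  then obtain g where "uniform_limit UNIV f g sequentially"
    using uniformly_convergent_eq_cauchy[of "\<lambda>_. True" f]
    unfolding Cauchy_def uniform_limit_sequentially_iff
    by (metis dist_fun_lt_imp_dist_val_lt)
  from uniform_limit_bcontfunE[OF this sequentially_bot]
  obtain l' where "g = apply_bcontfun l'" "(f \<longlonglongrightarrow> l')" by metis
  then show "\<exists>l\<in>UNIV. f \<longlonglongrightarrow> l" by blast
qed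

lemma complete_Times_UNIV:
  assumes "complete (UNIV :: 'a::metric_space set)" "complete (UNIV :: 'b::metric_space set)"
  shows "complete (UNIV :: ('a \<times> 'b) set)"
proof (rule completeI)
  fix f :: "nat \<Rightarrow> 'a \<times> 'b" assume c: "Cauchy f"
  obtain a where a: "(\<lambda>n. fst (f n)) \<longlonglongrightarrow> a"
    using assms(1) Cauchy_fst[OF c] unfolding complete_def by auto
  obtain b where b: "(\<lambda>n. snd (f n)) \<longlonglongrightarrow> b"
    using assms(2) Cauchy_snd[OF c] unfolding complete_def by auto
  show "\<exists>l\<in>UNIV. f \<longlonglongrightarrow> l" using tendsto_Pair[OF a b] by auto
qed

lemma complete_state: "complete (UNIV :: state set)"
  by (intro complete_Times_UNIV complete_alg)

text \<open>If \<open>B\<close> bounds the size and the Lipschitz constant of \<open>Psi\<close>,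
  then for \<open>\<kappa> \<le> 1 / (2 (B+1))\<close> the map \<open>\<kappa> Psi\<close> sends the
  unit ball into itself and contracts by \<open>1/2\<close>.\<close>

lemma fixed_point:
  obtains K where "K > 0" "\<And>\<kappa> e. 0 < \<kappa> \<Longrightarrow> \<kappa> \<le> K \<Longrightarrow> 0 \<le> e \<Longrightarrow> e \<le> 1 \<Longrightarrow>
    \<exists>!x. x \<in> cball 0 1 \<and> \<kappa> *\<^sub>R Psi \<kappa> e x = x"
proof -
  obtain B where B: "B \<ge> 0" "\<And>p x. p \<in> {0..1}\<times>{0..1} \<Longrightarrow> x \<in> cball 0 1 \<Longrightarrow> norm (Psi (fst p) (snd p) x) \<le> B"
    "\<And>p x y. p \<in> {0..1}\<times>{0..1} \<Longrightarrow> x \<in> cball 0 1 \<Longrightarrow> y \<in> cball 0 1 \<Longrightarrow>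
      norm (Psi (fst p) (snd p) x - Psi (fst p) (snd p) y) \<le> B * norm (x - y)"
    by (rule UL_E[OF UL_Psi], rule that)
  define K where "K = 1 / (2 * (B + 1))"
  show ?thesis
  proof (rule that)
    show "K > 0" using B(1) by (simp add: K_def)
    fix \<kappa> e :: real assume k: "0 < \<kappa>" "\<kappa> \<le> K" "0 \<le> e" "e \<le> 1"
    have K1: "K \<le> 1" using B(1) by (simp add: K_def)
    then have p: "(\<kappa>, e) \<in> {0..1}\<times>{0..1}" using k by auto
    have kB: "\<kappa> * B \<le> 1/2"
    proof -
      have "\<kappa> * B \<le> K * B" using k B by (intro mult_right_mono) auto
      also have "\<dots> \<le> 1/2" using B(1) by (simp add: K_def divide_simps)
      finally show ?thesis .
    qed
    have "\<exists>!x\<in>cball 0 1. \<kappa> *\<^sub>R Psi \<kappa> e x = x"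
    proof (rule Banach_fix)
      show "complete (cball (0::state) 1)" by (rule complete_closed_subset[OF _ subset_UNIV complete_state]) simp
      show "cball (0::state) 1 \<noteq> {}" by simp
      show "(\<lambda>x. \<kappa> *\<^sub>R Psi \<kappa> e x) ` cball 0 1 \<subseteq> cball 0 1"
      proof (rule image_subsetI)
        fix x :: state assume "x \<in> cball 0 1"
        have "norm (\<kappa> *\<^sub>R Psi \<kappa> e x) = \<kappa> * norm (Psi \<kappa> e x)" using k by simp
        also have "\<dots> \<le> \<kappa> * B" using mult_left_mono[OF B(2)[OF p \<open>x \<in> cball 0 1\<close>] less_imp_le[OF k(1)]] by (simp only: fst_conv snd_conv)
        finally show "\<kappa> *\<^sub>R Psi \<kappa> e x \<in> cball 0 1" using kB by simp
      qed
      show "dist (\<kappa> *\<^sub>R Psi \<kappa> e x) (\<kappa> *\<^sub>R Psi \<kappa> e y) \<le> 1/2 * dist x y" if "x \<in> cball 0 1" "y \<in> cball 0 1" for x y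
      proof -
        have "dist (\<kappa> *\<^sub>R Psi \<kappa> e x) (\<kappa> *\<^sub>R Psi \<kappa> e y) = \<kappa> * norm (Psi \<kappa> e x - Psi \<kappa> e y)"
          using k by (simp add: dist_norm flip: scaleR_diff_right)
        also have "\<dots> \<le> \<kappa> * (B * norm (x - y))" using B(3)[OF p, of x y] that k by (intro mult_left_mono) auto
        also have "\<dots> \<le> 1/2 * norm (x - y)" using mult_right_mono[OF kB, of "norm (x - y)"] by simp
        finally show ?thesis by (simp add: dist_norm)
      qed
    qed auto
    then show "\<exists>!x. x \<in> cball 0 1 \<and> \<kappa> *\<^sub>R Psi \<kappa> e x = x" by blast
  qed
qed

subsection \<open>Symmetry of the fixed point\<close>

lemma kd_swap: "kd (prod.swap n) = - kd n" and big_swap: "big (prod.swap n) = big n"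
  and kp_swap: "kp (prod.swap n) = kp n" and mm_swap: "mm (prod.swap n) = mm n" and lam_swap: "lam (prod.swap n) = lam n"
proof -
  show "kd (prod.swap n) = - kd n" by (simp add: kd_def)
  then show "big (prod.swap n) = big n" "kp (prod.swap n) = kp n" "mm (prod.swap n) = mm n" "lam (prod.swap n) = lam n"
    by (simp_all add: big_def kp_def mm_def lam_def)
qed

lemma vsol_swap: "vsol (prod.swap n) f = vsol n f"
  by (rule ext) (simp add: vsol_def pVL_def qVL_def pVR_def qVR_def pVS_def qVS_def big_swap kp_swap mm_swap)

text \<open>Under the swap \<open>kd\<close> changes sign. The part driven by \<open>g\<close> is a
  quotient that is even in \<open>kd\<close>, the part driven by \<open>f\<close> has the odd factor
  \<open>cY\<close>, so \<open>f\<close> must change sign too.\<close>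

lemma ysol_swap: "ysol (prod.swap n) g (\<lambda>t. - f t) = ysol n g f"
  and ysol1_swap: "ysol1 (prod.swap n) g (\<lambda>t. - f t) = ysol1 n g f"
  by (rule ext, simp add: ysol_def pYG_def qVL_def pYL_def qYL_def pYR_def qYR_def big_swap kp_swap lam_swap kd_swap cY_def
      ysol1_def pYG1_def pYL1_def pYR1_def)+

lemma cf_swop': "cf (swop a) n = cf a (prod.swap n)"
  by (rule ext) (simp add: cf_swop prod.swap_def)

lemmas swl_add = linear_add[OF bounded_linear.linear[OF bounded_linear_swop]]
  and swl_diff = linear_diff[OF bounded_linear.linear[OF bounded_linear_swop]]
  and swl_scaleR = linear_scale[OF bounded_linear.linear[OF bounded_linear_swop]]

lemma swop_ops:
  "swop (Vop a) = Vop (swop a)" "swop (KVop a) = KVop (swop a)"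
  "swop (Yop g r) = Yop (swop g) (- swop r)" "swop (KYop g r) = - KYop (swop g) (- swop r)"
  "swop (Y1op g r) = Y1op (swop g) (- swop r)" "swop (W0mul a) = W0mul (swop a)"
  "swop (Nop a) = Nop (swop a)" "swop (Iop a) = Iop (swop a)" "swop (Cop a) = Cop (swop a)"
proof -
  have cfn: "cf (- swop r) n = (\<lambda>t. - cf r (prod.swap n) t)" for r n
    by (rule ext) (simp add: cf_swop')
  show "swop (Vop a) = Vop (swop a)" "swop (KVop a) = KVop (swop a)" "swop (W0mul a) = W0mul (swop a)"
     "swop (Iop a) = Iop (swop a)" "swop (Cop a) = Cop (swop a)"
    by (rule alg_eqI, simp add: cf_swop' cf_Vop cf_KVop vsol_swap kd_swap cf_W0mul cf_Iop cf_Cop)+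
  show "swop (Yop g r) = Yop (swop g) (- swop r)" "swop (KYop g r) = - KYop (swop g) (- swop r)"
    "swop (Y1op g r) = Y1op (swop g) (- swop r)"
    by (rule alg_eqI, simp only: cf_minus cf_swop' cf_Yop cf_KYop cf_Y1op cfn kd_swap,
      use ysol_swap[of _ "cf g (prod.swap _)" "cf r (prod.swap _)"] ysol1_swap[of _ "cf g (prod.swap _)" "cf r (prod.swap _)"]
        ysol_swap[of "prod.swap _"] ysol1_swap[of "prod.swap _"] in \<open>auto simp: \<close>)+
  show "swop (Nop a) = Nop (swop a)"
    by (rule alg_eqI) (auto simp: cf_swop' cf_Nop prod.swap_def)
qed

lemma swop_consts: "swop oneA = oneA" "swop thA = thA" "swop W0A = W0A" "swop VbA = VbA" "swop YbA = YbA"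
  "swop KYbA = - KYbA" "swop Y1bA = Y1bA"
  by (rule alg_eqI, auto simp: cf_swop cf_consts kd_def)+

text \<open>The sign in the second component is there because \<open>r = L \<star> KY\<close> and
  \<open>KY = k Y\<close> is antisymmetric when \<open>Y\<close> is symmetric.\<close>

definition swst :: "state \<Rightarrow> state" where
  "swst x = (swop (sg x), - swop (sr x), swop (sT x), swop (sN x), swop (sL x))"

lemma s_swst: "sg (swst x) = swop (sg x)" "sr (swst x) = - swop (sr x)" "sT (swst x) = swop (sT x)"
  "sN (swst x) = swop (sN x)" "sL (swst x) = swop (sL x)"
  by (simp_all add: swst_def sg_def sr_def sT_def sN_def sL_def)

lemma norm_swst: "norm (swst x) \<le> norm x"
proof -
  obtain a b c d e where x: "x = (a, b, c, d, e)" by (cases x) auto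
  show ?thesis unfolding x swst_def sg_def sr_def sT_def sN_def sL_def
    by (simp add: norm_Pair) (intro add_mono power_mono norm_swop, auto)
qed

lemma neg_conv: "(- a) \<star> b = - (a \<star> b)" "a \<star> (- b) = - (a \<star> b)"
  using bounded_bilinear.minus_left[OF bounded_bilinear_conv] bounded_bilinear.minus_right[OF bounded_bilinear_conv] by auto

lemma swop_h:
  "swop (hv \<kappa> x) = hv \<kappa> (swst x)" "swop (hkv \<kappa> x) = hkv \<kappa> (swst x)" "swop (hy \<kappa> x) = hy \<kappa> (swst x)"
  "swop (hky \<kappa> x) = - hky \<kappa> (swst x)" "swop (hy1 \<kappa> x) = hy1 \<kappa> (swst x)"
  "swop (L1 \<kappa> x) = L1 \<kappa> (swst x)" "swop (N1 \<kappa> x) = N1 \<kappa> (swst x)" "swop (Tf x) = Tf (swst x)"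
  by (simp_all add: hv_def hkv_def hy_def hky_def hy1_def L1_def N1_def Tf_def s_swst swop_ops swop_consts
     swl_add swl_scaleR)

lemma swop_hw: "swop (hw \<kappa> x) = hw \<kappa> (swst x)"
  by (simp add: hw_def swop_h swop_ops swl_add)

lemma swop_Wf: "swop (Wf \<kappa> x) = Wf \<kappa> (swst x)"
  by (simp add: Wf_def swop_hw swop_consts swl_add swl_scaleR)

lemma swop_q2: "swop (q2 \<kappa> x) = q2 \<kappa> (swst x)"
  by (simp add: q2_def swop_h swop_conv swl_diff swl_scaleR neg_conv)

lemma swop_Qf: "swop (Qf \<kappa> x) = Qf \<kappa> (swst x)"
  by (simp add: Qf_def swop_h swop_q2 swop_consts swl_add swl_scaleR)

lemma swop_Rh: "swop (Rh \<kappa> e x) = Rh \<kappa> e (swst x)"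
  by (simp add: Rh_def swop_h swop_q2 swop_hw swop_Wf swop_Qf swop_consts swop_conv swl_add swl_diff swl_scaleR s_swst)

lemma swop_swop: "swop (swop a) = a" and swop_shop: "swop (shop a) = shop a"
  by (rule alg_eqI, auto simp: cf_swop cf_shop)+

lemma swst_swst: "swst (swst x) = x"
  unfolding swst_def[of "swst x"]
  by (simp add: s_swst swop_swop linear_neg[OF bounded_linear.linear[OF bounded_linear_swop]])
    (simp add: sg_def sr_def sT_def sN_def sL_def)

lemma Psi_swst: "swst (Psi \<kappa> e x) = Psi \<kappa> e (swst x)"
  unfolding swst_def[of "Psi \<kappa> e x"]
  by (simp add: Psi_def sg_def[of "(_,_)"] sr_def[of "(_,_)"] sT_def[of "(_,_)"] sN_def[of "(_,_)"] sL_def[of "(_,_)"]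
     swop_Rh swop_h swop_consts swop_conv swl_add swl_diff swl_scaleR s_swst neg_conv swop_ops swop_swop swop_shop swst_swst add.commute)

lemma swst_scaleR: "swst (r *\<^sub>R x) = r *\<^sub>R swst x"
  by (simp add: swst_def sg_def sr_def sT_def sN_def sL_def swl_scaleR)

text \<open>The reflection preserves the ball and commutes with \<open>Psi\<close>, so it maps the
  fixed point to a fixed point; uniqueness makes the two equal.\<close>

lemma symmetric_fixed_point:
  obtains K where "K > 0" "\<And>\<kappa> e. 0 < \<kappa> \<Longrightarrow> \<kappa> \<le> K \<Longrightarrow> 0 \<le> e \<Longrightarrow> e \<le> 1 \<Longrightarrow>
    \<exists>x. norm x \<le> 1 \<and> \<kappa> *\<^sub>R Psi \<kappa> e x = x \<and> swst x = x"
proof -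
  obtain K where K: "K > 0" "\<And>\<kappa> e. 0 < \<kappa> \<Longrightarrow> \<kappa> \<le> K \<Longrightarrow> 0 \<le> e \<Longrightarrow> e \<le> 1 \<Longrightarrow>
    \<exists>!x. x \<in> cball 0 1 \<and> \<kappa> *\<^sub>R Psi \<kappa> e x = x"
    by (rule fixed_point, rule that)
  show ?thesis
  proof (rule that[OF K(1)])
    fix \<kappa> e :: real assume a: "0 < \<kappa>" "\<kappa> \<le> K" "0 \<le> e" "e \<le> 1"
    from ex1_implies_ex[OF K(2)[OF a]] obtain x where x: "x \<in> cball 0 1" "\<kappa> *\<^sub>R Psi \<kappa> e x = x" by blast
    have "swst x \<in> cball 0 1" using x(1) norm_swst[of x] by simp
    moreover have "\<kappa> *\<^sub>R Psi \<kappa> e (swst x) = swst x"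
      using x(2) by (metis Psi_swst swst_scaleR)
    ultimately have "swst x = x" using K(2)[OF a] x by blast
    then show "\<exists>x. norm x \<le> 1 \<and> \<kappa> *\<^sub>R Psi \<kappa> e x = x \<and> swst x = x" using x(2) x(1)[unfolded mem_cball_0] by blast
  qed
qed

subsection \<open>Mode equations solved by the operators\<close>

lemma deriv_int_left:
  fixes f :: "real \<Rightarrow> real"
  assumes "continuous_on UNIV f" "\<theta> \<in> {0..c}"
  shows "((\<lambda>x. integral {0..x} f) has_real_derivative f \<theta>) (at \<theta> within {0..c})"
  by (rule integral_has_real_derivative[OF continuous_on_subset[OF assms(1) subset_UNIV] assms(2)])

lemma deriv_int_right:
  fixes f :: "real \<Rightarrow> real"
  assumes "continuous_on UNIV f" "\<theta> \<in> {0..c}"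
  shows "((\<lambda>x. integral {x..c} f) has_real_derivative - f \<theta>) (at \<theta> within {0..c})"
proof -
  have "((\<lambda>x. integral {0..c} f - integral {0..x} f) has_real_derivative 0 - f \<theta>) (at \<theta> within {0..c})"
    by (intro derivative_intros deriv_int_left assms)
  moreover have "integral {0..c} f - integral {0..x} f = integral {x..c} f" if "x \<in> {0..c}" for x
    using Henstock_Kurzweil_Integration.integral_combine[of 0 x c f] that
      integrable_continuous_real[OF continuous_on_subset[OF assms(1) subset_UNIV]] by auto
  ultimately show ?thesis
    using has_field_derivative_transform_within[of "\<lambda>x. integral {0..c} f - integral {0..x} f" "0 - f \<theta>" \<theta> "{0..c}" 1] assms(2)
    by auto
qed

text \<open>Variation of constants: \<open>J\<close> collects the contributions of the moving
  endpoints. It is 0 for the solution itself and a Wronskian for its derivative, and in the second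
  case it produces the source term.\<close>

lemma deriv_three:
  fixes f :: "real \<Rightarrow> real"
  assumes f: "continuous_on UNIV f" and \<theta>: "\<theta> \<in> {0..c}"
    and q: "continuous_on UNIV qa" "continuous_on UNIV qb" "continuous_on UNIV qd"
    and p: "(pa has_real_derivative pa') (at \<theta>)" "(pb has_real_derivative pb') (at \<theta>)" "(pd has_real_derivative pd') (at \<theta>)"
    and J: "pa \<theta> * qa \<theta> - pb \<theta> * qb \<theta> - pd \<theta> * qd \<theta> = J"
  shows "((\<lambda>\<theta>. pa \<theta> * integral {0..\<theta>} (\<lambda>t. qa t * f t) + pb \<theta> * integral {\<theta>..c} (\<lambda>t. qb t * f t)
      + pd \<theta> * integral {\<theta>..c} (\<lambda>t. qd t * f t))
     has_real_derivative (pa' * integral {0..\<theta>} (\<lambda>t. qa t * f t) + pb' * integral {\<theta>..c} (\<lambda>t. qb t * f t)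
      + pd' * integral {\<theta>..c} (\<lambda>t. qd t * f t) + J * f \<theta>)) (at \<theta> within {0..c})"
proof -
  have c: "continuous_on UNIV (\<lambda>t. qa t * f t)" "continuous_on UNIV (\<lambda>t. qb t * f t)" "continuous_on UNIV (\<lambda>t. qd t * f t)"
    by (intro continuous_intros f q)+
  show ?thesis
    by (rule derivative_eq_intros DERIV_subset[OF p(1)] DERIV_subset[OF p(2)] DERIV_subset[OF p(3)]
        deriv_int_left[OF c(1) \<theta>] deriv_int_right[OF c(2) \<theta>] deriv_int_right[OF c(3) \<theta>] refl subset_UNIV)+
      (simp add: J[symmetric] algebra_simps)
qed

definition pVL1 where "pVL1 n \<theta> = (if big n then cosh (kp n * (pi/2 - \<theta>)) / cosh (kp n * (pi/2)) else 0)"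
definition pVR1 where "pVR1 n \<theta> = (if big n then - sinh (kp n * \<theta>) / cosh (kp n * (pi/2)) else - cos (mm n * \<theta>))"
definition pVS1 where "pVS1 n \<theta> = (if big n then 0 else - sin (mm n * \<theta>))"

definition vsol1 :: "nat \<times> nat \<Rightarrow> (real \<Rightarrow> real) \<Rightarrow> real \<Rightarrow> real" where
  "vsol1 n f \<theta> = pVL1 n \<theta> * integral {0..\<theta>} (\<lambda>t. qVL n t * f t)
    + pVR1 n \<theta> * integral {\<theta>..pi/2} (\<lambda>t. qVR n t * f t)
    + pVS1 n \<theta> * integral {\<theta>..pi/2} (\<lambda>t. qVS n t * f t)"

lemma q_cont: "continuous_on UNIV (qVL n)" "continuous_on UNIV (qVR n)" "continuous_on UNIV (qVS n)"
    "continuous_on UNIV (qYL n)" "continuous_on UNIV (qYR n)"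
  using okVL okVR okVS okYL okYR unfolding eop_ok_def by (elim conjE, blast)+

lemma mm_nz: "mm n \<noteq> 0" by (simp add: mm_def)

lemma vsol_deriv:
  assumes "continuous_on UNIV f" "\<theta> \<in> {0..pi/2}"
  shows "(vsol n f has_real_derivative vsol1 n f \<theta>) (at \<theta> within {0..pi/2})"
proof -
  have p: "(pVL n has_real_derivative pVL1 n \<theta>) (at \<theta>)" 
    unfolding pVL_def[abs_def] pVL1_def by (cases "big n") (auto intro!: derivative_eq_intros dest: big_nz)
  have p2: "(pVR n has_real_derivative pVR1 n \<theta>) (at \<theta>)" "(pVS n has_real_derivative pVS1 n \<theta>) (at \<theta>)"
    using mm_nz[of n] unfolding pVR_def[abs_def] pVR1_def pVS_def[abs_def] pVS1_def
    by (cases "big n"; auto intro!: derivative_eq_intros dest: big_nz)+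
  have J: "pVL n \<theta> * qVL n \<theta> - pVR n \<theta> * qVR n \<theta> - pVS n \<theta> * qVS n \<theta> = 0"
    by (simp add: pVL_def qVL_def pVR_def qVR_def pVS_def qVS_def)
  show ?thesis
    using deriv_three[OF assms q_cont(1-3) p p2 J] unfolding vsol_def[abs_def] vsol1_def by simp
qed

lemma vsol1_deriv:
  assumes "continuous_on UNIV f" "\<theta> \<in> {0..pi/2}"
  shows "(vsol1 n f has_real_derivative (3 * (kd n)\<^sup>2 - 4) * vsol n f \<theta> + f \<theta>) (at \<theta> within {0..pi/2})"
proof -
  have K: "3 * (kd n)\<^sup>2 - 4 = (if big n then (kp n)\<^sup>2 else - (mm n)\<^sup>2)"
    using kd_cases[of n] kp_sq[of n] by (auto simp: mm_def abs_square_eq_1[THEN iffD2])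
  have p: "(pVL1 n has_real_derivative (3 * (kd n)\<^sup>2 - 4) * pVL n \<theta>) (at \<theta>)" 
    unfolding pVL_def[abs_def] pVL1_def[abs_def] K 
    by (cases "big n") (auto intro!: derivative_eq_intros dest: big_nz simp: power2_eq_square)
  have p2: "(pVR1 n has_real_derivative (3 * (kd n)\<^sup>2 - 4) * pVR n \<theta>) (at \<theta>)" 
     "(pVS1 n has_real_derivative (3 * (kd n)\<^sup>2 - 4) * pVS n \<theta>) (at \<theta>)"
    using mm_nz[of n] unfolding pVR_def[abs_def] pVR1_def[abs_def] pVS_def[abs_def] pVS1_def[abs_def] K
    by (cases "big n"; auto intro!: derivative_eq_intros dest: big_nz simp: power2_eq_square)+
  have J: "pVL1 n \<theta> * qVL n \<theta> - pVR1 n \<theta> * qVR n \<theta> - pVS1 n \<theta> * qVS n \<theta> = 1"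
  proof (cases "big n")
    case True
    have "cosh (kp n * (pi/2 - \<theta>)) * cosh (kp n * \<theta>) + sinh (kp n * \<theta>) * sinh (kp n * (pi/2 - \<theta>)) = cosh (kp n * (pi/2 - \<theta>) + kp n * \<theta>)"
      by (simp add: cosh_add mult_ac)
    also have "\<dots> = cosh (kp n * (pi/2))" by (simp add: algebra_simps)
    finally show ?thesis using True
      by (simp add: pVL1_def qVL_def pVR1_def qVR_def pVS1_def qVS_def flip: add_divide_distrib)
  next
    case False
    then show ?thesis using sin_cos_squared_add2[of "mm n * \<theta>"]
      by (simp add: pVL1_def qVL_def pVR1_def qVR_def pVS1_def qVS_def power2_eq_square)
  qed
  show ?thesis
    using deriv_three[OF assms q_cont(1-3) p p2 J] unfolding vsol_def vsol1_def[abs_def] by (simp add: algebra_simps)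
qed

text \<open>The third identity exposes the solvability condition: for \<open>|k| \<le> 1\<close> the
  slope at 0 is minus a moment of \<open>f\<close>. The second shows that these modes contribute
  nothing to the slope at \<open>pi/2\<close>.\<close>

lemma vsol_ends: "vsol n f (pi/2) = 0" 
  "vsol1 n f (pi/2) = (if big n then integral {0..pi/2} (\<lambda>t. qVL n t * f t) / cosh (kp n * (pi/2)) else 0)"
  "vsol1 n f 0 = (if big n then 0 else - integral {0..pi/2} (\<lambda>t. cos (mm n * t) * f t))"
  by (simp_all add: vsol_def vsol1_def pVL_def pVL1_def pVR1_def pVS1_def qVR_def)

lemma ysol_deriv:
  assumes "continuous_on UNIV f" "\<theta> \<in> {0..pi/2}"
  shows "(ysol n g f has_real_derivative ysol1 n g f \<theta>) (at \<theta> within {0..pi/2})"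
proof -
  have p: "(pYL n has_real_derivative pYL1 n \<theta>) (at \<theta>)" "(pYR n has_real_derivative pYR1 n \<theta>) (at \<theta>)"
     "((\<lambda>_::real. 0::real) has_real_derivative 0) (at \<theta>)"
    unfolding pYL_def[abs_def] pYL1_def pYR_def[abs_def] pYR1_def by (auto intro!: derivative_eq_intros)
  have pg: "(pYG n has_real_derivative pYG1 n \<theta>) (at \<theta> within {0..pi/2})"
    unfolding pYG_def[abs_def] pYG1_def by (cases "big n") (auto intro!: derivative_eq_intros dest: big_nz simp: mult_ac)
  have J: "pYL n \<theta> * qYL n \<theta> - pYR n \<theta> * qYR n \<theta> - 0 * 0 = 0"
    by (simp add: pYL_def qYL_def pYR_def qYR_def)
  have "((\<lambda>\<theta>. pYG n \<theta> * integral {0..pi/2} (\<lambda>t. qVL n t * g t)) has_real_derivative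
       pYG1 n \<theta> * integral {0..pi/2} (\<lambda>t. qVL n t * g t)) (at \<theta> within {0..pi/2})"
    by (rule DERIV_cmult_right[OF pg])
  from DERIV_add[OF this deriv_three[OF assms q_cont(4,5) continuous_on_const[of UNIV 0] p J]]
  show ?thesis
    unfolding ysol_def[abs_def] ysol1_def by (simp add: add_ac)
qed

lemma ysol1_deriv:
  assumes "continuous_on UNIV f" "\<theta> \<in> {0..pi/2}"
  shows "(ysol1 n g f has_real_derivative 3 * (kd n)\<^sup>2 * ysol n g f \<theta> + 3 * kd n * f \<theta>) (at \<theta> within {0..pi/2})"
proof -
  have L2: "3 * (kd n)\<^sup>2 = lam n * lam n" using lam_sq[of n] by (simp add: power2_eq_square)
  have p: "(pYL1 n has_real_derivative 3 * (kd n)\<^sup>2 * pYL n \<theta>) (at \<theta>)" "(pYR1 n has_real_derivative 3 * (kd n)\<^sup>2 * pYR n \<theta>) (at \<theta>)"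
     "((\<lambda>_::real. 0::real) has_real_derivative 0) (at \<theta>)"
    unfolding pYL_def[abs_def] pYL1_def[abs_def] pYR_def[abs_def] pYR1_def[abs_def] L2 by (auto intro!: derivative_eq_intros)
  have L3: "3 * (kd n)\<^sup>2 = (sqrt 3 * kd n) * (sqrt 3 * kd n)" by (simp add: power2_eq_square)
  have pg: "(pYG1 n has_real_derivative 3 * (kd n)\<^sup>2 * pYG n \<theta>) (at \<theta> within {0..pi/2})"
    unfolding pYG_def[abs_def] pYG1_def[abs_def] L3 by (cases "big n") (auto intro!: derivative_eq_intros dest: big_nz simp: mult_ac)
  have J: "pYL1 n \<theta> * qYL n \<theta> - pYR1 n \<theta> * qYR n \<theta> - 0 * 0 = 3 * kd n"
  proof (cases "kd n = 0")
    case False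
    have "cosh (lam n * (pi/2 - \<theta>)) * sinh (lam n * \<theta>) + cosh (lam n * \<theta>) * sinh (lam n * (pi/2 - \<theta>)) = sinh (lam n * (pi/2 - \<theta>) + lam n * \<theta>)"
      by (simp add: sinh_add mult_ac)
    also have "\<dots> = sinh (lam n * (pi/2))" by (simp add: algebra_simps)
    finally have e: "cosh (lam n * (pi/2 - \<theta>)) * sinh (lam n * \<theta>) + cosh (lam n * \<theta>) * sinh (lam n * (pi/2 - \<theta>)) = sinh (lam n * (pi/2))" .
    have "pYL1 n \<theta> * qYL n \<theta> - pYR1 n \<theta> * qYR n \<theta> - 0 * 0 = - cY n * lam n *
        (cosh (lam n * (pi/2 - \<theta>)) * sinh (lam n * \<theta>) + cosh (lam n * \<theta>) * sinh (lam n * (pi/2 - \<theta>)))"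
      by (simp add: pYL1_def qYL_def pYR1_def qYR_def algebra_simps)
    also have "\<dots> = - cY n * lam n * sinh (lam n * (pi/2))" unfolding e ..
    also have "\<dots> = 3 * kd n" using False lam_pos[OF False] by (simp add: cY_def)
    finally show ?thesis .
  qed (simp add: pYL1_def pYR1_def cY_def)
  have "((\<lambda>\<theta>. pYG1 n \<theta> * integral {0..pi/2} (\<lambda>t. qVL n t * g t)) has_real_derivative
       (3 * (kd n)\<^sup>2 * pYG n \<theta>) * integral {0..pi/2} (\<lambda>t. qVL n t * g t)) (at \<theta> within {0..pi/2})"
    by (rule DERIV_cmult_right[OF pg])
  from DERIV_add[OF this deriv_three[OF assms q_cont(4,5) continuous_on_const[of UNIV 0] p J]]
  show ?thesis
    unfolding ysol_def ysol1_def[abs_def] by (simp add: algebra_simps)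
qed

text \<open>The quarter comes from the Neumann condition: the \<theta>-derivative of
  \<open>- cos 2\<theta> + V + 2 sin 2\<theta> Y\<close> at \<open>pi/2\<close> is
  \<open>V' - 4 Y\<close>.\<close>

lemma ysol_ends: "ysol n g f 0 = 0" "ysol n g f (pi/2) = vsol1 n g (pi/2) / 4"
  "kd n = 0 \<Longrightarrow> ysol n g f \<theta> = 0"
proof -
  show "ysol n g f 0 = 0" by (simp add: ysol_def pYG_def pYR_def)
  show "ysol n g f (pi/2) = vsol1 n g (pi/2) / 4"
    unfolding vsol_ends by (auto simp: ysol_def pYG_def pYL_def dest: big_nz)
  show "kd n = 0 \<Longrightarrow> ysol n g f \<theta> = 0"
    by (auto simp: ysol_def pYG_def pYL_def pYR_def cY_def dest: big_nz)
qed

lemma ybf_deriv: "(ybf has_real_derivative yb1f \<theta>) (at \<theta> within S)" "(yb1f has_real_derivative 3 * ybf \<theta>) (at \<theta> within S)"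
  using sinh_b_pos unfolding ybf_def[abs_def] yb1f_def[abs_def]
  by (auto intro!: derivative_eq_intros simp del: sinh_real_pos_iff)

subsection \<open>The resulting coefficient families\<close>

text \<open>The map is \<open>(\<xi>, \<theta>) \<mapsto> (\<xi> + X, \<theta> + Y)\<close>, where \<open>X\<close> has the sine coefficients \<open>Y1 / k\<close>, and the solution is \<open>- cos 2\<theta> + V + 2 sin 2\<theta> Y\<close>: subtracting the
  derivative of \<open>- cos 2\<theta>\<close> in the direction of the displacement \<open>Y\<close> removes the derivatives
  of \<open>Y\<close> from the equation for \<open>V\<close> to first order. \<open>Y1\<close> is the \<open>\<theta>\<close>-derivative of \<open>Y\<close>, and \<open>T\<close> is
  \<open>tanh (\<surd>E (\<theta> + Y)) / \<surd>E\<close> with \<open>E = 3 \<epsilon> (1 + L)\<close>, so that \<open>1 / cosh\<^sup>2 = 1 - E T\<^sup>2\<close>.\<close>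

locale mode_sol =
  fixes \<kappa> \<epsilon> \<delta> :: real and V KV Y KY Y1 g r T N L :: alg and V1 :: "nat \<times> nat \<Rightarrow> real \<Rightarrow> real"
  assumes kappa: "\<kappa> > 0" and eps: "\<epsilon> > 0"
  assumes small: "norm Y1 \<le> \<delta>" "norm KY \<le> \<delta>" "norm Y \<le> \<delta>" "norm L \<le> \<delta>" "norm N \<le> \<delta>" "norm T \<le> 1 + norm thA" "\<epsilon> \<le> \<delta>"
  assumes sym: "swop V = V" "swop Y = Y" "swop Y1 = Y1" "swop g = g" "swop T = T" "swop N = N" "swop L = L"
  assumes cf_KV: "cf KV n \<theta> = (kd n)\<^sup>2 * cf V n \<theta>"
    and cf_KY: "cf KY n \<theta> = kd n * cf Y n \<theta>"
  assumes dV: "\<theta> \<in> {0..pi/2} \<Longrightarrow> (cf V n has_real_derivative V1 n \<theta>) (at \<theta> within {0..pi/2})"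
    and dV1: "\<theta> \<in> {0..pi/2} \<Longrightarrow> (V1 n has_real_derivative (3 * (kd n)\<^sup>2 - 4) * cf V n \<theta> + cf g n \<theta>) (at \<theta> within {0..pi/2})"
    and dY: "\<theta> \<in> {0..pi/2} \<Longrightarrow> (cf Y n has_real_derivative cf Y1 n \<theta>) (at \<theta> within {0..pi/2})"
    and dY1: "\<theta> \<in> {0..pi/2} \<Longrightarrow> (cf Y1 n has_real_derivative 3 * (kd n)\<^sup>2 * cf Y n \<theta> + 3 * kd n * cf r n \<theta>) (at \<theta> within {0..pi/2})"
    and dT: "\<theta> \<in> {0..pi/2} \<Longrightarrow> (cf T n has_real_derivative
      cf (oneA + Y1 - (3 * \<epsilon>) *\<^sub>R (((oneA + L) \<star> (T \<star> T)) \<star> (oneA + Y1))) n \<theta>) (at \<theta> within {0..pi/2})"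
  assumes V_end: "cf V n (pi/2) = 0" "V1 n 0 = 0" "V1 n (pi/2) = 4 * cf Y n (pi/2)"
    and Y_0: "cf Y n 0 = 0" "kd n = 0 \<Longrightarrow> cf Y n \<theta> = 0" "cf Y (Suc 0, 0) (pi/2) = \<kappa>^3" "cf Y (0, Suc 0) (pi/2) = \<kappa>^3"
    and T_0: "cf T n 0 = 0"
  assumes r_eq: "r = L \<star> KY"
    and diag: "fst n \<noteq> snd n \<Longrightarrow> cf N n \<theta> = 0" "fst n \<noteq> snd n \<Longrightarrow> cf L n \<theta> = 0"
      "cf N n \<theta> = cf N n 0" "cf L n \<theta> = cf L n 0"
  assumes g_eq: "g = 3 *\<^sub>R (L \<star> KV)
    - 4 *\<^sub>R (N \<star> ((V + W0mul Y) + 2 *\<^sub>R (Y1 \<star> W0A))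
      + (oneA + N) \<star> (2 *\<^sub>R (Y1 \<star> (V + W0mul Y)) + (Y1 \<star> Y1 - 3 *\<^sub>R ((oneA + L) \<star> (KY \<star> KY))) \<star> (W0A + (V + W0mul Y)))
      - (3 * \<epsilon>) *\<^sub>R (((oneA + N) \<star> ((oneA + 2 *\<^sub>R Y1 + (Y1 \<star> Y1 - 3 *\<^sub>R ((oneA + L) \<star> (KY \<star> KY)))) \<star> (W0A + (V + W0mul Y))))
         \<star> ((oneA + L) \<star> (T \<star> T))))
    - 4 *\<^sub>R (N \<star> W0A)"

section \<open>From the fixed point to solutions of the mode equations\<close>

lemmas conv_add_right = bounded_bilinear.add_right[OF bounded_bilinear_conv]
  and conv_scaleR_left = bounded_bilinear.scaleR_left[OF bounded_bilinear_conv]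
  and conv_scaleR_right = bounded_bilinear.scaleR_right[OF bounded_bilinear_conv]

lemma vsol_scale: "vsol n (\<lambda>t. c * f t) \<theta> = c * vsol n f \<theta>"
  by (simp add: vsol_def mult.left_commute[of _ c] algebra_simps)

lemma ysol_scale: "ysol n (\<lambda>t. c * g t) (\<lambda>t. c * f t) \<theta> = c * ysol n g f \<theta>"
    and ysol1_scale: "ysol1 n (\<lambda>t. c * g t) (\<lambda>t. c * f t) \<theta> = c * ysol1 n g f \<theta>"
  by (simp_all add: ysol_def ysol1_def mult.left_commute[of _ c] algebra_simps)

lemma W0mul_scaleR: "W0mul (c *\<^sub>R a) = c *\<^sub>R W0mul a"
  using linear_scale[OF bounded_linear.linear[OF W0mul_lin]] by auto

text \<open>Convolution with a diagonal family leaves the wave number unchanged, so multipliers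
  depending on \<open>k\<close> pass through it.\<close>

lemma conv_mode:
  assumes d: "\<And>n \<theta>. fst n \<noteq> snd n \<Longrightarrow> cf a n \<theta> = 0" and c: "\<And>n \<theta>. cf b' n \<theta> = f (kd n) * cf b n \<theta>"
  shows "cf (a \<star> b') n \<theta> = f (kd n) * cf (a \<star> b) n \<theta>"
proof -
  have "cf a (p, q) \<theta> * cf b' (fst n - p, snd n - q) \<theta> = f (kd n) * (cf a (p, q) \<theta> * cf b (fst n - p, snd n - q) \<theta>)"
    if "p \<le> fst n" "q \<le> snd n" for p q
  proof (cases "p = q")
    case True
    then have "kd (fst n - p, snd n - q) = kd n" using that by (simp add: kd_def)
    then show ?thesis by (simp add: c)
  qed (simp add: d)
  then show ?thesis unfolding cf_conv ccf_def sum_distrib_left by (intro sum.cong) auto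
qed

lemma integral_cos_sq: "integral {0..pi/2} (\<lambda>t. cos t * cos t) = pi / 4"
  and integral_cos2_sq: "integral {0..pi/2} (\<lambda>t. cos (2 * t) * cos (2 * t)) = pi / 4"
proof -
  have "((\<lambda>t. cos t * cos t) has_integral ((pi/2) / 2 + sin (2 * (pi/2)) / 4 - (0 / 2 + sin (2 * 0) / 4))) {0..pi/2}"
    by (rule fundamental_theorem_of_calculus[of 0 "pi/2" "\<lambda>t. t / 2 + sin (2 * t) / 4"])
      (auto intro!: derivative_eq_intros simp: cos_double_cos power2_eq_square
        simp flip: has_real_derivative_iff_has_vector_derivative, simp add: field_simps)
  then show "integral {0..pi/2} (\<lambda>t. cos t * cos t) = pi / 4" by (simp add: integral_unique)
  have "cos (2 * t * 2) = 2 * (cos (2 * t) * cos (2 * t)) - 1" for t :: real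
    using cos_double_cos[of "2 * t"] by (simp add: power2_eq_square mult_ac)
  then have "((\<lambda>t. cos (2 * t) * cos (2 * t)) has_integral ((pi/2) / 2 + sin (4 * (pi/2)) / 8 - (0 / 2 + sin (4 * 0) / 8))) {0..pi/2}"
    by (intro fundamental_theorem_of_calculus[of 0 "pi/2" "\<lambda>t. t / 2 + sin (4 * t) / 8"])
      (auto intro!: derivative_eq_intros simp: mult_ac
        simp flip: has_real_derivative_iff_has_vector_derivative, simp add: field_simps)
  then show "integral {0..pi/2} (\<lambda>t. cos (2 * t) * cos (2 * t)) = pi / 4" 
    using sin_npi[of 2] by (simp add: integral_unique mult.commute)
qed

lemma fixed_point_equations:
  fixes x :: state
  assumes k: "\<kappa> > 0" and fp: "\<kappa> *\<^sub>R Psi \<kappa> e x = x"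
  shows "sg x = \<kappa> *\<^sub>R (3 *\<^sub>R (sL x \<star> hkv \<kappa> x) - \<kappa> *\<^sub>R Rh \<kappa> e x - (4 * \<kappa>) *\<^sub>R (Nop (Rh \<kappa> e x) \<star> W0A))"
    "sr x = \<kappa> *\<^sub>R (sL x \<star> hky \<kappa> x)"
    "sT x = \<kappa> *\<^sub>R Iop (\<kappa>^2 *\<^sub>R hy1 \<kappa> x - (3 * \<kappa>^5 * e) *\<^sub>R ((L1 \<kappa> x \<star> (Tf x \<star> Tf x)) \<star> (oneA + \<kappa>^3 *\<^sub>R hy1 \<kappa> x)))"
    "sN x = \<kappa> *\<^sub>R \<kappa> *\<^sub>R Nop (Rh \<kappa> e x)"
    "sL x = \<kappa> *\<^sub>R ((1 / (6 * pi)) *\<^sub>R shop (Cop (3 *\<^sub>R (sL x \<star> KVop (sg x)) - Rh \<kappa> e x)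
       + swop (Cop (3 *\<^sub>R (sL x \<star> KVop (sg x)) - Rh \<kappa> e x))))"
proof -
  have a: "sg (c *\<^sub>R y) = c *\<^sub>R sg y" "sr (c *\<^sub>R y) = c *\<^sub>R sr y" "sT (c *\<^sub>R y) = c *\<^sub>R sT y" "sN (c *\<^sub>R y) = c *\<^sub>R sN y" "sL (c *\<^sub>R y) = c *\<^sub>R sL y"
    for c y by (simp_all add: sg_def sr_def sT_def sN_def sL_def)
  note b = arg_cong[OF fp, of sg] arg_cong[OF fp, of sr] arg_cong[OF fp, of sT] arg_cong[OF fp, of sN] arg_cong[OF fp, of sL]
  note b = b[unfolded a, symmetric]
  have c: "sg (Psi \<kappa> e x) = fst (Psi \<kappa> e x)" "sr (Psi \<kappa> e x) = fst (snd (Psi \<kappa> e x))" 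
    "sT (Psi \<kappa> e x) = fst (snd (snd (Psi \<kappa> e x)))"  "sN (Psi \<kappa> e x) = fst (snd (snd (snd (Psi \<kappa> e x))))" 
    "sL (Psi \<kappa> e x) = snd (snd (snd (snd (Psi \<kappa> e x))))" 
    by (simp_all add: sg_def sr_def sT_def sN_def sL_def)
  show "sg x = \<kappa> *\<^sub>R (3 *\<^sub>R (sL x \<star> hkv \<kappa> x) - \<kappa> *\<^sub>R Rh \<kappa> e x - (4 * \<kappa>) *\<^sub>R (Nop (Rh \<kappa> e x) \<star> W0A))"
    using b(1) unfolding c unfolding Psi_def by simp
  show "sr x = \<kappa> *\<^sub>R (sL x \<star> hky \<kappa> x)" using b(2) unfolding c unfolding Psi_def by simp
  show "sT x = \<kappa> *\<^sub>R Iop (\<kappa>^2 *\<^sub>R hy1 \<kappa> x - (3 * \<kappa>^5 * e) *\<^sub>R ((L1 \<kappa> x \<star> (Tf x \<star> Tf x)) \<star> (oneA + \<kappa>^3 *\<^sub>R hy1 \<kappa> x)))"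
    using b(3) unfolding c unfolding Psi_def by simp
  show "sN x = \<kappa> *\<^sub>R \<kappa> *\<^sub>R Nop (Rh \<kappa> e x)"
    using b(4) unfolding c unfolding Psi_def by simp
  show "sL x = \<kappa> *\<^sub>R ((1 / (6 * pi)) *\<^sub>R shop (Cop (3 *\<^sub>R (sL x \<star> KVop (sg x)) - Rh \<kappa> e x)
       + swop (Cop (3 *\<^sub>R (sL x \<star> KVop (sg x)) - Rh \<kappa> e x))))"
    using b(5) unfolding c unfolding Psi_def by simp
qed

lemma cf_conv_W0A: "cf (a \<star> W0A) n \<theta> = - cos (2 * cl \<theta>) * cf a n \<theta>"
proof -
  have "cf a (p, q) \<theta> * cf W0A (fst n - p, snd n - q) \<theta> =
     (if q = snd n then (if p = fst n then - cos (2 * cl \<theta>) * cf a n \<theta> else 0) else 0)" if "p \<le> fst n" "q \<le> snd n" for p q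
    using that by (cases n) (auto simp: cf_consts)
  then have "ccf a W0A n \<theta> = (\<Sum>p\<le>fst n. \<Sum>q\<le>snd n.
     (if q = snd n then (if p = fst n then - cos (2 * cl \<theta>) * cf a n \<theta> else 0) else 0))"
    unfolding ccf_def by (intro sum.cong) auto
  then show ?thesis by (simp add: cf_conv sum.delta)
qed

text \<open>Of the two entries of \<open>VbA\<close>, only \<open>(1,0)\<close> can meet a diagonal
  coefficient at \<open>(j+1, j)\<close>; the entry \<open>(0,1)\<close> would require an
  off-diagonal one.\<close>

lemma cf_conv_VbA:
  assumes d: "\<And>n \<theta>. fst n \<noteq> snd n \<Longrightarrow> cf a n \<theta> = 0"
  shows "cf (a \<star> VbA) (Suc j, j) \<theta> = - 4 * cos (cl \<theta>) * cf a (j, j) \<theta>"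
proof -
  have "cf a (p, q) \<theta> * cf VbA (Suc j - p, j - q) \<theta> =
     (if q = j then (if p = j then - 4 * cos (cl \<theta>) * cf a (j, j) \<theta> else 0) else 0)" if "p \<le> Suc j" "q \<le> j" for p q
    using that d[of "(p, q)" \<theta>] by (auto simp: cf_consts)
  then have "ccf a VbA (Suc j, j) \<theta> = (\<Sum>p\<le>Suc j. \<Sum>q\<le>j.
     (if q = j then (if p = j then - 4 * cos (cl \<theta>) * cf a (j, j) \<theta> else 0) else 0))"
    unfolding ccf_def by (intro sum.cong) auto
  then show ?thesis by (simp add: cf_conv sum.delta)
qed

text \<open>Undoes the rescaling: \<open>V\<close>, \<open>Y\<close> carry
  \<open>\<kappa>^3\<close>, \<open>N\<close> carries \<open>\<kappa>^4\<close> and \<epsilon>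
  carries \<open>\<kappa>^6\<close>, so \<open>\<kappa>^6\<close> factors out of every term.\<close>

lemma Rh_scaled:
  assumes "W = \<kappa>^3 *\<^sub>R hw \<kappa> x" "Y1 = \<kappa>^3 *\<^sub>R hy1 \<kappa> x" "KY = \<kappa>^3 *\<^sub>R hky \<kappa> x" "N = \<kappa>^4 *\<^sub>R sN x" "L = \<kappa>^2 *\<^sub>R sL x"
     "T = Tf x" "\<epsilon> = \<kappa>^6 * e"
  shows "\<kappa>^6 *\<^sub>R Rh \<kappa> e x = 4 *\<^sub>R (N \<star> (W + 2 *\<^sub>R (Y1 \<star> W0A))
      + (oneA + N) \<star> (2 *\<^sub>R (Y1 \<star> W) + (Y1 \<star> Y1 - 3 *\<^sub>R ((oneA + L) \<star> (KY \<star> KY))) \<star> (W0A + W))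
      - (3 * \<epsilon>) *\<^sub>R (((oneA + N) \<star> ((oneA + 2 *\<^sub>R Y1 + (Y1 \<star> Y1 - 3 *\<^sub>R ((oneA + L) \<star> (KY \<star> KY)))) \<star> (W0A + W)))
         \<star> ((oneA + L) \<star> (T \<star> T))))"
proof -
  have n1: "N1 \<kappa> x = oneA + N" and l1: "L1 \<kappa> x = oneA + L" and wf: "Wf \<kappa> x = W0A + W"
    by (simp_all add: N1_def L1_def Wf_def assms)
  have q: "\<kappa>^6 *\<^sub>R q2 \<kappa> x = Y1 \<star> Y1 - 3 *\<^sub>R ((oneA + L) \<star> (KY \<star> KY))"
  proof -
    have "(oneA + L) \<star> (KY \<star> KY) = \<kappa>^6 *\<^sub>R (L1 \<kappa> x \<star> (hky \<kappa> x \<star> hky \<kappa> x))"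
      unfolding l1[symmetric] assms(3) by (simp add: conv_scaleR_left conv_scaleR_right flip: power_add)
    moreover have "Y1 \<star> Y1 = \<kappa>^6 *\<^sub>R (hy1 \<kappa> x \<star> hy1 \<kappa> x)"
      unfolding assms by (simp add: conv_scaleR_left conv_scaleR_right flip: power_add)
    ultimately show ?thesis by (simp add: q2_def scaleR_diff_right mult.commute)
  qed
  have qf: "Qf \<kappa> x = oneA + 2 *\<^sub>R Y1 + (Y1 \<star> Y1 - 3 *\<^sub>R ((oneA + L) \<star> (KY \<star> KY)))"
    unfolding Qf_def q by (simp add: assms)
  have 1: "N \<star> (W + 2 *\<^sub>R (Y1 \<star> W0A)) = \<kappa>^6 *\<^sub>R \<kappa> *\<^sub>R (sN x \<star> (hw \<kappa> x + 2 *\<^sub>R (hy1 \<kappa> x \<star> W0A)))"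
    unfolding assms by (simp add: conv_scaleR_left conv_scaleR_right conv_add_right scaleR_add_right mult_ac eval_nat_numeral)
  have 2: "2 *\<^sub>R (Y1 \<star> W) = \<kappa>^6 *\<^sub>R (2 *\<^sub>R (hy1 \<kappa> x \<star> hw \<kappa> x))"
    unfolding assms by (simp add: conv_scaleR_left conv_scaleR_right mult_ac eval_nat_numeral)
  have 3: "(Y1 \<star> Y1 - 3 *\<^sub>R ((oneA + L) \<star> (KY \<star> KY))) \<star> (W0A + W) = \<kappa>^6 *\<^sub>R (q2 \<kappa> x \<star> Wf \<kappa> x)"
    unfolding q[symmetric] wf[symmetric] by (simp add: conv_scaleR_left)
  have 4: "(3 * (\<kappa>^6 * e)) *\<^sub>R Z = \<kappa>^6 *\<^sub>R ((3 * e) *\<^sub>R Z)" for Z :: alg by (simp add: mult_ac)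
  show ?thesis
    unfolding 1 2 3 unfolding Rh_def n1 l1 qf[symmetric] wf[symmetric] assms(6,7) 4
    unfolding scaleR_add_right[symmetric] conv_scaleR_right scaleR_diff_right[symmetric]
    by (rule scaleR_left_commute)
qed

theorem mode_sol_exists:
  assumes "\<delta> > 0"
  obtains \<kappa> where "\<kappa> > 0" "\<And>\<epsilon>. 0 < \<epsilon> \<Longrightarrow> \<epsilon> \<le> \<kappa>^6 \<Longrightarrow> \<exists>V KV Y KY Y1 g r T N L V1. mode_sol \<kappa> \<epsilon> \<delta> V KV Y KY Y1 g r T N L V1"
proof -
  obtain K where K: "K > 0" "\<And>\<kappa> e. 0 < \<kappa> \<Longrightarrow> \<kappa> \<le> K \<Longrightarrow> 0 \<le> e \<Longrightarrow> e \<le> 1 \<Longrightarrow>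
    \<exists>x. norm x \<le> 1 \<and> \<kappa> *\<^sub>R Psi \<kappa> e x = x \<and> swst x = x"
    by (rule symmetric_fixed_point, rule that)
  obtain B1 where B1: "B1 \<ge> 0" "\<And>p x. p \<in> {0..1::real}\<times>{0..1::real} \<Longrightarrow> x \<in> cball 0 1 \<Longrightarrow> norm (hy (fst p) x) \<le> B1"
    by (rule UL_E[OF UL_h(3)], rule that, assumption, blast)
  obtain B2 where B2: "B2 \<ge> 0" "\<And>p x. p \<in> {0..1::real}\<times>{0..1::real} \<Longrightarrow> x \<in> cball 0 1 \<Longrightarrow> norm (hky (fst p) x) \<le> B2"
    by (rule UL_E[OF UL_h(4)], rule that, assumption, blast)
  obtain B3 where B3: "B3 \<ge> 0" "\<And>p x. p \<in> {0..1::real}\<times>{0..1::real} \<Longrightarrow> x \<in> cball 0 1 \<Longrightarrow> norm (hy1 (fst p) x) \<le> B3"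
    by (rule UL_E[OF UL_h(5)], rule that, assumption, blast)
  \<comment> \<open>The third entry yields the bounds by \<delta>; the summand 1 covers
    \<open>L\<close>, \<open>N\<close> and \<epsilon>, whose rescaled versions are at most 1. The
    choice does not involve \<epsilon>.\<close>
  define \<kappa> where "\<kappa> = Min {K, 1, \<delta> / (B1 + B2 + B3 + 1)}"
  have k: "\<kappa> > 0" "\<kappa> \<le> K" "\<kappa> \<le> 1" "\<kappa> \<le> \<delta> / (B1 + B2 + B3 + 1)"
    using K(1) assms B1(1) B2(1) B3(1) by (auto simp: \<kappa>_def)
  have kd: "\<kappa> * (B1 + B2 + B3 + 1) \<le> \<delta>" using k(4) B1(1) B2(1) B3(1) by (simp add: pos_le_divide_eq)
  have kpow: "\<kappa> ^ Suc m \<le> \<kappa>" for m using k power_le_one[of \<kappa> m] mult_left_mono[of "\<kappa>^m" 1 \<kappa>] by simp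
  have kb: "\<kappa> ^ Suc m * b \<le> \<delta>" if "0 \<le> b" "b \<le> B1 + B2 + B3 + 1" for m b
  proof -
    have "\<kappa> ^ Suc m * b \<le> \<kappa> * (B1 + B2 + B3 + 1)" using kpow[of m] that k by (intro mult_mono) auto
    with kd show ?thesis by linarith
  qed
  show ?thesis
  proof (rule that[OF k(1)])
    fix \<epsilon> :: real assume e: "0 < \<epsilon>" "\<epsilon> \<le> \<kappa>^6"
    define e where "e = \<epsilon> / \<kappa>^6"
    have e01: "0 \<le> e" "e \<le> 1" "\<epsilon> = \<kappa>^6 * e" using e k by (auto simp: e_def divide_le_eq_1)
    obtain x where x: "norm x \<le> 1" "\<kappa> *\<^sub>R Psi \<kappa> e x = x" "swst x = x" using K(2)[OF k(1,2) e01(1,2)] by blast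
    have xc: "x \<in> cball 0 1" using x(1) by simp
    note fp = fixed_point_equations[OF k(1) x(2)]
    define V KV Y KY Y1 g r T N L where defs: "V = \<kappa>^3 *\<^sub>R hv \<kappa> x" "KV = \<kappa>^3 *\<^sub>R hkv \<kappa> x" "Y = \<kappa>^3 *\<^sub>R hy \<kappa> x"
      "KY = \<kappa>^3 *\<^sub>R hky \<kappa> x" "Y1 = \<kappa>^3 *\<^sub>R hy1 \<kappa> x" "g = \<kappa>^4 *\<^sub>R sg x" "r = \<kappa>^4 *\<^sub>R sr x" "T = Tf x"
      "N = \<kappa>^4 *\<^sub>R sN x" "L = \<kappa>^2 *\<^sub>R sL x"
    define V1 where "V1 n \<theta> = (if n \<in> {(1,0),(0,1)} then 4 * \<kappa>^3 * sin \<theta> else 0) + vsol1 n (cf g n) \<theta>" for n \<theta>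
    have ssw: "swop (sg x) = sg x" "- swop (sr x) = sr x" "swop (sT x) = sT x" "swop (sN x) = sN x" "swop (sL x) = sL x"
      using s_swst[of x] unfolding x(3) by auto
    have p01: "(\<kappa>, e) \<in> {0..1::real}\<times>{0..1::real}" using k e01 by auto
    have nx: "norm (sL x) \<le> 1" "norm (sN x) \<le> 1" "norm (sT x) \<le> 1"
    proof -
      have f: "norm (fst z) \<le> norm z" for z :: "alg \<times> 'b::real_normed_vector" using norm_fst_le[of "fst z" "snd z"] by simp
      have s: "norm (snd z) \<le> norm z" for z :: "alg \<times> 'b::real_normed_vector" using norm_snd_le[of "snd z" "fst z"] by simp
      have 1: "norm (snd (snd x)) \<le> 1" using x(1) s[of x] s[of "snd x"] by linarith
      then show "norm (sT x) \<le> 1" using f[of "snd (snd x)"] unfolding sT_def by linarith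
      have 2: "norm (snd (snd (snd x))) \<le> 1" using 1 s[of "snd (snd x)"] by linarith
      then show "norm (sN x) \<le> 1" using f[of "snd (snd (snd x))"] unfolding sN_def by linarith
      show "norm (sL x) \<le> 1" using 2 s[of "snd (snd (snd x))"] unfolding sL_def by linarith
    qed
    have k4: "\<kappa>^4 = \<kappa>^3 * \<kappa>" by (simp add: eval_nat_numeral)
    have cV: "cf V n \<theta> = (if n \<in> {(1,0),(0,1)} then - 4 * \<kappa>^3 * cos (cl \<theta>) else 0) + vsol n (cf g n) (cl \<theta>)" for n \<theta>
    proof -
      have "cf g n = (\<lambda>t. \<kappa>^4 * cf (sg x) n t)" by (rule ext) (simp add: defs)
      then have "vsol n (cf g n) (cl \<theta>) = \<kappa>^4 * vsol n (cf (sg x) n) (cl \<theta>)"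
        by (simp only: vsol_scale)
      then show ?thesis by (auto simp: defs hv_def cf_consts cf_Vop k4 algebra_simps)
    qed
    have gsc: "cf g n = (\<lambda>t. \<kappa>^4 * cf (sg x) n t)" "cf r n = (\<lambda>t. \<kappa>^4 * cf (sr x) n t)" for n
      by (rule ext; simp add: defs)+
    have cY: "cf Y n \<theta> = (if n \<in> {(1,0),(0,1)} then \<kappa>^3 * ybf (cl \<theta>) else 0) + ysol n (cf g n) (cf r n) (cl \<theta>)" for n \<theta>
    proof -
      have "ysol n (cf g n) (cf r n) (cl \<theta>) = \<kappa>^4 * ysol n (cf (sg x) n) (cf (sr x) n) (cl \<theta>)"
        unfolding gsc by (rule ysol_scale)
      then show ?thesis by (auto simp: defs hy_def cf_consts cf_Yop k4 algebra_simps)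
    qed
    have cY1: "cf Y1 n \<theta> = (if n \<in> {(1,0),(0,1)} then \<kappa>^3 * yb1f (cl \<theta>) else 0) + ysol1 n (cf g n) (cf r n) (cl \<theta>)" for n \<theta>
    proof -
      have "ysol1 n (cf g n) (cf r n) (cl \<theta>) = \<kappa>^4 * ysol1 n (cf (sg x) n) (cf (sr x) n) (cl \<theta>)"
        unfolding gsc by (rule ysol1_scale)
      then show ?thesis by (auto simp: defs hy1_def cf_consts cf_Y1op k4 algebra_simps)
    qed
    have cKV: "cf KV n \<theta> = (kd n)\<^sup>2 * cf V n \<theta>" for n \<theta>
      by (auto simp: defs hkv_def hv_def cf_consts cf_KVop cf_Vop algebra_simps kd_def)
    have cKY: "cf KY n \<theta> = kd n * cf Y n \<theta>" for n \<theta>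
      by (auto simp: defs hky_def hy_def cf_consts cf_KYop cf_Yop algebra_simps)
    have Neq: "N = \<kappa>^6 *\<^sub>R Nop (Rh \<kappa> e x)"
      unfolding defs by (subst fp(4)) (simp add: eval_nat_numeral)
    have Ndiag: "fst n \<noteq> snd n \<Longrightarrow> cf N n \<theta> = 0" for n \<theta> unfolding Neq by (simp add: cf_Nop)
    have Ldiag: "fst n \<noteq> snd n \<Longrightarrow> cf L n \<theta> = 0" for n \<theta> unfolding defs by (subst fp(5)) (simp add: cf_shop)
    have sLdiag: "fst n \<noteq> snd n \<Longrightarrow> cf (sL x) n \<theta> = 0" for n \<theta> by (subst fp(5)) (simp add: cf_shop)
    have geq: "g = 3 *\<^sub>R (L \<star> KV) - \<kappa>^6 *\<^sub>R Rh \<kappa> e x - 4 *\<^sub>R (N \<star> W0A)"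
      unfolding Neq unfolding defs by (subst fp(1)) (simp add: conv_scaleR_left conv_scaleR_right scaleR_diff_right eval_nat_numeral mult_ac)
    have LKV: "cf (L \<star> KV) n \<theta> = (kd n)\<^sup>2 * cf (L \<star> V) n \<theta>" for n \<theta>
      by (rule conv_mode[where f="\<lambda>k. k\<^sup>2"]) (use Ldiag cKV in auto)
    have req: "r = L \<star> KY" unfolding defs by (subst fp(2)) (simp add: conv_scaleR_left conv_scaleR_right eval_nat_numeral mult_ac)
    have intc: "((\<lambda>t. f t * cf a n t) has_integral integral {0..pi/2} (\<lambda>t. f t * cf a n t)) {0..pi/2}"
      if "continuous_on UNIV f" for f a n
      by (intro integrable_integral integrable_continuous_real continuous_intros continuous_on_subset[OF that]) auto
    \<comment> \<open>\<open>N\<close> was chosen for this: at wave number 0 the term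
      \<open>L \<star> KV\<close> vanishes, and \<open>4 N W0\<close> balances the projection of the
      remainder.\<close>
    have orth0: "integral {0..pi/2} (\<lambda>t. cos (2 * t) * cf g n t) = 0" if n: "fst n = snd n" for n
    proof -
      define I where "I = integral {0..pi/2} (\<lambda>t. cos (2 * t) * cf (Rh \<kappa> e x) n t)"
      have I: "((\<lambda>t. cos (2 * t) * cf (Rh \<kappa> e x) n t) has_integral I) {0..pi/2}"
        unfolding I_def by (rule intc) (intro continuous_intros)
      have J: "((\<lambda>t. cos (2 * t) * cos (2 * t)) has_integral (pi/4)) {0..pi/2}"
        unfolding integral_cos2_sq[symmetric] by (intro integrable_integral integrable_continuous_real continuous_intros)
      have kd0: "kd n = 0" using n by (simp add: kd_def)
      have "((\<lambda>t. cos (2 * t) * cf g n t) has_integral (- (\<kappa>^6)) * I + (4 * \<kappa>^6 * I / pi) * (pi/4)) {0..pi/2}"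
      proof (rule has_integral_eq[OF _ has_integral_add[OF has_integral_mult_right[OF I] has_integral_mult_right[OF J]]])
        fix t :: real assume t: "t \<in> {0..pi/2}"
        have gt: "cf g n t = - (\<kappa>^6) * cf (Rh \<kappa> e x) n t + 4 * cos (2 * t) * (\<kappa>^6 * (1 / pi * I))"
          using t n by (simp add: geq LKV kd0 cf_conv_W0A cl_id) (simp add: Neq cf_Nop I_def)
        show "- (\<kappa>^6) * (cos (2 * t) * cf (Rh \<kappa> e x) n t) + 4 * \<kappa>^6 * I / pi * (cos (2 * t) * cos (2 * t)) = cos (2 * t) * cf g n t"
          unfolding gt by (simp add: algebra_simps)
      qed
      then show ?thesis by (simp add: integral_unique)
    qed
    \<comment> \<open>\<open>L\<close> was chosen for this: \<open>N \<star> W0A\<close> has no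
      coefficient at \<open>(j+1, j)\<close>, and \<open>L \<star> VbA\<close> contributes a
      multiple of the kernel function \<open>cos\<close>.\<close>
    have orth1: "integral {0..pi/2} (\<lambda>t. cos t * cf g (Suc j, j) t) = 0" for j
    proof -
      define b where "b = 3 *\<^sub>R (sL x \<star> KVop (sg x)) - Rh \<kappa> e x"
      define J where "J = integral {0..pi/2} (\<lambda>t. cos t * cf b (Suc j, j) t)"
      have J: "((\<lambda>t. cos t * cf b (Suc j, j) t) has_integral J) {0..pi/2}"
        unfolding J_def by (rule intc) (intro continuous_intros)
      have C: "((\<lambda>t. cos t * cos t) has_integral (pi/4)) {0..pi/2}"
        unfolding integral_cos_sq[symmetric] by (intro integrable_integral integrable_continuous_real continuous_intros)
      have sb: "swop (Cop b) = Cop b"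
        by (simp add: b_def swop_ops swl_diff swl_scaleR swop_conv ssw swop_Rh x(3))
      have "cf (sL x) (j, j) t = \<kappa> / (3 * pi) * J" for t
        by (subst fp(5)) (simp add: sb[unfolded b_def] cf_shop cf_Cop J_def b_def)
      moreover have "g = \<kappa>^6 *\<^sub>R b + (3 * \<kappa>^5) *\<^sub>R (sL x \<star> VbA) - 4 *\<^sub>R (N \<star> W0A)"
        unfolding geq b_def defs hkv_def
        by (simp add: conv_scaleR_left conv_scaleR_right conv_add_right scaleR_add_right scaleR_diff_right mult_ac eval_nat_numeral)
      ultimately have gt: "cf g (Suc j, j) t = \<kappa>^6 * cf b (Suc j, j) t - 12 * \<kappa>^5 * (\<kappa> / (3 * pi) * J) * cos t" if "t \<in> {0..pi/2}" for t
        using that by (simp add: cf_conv_VbA[OF sLdiag] cf_conv_W0A cl_id Ndiag)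
      have "((\<lambda>t. cos t * cf g (Suc j, j) t) has_integral \<kappa>^6 * J + (- 12 * \<kappa>^5 * (\<kappa> / (3 * pi) * J)) * (pi/4)) {0..pi/2}"
        by (rule has_integral_eq[OF _ has_integral_add[OF has_integral_mult_right[OF J] has_integral_mult_right[OF C]]]) (simp add: gt algebra_simps)
      then show ?thesis by (simp add: integral_unique field_simps eval_nat_numeral)
    qed
    have symm: "swop V = V" "swop Y = Y" "swop Y1 = Y1" "swop g = g" "swop T = T" "swop N = N" "swop L = L"
      unfolding defs by (simp_all add: swl_scaleR swop_h x(3) ssw)
    have orth1': "integral {0..pi/2} (\<lambda>t. cos t * cf g n t) = 0" if n: "\<bar>kd n\<bar> = 1" for n
    proof -
      have "\<bar>int (fst n) - int (snd n)\<bar> = 1"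
      proof -
        have "kd n = real_of_int (int (fst n) - int (snd n))" by (simp add: kd_def)
        with n show ?thesis by linarith
      qed
      then consider "n = (Suc (snd n), snd n)" | "n = (fst n, Suc (fst n))"
        by (cases n) (auto simp: abs_if split: if_splits)
      then show ?thesis
      proof cases
        case 1 then show ?thesis using orth1 by metis
      next
        case 2
        have "cf g n t = cf g (Suc (fst n), fst n) t" for t
          by (subst symm(4)[symmetric], subst 2, simp add: cf_swop)
        then show ?thesis using orth1 by simp
      qed
    qed
    have gc: "continuous_on UNIV (cf g n)" "continuous_on UNIV (cf r n)" for n by (intro continuous_intros)+
    have kdB: "n \<in> {(1,0),(0,1)} \<Longrightarrow> (kd n)\<^sup>2 = 1 \<and> \<not> big n \<and> kd n \<noteq> 0" for n by (auto simp: kd_def big_def)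
    have sol: "mode_sol \<kappa> \<epsilon> \<delta> V KV Y KY Y1 g r T N L V1"
    proof
      show "\<kappa> > 0" "\<epsilon> > 0" by fact+
      show "norm Y1 \<le> \<delta>" "norm KY \<le> \<delta>" "norm Y \<le> \<delta>"
        unfolding defs using B1(2)[OF p01 xc] B2(2)[OF p01 xc] B3(2)[OF p01 xc] kb[of _ 2] k B1(1) B2(1) B3(1)
        by (simp_all add: numeral_3_eq_3 numeral_2_eq_2)
      show "norm L \<le> \<delta>" "norm N \<le> \<delta>"
        unfolding defs using nx kb[of "norm (sL x)" 1] kb[of "norm (sN x)" 3] k B1(1) B2(1) B3(1)
        by (simp_all add: numeral_eq_Suc)
      show "norm T \<le> 1 + norm thA" unfolding defs Tf_def using norm_triangle_ineq[of thA "sT x"] nx by linarith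
      show "\<epsilon> \<le> \<delta>" using e(2) kb[of 1 5] B1(1) B2(1) B3(1) by (simp add: numeral_eq_Suc)
      show "swop V = V" "swop Y = Y" "swop Y1 = Y1" "swop g = g" "swop T = T" "swop N = N" "swop L = L" by fact+
      show "cf KV n \<theta> = (kd n)\<^sup>2 * cf V n \<theta>" "cf KY n \<theta> = kd n * cf Y n \<theta>" for n \<theta> by (fact cKV cKY)+
      show "r = L \<star> KY" by fact
      show "fst n \<noteq> snd n \<Longrightarrow> cf N n \<theta> = 0" "fst n \<noteq> snd n \<Longrightarrow> cf L n \<theta> = 0" for n \<theta> by (fact Ndiag Ldiag)+
      show "cf N n \<theta> = cf N n 0" for n \<theta> unfolding Neq by (simp add: cf_Nop)
      show "cf L n \<theta> = cf L n 0" for n \<theta> unfolding defs by (subst (1 2) fp(5)) (simp add: cf_shop cf_Cop cf_swop)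
      show "g = 3 *\<^sub>R (L \<star> KV)
        - 4 *\<^sub>R (N \<star> ((V + W0mul Y) + 2 *\<^sub>R (Y1 \<star> W0A))
          + (oneA + N) \<star> (2 *\<^sub>R (Y1 \<star> (V + W0mul Y)) + (Y1 \<star> Y1 - 3 *\<^sub>R ((oneA + L) \<star> (KY \<star> KY))) \<star> (W0A + (V + W0mul Y)))
          - (3 * \<epsilon>) *\<^sub>R (((oneA + N) \<star> ((oneA + 2 *\<^sub>R Y1 + (Y1 \<star> Y1 - 3 *\<^sub>R ((oneA + L) \<star> (KY \<star> KY)))) \<star> (W0A + (V + W0mul Y))))
             \<star> ((oneA + L) \<star> (T \<star> T))))
        - 4 *\<^sub>R (N \<star> W0A)"
        unfolding geq
        by (subst Rh_scaled[of "V + W0mul Y" \<kappa> x Y1 KY N L T \<epsilon> e]) (simp_all add: defs hw_def W0mul_scaleR scaleR_add_right e01(3)[unfolded defs])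
      fix n \<theta>
      show "cf V n (pi/2) = 0" "V1 n (pi/2) = 4 * cf Y n (pi/2)"
        using sinh_b_pos by (auto simp: cV cl_id vsol_ends(1) cY ysol_ends(2) V1_def ybf_def)
      show "V1 n 0 = 0"
        using orth0[of n] orth1'[of n] kd_cases[of n] by (auto simp: V1_def vsol_ends(3) mm_def kd_def)
      show "cf Y n 0 = 0" by (simp add: cY cl_id ysol_ends(1) ybf_def)
      show "kd n = 0 \<Longrightarrow> cf Y n \<theta> = 0" using kdB[of n] by (auto simp: cY ysol_ends(3))
      \<comment> \<open>Exact, without a correction: at these modes \<open>vsol\<close> has zero
        slope at \<open>pi/2\<close>, so only the first order term reaches the boundary. This
        normalises the amplitude.\<close>
      show "cf Y (Suc 0, 0) (pi/2) = \<kappa>^3" "cf Y (0, Suc 0) (pi/2) = \<kappa>^3"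
        using sinh_b_pos by (simp_all add: cY cl_id ysol_ends(2) vsol_ends(2) ybf_def big_def kd_def)
      show "cf T n 0 = 0" unfolding defs Tf_def by (subst fp(3)) (simp add: cf_consts cl_id cf_Iop)
      assume th: "\<theta> \<in> {0..pi/2}"
      show "(cf V n has_real_derivative V1 n \<theta>) (at \<theta> within {0..pi/2})"
      proof (rule has_field_derivative_transform_within[OF _ zero_less_one th])
        show "((\<lambda>\<theta>. (if n \<in> {(1,0),(0,1)} then - 4 * \<kappa>^3 * cos \<theta> else 0) + vsol n (cf g n) \<theta>) has_real_derivative V1 n \<theta>) (at \<theta> within {0..pi/2})"
          unfolding V1_def by (cases "n \<in> {(1,0),(0,1)}") (auto intro!: derivative_eq_intros vsol_deriv[OF gc(1) th])
      qed (simp add: cV cl_id)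
      show "(V1 n has_real_derivative (3 * (kd n)\<^sup>2 - 4) * cf V n \<theta> + cf g n \<theta>) (at \<theta> within {0..pi/2})"
      proof (cases "n \<in> {(1,0),(0,1)}")
        case True
        have "((\<lambda>\<theta>. 4 * \<kappa>^3 * sin \<theta> + vsol1 n (cf g n) \<theta>) has_real_derivative
            4 * \<kappa>^3 * cos \<theta> + ((3 * (kd n)\<^sup>2 - 4) * vsol n (cf g n) \<theta> + cf g n \<theta>)) (at \<theta> within {0..pi/2})"
          by (intro DERIV_add vsol1_deriv[OF gc(1) th]) (auto intro!: derivative_eq_intros)
        then show ?thesis unfolding V1_def[abs_def] using True kdB[OF True] th
          by (simp only: if_True cV cl_id atLeastAtMost_iff) (simp add: algebra_simps)
      next
        case False
        then show ?thesis unfolding V1_def[abs_def] using vsol1_deriv[OF gc(1) th] th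
          by (simp only: if_False cV cl_id atLeastAtMost_iff add_0)
      qed
      show "(cf Y n has_real_derivative cf Y1 n \<theta>) (at \<theta> within {0..pi/2})"
      proof (rule has_field_derivative_transform_within[OF _ zero_less_one th])
        show "((\<lambda>\<theta>. (if n \<in> {(1,0),(0,1)} then \<kappa>^3 * ybf \<theta> else 0) + ysol n (cf g n) (cf r n) \<theta>) has_real_derivative cf Y1 n \<theta>) (at \<theta> within {0..pi/2})"
          using th unfolding cY1 by (cases "n \<in> {(1,0),(0,1)}") (auto intro!: derivative_eq_intros ysol_deriv[OF gc(2) th] ybf_deriv simp: cl_id)
      qed (simp add: cY cl_id)
      show "(cf Y1 n has_real_derivative 3 * (kd n)\<^sup>2 * cf Y n \<theta> + 3 * kd n * cf r n \<theta>) (at \<theta> within {0..pi/2})"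
      proof (rule has_field_derivative_transform_within[OF _ zero_less_one th])
        show "((\<lambda>\<theta>. (if n \<in> {(1,0),(0,1)} then \<kappa>^3 * yb1f \<theta> else 0) + ysol1 n (cf g n) (cf r n) \<theta>) has_real_derivative 3 * (kd n)\<^sup>2 * cf Y n \<theta> + 3 * kd n * cf r n \<theta>) (at \<theta> within {0..pi/2})"
        proof (cases "n \<in> {(1,0),(0,1)}")
          case True
          have "((\<lambda>\<theta>. \<kappa>^3 * yb1f \<theta> + ysol1 n (cf g n) (cf r n) \<theta>) has_real_derivative
              \<kappa>^3 * (3 * ybf \<theta>) + (3 * (kd n)\<^sup>2 * ysol n (cf g n) (cf r n) \<theta> + 3 * kd n * cf r n \<theta>)) (at \<theta> within {0..pi/2})"
            by (intro DERIV_add ysol1_deriv[OF gc(2) th]) (auto intro!: derivative_eq_intros ybf_deriv)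
          then show ?thesis using True kdB[OF True] th
            by (simp only: if_True cY cl_id atLeastAtMost_iff) (simp add: algebra_simps)
        next
          case False
          then show ?thesis using ysol1_deriv[OF gc(2) th] th
            by (simp only: if_False cY cl_id atLeastAtMost_iff add_0)
        qed
      qed (simp add: cY1 cl_id)
      define h where "h = Y1 - (3 * \<epsilon>) *\<^sub>R (((oneA + L) \<star> (T \<star> T)) \<star> (oneA + Y1))"
      have sTh: "sT x = Iop h"
      proof -
        have "\<kappa> *\<^sub>R (\<kappa>^2 *\<^sub>R hy1 \<kappa> x - (3 * \<kappa>^5 * e) *\<^sub>R ((L1 \<kappa> x \<star> (Tf x \<star> Tf x)) \<star> (oneA + \<kappa>^3 *\<^sub>R hy1 \<kappa> x))) = h"
          unfolding h_def defs L1_def e01(3) by (simp add: scaleR_diff_right eval_nat_numeral mult_ac)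
        then show ?thesis by (subst fp(3)) (simp flip: linear_scale[OF bounded_linear.linear[OF Iop_lin]])
      qed
      show "(cf T n has_real_derivative cf (oneA + Y1 - (3 * \<epsilon>) *\<^sub>R (((oneA + L) \<star> (T \<star> T)) \<star> (oneA + Y1))) n \<theta>) (at \<theta> within {0..pi/2})"
      proof (rule has_field_derivative_transform_within[OF _ zero_less_one th])
        have "continuous_on UNIV (cf h n)" by (intro continuous_intros)
        from deriv_int_left[OF this th]
        show "((\<lambda>\<theta>. (if n = (0,0) then \<theta> else 0) + integral {0..\<theta>} (cf h n)) has_real_derivative
          cf (oneA + Y1 - (3 * \<epsilon>) *\<^sub>R (((oneA + L) \<star> (T \<star> T)) \<star> (oneA + Y1))) n \<theta>) (at \<theta> within {0..pi/2})"
          by (cases "n = (0,0)") (auto intro!: derivative_eq_intros simp: h_def cf_consts)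
      qed (simp add: defs(8) Tf_def cf_consts sTh cf_Iop cl_id)
    qed
    then show "\<exists>V KV Y KY Y1 g r T N L V1. mode_sol \<kappa> \<epsilon> \<delta> V KV Y KY Y1 g r T N L V1" by blast
  qed
qed

subsection \<open>Evaluation of coefficient families\<close>

definition dg :: "nat \<times> nat \<Rightarrow> nat" where "dg n = fst n + snd n"

text \<open>The majorant of all series for \<open>|s| \<le> 1/2\<close>. The exponent
  \<open>p\<close> absorbs any number of derivatives, each of which costs at most one factor of the
  degree.\<close>

definition mw :: "nat \<Rightarrow> nat \<times> nat \<Rightarrow> real" where "mw p n = (1 + real (dg n)) ^ p * (1/2) ^ dg n"

lemma mw_nonneg [simp]: "0 \<le> mw p n" by (simp add: mw_def)

lemma summable_poly_geometric: "summable (\<lambda>i. (1 + real i) ^ p * (1/2) ^ i)"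
proof -
  have "(\<lambda>i. 1 + inverse (real (Suc i))) \<longlonglongrightarrow> 1 + 0" by (intro tendsto_intros LIMSEQ_inverse_real_of_nat)
  moreover have "1 + inverse (real (Suc i)) = (2 + real i) / (1 + real i)" for i by (simp add: field_simps)
  ultimately have "(\<lambda>i. (2 + real i) / (1 + real i)) \<longlonglongrightarrow> 1" by simp
  then have "(\<lambda>i. ((2 + real i) / (1 + real i)) ^ p * (1/2)) \<longlonglongrightarrow> 1 ^ p * (1/2)"
    by (intro tendsto_intros)
  then have "\<forall>\<^sub>F i in sequentially. ((2 + real i) / (1 + real i)) ^ p * (1/2) < 3/4"
    by (rule order_tendstoD) simp
  then obtain N where N: "\<And>i. i \<ge> N \<Longrightarrow> ((2 + real i) / (1 + real i)) ^ p * (1/2) < 3/4"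
    unfolding eventually_sequentially by blast
  show ?thesis
  proof (rule summable_ratio_test[where c="3/4" and N=N])
    fix i assume "i \<ge> N"
    have "(1 + real (Suc i)) ^ p * (1/2) ^ Suc i = ((2 + real i) / (1 + real i)) ^ p * (1/2) * ((1 + real i) ^ p * (1/2) ^ i)"
      by (simp add: power_divide)
    also have "\<dots> \<le> 3/4 * ((1 + real i) ^ p * (1/2) ^ i)"
      using N[OF \<open>i \<ge> N\<close>] by (intro mult_right_mono) auto
    finally show "norm ((1 + real (Suc i)) ^ p * (1/2) ^ Suc i) \<le> 3/4 * norm ((1 + real i) ^ p * (1/2) ^ i)"
      by (simp add: abs_mult)
  qed simp
qed

lemma abs_summable_prod:
  fixes f :: "'a \<Rightarrow> complex" and g :: "'b \<Rightarrow> complex"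
  assumes "(\<lambda>x. norm (f x)) summable_on A" "(\<lambda>x. norm (g x)) summable_on B"
  shows "(\<lambda>p. norm ((\<lambda>(x, y). f x * g y) p)) summable_on A \<times> B"
  unfolding Infinite_Sum.abs_summable_on_Sigma_iff
proof (intro conjI ballI)
  show "(\<lambda>y. norm (case (x, y) of (x, y) \<Rightarrow> f x * g y)) summable_on B" for x
    using summable_on_cmult_right[OF assms(2), of "norm (f x)"] by (simp add: norm_mult)
  show "(\<lambda>x. norm (\<Sum>\<^sub>\<infinity>y\<in>B. norm (case (x, y) of (x, y) \<Rightarrow> f x * g y))) summable_on A"
    using summable_on_cmult_left[OF assms(1), of "\<Sum>\<^sub>\<infinity>y\<in>B. norm (g y)"]
    by (simp add: norm_mult infsum_cmult_right' abs_mult infsum_nonneg)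
qed

lemma mw_summable_on: "mw p summable_on UNIV"
proof -
  have 1: "(\<lambda>i. norm (complex_of_real ((1 + real i) ^ p * (1/2) ^ i))) summable_on UNIV"
    using summable_poly_geometric[of p] unfolding norm_of_real
    by (intro norm_summable_imp_summable_on) (simp add: abs_mult)
  have "(\<lambda>n. (1 + real (fst n)) ^ p * (1/2) ^ fst n * ((1 + real (snd n)) ^ p * (1/2) ^ snd n)) summable_on UNIV"
    using abs_summable_prod[OF 1 1] unfolding case_prod_beta norm_mult norm_of_real by (simp add: abs_mult)
  then show ?thesis
  proof (rule summable_on_comparison_test)
    fix n :: "nat \<times> nat"
    have "1 + real (dg n) \<le> (1 + real (fst n)) * (1 + real (snd n))" by (simp add: dg_def algebra_simps)
    then have "(1 + real (dg n)) ^ p \<le> ((1 + real (fst n)) * (1 + real (snd n))) ^ p" by (intro power_mono) auto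
    then show "mw p n \<le> (1 + real (fst n)) ^ p * (1/2) ^ fst n * ((1 + real (snd n)) ^ p * (1/2) ^ snd n)"
      using mult_right_mono[of "(1 + real (dg n)) ^ p" _ "(1/2) ^ dg n"]
      by (simp add: mw_def dg_def power_mult_distrib power_add mult_ac)
  qed auto
qed

lemma bij_prod_decode': "bij_betw prod_decode UNIV (UNIV :: (nat \<times> nat) set)"
  by (rule bij_prod_decode)

lemma mw_summable: "summable (\<lambda>m. mw p (prod_decode m))"
  by (rule summable_on_imp_summable)
    (use mw_summable_on summable_on_reindex_bij_betw[OF bij_prod_decode', of "mw p"] in simp)

lemma suminf_decode:
  fixes f :: "nat \<times> nat \<Rightarrow> 'a::banach"
  assumes "f summable_on UNIV"
  shows "(\<Sum>m. f (prod_decode m)) = infsum f UNIV"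
proof -
  have "(\<lambda>m. f (prod_decode m)) summable_on UNIV"
    using assms summable_on_reindex_bij_betw[OF bij_prod_decode', of f] by simp
  from has_sum_imp_sums[OF has_sum_infsum[OF this]]
  show ?thesis using infsum_reindex_bij_betw[OF bij_prod_decode', of f] by (simp add: sums_iff)
qed

text \<open>With \<open>u = s e^(ix)\<close> and \<open>v = s e^(-ix)\<close> the monomial
  \<open>u^i v^j\<close> is \<open>s^(i+j) e^(i (i-j) x)\<close>; \<open>FC\<close> and
  \<open>FS\<close> are the real and imaginary parts. Summing along an enumeration of the index
  pairs gives access to uniform convergence of sequences.\<close>

definition FC :: "(nat \<times> nat \<Rightarrow> real \<Rightarrow> real) \<Rightarrow> real \<Rightarrow> real \<times> real \<Rightarrow> real" where
  "FC c s z = (\<Sum>m. c (prod_decode m) (snd z) * (s ^ dg (prod_decode m) * cos (kd (prod_decode m) * fst z)))"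
definition FS :: "(nat \<times> nat \<Rightarrow> real \<Rightarrow> real) \<Rightarrow> real \<Rightarrow> real \<times> real \<Rightarrow> real" where
  "FS c s z = (\<Sum>m. c (prod_decode m) (snd z) * (s ^ dg (prod_decode m) * sin (kd (prod_decode m) * fst z)))"

text \<open>Polynomial growth in the degree is all that convergence needs, and it survives
  multiplication by \<open>kd\<close>, that is, differentiation in \<xi>.\<close>

definition pbd :: "real set \<Rightarrow> (nat \<times> nat \<Rightarrow> real \<Rightarrow> real) \<Rightarrow> bool" where
  "pbd S c \<longleftrightarrow> (\<exists>A p. A \<ge> 0 \<and> (\<forall>n. \<forall>\<theta>\<in>S. \<bar>c n \<theta>\<bar> \<le> A * (1 + real (dg n)) ^ p))"

lemma pbdI: "(\<And>n \<theta>. \<theta> \<in> S \<Longrightarrow> \<bar>c n \<theta>\<bar> \<le> A * (1 + real (dg n)) ^ p) \<Longrightarrow> pbd S c"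
  unfolding pbd_def
proof (intro exI[of _ "\<bar>A\<bar>"] exI[of _ p] conjI allI ballI)
  fix n \<theta> assume "\<And>n \<theta>. \<theta> \<in> S \<Longrightarrow> \<bar>c n \<theta>\<bar> \<le> A * (1 + real (dg n)) ^ p" "\<theta> \<in> S"
  from this(1)[OF this(2)] have "\<bar>c n \<theta>\<bar> \<le> A * (1 + real (dg n)) ^ p" .
  also have "\<dots> \<le> \<bar>A\<bar> * (1 + real (dg n)) ^ p" by (intro mult_right_mono) auto
  finally show "\<bar>c n \<theta>\<bar> \<le> \<bar>A\<bar> * (1 + real (dg n)) ^ p" .
qed simp

lemma pow1_mono: "p \<le> q \<Longrightarrow> (1 + real m) ^ p \<le> (1 + real m) ^ q"
  by (intro power_increasing) auto

lemma pbd_add: assumes "pbd S c" "pbd S d" shows "pbd S (\<lambda>n \<theta>. c n \<theta> + d n \<theta>)"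
proof -
  obtain A p B q where *: "A \<ge> 0" "\<And>n \<theta>. \<theta> \<in> S \<Longrightarrow> \<bar>c n \<theta>\<bar> \<le> A * (1 + real (dg n)) ^ p"
    "B \<ge> 0" "\<And>n \<theta>. \<theta> \<in> S \<Longrightarrow> \<bar>d n \<theta>\<bar> \<le> B * (1 + real (dg n)) ^ q"
    using assms unfolding pbd_def by metis
  show ?thesis
  proof (rule pbdI)
    fix n \<theta> assume S: "\<theta> \<in> S"
    have "A * (1 + real (dg n)) ^ p \<le> A * (1 + real (dg n)) ^ (p + q)"
      "B * (1 + real (dg n)) ^ q \<le> B * (1 + real (dg n)) ^ (p + q)"
      using * by (auto intro!: mult_left_mono pow1_mono)
    with *(2,4)[OF S, of n] show "\<bar>c n \<theta> + d n \<theta>\<bar> \<le> (A + B) * (1 + real (dg n)) ^ (p + q)"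
      by (simp add: distrib_right)
  qed
qed

lemma pbd_mult: assumes "pbd S c" "pbd S d" shows "pbd S (\<lambda>n \<theta>. c n \<theta> * d n \<theta>)"
proof -
  obtain A p B q where *: "A \<ge> 0" "\<And>n \<theta>. \<theta> \<in> S \<Longrightarrow> \<bar>c n \<theta>\<bar> \<le> A * (1 + real (dg n)) ^ p"
    "B \<ge> 0" "\<And>n \<theta>. \<theta> \<in> S \<Longrightarrow> \<bar>d n \<theta>\<bar> \<le> B * (1 + real (dg n)) ^ q"
    using assms unfolding pbd_def by metis
  show ?thesis
  proof (rule pbdI)
    fix n \<theta> assume S: "\<theta> \<in> S"
    show "\<bar>c n \<theta> * d n \<theta>\<bar> \<le> (A * B) * (1 + real (dg n)) ^ (p + q)"
      using mult_mono[OF *(2)[OF S] *(4)[OF S], of n n] * by (simp add: abs_mult power_add mult_ac)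
  qed
qed

lemma pbd_bounded: assumes "\<And>\<theta>. \<theta> \<in> S \<Longrightarrow> \<bar>f \<theta>\<bar> \<le> B" shows "pbd S (\<lambda>n. f)"
  by (rule pbdI[where A=B and p=0]) (use assms in simp)

lemma abs_kd_le: "\<bar>kd n\<bar> \<le> real (dg n)" by (auto simp: kd_def dg_def)

lemma pbd_kd: "pbd S (\<lambda>n \<theta>. kd n)"
  by (rule pbdI[where A=1 and p=1]) (use abs_kd_le in \<open>simp add: add_increasing\<close>)

lemma pbd_const: "pbd S (\<lambda>n \<theta>. r)" by (rule pbd_bounded[of _ _ "\<bar>r\<bar>"]) simp

lemma pbd_cf: "pbd S (cf a)"
proof (rule pbdI[where A="norm a" and p=0])
  fix n \<theta> show "\<bar>cf a n \<theta>\<bar> \<le> norm a * (1 + real (dg n)) ^ 0"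
    using cf_bound[of a n \<theta>] wt_ge1[of n] divide_left_mono[of 1 "wt n" "norm a"] by simp
qed

lemmas pbd_intros = pbd_add pbd_mult pbd_kd pbd_const pbd_cf

lemma pbd_term:
  assumes "pbd S c"
  obtains A p where "A \<ge> 0" "\<And>n \<theta> s x. \<theta> \<in> S \<Longrightarrow> \<bar>s\<bar> \<le> 1/2 \<Longrightarrow> \<bar>x\<bar> \<le> 1 \<Longrightarrow> \<bar>c n \<theta> * (s ^ dg n * x)\<bar> \<le> A * mw p n"
proof -
  obtain A p where *: "A \<ge> 0" "\<And>n \<theta>. \<theta> \<in> S \<Longrightarrow> \<bar>c n \<theta>\<bar> \<le> A * (1 + real (dg n)) ^ p"
    using assms unfolding pbd_def by metis
  show ?thesis
  proof (rule that[OF *(1)])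
    fix n \<theta> and s x :: real assume a: "\<theta> \<in> S" "\<bar>s\<bar> \<le> 1/2" "\<bar>x\<bar> \<le> 1"
    have "\<bar>s ^ dg n * x\<bar> \<le> (1/2) ^ dg n * 1" unfolding abs_mult power_abs
      using a by (intro mult_mono power_mono) auto
    from mult_mono[OF *(2)[OF a(1)] this] *(1)
    show "\<bar>c n \<theta> * (s ^ dg n * x)\<bar> \<le> A * mw p n" by (simp add: abs_mult mw_def mult_ac)
  qed
qed

lemma F_summable:
  assumes "pbd S c" "\<bar>s\<bar> \<le> 1/2" "snd z \<in> S"
  shows "summable (\<lambda>m. c (prod_decode m) (snd z) * (s ^ dg (prod_decode m) * cos (kd (prod_decode m) * fst z)))"
    and "summable (\<lambda>m. c (prod_decode m) (snd z) * (s ^ dg (prod_decode m) * sin (kd (prod_decode m) * fst z)))"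
proof -
  obtain A p where *: "A \<ge> 0" "\<And>n \<theta> s x. \<theta> \<in> S \<Longrightarrow> \<bar>s\<bar> \<le> 1/2 \<Longrightarrow> \<bar>x\<bar> \<le> 1 \<Longrightarrow> \<bar>c n \<theta> * (s ^ dg n * x)\<bar> \<le> A * mw p n"
    by (rule pbd_term[OF assms(1)], rule that, assumption, blast)
  have M: "summable (\<lambda>m. A * mw p (prod_decode m))" by (intro summable_mult mw_summable)
  show "summable (\<lambda>m. c (prod_decode m) (snd z) * (s ^ dg (prod_decode m) * cos (kd (prod_decode m) * fst z)))"
    "summable (\<lambda>m. c (prod_decode m) (snd z) * (s ^ dg (prod_decode m) * sin (kd (prod_decode m) * fst z)))"
    by (rule summable_comparison_test'[OF M, of 0], unfold real_norm_def, rule *(2)[OF assms(3,2)], simp)+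
qed

lemma
  assumes "pbd S c" "\<bar>s\<bar> \<le> 1/2" "snd z \<in> S"
  shows FC_add: "pbd S d \<Longrightarrow> FC (\<lambda>n \<theta>. c n \<theta> + d n \<theta>) s z = FC c s z + FC d s z"
    and FS_add: "pbd S d \<Longrightarrow> FS (\<lambda>n \<theta>. c n \<theta> + d n \<theta>) s z = FS c s z + FS d s z"
    and FC_mult: "FC (\<lambda>n \<theta>. f \<theta> * c n \<theta>) s z = f (snd z) * FC c s z"
    and FS_mult: "FS (\<lambda>n \<theta>. f \<theta> * c n \<theta>) s z = f (snd z) * FS c s z"
proof -
  note sm = F_summable[OF _ assms(2,3)]
  show "FC (\<lambda>n \<theta>. f \<theta> * c n \<theta>) s z = f (snd z) * FC c s z" "FS (\<lambda>n \<theta>. f \<theta> * c n \<theta>) s z = f (snd z) * FS c s z"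
    unfolding FC_def FS_def using suminf_mult[OF sm(1)[OF assms(1)], of "f (snd z)"] suminf_mult[OF sm(2)[OF assms(1)], of "f (snd z)"]
    by (simp_all add: mult.assoc)
  assume d: "pbd S d"
  show "FC (\<lambda>n \<theta>. c n \<theta> + d n \<theta>) s z = FC c s z + FC d s z" "FS (\<lambda>n \<theta>. c n \<theta> + d n \<theta>) s z = FS c s z + FS d s z"
    unfolding FC_def FS_def using suminf_add[OF sm(1)[OF assms(1)] sm(1)[OF d]] suminf_add[OF sm(2)[OF assms(1)] sm(2)[OF d]]
    by (simp_all add: distrib_right)
qed

lemma M_test_cont:
  fixes f :: "nat \<Rightarrow> 'a::topological_space \<Rightarrow> real"
  assumes "\<And>m. continuous_on S (f m)" "\<And>m x. x \<in> S \<Longrightarrow> \<bar>f m x\<bar> \<le> M m" "summable M"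
  shows "continuous_on S (\<lambda>x. \<Sum>m. f m x)"
proof -
  have "uniform_limit S (\<lambda>n x. \<Sum>i<n. f i x) (\<lambda>x. suminf (\<lambda>i. f i x)) sequentially"
    by (rule Weierstrass_m_test[OF _ assms(3)]) (use assms(2) in auto)
  then show ?thesis
    by (rule uniform_limit_theorem[rotated]) (auto intro!: always_eventually continuous_on_sum assms(1))
qed

lemma FC_cont:
  assumes "pbd S c" "\<bar>s\<bar> \<le> 1/2" "\<And>n. continuous_on S (c n)"
  shows "continuous_on (UNIV \<times> S) (FC c s)" "continuous_on (UNIV \<times> S) (FS c s)"
proof -
  obtain A p where *: "A \<ge> 0" "\<And>n \<theta> s x. \<theta> \<in> S \<Longrightarrow> \<bar>s\<bar> \<le> 1/2 \<Longrightarrow> \<bar>x\<bar> \<le> 1 \<Longrightarrow> \<bar>c n \<theta> * (s ^ dg n * x)\<bar> \<le> A * mw p n"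
    by (rule pbd_term[OF assms(1)], rule that, assumption, blast)
  have M: "summable (\<lambda>m. A * mw p (prod_decode m))" by (intro summable_mult mw_summable)
  have c: "continuous_on (UNIV \<times> S) (\<lambda>z. c n (snd z))" for n
    by (rule continuous_on_compose2[OF assms(3)[of n]]) (auto intro!: continuous_intros)
  show "continuous_on (UNIV \<times> S) (FC c s)" "continuous_on (UNIV \<times> S) (FS c s)"
    unfolding FC_def[abs_def] FS_def[abs_def]
    by (rule M_test_cont[OF _ _ M], intro continuous_intros c, rule *(2)[OF _ assms(2)], auto)+
qed

lemma series_has_derivative_2d:
  fixes f fx fy :: "nat \<Rightarrow> real \<times> real \<Rightarrow> real"
  assumes S: "convex S"
    and d: "\<And>m z. z \<in> S \<Longrightarrow> (f m has_derivative (\<lambda>h. fx m z * fst h + fy m z * snd h)) (at z within S)"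
    and b: "\<And>m z. z \<in> S \<Longrightarrow> \<bar>f m z\<bar> \<le> M m" "\<And>m z. z \<in> S \<Longrightarrow> \<bar>fx m z\<bar> \<le> M m" "\<And>m z. z \<in> S \<Longrightarrow> \<bar>fy m z\<bar> \<le> M m"
    and M: "summable M" and z: "z \<in> S"
  shows "((\<lambda>z. \<Sum>m. f m z) has_derivative (\<lambda>h. (\<Sum>m. fx m z) * fst h + (\<Sum>m. fy m z) * snd h)) (at z within S)"
proof -
  have sm: "summable (\<lambda>m. f m z)" "summable (\<lambda>m. fx m z)" "summable (\<lambda>m. fy m z)" if "z \<in> S" for z
    by (rule summable_comparison_test'[OF M, of 0]; simp add: b that)+
  have ux: "uniform_limit S (\<lambda>n z. \<Sum>i<n. fx i z) (\<lambda>z. \<Sum>i. fx i z) sequentially"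
    and uy: "uniform_limit S (\<lambda>n z. \<Sum>i<n. fy i z) (\<lambda>z. \<Sum>i. fy i z) sequentially"
    by (rule Weierstrass_m_test[OF _ M]; use b in auto)+
  have "\<exists>g. \<forall>z\<in>S. (\<lambda>n. f n z) sums (g z) \<and> (g has_derivative (\<lambda>h. (\<Sum>m. fx m z) * fst h + (\<Sum>m. fy m z) * snd h)) (at z within S)"
  proof (rule has_derivative_series[OF S d _ z summable_sums[OF sm(1)[OF z]]])
    fix e :: real assume e: "e > 0"
    have "\<forall>\<^sub>F n in sequentially. \<forall>z\<in>S. dist (\<Sum>i<n. fx i z) (\<Sum>i. fx i z) < e/2"
      "\<forall>\<^sub>F n in sequentially. \<forall>z\<in>S. dist (\<Sum>i<n. fy i z) (\<Sum>i. fy i z) < e/2"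
      using e uniform_limitD[OF ux, of "e/2"] uniform_limitD[OF uy, of "e/2"] by auto
    then show "\<forall>\<^sub>F n in sequentially. \<forall>x\<in>S. \<forall>h. norm ((\<Sum>i<n. fx i x * fst h + fy i x * snd h) -
        ((\<Sum>m. fx m x) * fst h + (\<Sum>m. fy m x) * snd h)) \<le> e * norm h"
    proof eventually_elim
      case (elim n)
      show ?case
      proof (intro ballI allI)
        fix x and h :: "real \<times> real" assume x: "x \<in> S"
        have n: "\<bar>fst h\<bar> \<le> norm h" "\<bar>snd h\<bar> \<le> norm h"
          using norm_fst_le[of "fst h" "snd h"] norm_snd_le[of "snd h" "fst h"] by auto
        have "(\<Sum>i<n. fx i x * fst h + fy i x * snd h) - ((\<Sum>m. fx m x) * fst h + (\<Sum>m. fy m x) * snd h)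
          = ((\<Sum>i<n. fx i x) - (\<Sum>m. fx m x)) * fst h + ((\<Sum>i<n. fy i x) - (\<Sum>m. fy m x)) * snd h"
          by (simp add: sum.distrib algebra_simps flip: sum_distrib_right sum_distrib_left)
        also have "norm \<dots> \<le> \<bar>(\<Sum>i<n. fx i x) - (\<Sum>m. fx m x)\<bar> * \<bar>fst h\<bar> + \<bar>(\<Sum>i<n. fy i x) - (\<Sum>m. fy m x)\<bar> * \<bar>snd h\<bar>"
          using abs_triangle_ineq by (simp flip: abs_mult)
        also have "\<dots> \<le> (e/2) * norm h + (e/2) * norm h"
          using elim x n e by (intro add_mono mult_mono) (auto simp: dist_real_def less_imp_le)
        finally show "norm ((\<Sum>i<n. fx i x * fst h + fy i x * snd h) - ((\<Sum>m. fx m x) * fst h + (\<Sum>m. fy m x) * snd h)) \<le> e * norm h"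
          by simp
      qed
    qed
  qed
  then obtain g where g: "\<And>z. z \<in> S \<Longrightarrow> (\<lambda>n. f n z) sums (g z)"
    "\<And>z. z \<in> S \<Longrightarrow> (g has_derivative (\<lambda>h. (\<Sum>m. fx m z) * fst h + (\<Sum>m. fy m z) * snd h)) (at z within S)" by blast
  show ?thesis
    by (rule has_derivative_transform[OF z _ g(2)[OF z]]) (use g(1) in \<open>auto simp: sums_iff\<close>)
qed

lemma F_deriv:
  assumes S: "convex S" and s: "\<bar>s\<bar> \<le> 1/2"
    and d: "\<And>n \<theta>. \<theta> \<in> S \<Longrightarrow> (c n has_real_derivative c1 n \<theta>) (at \<theta> within S)"
    and b: "pbd S c" "pbd S c1" and z: "snd z \<in> S"
  shows "(FC c s has_derivative (\<lambda>h. - FS (\<lambda>n \<theta>. kd n * c n \<theta>) s z * fst h + FC c1 s z * snd h)) (at z within UNIV \<times> S)"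
    and "(FS c s has_derivative (\<lambda>h. FC (\<lambda>n \<theta>. kd n * c n \<theta>) s z * fst h + FS c1 s z * snd h)) (at z within UNIV \<times> S)"
proof -
  obtain A p where 1: "A \<ge> 0" "\<And>n \<theta> s x. \<theta> \<in> S \<Longrightarrow> \<bar>s\<bar> \<le> 1/2 \<Longrightarrow> \<bar>x\<bar> \<le> 1 \<Longrightarrow> \<bar>c n \<theta> * (s ^ dg n * x)\<bar> \<le> A * mw p n"
    by (rule pbd_term[OF b(1)], rule that, assumption, blast)
  obtain B q where 2: "B \<ge> 0" "\<And>n \<theta> s x. \<theta> \<in> S \<Longrightarrow> \<bar>s\<bar> \<le> 1/2 \<Longrightarrow> \<bar>x\<bar> \<le> 1 \<Longrightarrow> \<bar>c1 n \<theta> * (s ^ dg n * x)\<bar> \<le> B * mw q n"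
    by (rule pbd_term[OF b(2)], rule that, assumption, blast)
  have b3: "pbd S (\<lambda>n \<theta>. kd n * c n \<theta>)" by (intro pbd_intros b)
  obtain C r where 3: "C \<ge> 0" "\<And>n \<theta> s x. \<theta> \<in> S \<Longrightarrow> \<bar>s\<bar> \<le> 1/2 \<Longrightarrow> \<bar>x\<bar> \<le> 1 \<Longrightarrow> \<bar>kd n * c n \<theta> * (s ^ dg n * x)\<bar> \<le> C * mw r n"
    by (rule pbd_term[OF b3], rule that, assumption, blast)
  define M where "M m = A * mw p (prod_decode m) + B * mw q (prod_decode m) + C * mw r (prod_decode m)" for m
  have M: "summable M" unfolding M_def[abs_def] by (intro summable_add summable_mult mw_summable)
  have Ml: "A * mw p (prod_decode m) \<le> M m" "B * mw q (prod_decode m) \<le> M m" "C * mw r (prod_decode m) \<le> M m" for m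
    using 1 2 3 by (auto simp: M_def)
  have cS: "convex (UNIV \<times> S)" using S by (intro convex_Times) auto
  have zS: "z \<in> UNIV \<times> S" using z by (cases z) auto
  have dc: "((\<lambda>z. c n (snd z)) has_derivative (\<lambda>h. c1 n (snd z) * snd h)) (at z within UNIV \<times> S)" if "z \<in> UNIV \<times> S" for n z
  proof -
    have 1: "snd z \<in> S" using that by auto
    have "(c n has_derivative (\<lambda>h. c1 n (snd z) * h)) (at (snd z) within S)"
      using d[OF 1] unfolding has_field_derivative_def .
    then have "(c n has_derivative (\<lambda>h. c1 n (snd z) * h)) (at (snd z) within snd ` (UNIV \<times> S))"
      by (rule has_derivative_subset) auto
    from has_derivative_in_compose[OF has_derivative_snd[OF has_derivative_ident] this] show ?thesis by simp
  qed
  have "((\<lambda>z. \<Sum>m. c (prod_decode m) (snd z) * (s ^ dg (prod_decode m) * cos (kd (prod_decode m) * fst z)))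
     has_derivative (\<lambda>h. (\<Sum>m. - (kd (prod_decode m) * c (prod_decode m) (snd z) * (s ^ dg (prod_decode m) * sin (kd (prod_decode m) * fst z)))) * fst h
       + (\<Sum>m. c1 (prod_decode m) (snd z) * (s ^ dg (prod_decode m) * cos (kd (prod_decode m) * fst z))) * snd h)) (at z within UNIV \<times> S)"
  proof (rule series_has_derivative_2d[OF cS _ _ _ _ M zS])
    fix m and z :: "real \<times> real" assume z': "z \<in> UNIV \<times> S"
    then have "snd z \<in> S" by auto
    show "((\<lambda>z. c (prod_decode m) (snd z) * (s ^ dg (prod_decode m) * cos (kd (prod_decode m) * fst z))) has_derivative
      (\<lambda>h. - (kd (prod_decode m) * c (prod_decode m) (snd z) * (s ^ dg (prod_decode m) * sin (kd (prod_decode m) * fst z))) * fst h +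
         c1 (prod_decode m) (snd z) * (s ^ dg (prod_decode m) * cos (kd (prod_decode m) * fst z)) * snd h)) (at z within UNIV \<times> S)"
      by (rule derivative_eq_intros dc[OF z'] refl)+ (simp add: fun_eq_iff algebra_simps)
    show "\<bar>c (prod_decode m) (snd z) * (s ^ dg (prod_decode m) * cos (kd (prod_decode m) * fst z))\<bar> \<le> M m"
      by (rule order_trans[OF 1(2)[OF \<open>snd z \<in> S\<close> s] Ml(1)]) simp
    show "\<bar>- (kd (prod_decode m) * c (prod_decode m) (snd z) * (s ^ dg (prod_decode m) * sin (kd (prod_decode m) * fst z)))\<bar> \<le> M m"
      unfolding abs_minus_cancel by (rule order_trans[OF 3(2)[OF \<open>snd z \<in> S\<close> s] Ml(3)]) simp
    show "\<bar>c1 (prod_decode m) (snd z) * (s ^ dg (prod_decode m) * cos (kd (prod_decode m) * fst z))\<bar> \<le> M m"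
      by (rule order_trans[OF 2(2)[OF \<open>snd z \<in> S\<close> s] Ml(2)]) simp
  qed
  then show "(FC c s has_derivative (\<lambda>h. - FS (\<lambda>n \<theta>. kd n * c n \<theta>) s z * fst h + FC c1 s z * snd h)) (at z within UNIV \<times> S)"
    unfolding FC_def[abs_def] FS_def[abs_def] using suminf_minus[OF F_summable(2)[OF b3 s z]] by simp
  have "((\<lambda>z. \<Sum>m. c (prod_decode m) (snd z) * (s ^ dg (prod_decode m) * sin (kd (prod_decode m) * fst z)))
     has_derivative (\<lambda>h. (\<Sum>m. kd (prod_decode m) * c (prod_decode m) (snd z) * (s ^ dg (prod_decode m) * cos (kd (prod_decode m) * fst z))) * fst h
       + (\<Sum>m. c1 (prod_decode m) (snd z) * (s ^ dg (prod_decode m) * sin (kd (prod_decode m) * fst z))) * snd h)) (at z within UNIV \<times> S)"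
  proof (rule series_has_derivative_2d[OF cS _ _ _ _ M zS])
    fix m and z :: "real \<times> real" assume z': "z \<in> UNIV \<times> S"
    then have "snd z \<in> S" by auto
    show "((\<lambda>z. c (prod_decode m) (snd z) * (s ^ dg (prod_decode m) * sin (kd (prod_decode m) * fst z))) has_derivative
      (\<lambda>h. kd (prod_decode m) * c (prod_decode m) (snd z) * (s ^ dg (prod_decode m) * cos (kd (prod_decode m) * fst z)) * fst h +
         c1 (prod_decode m) (snd z) * (s ^ dg (prod_decode m) * sin (kd (prod_decode m) * fst z)) * snd h)) (at z within UNIV \<times> S)"
      by (rule derivative_eq_intros dc[OF z'] refl)+ (simp add: fun_eq_iff algebra_simps)
    show "\<bar>c (prod_decode m) (snd z) * (s ^ dg (prod_decode m) * sin (kd (prod_decode m) * fst z))\<bar> \<le> M m"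
      by (rule order_trans[OF 1(2)[OF \<open>snd z \<in> S\<close> s] Ml(1)]) simp
    show "\<bar>kd (prod_decode m) * c (prod_decode m) (snd z) * (s ^ dg (prod_decode m) * cos (kd (prod_decode m) * fst z))\<bar> \<le> M m"
      by (rule order_trans[OF 3(2)[OF \<open>snd z \<in> S\<close> s] Ml(3)]) simp
    show "\<bar>c1 (prod_decode m) (snd z) * (s ^ dg (prod_decode m) * sin (kd (prod_decode m) * fst z))\<bar> \<le> M m"
      by (rule order_trans[OF 2(2)[OF \<open>snd z \<in> S\<close> s] Ml(2)]) simp
  qed
  then show "(FS c s has_derivative (\<lambda>h. FC (\<lambda>n \<theta>. kd n * c n \<theta>) s z * fst h + FS c1 s z * snd h)) (at z within UNIV \<times> S)"
    unfolding FC_def[abs_def] FS_def[abs_def] .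
qed

subsection \<open>Multiplicativity\<close>

text \<open>Cosine series alone are not multiplicative; evaluation at complex \<open>u\<close>,
  \<open>v\<close> is. Real products are read off from it afterwards.\<close>

definition Ev :: "(nat \<times> nat \<Rightarrow> real) \<Rightarrow> complex \<Rightarrow> complex \<Rightarrow> complex" where
  "Ev a u v = (\<Sum>\<^sub>\<infinity>n. of_real (a n) * (u ^ fst n * v ^ snd n))"

lemma Ev_abs_summable:
  fixes u v :: complex
  assumes "\<And>n. \<bar>a n\<bar> \<le> A" "norm u \<le> 1/2" "norm v \<le> 1/2"
  shows "(\<lambda>n. norm (of_real (a n) * (u ^ fst n * v ^ snd n))) summable_on UNIV"
proof (rule summable_on_comparison_test)
  show "(\<lambda>n. A * mw 0 n) summable_on UNIV" by (intro summable_on_cmult_right mw_summable_on)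
  fix n :: "nat \<times> nat"
  have "norm (u ^ fst n * v ^ snd n) \<le> (1/2) ^ fst n * (1/2) ^ snd n"
    unfolding norm_mult norm_power by (intro mult_mono power_mono) (use assms in auto)
  then show "norm (of_real (a n) * (u ^ fst n * v ^ snd n)) \<le> A * mw 0 n"
    unfolding norm_mult[of "of_real (a n)"] using assms(1)[of n] order_trans[OF abs_ge_zero assms(1)[of n]]
    by (intro mult_mono) (auto simp: mw_def dg_def power_add)
qed auto

text \<open>The Cauchy product: absolute summability allows the pairs of indices to be regrouped
  according to their sum.\<close>

lemma Ev_conv:
  assumes a: "\<And>n. \<bar>a n\<bar> \<le> A" and b: "\<And>n. \<bar>b n\<bar> \<le> B" and uv: "norm u \<le> 1/2" "norm v \<le> 1/2"
  shows "Ev (\<lambda>n. \<Sum>p\<le>fst n. \<Sum>q\<le>snd n. a (p, q) * b (fst n - p, snd n - q)) u v = Ev a u v * Ev b u v"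
proof -
  define f g where "f n = of_real (a n) * (u ^ fst n * v ^ snd n)" and "g n = of_real (b n) * (u ^ fst n * v ^ snd n)" for n
  have fs: "(\<lambda>n. norm (f n)) summable_on UNIV" and gs: "(\<lambda>n. norm (g n)) summable_on UNIV"
    unfolding f_def g_def by (rule Ev_abs_summable[OF a uv] Ev_abs_summable[OF b uv])+
  have prod: "(\<lambda>(x, y). f x * g y) summable_on UNIV \<times> UNIV"
    using abs_summable_summable[OF abs_summable_prod[OF fs gs]] .
  have "Ev a u v * Ev b u v = (\<Sum>\<^sub>\<infinity>x. f x * (\<Sum>\<^sub>\<infinity>y. g y))"
    unfolding Ev_def f_def g_def by (rule infsum_cmult_left'[symmetric])
  also have "\<dots> = (\<Sum>\<^sub>\<infinity>x. \<Sum>\<^sub>\<infinity>y. f x * g y)"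
    by (intro infsum_cong infsum_cmult_right'[symmetric])
  also have "\<dots> = (\<Sum>\<^sub>\<infinity>(x, y)\<in>UNIV \<times> UNIV. f x * g y)"
    by (rule infsum_Sigma'_banach[OF prod])
  also have "\<dots> = (\<Sum>\<^sub>\<infinity>(n, x)\<in>Sigma UNIV (\<lambda>n. {..fst n} \<times> {..snd n}). f x * g (fst n - fst x, snd n - snd x))"
    by (rule infsum_reindex_bij_witness[where
          j="\<lambda>(x, y). ((fst x + fst y, snd x + snd y), x)" and
          i="\<lambda>(n, x). (x, (fst n - fst x, snd n - snd x))"]) auto
  also have "\<dots> = (\<Sum>\<^sub>\<infinity>n. \<Sum>\<^sub>\<infinity>x\<in>{..fst n} \<times> {..snd n}. f x * g (fst n - fst x, snd n - snd x))"
  proof (rule infsum_Sigma'_banach[symmetric])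
    show "(\<lambda>(n, x). f x * g (fst n - fst x, snd n - snd x)) summable_on Sigma UNIV (\<lambda>n. {..fst n} \<times> {..snd n})"
      using prod
      by (subst summable_on_reindex_bij_witness[where T="UNIV \<times> UNIV" and
          i="\<lambda>(x, y). ((fst x + fst y, snd x + snd y), x)" and
          j="\<lambda>(n, x). (x, (fst n - fst x, snd n - snd x))" and h="\<lambda>(x, y). f x * g y"]) auto
  qed
  also have "\<dots> = Ev (\<lambda>n. \<Sum>p\<le>fst n. \<Sum>q\<le>snd n. a (p, q) * b (fst n - p, snd n - q)) u v"
    unfolding Ev_def
  proof (rule infsum_cong)
    fix n :: "nat \<times> nat"
    have t: "f (p, q) * g (fst n - p, snd n - q) = of_real (a (p, q) * b (fst n - p, snd n - q)) * (u ^ fst n * v ^ snd n)"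
      if "p \<le> fst n" "q \<le> snd n" for p q
    proof -
      have "u ^ fst n = u ^ p * u ^ (fst n - p)" "v ^ snd n = v ^ q * v ^ (snd n - q)"
        using that by (simp_all flip: power_add)
      then show ?thesis by (simp add: f_def g_def mult_ac)
    qed
    have "(\<Sum>\<^sub>\<infinity>x\<in>{..fst n} \<times> {..snd n}. f x * g (fst n - fst x, snd n - snd x))
        = (\<Sum>p\<le>fst n. \<Sum>q\<le>snd n. f (p, q) * g (fst n - p, snd n - q))"
      by (simp add: sum.cartesian_product' case_prod_beta)
    also have "\<dots> = (\<Sum>p\<le>fst n. \<Sum>q\<le>snd n. of_real (a (p, q) * b (fst n - p, snd n - q)) * (u ^ fst n * v ^ snd n))"
      using t by (intro sum.cong) auto
    also have "\<dots> = of_real (\<Sum>p\<le>fst n. \<Sum>q\<le>snd n. a (p, q) * b (fst n - p, snd n - q)) * (u ^ fst n * v ^ snd n)"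
      by (simp add: sum_distrib_right)
    finally show "(\<Sum>\<^sub>\<infinity>x\<in>{..fst n} \<times> {..snd n}. f x * g (fst n - fst x, snd n - snd x)) = 
      of_real (\<Sum>p\<le>fst n. \<Sum>q\<le>snd n. a (p, q) * b (fst n - p, snd n - q)) * (u ^ fst n * v ^ snd n)" .
  qed
  finally show ?thesis ..
qed

lemma Ev_cis:
  assumes a: "\<And>n. \<bar>a n\<bar> \<le> A" and s: "\<bar>s\<bar> \<le> 1/2"
  shows "Ev a (of_real s * cis x) (of_real s * cis (- x)) = of_real (FC (\<lambda>n _. a n) s (x, t)) + \<i> * of_real (FS (\<lambda>n _. a n) s (x, t))"
proof -
  have p: "pbd UNIV (\<lambda>n _::real. a n)" by (rule pbdI[where A=A and p=0]) (use a in simp)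
  obtain B q where *: "B \<ge> 0" "\<And>n \<theta> s x. \<theta> \<in> (UNIV :: real set) \<Longrightarrow> \<bar>s\<bar> \<le> 1/2 \<Longrightarrow> \<bar>x\<bar> \<le> 1 \<Longrightarrow> \<bar>a n * (s ^ dg n * x)\<bar> \<le> B * mw q n"
    by (rule pbd_term[OF p], rule that, assumption, blast)
  have sm: "(\<lambda>n. a n * (s ^ dg n * h n)) summable_on UNIV" if "\<And>n. \<bar>h n\<bar> \<le> 1" for h
  proof (rule abs_summable_summable, rule summable_on_comparison_test)
    show "(\<lambda>n. B * mw q n) summable_on UNIV" by (intro summable_on_cmult_right mw_summable_on)
    show "norm (a n * (s ^ dg n * h n)) \<le> B * mw q n" for n unfolding real_norm_def by (rule *(2)[OF UNIV_I s that])
  qed auto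
  have t: "of_real (a n) * ((of_real s * cis x) ^ fst n * (of_real s * cis (- x)) ^ snd n)
     = complex_of_real (a n * (s ^ dg n * cos (kd n * x))) + \<i> * complex_of_real (a n * (s ^ dg n * sin (kd n * x)))" for n
  proof -
    have "cis x ^ fst n * cis (- x) ^ snd n = cis (real (fst n) * x) * cis (real (snd n) * - x)"
      unfolding Complex.DeMoivre ..
    also have "\<dots> = cis (kd n * x)" unfolding cis_mult kd_def by (simp add: algebra_simps)
    finally have "cis x ^ fst n * cis (- x) ^ snd n = cis (kd n * x)" .
    then have "(of_real s * cis x) ^ fst n * (of_real s * cis (- x)) ^ snd n = of_real (s ^ dg n) * cis (kd n * x)"
      by (simp add: power_mult_distrib dg_def power_add mult_ac)
    then show ?thesis by (simp add: cis_conv_exp exp_Euler algebra_simps flip: cos_of_real sin_of_real)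
  qed
  have "Ev a (of_real s * cis x) (of_real s * cis (- x)) =
    (\<Sum>\<^sub>\<infinity>n. complex_of_real (a n * (s ^ dg n * cos (kd n * x)))) + (\<Sum>\<^sub>\<infinity>n. \<i> * complex_of_real (a n * (s ^ dg n * sin (kd n * x))))"
    unfolding Ev_def t
    by (intro infsum_add summable_on_cmult_right summable_on_bounded_linear[OF bounded_linear_of_real sm]) auto
  also have "(\<Sum>\<^sub>\<infinity>n. complex_of_real (a n * (s ^ dg n * cos (kd n * x)))) = of_real (\<Sum>\<^sub>\<infinity>n. a n * (s ^ dg n * cos (kd n * x)))"
    by (intro infsumI has_sum_of_real has_sum_infsum sm) simp
  also have "(\<Sum>\<^sub>\<infinity>n. \<i> * complex_of_real (a n * (s ^ dg n * sin (kd n * x)))) = \<i> * of_real (\<Sum>\<^sub>\<infinity>n. a n * (s ^ dg n * sin (kd n * x)))"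
    unfolding infsum_cmult_right' by (intro arg_cong[where f="\<lambda>z. \<i> * z"] infsumI has_sum_of_real has_sum_infsum sm) simp
  also have "(\<Sum>\<^sub>\<infinity>n. a n * (s ^ dg n * cos (kd n * x))) = FC (\<lambda>n _. a n) s (x, t)"
    unfolding FC_def by (subst suminf_decode[symmetric]) (auto intro: sm)
  also have "(\<Sum>\<^sub>\<infinity>n. a n * (s ^ dg n * sin (kd n * x))) = FS (\<lambda>n _. a n) s (x, t)"
    unfolding FS_def by (subst suminf_decode[symmetric]) (auto intro: sm)
  finally show ?thesis .
qed

text \<open>Swapping the index keeps the degree and reverses \<open>kd\<close>, so the terms cancel
  in pairs.\<close>

lemma
  assumes a: "\<And>n. \<bar>a n\<bar> \<le> A" and s: "\<bar>s\<bar> \<le> 1/2"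
  shows FS_symmetric: "(\<And>n. a (prod.swap n) = a n) \<Longrightarrow> FS (\<lambda>n _. a n) s (x, t) = 0"
    and FC_antisymmetric: "(\<And>n. a (prod.swap n) = - a n) \<Longrightarrow> FC (\<lambda>n _. a n) s (x, t) = 0"
proof -
  have p: "pbd UNIV (\<lambda>n _::real. a n)" by (rule pbdI[where A=A and p=0]) (use a in simp)
  obtain B q where *: "B \<ge> 0" "\<And>n \<theta> s x. \<theta> \<in> (UNIV :: real set) \<Longrightarrow> \<bar>s\<bar> \<le> 1/2 \<Longrightarrow> \<bar>x\<bar> \<le> 1 \<Longrightarrow> \<bar>a n * (s ^ dg n * x)\<bar> \<le> B * mw q n"
    by (rule pbd_term[OF p], rule that, assumption, blast)
  have sm: "(\<lambda>n. a n * (s ^ dg n * h n)) summable_on UNIV" if "\<And>n. \<bar>h n\<bar> \<le> 1" for h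
  proof (rule abs_summable_summable, rule summable_on_comparison_test)
    show "(\<lambda>n. B * mw q n) summable_on UNIV" by (intro summable_on_cmult_right mw_summable_on)
    show "norm (a n * (s ^ dg n * h n)) \<le> B * mw q n" for n unfolding real_norm_def by (rule *(2)[OF UNIV_I s that])
  qed auto
  have dgs: "dg (prod.swap n) = dg n" for n by (simp add: dg_def)
  have neg: "infsum f UNIV = 0" if "\<And>n. f (prod.swap n) = - f n" for f :: "nat \<times> nat \<Rightarrow> real"
  proof -
    have "infsum f UNIV = infsum (\<lambda>n. f (prod.swap n)) UNIV"
      by (rule infsum_reindex_bij_betw[symmetric]) (simp add: bij_swap)
    also have "\<dots> = - infsum f UNIV" unfolding that by (rule infsum_uminus)
    finally show ?thesis by simp
  qed
  show "FS (\<lambda>n _. a n) s (x, t) = 0" if "\<And>n. a (prod.swap n) = a n"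
  proof -
    have "FS (\<lambda>n _. a n) s (x, t) = (\<Sum>\<^sub>\<infinity>n. a n * (s ^ dg n * sin (kd n * x)))"
      unfolding FS_def by (subst suminf_decode[symmetric]) (auto intro: sm)
    also have "\<dots> = 0" by (rule neg) (simp add: that dgs kd_swap)
    finally show ?thesis .
  qed
  show "FC (\<lambda>n _. a n) s (x, t) = 0" if "\<And>n. a (prod.swap n) = - a n"
  proof -
    have "FC (\<lambda>n _. a n) s (x, t) = (\<Sum>\<^sub>\<infinity>n. a n * (s ^ dg n * cos (kd n * x)))"
      unfolding FC_def by (subst suminf_decode[symmetric]) (auto intro: sm)
    also have "\<dots> = 0" by (rule neg) (simp add: that dgs kd_swap)
    finally show ?thesis .
  qed
qed

definition val :: "alg \<Rightarrow> real \<Rightarrow> real \<Rightarrow> real \<Rightarrow> real" where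
  "val a s x \<theta> = FC (cf a) s (x, \<theta>)"
definition valS :: "alg \<Rightarrow> real \<Rightarrow> real \<Rightarrow> real \<Rightarrow> real" where
  "valS a s x \<theta> = FS (cf a) s (x, \<theta>)"

lemma cf_norm: "\<bar>cf a n \<theta>\<bar> \<le> norm a"
  using cf_bound[of a n \<theta>] wt_ge1[of n] divide_left_mono[of 1 "wt n" "norm a"] by simp

lemma FC_fix: "FC c s (x, \<theta>) = FC (\<lambda>n _. c n \<theta>) s (x, t)" "FS c s (x, \<theta>) = FS (\<lambda>n _. c n \<theta>) s (x, t)"
  by (simp_all add: FC_def FS_def)

lemma Ev_val:
  assumes "\<bar>s\<bar> \<le> 1/2"
  shows "Ev (\<lambda>n. cf a n \<theta>) (of_real s * cis x) (of_real s * cis (- x)) = of_real (val a s x \<theta>) + \<i> * of_real (valS a s x \<theta>)"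
  unfolding val_def valS_def FC_fix(1)[of "cf a" s x \<theta> 0] FC_fix(2)[of "cf a" s x \<theta> 0]
  by (rule Ev_cis[OF cf_norm assms])

lemma valS_sym: "swop a = a \<Longrightarrow> \<bar>s\<bar> \<le> 1/2 \<Longrightarrow> valS a s x \<theta> = 0"
  unfolding valS_def FC_fix(2)[of "cf a" s x \<theta> 0]
  by (rule FS_symmetric[OF cf_norm]) (simp_all flip: cf_swop')

lemma val_antisym: "swop a = - a \<Longrightarrow> \<bar>s\<bar> \<le> 1/2 \<Longrightarrow> val a s x \<theta> = 0"
  unfolding val_def FC_fix(1)[of "cf a" s x \<theta> 0]
  by (rule FC_antisymmetric[OF cf_norm]) (simp_all flip: cf_swop' cf_minus)

lemma val_conv_complex:
  assumes "\<bar>s\<bar> \<le> 1/2"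
  shows "val (a \<star> b) s x \<theta> = val a s x \<theta> * val b s x \<theta> - valS a s x \<theta> * valS b s x \<theta>"
proof -
  have n: "norm (complex_of_real s * cis x) \<le> 1/2" "norm (complex_of_real s * cis (- x)) \<le> 1/2"
    using assms by (simp_all add: norm_mult)
  have "of_real (val (a \<star> b) s x \<theta>) + \<i> * of_real (valS (a \<star> b) s x \<theta>) =
    (of_real (val a s x \<theta>) + \<i> * of_real (valS a s x \<theta>)) * (complex_of_real (val b s x \<theta>) + \<i> * of_real (valS b s x \<theta>))"
    unfolding Ev_val[OF assms, symmetric] cf_conv ccf_def by (rule Ev_conv[OF cf_norm cf_norm n])
  from arg_cong[OF this, of Re] show ?thesis by simp
qed

lemma val_conv: "swop a = a \<Longrightarrow> \<bar>s\<bar> \<le> 1/2 \<Longrightarrow> val (a \<star> b) s x \<theta> = val a s x \<theta> * val b s x \<theta>"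
  by (simp add: val_conv_complex valS_sym)

text \<open>An antisymmetric family evaluates to an imaginary number, whose square is negative; this
  is the sign that occurs in the conformal factor.\<close>

lemma val_conv_anti: "swop a = - a \<Longrightarrow> \<bar>s\<bar> \<le> 1/2 \<Longrightarrow> val (a \<star> a) s x \<theta> = - (valS a s x \<theta>)\<^sup>2"
  by (simp add: val_conv_complex val_antisym power2_eq_square)

lemma
  assumes s: "\<bar>s\<bar> \<le> 1/2"
  shows val_add: "val (a + b) s x \<theta> = val a s x \<theta> + val b s x \<theta>"
    and val_scaleR: "val (c *\<^sub>R a) s x \<theta> = c * val a s x \<theta>"
    and val_diff: "val (a - b) s x \<theta> = val a s x \<theta> - val b s x \<theta>"
proof -
  have 1: "cf (a + b) = (\<lambda>n \<theta>. cf a n \<theta> + cf b n \<theta>)" "cf (c *\<^sub>R a) = (\<lambda>n \<theta>. (\<lambda>_. c) \<theta> * cf a n \<theta>)" for a b c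
    by (intro ext; simp)+
  show add: "val (a + b) s x \<theta> = val a s x \<theta> + val b s x \<theta>" for a b
    unfolding val_def 1 by (rule FC_add[OF pbd_cf[of UNIV] s UNIV_I pbd_cf])
  show sc: "val (c *\<^sub>R a) s x \<theta> = c * val a s x \<theta>" for a c
    unfolding val_def 1(2) by (rule FC_mult[OF pbd_cf[of UNIV] s UNIV_I])
  show "val (a - b) s x \<theta> = val a s x \<theta> - val b s x \<theta>"
    using add[of a "(-1) *\<^sub>R b"] sc[of "-1" b] by simp
qed

lemma val_W0mul: "\<bar>s\<bar> \<le> 1/2 \<Longrightarrow> val (W0mul a) s x \<theta> = 2 * sin (2 * cl \<theta>) * val a s x \<theta>"
  unfolding val_def cf_W0mul[abs_def] by (subst FC_mult[OF pbd_cf[of UNIV] _ UNIV_I]) auto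

lemma FC_single:
  assumes "\<And>n. n \<noteq> (0,0) \<Longrightarrow> c n \<theta> = 0"
  shows "FC c s (x, \<theta>) = c (0,0) \<theta>"
proof -
  have "c (prod_decode m) \<theta> * (s ^ dg (prod_decode m) * cos (kd (prod_decode m) * x)) = (if m = prod_encode (0,0) then c (0,0) \<theta> else 0)" for m
  proof (cases "prod_decode m = (0,0)")
    case True
    then have "m = prod_encode (0,0)" by (metis prod_decode_inverse)
    with True show ?thesis by (simp add: dg_def kd_def)
  next
    case False
    then have "m \<noteq> prod_encode (0,0)" by (metis prod_encode_inverse)
    with False assms show ?thesis by simp
  qed
  then show ?thesis unfolding FC_def using suminf_finite[of "{prod_encode (0,0)}" "\<lambda>m. if m = prod_encode (0,0) then c (0,0) \<theta> else 0"]
    by simp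
qed

lemma val_consts: "val oneA s x \<theta> = 1" "val W0A s x \<theta> = - cos (2 * cl \<theta>)"
  unfolding val_def by (subst FC_single; simp add: cf_consts)+

lemma val_bound: 
  assumes "\<bar>s\<bar> \<le> 1/2" shows "\<bar>val a s x \<theta>\<bar> \<le> norm a * (\<Sum>m. mw 0 (prod_decode m))" "\<bar>valS a s x \<theta>\<bar> \<le> norm a * (\<Sum>m. mw 0 (prod_decode m))"
proof -
  have b: "norm (cf a n \<theta> * (s ^ dg n * y)) \<le> norm a * mw 0 n" if "\<bar>y\<bar> \<le> 1" for n y
  proof -
    have "\<bar>s ^ dg n * y\<bar> \<le> (1/2) ^ dg n * 1" unfolding abs_mult power_abs
      using assms that by (intro mult_mono power_mono) auto
    then show ?thesis using mult_mono[OF cf_norm[of a n \<theta>]] by (simp add: abs_mult mw_def)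
  qed
  have M: "summable (\<lambda>m. norm a * mw 0 (prod_decode m))" by (intro summable_mult mw_summable)
  show "\<bar>val a s x \<theta>\<bar> \<le> norm a * (\<Sum>m. mw 0 (prod_decode m))"
    unfolding val_def FC_def suminf_mult[OF mw_summable, symmetric] fst_conv snd_conv real_norm_def[symmetric]
    by (rule norm_suminf_le[OF _ M], rule b, simp)
  show "\<bar>valS a s x \<theta>\<bar> \<le> norm a * (\<Sum>m. mw 0 (prod_decode m))"
    unfolding valS_def FS_def suminf_mult[OF mw_summable, symmetric] fst_conv snd_conv real_norm_def[symmetric]
    by (rule norm_suminf_le[OF _ M], rule b, simp)
qed

subsection \<open>Even and odd extension\<close>

text \<open>The two halves are glued at 0, where the one-sided derivatives must agree: for the even
  extension this forces derivative 0, while for the odd one it suffices that the value is 0.\<close>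

lemma
  fixes f :: "real \<Rightarrow> real"
  assumes d: "\<And>t. t \<in> {0..c} \<Longrightarrow> (f has_real_derivative f1 t) (at t within {0..c})" and t: "t \<in> {-c..c}" and c: "c > 0"
  shows deriv_even_ext: "f1 0 = 0 \<Longrightarrow> ((\<lambda>t. f \<bar>t\<bar>) has_real_derivative sgn t * f1 \<bar>t\<bar>) (at t within {-c..c})"
    and deriv_odd_ext: "f 0 = 0 \<Longrightarrow> ((\<lambda>t. sgn t * f \<bar>t\<bar>) has_real_derivative f1 \<bar>t\<bar>) (at t within {-c..c})"
proof -
  have neg: "((\<lambda>t. f (- t)) has_real_derivative - f1 (- t)) (at t within {-c..0})" if "t \<in> {-c..0}" for t
  proof -
    have "(f has_real_derivative f1 (- t)) (at (- t) within uminus ` {-c..0})"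
      using d[of "- t"] that c by (auto simp: image_uminus_atLeastAtMost)
    from DERIV_image_chain[OF this DERIV_minus[OF DERIV_ident]] show ?thesis by (simp add: o_def)
  qed
  have un: "{-c..c} = {-c..0} \<union> {0..c}" using c by auto
  have glue: "(h has_real_derivative y) (at t within {-c..c})"
    if "t \<ge> 0 \<Longrightarrow> (h has_real_derivative y) (at t within {0..c})" "t \<le> 0 \<Longrightarrow> (h has_real_derivative y) (at t within {-c..0})" for h y
  proof -
    consider "t > 0" | "t < 0" | "t = 0" by linarith
    then show ?thesis
    proof cases
      case 1
      have "at t within {-c..c} = at t within {0..c}"
        by (rule at_within_nhd[of _ "{0<..}"]) (use 1 in auto)
      then show ?thesis using that 1 by simp
    next
      case 2
      have "at t within {-c..c} = at t within {-c..0}"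
        by (rule at_within_nhd[of _ "{..<0}"]) (use 2 in auto)
      then show ?thesis using that 2 by simp
    next
      case 3
      then show ?thesis using that unfolding un has_field_derivative_iff
        by (simp add: Lim_within_Un)
    qed
  qed
  show "((\<lambda>t. f \<bar>t\<bar>) has_real_derivative sgn t * f1 \<bar>t\<bar>) (at t within {-c..c})" if z: "f1 0 = 0"
  proof (rule glue)
    assume "t \<ge> 0"
    then have "t \<in> {0..c}" using t by auto
    then have "(f has_real_derivative sgn t * f1 \<bar>t\<bar>) (at t within {0..c})" using d[of t] z by (auto simp: sgn_if)
    then show "((\<lambda>t. f \<bar>t\<bar>) has_real_derivative sgn t * f1 \<bar>t\<bar>) (at t within {0..c})"
      by (rule has_field_derivative_transform_within[OF _ zero_less_one \<open>t \<in> {0..c}\<close>]) auto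
  next
    assume "t \<le> 0"
    then have t': "t \<in> {-c..0}" using t by auto
    then have "((\<lambda>t. f (- t)) has_real_derivative sgn t * f1 \<bar>t\<bar>) (at t within {-c..0})" using neg[OF t'] z by (auto simp: sgn_if)
    then show "((\<lambda>t. f \<bar>t\<bar>) has_real_derivative sgn t * f1 \<bar>t\<bar>) (at t within {-c..0})"
      by (rule has_field_derivative_transform_within[OF _ zero_less_one t']) auto
  qed
  show "((\<lambda>t. sgn t * f \<bar>t\<bar>) has_real_derivative f1 \<bar>t\<bar>) (at t within {-c..c})" if z: "f 0 = 0"
  proof (rule glue)
    assume "t \<ge> 0"
    then have t': "t \<in> {0..c}" using t by auto
    then have "(f has_real_derivative f1 \<bar>t\<bar>) (at t within {0..c})" using d[of t] by auto
    then show "((\<lambda>t. sgn t * f \<bar>t\<bar>) has_real_derivative f1 \<bar>t\<bar>) (at t within {0..c})"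
      by (rule has_field_derivative_transform_within[OF _ zero_less_one t']) (auto simp: sgn_if z)
  next
    assume "t \<le> 0"
    then have t': "t \<in> {-c..0}" using t by auto
    then have "((\<lambda>t. - f (- t)) has_real_derivative f1 \<bar>t\<bar>) (at t within {-c..0})" using DERIV_minus[OF neg[OF t']] by simp
    then show "((\<lambda>t. sgn t * f \<bar>t\<bar>) has_real_derivative f1 \<bar>t\<bar>) (at t within {-c..0})"
      by (rule has_field_derivative_transform_within[OF _ zero_less_one t']) (auto simp: sgn_if z)
  qed
qed

subsection \<open>The solution on the strip\<close>

abbreviation strip :: "(real \<times> real) set" where "strip \<equiv> UNIV \<times> {- (pi/2)..pi/2}"

text \<open>\<open>(X, om y)\<close> is conformal in \<open>(x, om \<theta>)\<close>, with \<open>a = X\<^sub>x = y\<^sub>\<theta>\<close> and \<open>b = y\<^sub>x\<close>.\<close>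

locale strip_sol =
  fixes om m l :: real
    and X y a b bx bt W Wx Wt Wxx Wxt Wtt :: "real \<times> real \<Rightarrow> real"
  assumes om: "om > 0" "om\<^sup>2 \<le> 4" and m_pos: "m > 0" and l_pos: "l > 0"
    and dX: "\<And>z. z \<in> strip \<Longrightarrow> (X has_derivative (\<lambda>h. a z * fst h + (- om\<^sup>2 * b z) * snd h)) (at z within strip)"
    and dy: "\<And>z. z \<in> strip \<Longrightarrow> (y has_derivative (\<lambda>h. b z * fst h + a z * snd h)) (at z within strip)"
    and da: "\<And>z. z \<in> strip \<Longrightarrow> (a has_derivative (\<lambda>h. bt z * fst h + (- om\<^sup>2 * bx z) * snd h)) (at z within strip)"
    and db: "\<And>z. z \<in> strip \<Longrightarrow> (b has_derivative (\<lambda>h. bx z * fst h + bt z * snd h)) (at z within strip)"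
    and cb: "continuous_on strip bx" "continuous_on strip bt"
    and small_a: "\<And>z. z \<in> strip \<Longrightarrow> \<bar>a z - 1\<bar> \<le> 1/100" and small_b: "\<And>z. z \<in> strip \<Longrightarrow> \<bar>b z\<bar> \<le> 1/100"
    and dW: "\<And>z. z \<in> strip \<Longrightarrow> (W has_derivative (\<lambda>h. Wx z * fst h + Wt z * snd h)) (at z within strip)"
    and dWx: "\<And>z. z \<in> strip \<Longrightarrow> (Wx has_derivative (\<lambda>h. Wxx z * fst h + Wxt z * snd h)) (at z within strip)"
    and dWt: "\<And>z. z \<in> strip \<Longrightarrow> (Wt has_derivative (\<lambda>h. Wxt z * fst h + Wtt z * snd h)) (at z within strip)"
    and cW: "continuous_on strip Wxx" "continuous_on strip Wxt" "continuous_on strip Wtt"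
    and per: "\<And>x t. X (x + 2 * pi, t) = X (x, t) + 2 * pi" "\<And>x t. y (x + 2 * pi, t) = y (x, t)" "\<And>x t. W (x + 2 * pi, t) = W (x, t)"
    and par: "\<And>x t. X (x, - t) = X (x, t)" "\<And>x t. y (x, - t) = - y (x, t)" "\<And>x t. X (- x, t) = - X (x, t)" "\<And>x t. y (- x, t) = y (x, t)"
    and pde: "\<And>z. z \<in> strip \<Longrightarrow> Wtt z + om\<^sup>2 * Wxx z + m * om\<^sup>2 * ((a z)\<^sup>2 + om\<^sup>2 * (b z)\<^sup>2) / (cosh (om * y z / l))\<^sup>2 * W z = 0"
    and bc: "\<And>x t. \<bar>t\<bar> = pi/2 \<Longrightarrow> W (x, t) = 1" "\<And>x t. \<bar>t\<bar> = pi/2 \<Longrightarrow> Wx (x, t) = 0" "\<And>x t. \<bar>t\<bar> = pi/2 \<Longrightarrow> Wt (x, t) = 0"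

lemma pbd_abs: "pbd {0..pi/2} f \<Longrightarrow> pbd {- (pi/2)..pi/2} (\<lambda>n \<theta>. f n \<bar>\<theta>\<bar>)"
proof -
  assume "pbd {0..pi/2} f"
  then obtain A p where A: "A \<ge> 0" "\<And>n \<theta>. \<theta> \<in> {0..pi/2} \<Longrightarrow> \<bar>f n \<theta>\<bar> \<le> A * (1 + real (dg n)) ^ p"
    unfolding pbd_def by metis
  show ?thesis by (rule pbdI[where A=A and p=p]) (rule A(2), auto simp: abs_le_iff)
qed

lemma pbd_trig: "pbd S (\<lambda>n \<theta>. sin (f \<theta>))" "pbd S (\<lambda>n \<theta>. cos (f \<theta>))" "pbd S (\<lambda>n \<theta>. sgn \<theta>)"
  by (rule pbd_bounded[where B=1], simp add: sgn_if)+

lemma pbd_diff: "pbd S c \<Longrightarrow> pbd S d \<Longrightarrow> pbd S (\<lambda>n \<theta>. c n \<theta> - d n \<theta>)"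
  using pbd_add[of S c "\<lambda>n \<theta>. (-1) * d n \<theta>"] pbd_mult[OF pbd_const[of S "-1"], of d] by simp

lemma pbd_power: "pbd S c \<Longrightarrow> pbd S (\<lambda>n \<theta>. (c n \<theta>)\<^sup>2)"
  unfolding power2_eq_square by (rule pbd_mult)

lemmas pbd_rules = pbd_add pbd_diff pbd_mult pbd_power pbd_kd pbd_const pbd_cf pbd_trig

context mode_sol
begin

definition Vdd where "Vdd n t = (3 * (kd n)\<^sup>2 - 4) * cf V n t + cf g n t"
definition Ydd where "Ydd n t = 3 * (kd n)\<^sup>2 * cf Y n t + 3 * kd n * cf r n t"
text \<open>\<open>wh0\<close> holds the coefficients of \<open>W + cos 2\<theta>\<close>;
  \<open>wh1\<close> and \<open>wh2\<close> are its first two \<theta>-derivatives with the mode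
  equations inserted.\<close>

definition wh0 where "wh0 n t = cf V n t + 2 * sin (2 * t) * cf Y n t"
definition wh1 where "wh1 n t = V1 n t + 4 * cos (2 * t) * cf Y n t + 2 * sin (2 * t) * cf Y1 n t"
definition wh2 where "wh2 n t = Vdd n t - 8 * sin (2 * t) * cf Y n t + 8 * cos (2 * t) * cf Y1 n t + 2 * sin (2 * t) * Ydd n t"

lemma dsc: "((\<lambda>t. 2 * sin (2 * t)) has_real_derivative 4 * cos (2 * t)) (at t within S)"
  "((\<lambda>t. 4 * cos (2 * t)) has_real_derivative - 8 * sin (2 * t)) (at t within S)"
  by (auto intro!: derivative_eq_intros)

lemma dw0: 
  assumes t: "t \<in> {0..pi/2}" shows "(wh0 n has_real_derivative wh1 n t) (at t within {0..pi/2})"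
  unfolding wh0_def[abs_def] wh1_def
  by (rule DERIV_cong[OF DERIV_add[OF dV[OF t] DERIV_mult[OF dsc(1) dY[OF t]]]]) (simp add: algebra_simps)

lemma dw1:
  assumes t: "t \<in> {0..pi/2}" shows "(wh1 n has_real_derivative wh2 n t) (at t within {0..pi/2})"
  unfolding wh1_def[abs_def] wh2_def
  by (rule DERIV_cong[OF DERIV_add[OF DERIV_add[OF dV1[OF t, folded Vdd_def] DERIV_mult[OF dsc(2) dY[OF t]]] DERIV_mult[OF dsc(1) dY1[OF t, folded Ydd_def]]]])
    (simp add: algebra_simps)

text \<open>Makes a factor \<open>k\<close> in \<open>r\<close> visible, so that the source
  \<open>3 k r\<close> of the equation for \<open>Y\<close> may be divided by \<open>k\<close> when
  \<open>X\<close> is constructed.\<close>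

lemma cf_r: "cf r n t = kd n * cf (L \<star> Y) n t"
  unfolding r_eq by (rule conv_mode[where f="\<lambda>k. k"]) (use diag cf_KY in auto)

lemma zero_at_0: "wh1 n 0 = 0" "Ydd n 0 = 0" "cf Y n 0 = 0"
proof -
  show "cf Y n 0 = 0" by (rule Y_0)
  have "cf (L \<star> Y) n 0 = 0" unfolding cf_conv ccf_def by (simp add: Y_0)
  then show "wh1 n 0 = 0" "Ydd n 0 = 0" by (simp_all add: wh1_def Ydd_def V_end Y_0 cf_r)
qed

lemma zero_at_end: "wh0 n (pi/2) = 0" "wh1 n (pi/2) = 0"
  by (simp_all add: wh0_def wh1_def V_end)

text \<open>\<open>V1\<close> is not an element of the algebra and has no norm bound; it is
  recovered by integrating \<open>Vdd\<close> from 0, where \<open>V1\<close> vanishes.\<close>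

lemma pbd_V1: "pbd {0..pi/2} V1"
proof -
  have "pbd {0..pi/2} Vdd" unfolding Vdd_def[abs_def] by (intro pbd_rules)
  then obtain A p where A: "A \<ge> 0" "\<And>n \<theta>. \<theta> \<in> {0..pi/2} \<Longrightarrow> \<bar>Vdd n \<theta>\<bar> \<le> A * (1 + real (dg n)) ^ p"
    unfolding pbd_def by metis
  show ?thesis
  proof (rule pbdI[where A="2 * A" and p=p])
    fix n t assume t: "t \<in> {0..pi/2}"
    have "norm (V1 n t - V1 n 0) \<le> (A * (1 + real (dg n)) ^ p) * norm (t - 0)"
      by (rule field_differentiable_bound[OF _ dV1[folded Vdd_def]]) (use t A in auto)
    also have "\<dots> \<le> (A * (1 + real (dg n)) ^ p) * 2"
      using t A(1) pi_less_4 by (intro mult_left_mono) auto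
    finally show "\<bar>V1 n t\<bar> \<le> 2 * A * (1 + real (dg n)) ^ p" by (simp add: V_end mult_ac)
  qed
qed

lemma pbd_w: "pbd {0..pi/2} wh0" "pbd {0..pi/2} wh1" "pbd {0..pi/2} wh2" "pbd S Ydd"
proof -
  show y: "pbd S Ydd" for S unfolding Ydd_def[abs_def] by (intro pbd_rules)
  have v: "pbd {0..pi/2} Vdd" unfolding Vdd_def[abs_def] by (intro pbd_rules)
  show "pbd {0..pi/2} wh0" "pbd {0..pi/2} wh1" "pbd {0..pi/2} wh2"
    unfolding wh0_def[abs_def] wh1_def[abs_def] wh2_def[abs_def] by (intro pbd_rules pbd_V1 y v)+
qed

text \<open>Chosen so that \<open>k xe = Y1\<close>, which is the Cauchy-Riemann equation for the
  \<xi>-derivative of \<open>X\<close>. At \<open>k = 0\<close> the convention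
  \<open>inverse 0 = 0\<close> gives the right value, because \<open>Y1\<close> vanishes
  there.\<close>

definition xe where "xe n \<theta> = inverse (kd n) * cf Y1 n \<bar>\<theta>\<bar>"
definition xe1 where "xe1 n \<theta> = inverse (kd n) * (sgn \<theta> * Ydd n \<bar>\<theta>\<bar>)"

definition "Wz s z = - cos (2 * snd z) + FC (\<lambda>n \<theta>. wh0 n \<bar>\<theta>\<bar>) s z"
definition "Wxz s z = - FS (\<lambda>n \<theta>. kd n * wh0 n \<bar>\<theta>\<bar>) s z"
definition "Wtz s z = 2 * sin (2 * snd z) + FC (\<lambda>n \<theta>. sgn \<theta> * wh1 n \<bar>\<theta>\<bar>) s z"
definition "Wxxz s z = - FC (\<lambda>n \<theta>. kd n * (kd n * wh0 n \<bar>\<theta>\<bar>)) s z"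
definition "Wxtz s z = - FS (\<lambda>n \<theta>. kd n * (sgn \<theta> * wh1 n \<bar>\<theta>\<bar>)) s z"
definition "Wttz s z = 4 * cos (2 * snd z) + FC (\<lambda>n \<theta>. wh2 n \<bar>\<theta>\<bar>) s z"
definition "Yz s z = snd z + FC (\<lambda>n \<theta>. sgn \<theta> * cf Y n \<bar>\<theta>\<bar>) s z"
definition "az s z = 1 + FC (\<lambda>n \<theta>. cf Y1 n \<bar>\<theta>\<bar>) s z"
definition "bz s z = - FS (\<lambda>n \<theta>. kd n * (sgn \<theta> * cf Y n \<bar>\<theta>\<bar>)) s z"
definition "bxz s z = - FC (\<lambda>n \<theta>. kd n * (kd n * (sgn \<theta> * cf Y n \<bar>\<theta>\<bar>))) s z"
definition "btz s z = - FS (\<lambda>n \<theta>. kd n * cf Y1 n \<bar>\<theta>\<bar>) s z"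
definition "Xz s z = fst z + FS xe s z"
definition "Lam s = val L s 0 0"
definition "Nn s = val N s 0 0"

abbreviation "II \<equiv> {- (pi/2)..pi/2}"

lemma pi2: "pi / 2 > 0" by simp

lemma ext_derivs:
  assumes "\<theta> \<in> II"
  shows "((\<lambda>\<theta>. wh0 n \<bar>\<theta>\<bar>) has_real_derivative sgn \<theta> * wh1 n \<bar>\<theta>\<bar>) (at \<theta> within II)"
    "((\<lambda>\<theta>. sgn \<theta> * wh1 n \<bar>\<theta>\<bar>) has_real_derivative wh2 n \<bar>\<theta>\<bar>) (at \<theta> within II)"
    "((\<lambda>\<theta>. sgn \<theta> * cf Y n \<bar>\<theta>\<bar>) has_real_derivative cf Y1 n \<bar>\<theta>\<bar>) (at \<theta> within II)"
    "((\<lambda>\<theta>. cf Y1 n \<bar>\<theta>\<bar>) has_real_derivative sgn \<theta> * Ydd n \<bar>\<theta>\<bar>) (at \<theta> within II)"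
  by (rule deriv_even_ext[OF dw0 assms pi2 zero_at_0(1)], assumption)
    (rule deriv_odd_ext[OF dw1 assms pi2 zero_at_0(1)], assumption,
     rule deriv_odd_ext[OF dY assms pi2 zero_at_0(3)], assumption,
     rule deriv_even_ext[OF dY1[folded Ydd_def] assms pi2 zero_at_0(2)], assumption)

lemma ext_pbd: "pbd II (\<lambda>n \<theta>. wh0 n \<bar>\<theta>\<bar>)" "pbd II (\<lambda>n \<theta>. sgn \<theta> * wh1 n \<bar>\<theta>\<bar>)" "pbd II (\<lambda>n \<theta>. wh2 n \<bar>\<theta>\<bar>)"
  "pbd II (\<lambda>n \<theta>. cf Y1 n \<bar>\<theta>\<bar>)" "pbd II (\<lambda>n \<theta>. sgn \<theta> * cf Y n \<bar>\<theta>\<bar>)" "pbd II (\<lambda>n \<theta>. sgn \<theta> * Ydd n \<bar>\<theta>\<bar>)"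
  by (intro pbd_rules pbd_abs pbd_w)+

lemma pbd_inv_kd: "pbd S (\<lambda>n \<theta>. inverse (kd n))"
proof (rule pbdI[where A=1 and p=0])
  fix n show "\<bar>inverse (kd n)\<bar> \<le> 1 * (1 + real (dg n)) ^ 0"
    using kd_ge1[of n] by (cases "kd n = 0") (auto simp: abs_inverse inverse_le_1_iff)
qed

lemma pbd_xe: "pbd II xe" "pbd II xe1"
  unfolding xe_def[abs_def] xe1_def[abs_def] by (intro pbd_mult pbd_inv_kd ext_pbd)+

lemma dxe: "\<theta> \<in> II \<Longrightarrow> (xe n has_real_derivative xe1 n \<theta>) (at \<theta> within II)"
  unfolding xe_def[abs_def] xe1_def by (rule DERIV_cmult ext_derivs)+

lemma Y1_k0: "kd n = 0 \<Longrightarrow> t \<in> {0..pi/2} \<Longrightarrow> cf Y1 n t = 0"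
proof -
  assume k: "kd n = 0" and t: "t \<in> {0..pi/2}"
  have "((\<lambda>_. 0) has_real_derivative cf Y1 n t) (at t within {0..pi/2})"
    by (rule has_field_derivative_transform_within[OF dY[OF t] zero_less_one t]) (simp add: Y_0(2)[OF k])
  moreover have "((\<lambda>_. 0) has_real_derivative 0) (at t within {0..pi/2})" by simp
  ultimately show "cf Y1 n t = 0"
    unfolding has_real_derivative_iff_has_vector_derivative
    using t by (intro vector_derivative_unique_within_closed_interval[of 0 "pi/2" t "\<lambda>_. 0"]) (auto simp: cbox_interval)
qed

lemma FC_cong: "(\<And>n. c n (snd z) = d n (snd z)) \<Longrightarrow> FC c s z = FC d s z"
  and FS_cong: "(\<And>n. c n (snd z) = d n (snd z)) \<Longrightarrow> FS c s z = FS d s z"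
  by (simp_all add: FC_def FS_def)

lemma FS_k_xe: "z \<in> strip \<Longrightarrow> FC (\<lambda>n \<theta>. kd n * xe n \<theta>) s z = FC (\<lambda>n \<theta>. cf Y1 n \<bar>\<theta>\<bar>) s z"
proof (rule FC_cong)
  fix n assume z: "z \<in> strip"
  show "kd n * xe n (snd z) = cf Y1 n \<bar>snd z\<bar>"
    using Y1_k0[of n "\<bar>snd z\<bar>"] z by (cases "kd n = 0") (auto simp: xe_def abs_le_iff)
qed

lemma diag_val:
  assumes "\<And>n \<theta>. fst n \<noteq> snd n \<Longrightarrow> cf A n \<theta> = 0" "\<And>n \<theta>. cf A n \<theta> = cf A n 0"
  shows "val A s x \<theta> = val A s 0 0"
proof -
  have "cf A n \<theta> * (s ^ dg n * cos (kd n * x)) = cf A n 0 * (s ^ dg n * cos (kd n * 0))" for n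
    using assms(1)[of n \<theta>] assms(1)[of n 0] assms(2)[of n \<theta>] by (cases "fst n = snd n") (auto simp: kd_def)
  then show ?thesis unfolding val_def FC_def fst_conv snd_conv by (intro arg_cong[where f=suminf] ext)
qed

lemma val_L: "val L s x \<theta> = Lam s" and val_N: "val N s x \<theta> = Nn s"
  unfolding Lam_def Nn_def by (rule diag_val; use diag in auto)+

lemma sym_KY: "swop KY = - KY"
  by (rule alg_eqI) (simp add: cf_swop' cf_KY kd_swap, simp flip: cf_swop' add: sym)

lemma valS_r: "\<bar>s\<bar> \<le> 1/2 \<Longrightarrow> valS r s x t = Lam s * valS KY s x t"
proof -
  assume s: "\<bar>s\<bar> \<le> 1/2"
  have n: "norm (complex_of_real s * cis x) \<le> 1/2" "norm (complex_of_real s * cis (- x)) \<le> 1/2"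
    using s by (simp_all add: norm_mult)
  have "of_real (val r s x t) + \<i> * of_real (valS r s x t) =
    (of_real (val L s x t) + \<i> * of_real (valS L s x t)) * (complex_of_real (val KY s x t) + \<i> * of_real (valS KY s x t))"
    unfolding Ev_val[OF s, symmetric] r_eq cf_conv ccf_def by (rule Ev_conv[OF cf_norm cf_norm n])
  from arg_cong[OF this, of Im] show ?thesis using valS_sym[OF sym(7) s, of x t] by (simp add: val_L)
qed

text \<open>The identity \<open>valS_r\<close> is differentiated in \<xi>, with \<open>Lam s\<close>
  as a constant; a multiplier \<open>k\<close> outside a convolution is thereby moved onto one
  factor.\<close>

lemma FC_kr: 
  assumes s: "\<bar>s\<bar> \<le> 1/2"
  shows "FC (\<lambda>n \<theta>. kd n * cf r n \<theta>) s (x, t) = Lam s * FC (\<lambda>n \<theta>. kd n * cf KY n \<theta>) s (x, t)"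
proof -
  have d: "((\<lambda>x. valS A s x t) has_real_derivative FC (\<lambda>n \<theta>. kd n * cf A n \<theta>) s (x, t)) (at x)" for A :: alg
  proof -
    have "(FS (\<lambda>n _. cf A n t) s has_derivative (\<lambda>h. FC (\<lambda>n \<theta>. kd n * cf A n t) s (x, t) * fst h + FS (\<lambda>n \<theta>. 0) s (x, t) * snd h)) (at (x, t) within UNIV \<times> UNIV)"
      by (rule F_deriv(2)[OF _ s]) (auto intro!: pbd_rules pbdI[where A="norm A" and p=0] simp: cf_norm)
    then have "(FS (\<lambda>n _. cf A n t) s has_derivative (\<lambda>h. FC (\<lambda>n \<theta>. kd n * cf A n t) s (x, t) * fst h)) (at (x, t))"
      by (simp add: FS_def)
    moreover have "((\<lambda>x. (x, t)) has_derivative (\<lambda>h. (h, 0))) (at x)" by (auto intro!: derivative_eq_intros)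
    ultimately have "((\<lambda>x. FS (\<lambda>n _. cf A n t) s (x, t)) has_derivative (\<lambda>h. FC (\<lambda>n \<theta>. kd n * cf A n t) s (x, t) * fst (h, 0::real))) (at x)"
      by (rule has_derivative_compose[rotated])
    then show ?thesis unfolding has_field_derivative_def valS_def
      by (simp add: FC_def FS_def)
  qed
  have "((\<lambda>x. valS r s x t) has_real_derivative Lam s * FC (\<lambda>n \<theta>. kd n * cf KY n \<theta>) s (x, t)) (at x)"
    unfolding valS_r[OF s] by (rule DERIV_cmult[OF d])
  from DERIV_unique[OF d this] show ?thesis .
qed

text \<open>The norm of evaluation for \<open>|s| \<le> 1/2\<close>. It depends on no parameter of
  the locale, so smallness thresholds can be fixed in terms of it before a solution exists.\<close>

definition "Mz = (\<Sum>m. mw 0 (prod_decode m))"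

lemma FC_abs: "FC (\<lambda>n \<theta>. c n \<bar>\<theta>\<bar>) s (x, \<theta>) = FC c s (x, \<bar>\<theta>\<bar>)" "FS (\<lambda>n \<theta>. c n \<bar>\<theta>\<bar>) s (x, \<theta>) = FS c s (x, \<bar>\<theta>\<bar>)"
  by (simp_all add: FC_def FS_def)

context
  fixes s :: real
  assumes s: "\<bar>s\<bar> \<le> 1/2"
begin

lemma FC_sgn:
  assumes "pbd {0..pi/2} c" "\<theta> \<in> II"
  shows "FC (\<lambda>n \<theta>. sgn \<theta> * c n \<bar>\<theta>\<bar>) s (x, \<theta>) = sgn \<theta> * FC c s (x, \<bar>\<theta>\<bar>)"
    "FS (\<lambda>n \<theta>. sgn \<theta> * c n \<bar>\<theta>\<bar>) s (x, \<theta>) = sgn \<theta> * FS c s (x, \<bar>\<theta>\<bar>)"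
  using FC_mult[OF pbd_abs[OF assms(1)] s, of "(x, \<theta>)" sgn] FS_mult[OF pbd_abs[OF assms(1)] s, of "(x, \<theta>)" sgn] assms(2)
  by (simp_all add: FC_abs)

abbreviation "om2 \<equiv> 3 * (1 + Lam s)"

lemma pbd_kY: "pbd S (\<lambda>n \<theta>. kd n * cf Y n \<theta>)" "pbd S (\<lambda>n \<theta>. kd n * (kd n * cf Y n \<theta>))" "pbd S (\<lambda>n \<theta>. kd n * cf r n \<theta>)"
  by (intro pbd_rules)+

lemma valS_KY: "valS KY s x t = FS (\<lambda>n \<theta>. kd n * cf Y n \<theta>) s (x, t)"
  unfolding valS_def by (rule FS_cong) (simp add: cf_KY)

lemma bz_eq: "\<theta> \<in> II \<Longrightarrow> bz s (x, \<theta>) = - sgn \<theta> * valS KY s x \<bar>\<theta>\<bar>"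
proof -
  assume th: "\<theta> \<in> II"
  have "bz s (x, \<theta>) = - FS (\<lambda>n \<theta>. sgn \<theta> * (kd n * cf Y n \<bar>\<theta>\<bar>)) s (x, \<theta>)"
    unfolding bz_def by (simp add: mult.left_commute)
  then show ?thesis by (simp add: FC_sgn[OF pbd_kY(1) th] valS_KY)
qed

text \<open>Harmonicity of the second component for
  \<open>d^2/d\<theta>^2 + om^2 d^2/d\<xi>^2\<close>: \<open>3 k^2 Y\<close> accounts for the 3 in
  \<open>om^2\<close> and \<open>3 k r\<close> for \<open>3 Lam\<close>.\<close>

lemma FC_Ydd: "FC Ydd s (x, t) = om2 * FC (\<lambda>n \<theta>. kd n * (kd n * cf Y n \<theta>)) s (x, t)"
proof -
  have "FC Ydd s (x, t) = FC (\<lambda>n \<theta>. (\<lambda>_. 3) \<theta> * (kd n * (kd n * cf Y n \<theta>)) + (\<lambda>_. 3) \<theta> * (kd n * cf r n \<theta>)) s (x, t)"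
    by (rule FC_cong) (simp add: Ydd_def power2_eq_square mult_ac)
  also have "\<dots> = FC (\<lambda>n \<theta>. (\<lambda>_. 3) \<theta> * (kd n * (kd n * cf Y n \<theta>))) s (x, t) + FC (\<lambda>n \<theta>. (\<lambda>_. 3) \<theta> * (kd n * cf r n \<theta>)) s (x, t)"
    by (rule FC_add[OF _ s UNIV_I]) (intro pbd_rules)+
  also have "\<dots> = 3 * FC (\<lambda>n \<theta>. kd n * (kd n * cf Y n \<theta>)) s (x, t) + 3 * FC (\<lambda>n \<theta>. kd n * cf r n \<theta>) s (x, t)"
    by (simp only: FC_mult[OF pbd_kY(2)[of UNIV] s UNIV_I] FC_mult[OF pbd_kY(3)[of UNIV] s UNIV_I])
  also have "FC (\<lambda>n \<theta>. kd n * cf r n \<theta>) s (x, t) = Lam s * FC (\<lambda>n \<theta>. kd n * (kd n * cf Y n \<theta>)) s (x, t)"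
    unfolding FC_kr[OF s] by (simp add: cf_KY)
  finally show ?thesis by (simp add: algebra_simps)
qed

text \<open>The other Cauchy-Riemann equation. Dividing \<open>3 k^2 Y + 3 k r\<close> by
  \<open>k\<close> leaves \<open>3 k Y + 3 r\<close>, which evaluates to \<open>om^2\<close> times
  the sine series of \<open>KY\<close>.\<close>

lemma FS_xe1: "z \<in> strip \<Longrightarrow> FS xe1 s z = - om2 * bz s z"
proof -
  assume z: "z \<in> strip"
  obtain x \<theta> where zz: "z = (x, \<theta>)" "\<theta> \<in> II" using z by (cases z) auto
  have "FS xe1 s z = FS (\<lambda>n \<theta>. sgn \<theta> * (3 * (kd n * cf Y n \<bar>\<theta>\<bar>) + 3 * cf r n \<bar>\<theta>\<bar>)) s z"
  proof (rule FS_cong)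
    fix n
    show "xe1 n (snd z) = sgn (snd z) * (3 * (kd n * cf Y n \<bar>snd z\<bar>) + 3 * cf r n \<bar>snd z\<bar>)"
      by (cases "kd n = 0") (simp_all add: xe1_def Ydd_def cf_r power2_eq_square field_simps)
  qed
  also have "\<dots> = sgn \<theta> * FS (\<lambda>n \<theta>. (\<lambda>_. 3) \<theta> * (kd n * cf Y n \<theta>) + (\<lambda>_. 3) \<theta> * cf r n \<theta>) s (x, \<bar>\<theta>\<bar>)"
    unfolding zz(1) by (rule FC_sgn(2)[OF _ zz(2)]) (intro pbd_rules)
  also have "FS (\<lambda>n \<theta>. (\<lambda>_. 3) \<theta> * (kd n * cf Y n \<theta>) + (\<lambda>_. 3) \<theta> * cf r n \<theta>) s (x, \<bar>\<theta>\<bar>)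
     = FS (\<lambda>n \<theta>. (\<lambda>_. 3) \<theta> * (kd n * cf Y n \<theta>)) s (x, \<bar>\<theta>\<bar>) + FS (\<lambda>n \<theta>. (\<lambda>_. 3) \<theta> * cf r n \<theta>) s (x, \<bar>\<theta>\<bar>)"
    by (rule FS_add[OF _ s UNIV_I]) (intro pbd_rules)+
  also have "\<dots> = 3 * valS KY s x \<bar>\<theta>\<bar> + 3 * valS r s x \<bar>\<theta>\<bar>"
    by (simp only: FS_mult[OF pbd_kY(1)[of UNIV] s UNIV_I] FS_mult[OF pbd_cf[of UNIV] s UNIV_I] valS_KY snd_conv)
      (simp add: valS_def)
  finally show ?thesis unfolding zz(1) bz_eq[OF zz(2)] valS_r[OF s] by (simp add: algebra_simps)
qed

lemma az_eq: "az s (x, \<theta>) = 1 + val Y1 s x \<bar>\<theta>\<bar>"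
  unfolding az_def val_def by (simp add: FC_abs)

lemma conv_II: "convex II" by simp

lemma FD: 
  assumes "\<And>n \<theta>. \<theta> \<in> II \<Longrightarrow> (c n has_real_derivative c1 n \<theta>) (at \<theta> within II)" "pbd II c" "pbd II c1" "z \<in> strip"
  shows "(FC c s has_derivative (\<lambda>h. - FS (\<lambda>n \<theta>. kd n * c n \<theta>) s z * fst h + FC c1 s z * snd h)) (at z within strip)"
    and "(FS c s has_derivative (\<lambda>h. FC (\<lambda>n \<theta>. kd n * c n \<theta>) s z * fst h + FS c1 s z * snd h)) (at z within strip)"
  using F_deriv[OF conv_II s assms(1-3), of z] assms(4) by auto

lemma k_ext_derivs:
  assumes "\<theta> \<in> II"
  shows "((\<lambda>\<theta>. kd n * wh0 n \<bar>\<theta>\<bar>) has_real_derivative kd n * (sgn \<theta> * wh1 n \<bar>\<theta>\<bar>)) (at \<theta> within II)"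
    "((\<lambda>\<theta>. kd n * (sgn \<theta> * cf Y n \<bar>\<theta>\<bar>)) has_real_derivative kd n * cf Y1 n \<bar>\<theta>\<bar>) (at \<theta> within II)"
  by (intro DERIV_cmult ext_derivs assms)+

lemma d_X: "z \<in> strip \<Longrightarrow> (Xz s has_derivative (\<lambda>h. az s z * fst h + (- om2 * bz s z) * snd h)) (at z within strip)"
proof -
  assume z: "z \<in> strip"
  have "(Xz s has_derivative (\<lambda>h. fst h + (FC (\<lambda>n \<theta>. kd n * xe n \<theta>) s z * fst h + FS xe1 s z * snd h))) (at z within strip)"
    unfolding Xz_def[abs_def]
    by (intro has_derivative_add has_derivative_fst[OF has_derivative_ident] FD(2)[OF dxe pbd_xe z])
  then show ?thesis unfolding FS_k_xe[OF z] FS_xe1[OF z] by (simp add: az_def algebra_simps)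
qed

lemma d_Y: "z \<in> strip \<Longrightarrow> (Yz s has_derivative (\<lambda>h. bz s z * fst h + az s z * snd h)) (at z within strip)"
proof -
  assume z: "z \<in> strip"
  have "(Yz s has_derivative (\<lambda>h. snd h + (- FS (\<lambda>n \<theta>. kd n * (sgn \<theta> * cf Y n \<bar>\<theta>\<bar>)) s z * fst h + FC (\<lambda>n \<theta>. cf Y1 n \<bar>\<theta>\<bar>) s z * snd h))) (at z within strip)"
    unfolding Yz_def[abs_def]
    by (intro has_derivative_add has_derivative_snd[OF has_derivative_ident] FD(1)[OF ext_derivs(3) ext_pbd(5,4) z])
  then show ?thesis by (simp add: az_def bz_def algebra_simps)
qed

lemma d_a: "z \<in> strip \<Longrightarrow> (az s has_derivative (\<lambda>h. btz s z * fst h + (- om2 * bxz s z) * snd h)) (at z within strip)"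
proof -
  assume z: "z \<in> strip"
  obtain x \<theta> where zz: "z = (x, \<theta>)" "\<theta> \<in> II" using z by (cases z) auto
  have "(az s has_derivative (\<lambda>h. 0 + (- FS (\<lambda>n \<theta>. kd n * cf Y1 n \<bar>\<theta>\<bar>) s z * fst h + FC (\<lambda>n \<theta>. sgn \<theta> * Ydd n \<bar>\<theta>\<bar>) s z * snd h))) (at z within strip)"
    unfolding az_def[abs_def]
    by (intro has_derivative_add has_derivative_const FD(1)[OF ext_derivs(4) ext_pbd(4,6) z])
  moreover have "FC (\<lambda>n \<theta>. sgn \<theta> * Ydd n \<bar>\<theta>\<bar>) s z = - om2 * bxz s z"
  proof -
    have "bxz s z = - FC (\<lambda>n \<theta>. sgn \<theta> * (kd n * (kd n * cf Y n \<bar>\<theta>\<bar>))) s z"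
      unfolding bxz_def by (simp add: mult.left_commute)
    then show ?thesis unfolding zz(1) by (simp add: FC_sgn(1)[OF pbd_w(4) zz(2)] FC_sgn(1)[OF pbd_kY(2) zz(2)] FC_Ydd algebra_simps)
  qed
  ultimately show ?thesis by (simp add: btz_def)
qed

lemma d_b: "z \<in> strip \<Longrightarrow> (bz s has_derivative (\<lambda>h. bxz s z * fst h + btz s z * snd h)) (at z within strip)"
proof -
  assume z: "z \<in> strip"
  have "(bz s has_derivative (\<lambda>h. - (FC (\<lambda>n \<theta>. kd n * (kd n * (sgn \<theta> * cf Y n \<bar>\<theta>\<bar>))) s z * fst h + FS (\<lambda>n \<theta>. kd n * cf Y1 n \<bar>\<theta>\<bar>) s z * snd h))) (at z within strip)"
    unfolding bz_def[abs_def]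
    by (intro has_derivative_minus FD(2)[OF k_ext_derivs(2) _ _ z] pbd_mult[OF pbd_kd] ext_pbd)
  then show ?thesis by (simp add: bxz_def btz_def algebra_simps)
qed

lemma d_W: "z \<in> strip \<Longrightarrow> (Wz s has_derivative (\<lambda>h. Wxz s z * fst h + Wtz s z * snd h)) (at z within strip)"
proof -
  assume z: "z \<in> strip"
  have 1: "((\<lambda>z. - cos (2 * snd z)) has_derivative (\<lambda>h. 2 * sin (2 * snd z) * snd h)) (at z within strip)"
    by (auto intro!: derivative_eq_intros simp: fun_eq_iff)
  have "(Wz s has_derivative (\<lambda>h. 2 * sin (2 * snd z) * snd h + (- FS (\<lambda>n \<theta>. kd n * wh0 n \<bar>\<theta>\<bar>) s z * fst h + FC (\<lambda>n \<theta>. sgn \<theta> * wh1 n \<bar>\<theta>\<bar>) s z * snd h))) (at z within strip)"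
    unfolding Wz_def[abs_def] by (rule has_derivative_add[OF 1 FD(1)[OF ext_derivs(1) ext_pbd(1,2) z]])
  then show ?thesis by (simp add: Wxz_def Wtz_def algebra_simps)
qed

lemma d_Wx: "z \<in> strip \<Longrightarrow> (Wxz s has_derivative (\<lambda>h. Wxxz s z * fst h + Wxtz s z * snd h)) (at z within strip)"
proof -
  assume z: "z \<in> strip"
  have "(Wxz s has_derivative (\<lambda>h. - (FC (\<lambda>n \<theta>. kd n * (kd n * wh0 n \<bar>\<theta>\<bar>)) s z * fst h + FS (\<lambda>n \<theta>. kd n * (sgn \<theta> * wh1 n \<bar>\<theta>\<bar>)) s z * snd h))) (at z within strip)"
    unfolding Wxz_def[abs_def]
    by (intro has_derivative_minus FD(2)[OF k_ext_derivs(1) _ _ z] pbd_mult[OF pbd_kd] ext_pbd)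
  then show ?thesis by (simp add: Wxxz_def Wxtz_def algebra_simps)
qed

lemma d_Wt: "z \<in> strip \<Longrightarrow> (Wtz s has_derivative (\<lambda>h. Wxtz s z * fst h + Wttz s z * snd h)) (at z within strip)"
proof -
  assume z: "z \<in> strip"
  have 1: "((\<lambda>z. 2 * sin (2 * snd z)) has_derivative (\<lambda>h. 4 * cos (2 * snd z) * snd h)) (at z within strip)"
    by (auto intro!: derivative_eq_intros simp: fun_eq_iff)
  have "(Wtz s has_derivative (\<lambda>h. 4 * cos (2 * snd z) * snd h + (- FS (\<lambda>n \<theta>. kd n * (sgn \<theta> * wh1 n \<bar>\<theta>\<bar>)) s z * fst h + FC (\<lambda>n \<theta>. wh2 n \<bar>\<theta>\<bar>) s z * snd h))) (at z within strip)"
    unfolding Wtz_def[abs_def] by (rule has_derivative_add[OF 1 FD(1)[OF ext_derivs(2) ext_pbd(2,3) z]])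
  then show ?thesis by (simp add: Wxtz_def Wttz_def algebra_simps)
qed

end

end

section \<open>The weight \<open>1 / cosh^2\<close> and the equation on the strip\<close>

lemma tanh_artanh: "\<bar>u\<bar> < 1 \<Longrightarrow> tanh (artanh u) = (u :: real)"
proof -
  assume u: "\<bar>u\<bar> < 1"
  then have p: "1 + u > 0" "1 - u > 0" by auto
  have "exp (- (2 * artanh u)) = inverse (exp (2 * artanh u))" by (simp add: exp_minus)
  also have "exp (2 * artanh u) = (1 + u) / (1 - u)" using p by (simp add: artanh_def)
  finally have "exp (- (2 * artanh u)) = (1 - u) / (1 + u)" by simp
  then have "tanh (artanh u) = (1 - (1 - u) / (1 + u)) / (1 + (1 - u) / (1 + u))" by (simp add: tanh_real_altdef)
  also have "\<dots> = u" using p by (simp add: divide_simps)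
  finally show ?thesis .
qed

lemma tanh_sq_eq: "(tanh w)\<^sup>2 = 1 - 1 / (cosh w)\<^sup>2" for w :: real
proof -
  have "cosh w \<noteq> 0" by simp
  moreover have "(sinh w)\<^sup>2 = (cosh w)\<^sup>2 - 1" using cosh_square_eq[of w] by simp
  ultimately show ?thesis by (simp add: tanh_def power_divide diff_divide_distrib)
qed

context mode_sol
begin

context
  fixes s :: real
  assumes s: "\<bar>s\<bar> \<le> 1/2"
begin

lemma val_deriv_t:
  assumes "\<And>n t. t \<in> {0..pi/2} \<Longrightarrow> (cf A n has_real_derivative c1 n t) (at t within {0..pi/2})" "pbd {0..pi/2} c1" "t \<in> {0..pi/2}"
  shows "((\<lambda>t. val A s x t) has_real_derivative FC c1 s (x, t)) (at t within {0..pi/2})"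
proof -
  have 1: "(FC (cf A) s has_derivative (\<lambda>h. - FS (\<lambda>n \<theta>. kd n * cf A n \<theta>) s (x, t) * fst h + FC c1 s (x, t) * snd h)) (at (x, t) within UNIV \<times> {0..pi/2})"
    by (rule F_deriv(1)[OF _ s assms(1) pbd_cf assms(2)]) (use assms(3) in auto)
  have 2: "((\<lambda>t. (x, t)) has_derivative (\<lambda>h. (0, h))) (at t within {0..pi/2})" by (auto intro!: derivative_eq_intros)
  have "((\<lambda>t. FC (cf A) s (x, t)) has_derivative (\<lambda>h. - FS (\<lambda>n \<theta>. kd n * cf A n \<theta>) s (x, t) * fst (0::real, h) + FC c1 s (x, t) * snd (0::real, h))) (at t within {0..pi/2})"
    by (rule has_derivative_in_compose[OF 2 has_derivative_subset[OF 1]]) auto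
  then show ?thesis unfolding has_field_derivative_def val_def by simp
qed

text \<open>The Riccati equation of \<open>tanh\<close>, with inner derivative
  \<open>1 + Y1\<close>. It is an identity of products in the algebra, so multiplicativity of
  evaluation applies.\<close>

lemma val_T_deriv:
  assumes t: "t \<in> {0..pi/2}"
  shows "((\<lambda>t. val T s x t) has_real_derivative (1 + val Y1 s x t) * (1 - \<epsilon> * om2 s * (val T s x t)\<^sup>2)) (at t within {0..pi/2})"
proof -
  define H where "H = oneA + Y1 - (3 * \<epsilon>) *\<^sub>R (((oneA + L) \<star> (T \<star> T)) \<star> (oneA + Y1))"
  have sw: "swop (oneA + L) = oneA + L" "swop (T \<star> T) = T \<star> T" "swop ((oneA + L) \<star> (T \<star> T)) = (oneA + L) \<star> (T \<star> T)"
    by (simp_all add: swl_add swop_consts sym swop_conv)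
  have "val H s x t = (1 + val Y1 s x t) * (1 - \<epsilon> * om2 s * (val T s x t)\<^sup>2)"
    unfolding H_def val_diff[OF s] val_add[OF s] val_scaleR[OF s] val_conv[OF sw(3) s] val_conv[OF sw(1) s] val_conv[OF sym(5) s]
    by (simp add: val_consts val_L power2_eq_square algebra_simps)
  moreover have "((\<lambda>t. val T s x t) has_real_derivative FC (cf H) s (x, t)) (at t within {0..pi/2})"
    by (rule val_deriv_t[OF dT[folded H_def] pbd_cf t])
  ultimately show ?thesis by (simp add: val_def)
qed

lemma val_Y_deriv:
  assumes t: "t \<in> {0..pi/2}"
  shows "((\<lambda>t. val Y s x t) has_real_derivative val Y1 s x t) (at t within {0..pi/2})"
  unfolding val_def[of Y1] by (rule val_deriv_t[OF dY pbd_cf t])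

lemma val_0: "(\<And>n. cf A n 0 = 0) \<Longrightarrow> val A s x 0 = 0"
  by (simp add: val_def FC_def)

context
  assumes d1: "\<delta> * Mz \<le> 1/100" and d2: "4 * \<delta> * ((1 + norm thA) * Mz)\<^sup>2 < 1"
begin

lemma Mz_nonneg: "0 \<le> Mz"
  unfolding Mz_def by (intro suminf_nonneg mw_summable) simp

lemma small_vals: "\<bar>val Y1 s x t\<bar> \<le> 1/100" "\<bar>valS KY s x t\<bar> \<le> 1/100" "\<bar>Lam s\<bar> \<le> 1/100" "\<bar>Nn s\<bar> \<le> 1/100"
proof -
  have *: "norm A * Mz \<le> 1/100" if "norm A \<le> \<delta>" for A :: alg
    using mult_right_mono[OF that Mz_nonneg] d1 by linarith
  show "\<bar>val Y1 s x t\<bar> \<le> 1/100" "\<bar>valS KY s x t\<bar> \<le> 1/100" "\<bar>Lam s\<bar> \<le> 1/100" "\<bar>Nn s\<bar> \<le> 1/100"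
    unfolding Lam_def Nn_def using val_bound[OF s] small * unfolding Mz_def by (meson order_trans)+
qed

lemma om2_bounds: "om2 s > 0" "om2 s \<le> 4"
  using small_vals(3) by (auto simp: abs_le_iff)

text \<open>The bounds are \<delta> for \<epsilon>, 4 for \<open>om^2\<close> and
  \<open>(1 + norm thA) Mz\<close> for \<open>T\<close>, which is the combination controlled by
  \<open>d2\<close>. It keeps the argument of \<open>artanh\<close> inside its domain.\<close>

lemma T_small: "\<epsilon> * om2 s * (val T s x t)\<^sup>2 < 1"
proof -
  have "\<bar>val T s x t\<bar> \<le> norm T * Mz" using val_bound(1)[OF s] unfolding Mz_def .
  also have "\<dots> \<le> (1 + norm thA) * Mz" using small(6) Mz_nonneg by (intro mult_right_mono) auto
  finally have "\<bar>val T s x t\<bar>\<^sup>2 \<le> ((1 + norm thA) * Mz)\<^sup>2" by (intro power_mono) auto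
  then have "(val T s x t)\<^sup>2 \<le> ((1 + norm thA) * Mz)\<^sup>2" by simp
  moreover have "\<epsilon> * om2 s \<le> \<delta> * 4" using small(7) eps om2_bounds by (intro mult_mono) auto
  ultimately have "\<epsilon> * om2 s * (val T s x t)\<^sup>2 \<le> \<delta> * 4 * ((1 + norm thA) * Mz)\<^sup>2"
    using mult_mono[of "\<epsilon> * om2 s" "\<delta> * 4" "(val T s x t)\<^sup>2"] small(7) eps by simp
  with d2 show ?thesis by (simp add: mult_ac)
qed

text \<open>By the Riccati equation \<open>artanh (E T) - E (t + Y)\<close> has derivative 0, and it
  vanishes at \<open>t = 0\<close>. Hence \<open>E T\<close> is the \<open>tanh\<close> of
  \<open>E (t + Y)\<close>.\<close>

lemma T_tanh:
  assumes t: "t \<in> {0..pi/2}"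
  shows "1 - \<epsilon> * om2 s * (val T s x t)\<^sup>2 = 1 / (cosh (sqrt (\<epsilon> * om2 s) * (t + val Y s x t)))\<^sup>2"
proof -
  define E where "E = sqrt (\<epsilon> * om2 s)"
  have E2: "E * E = \<epsilon> * om2 s" using eps om2_bounds unfolding E_def by simp
  define G where "G t = artanh (E * val T s x t) - E * (t + val Y s x t)" for t
  have ab: "\<bar>E * val T s x t\<bar> < 1" for t
  proof -
    have "(E * val T s x t)\<^sup>2 = \<epsilon> * om2 s * (val T s x t)\<^sup>2" unfolding E2[symmetric] by (simp add: power2_eq_square mult_ac)
    then have "(E * val T s x t)\<^sup>2 < 1" using T_small by simp
    then show ?thesis by (simp add: abs_square_less_1)
  qed
  have "(G has_real_derivative 0) (at t within {0..pi/2})" if t: "t \<in> {0..pi/2}" for t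
  proof -
    have "1 - (E * val T s x t)\<^sup>2 > 0" using ab[of t] by (simp add: abs_square_less_1)
    have "(G has_real_derivative 1 / (1 - (E * val T s x t)\<^sup>2) * (E * ((1 + val Y1 s x t) * (1 - \<epsilon> * om2 s * (val T s x t)\<^sup>2))) - E * (1 + val Y1 s x t)) (at t within {0..pi/2})"
      unfolding G_def[abs_def]
      by (rule DERIV_diff[OF DERIV_chain2[OF artanh_real_has_field_derivative[OF ab] DERIV_cmult[OF val_T_deriv[OF t]]]
          DERIV_cmult[OF DERIV_add[OF DERIV_ident val_Y_deriv[OF t]]]])
    moreover have "1 - \<epsilon> * om2 s * (val T s x t)\<^sup>2 = 1 - (E * val T s x t)\<^sup>2" unfolding E2[symmetric] by (simp add: power2_eq_square)
    ultimately show ?thesis using \<open>1 - (E * val T s x t)\<^sup>2 > 0\<close> by simp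
  qed
  then obtain C where C: "\<And>t. t \<in> {0..pi/2} \<Longrightarrow> G t = C"
    using has_field_derivative_zero_constant[of "{0..pi/2}" G] by (auto simp: Ball_def)
  have "G 0 = 0" using val_0[of T x] val_0[of Y x] by (simp add: G_def T_0 Y_0)
  with C[of 0] C[OF t] have "artanh (E * val T s x t) = E * (t + val Y s x t)" by (simp add: G_def)
  then have "E * val T s x t = tanh (E * (t + val Y s x t))"
    using tanh_artanh[OF ab[of t]] by simp
  then have "\<epsilon> * om2 s * (val T s x t)\<^sup>2 = (tanh (E * (t + val Y s x t)))\<^sup>2"
    unfolding E2[symmetric] by (metis power2_eq_square power_mult_distrib)
  then show ?thesis unfolding E_def[symmetric] by (simp add: tanh_sq_eq)
qed

lemma sinh_cosh_step: "\<theta> \<in> II \<Longrightarrow> Yz s (x, \<theta>) = sgn \<theta> * (\<bar>\<theta>\<bar> + val Y s x \<bar>\<theta>\<bar>)"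
  unfolding Yz_def using FC_sgn(1)[OF s pbd_cf, of \<theta> Y x] sgn_mult_abs[of \<theta>] by (simp add: val_def distrib_left)

lemma cos_2_abs: "cos (2 * \<theta>) = cos (2 * \<bar>\<theta>\<bar> :: real)" by (simp add: abs_if)

lemma W_at: "\<theta> \<in> II \<Longrightarrow> Wz s (x, \<theta>) = - cos (2 * \<bar>\<theta>\<bar>) + (val V s x \<bar>\<theta>\<bar> + 2 * sin (2 * \<bar>\<theta>\<bar>) * val Y s x \<bar>\<theta>\<bar>)"
proof -
  have "FC wh0 s (x, t) = val V s x t + 2 * sin (2 * t) * val Y s x t" for t
    unfolding wh0_def[abs_def] val_def
    by (subst FC_add[OF pbd_cf[of UNIV] s UNIV_I], intro pbd_rules, subst FC_mult[OF pbd_cf[of UNIV] s UNIV_I, where f="\<lambda>t. 2 * sin (2 * t)"]) simp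
  then show ?thesis unfolding Wz_def by (simp add: FC_abs cos_2_abs[of \<theta>])
qed

text \<open>After evaluation this is a ring identity. The terms of \<open>2 sin 2\<theta> Y\<close>
  cancel as planned: \<open>8 cos 2\<theta> Y1\<close> against the part \<open>8 Y1 W0\<close> of
  the conformal factor, \<open>8 sin 2\<theta> Y\<close> against the zero order term, and the second
  derivatives of \<open>Y\<close> by harmonicity.\<close>

lemma pde_at:
  assumes th: "\<theta> \<in> II"
  shows "Wttz s (x, \<theta>) + om2 s * Wxxz s (x, \<theta>) +
    4 * (1 + Nn s) * ((az s (x, \<theta>))\<^sup>2 + om2 s * (bz s (x, \<theta>))\<^sup>2) * (1 - \<epsilon> * om2 s * (val T s x \<bar>\<theta>\<bar>)\<^sup>2) * Wz s (x, \<theta>) = 0"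
proof -
  define t where "t = \<bar>\<theta>\<bar>"
  have t: "t \<in> {0..pi/2}" using th by (auto simp: t_def)
  define v y y1 ky sn cs k2 D where "v = val V s x t" "y = val Y s x t" "y1 = val Y1 s x t" "ky = valS KY s x t"
    "sn = sin (2 * t)" "cs = cos (2 * t)" "k2 = val KV s x t" "D = FC (\<lambda>n \<theta>. kd n * (kd n * cf Y n \<theta>)) s (x, t)"
  note defs = this
  define La Nv Tv where "La = Lam s" "Nv = Nn s" "Tv = val T s x t"
  note defs2 = this
  have clt: "cl t = t" using t by (simp add: cl_id)
  have kV: "val KV s x t = FC (\<lambda>n \<theta>. kd n * (kd n * cf V n \<theta>)) s (x, t)"
    unfolding val_def by (rule FC_cong) (simp add: cf_KV power2_eq_square mult_ac)
  have bb: "(bz s (x, \<theta>))\<^sup>2 = ky\<^sup>2"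
  proof (cases "\<theta> = 0")
    case True
    have "valS KY s x 0 = 0" unfolding valS_def FS_def by (simp add: cf_KY Y_0)
    then show ?thesis using True bz_eq[OF s th] by (simp add: defs t_def)
  next
    case False
    then show ?thesis using bz_eq[OF s th] by (simp add: defs t_def sgn_if)
  qed
  have aa: "az s (x, \<theta>) = 1 + y1" using az_eq[OF s] by (simp add: defs t_def)
  have ww: "Wz s (x, \<theta>) = - cs + (v + 2 * sn * y)" using W_at[OF th] by (simp add: defs t_def)
  have wxx: "Wxxz s (x, \<theta>) = - (k2 + 2 * sn * D)"
  proof -
    have "Wxxz s (x, \<theta>) = - FC (\<lambda>n \<theta>. kd n * (kd n * wh0 n \<theta>)) s (x, t)"
      unfolding Wxxz_def t_def by (subst FC_abs(1)[symmetric]) simp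
    also have "FC (\<lambda>n \<theta>. kd n * (kd n * wh0 n \<theta>)) s (x, t) =
      FC (\<lambda>n \<theta>. kd n * (kd n * cf V n \<theta>) + (\<lambda>\<theta>. 2 * sin (2 * \<theta>)) \<theta> * (kd n * (kd n * cf Y n \<theta>))) s (x, t)"
      by (rule FC_cong) (simp add: wh0_def algebra_simps)
    also have "\<dots> = FC (\<lambda>n \<theta>. kd n * (kd n * cf V n \<theta>)) s (x, t) + FC (\<lambda>n \<theta>. (\<lambda>\<theta>. 2 * sin (2 * \<theta>)) \<theta> * (kd n * (kd n * cf Y n \<theta>))) s (x, t)"
      by (rule FC_add[of UNIV, OF _ s UNIV_I]) (intro pbd_rules)+
    also have "\<dots> = k2 + 2 * sn * D"
      by (simp only: FC_mult[OF pbd_kY(2)[OF s, of UNIV] s UNIV_I] snd_conv kV defs)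
    finally show ?thesis .
  qed
  have wtt: "Wttz s (x, \<theta>) = 4 * cs + (3 * k2 - 4 * v + val g s x t - 8 * sn * y + 8 * cs * y1 + 2 * sn * (om2 s * D))"
  proof -
    have "FC (\<lambda>n \<theta>. wh2 n \<bar>\<theta>\<bar>) s (x, \<theta>) = FC (\<lambda>n \<theta>. ((\<lambda>_. 3) \<theta> * (kd n * (kd n * cf V n \<theta>)) + (\<lambda>_. -4) \<theta> * cf V n \<theta>) + (cf g n \<theta> + 
       ((\<lambda>\<theta>. - 8 * sin (2 * \<theta>)) \<theta> * cf Y n \<theta> + ((\<lambda>\<theta>. 8 * cos (2 * \<theta>)) \<theta> * cf Y1 n \<theta> + (\<lambda>\<theta>. 2 * sin (2 * \<theta>)) \<theta> * Ydd n \<theta>)))) s (x, t)"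
      unfolding FC_abs t_def[symmetric] by (rule FC_cong) (simp add: wh2_def Vdd_def algebra_simps power2_eq_square)
    also have "\<dots> = (FC (\<lambda>n \<theta>. (\<lambda>_. 3) \<theta> * (kd n * (kd n * cf V n \<theta>))) s (x, t) + FC (\<lambda>n \<theta>. (\<lambda>_. -4) \<theta> * cf V n \<theta>) s (x, t)) + (FC (cf g) s (x, t) + 
       (FC (\<lambda>n \<theta>. (\<lambda>\<theta>. - 8 * sin (2 * \<theta>)) \<theta> * cf Y n \<theta>) s (x, t) + (FC (\<lambda>n \<theta>. (\<lambda>\<theta>. 8 * cos (2 * \<theta>)) \<theta> * cf Y1 n \<theta>) s (x, t) + FC (\<lambda>n \<theta>. (\<lambda>\<theta>. 2 * sin (2 * \<theta>)) \<theta> * Ydd n \<theta>) s (x, t))))"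
      by (subst FC_add[of UNIV, OF _ s UNIV_I], (intro pbd_rules pbd_w)+)+ (rule refl)
    also have "\<dots> = 3 * k2 + (- 4) * v + (val g s x t + ((- 8 * sn) * y + ((8 * cs) * y1 + (2 * sn) * (om2 s * D))))"
      by (simp only: FC_mult[OF pbd_w(4)[of UNIV] s UNIV_I] FC_mult[OF pbd_cf[of UNIV] s UNIV_I]
         FC_mult[of UNIV "\<lambda>n \<theta>. kd n * (kd n * cf V n \<theta>)", OF pbd_mult[OF pbd_kd pbd_mult[OF pbd_kd pbd_cf]] s UNIV_I] snd_conv kV[unfolded val_def] defs val_def FC_Ydd[OF s])
    finally show ?thesis unfolding Wttz_def snd_conv cos_2_abs[of \<theta>] t_def[symmetric] defs(6)[symmetric] by (simp add: add_ac)
  qed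
  have sw: "swop oneA = oneA" "swop (oneA + N) = oneA + N" "swop (oneA + L) = oneA + L"
    "swop (KY \<star> KY) = KY \<star> KY" "swop (V + W0mul Y) = V + W0mul Y" "swop W0A = W0A"
    by (simp_all add: swl_add swop_consts sym swop_conv sym_KY neg_conv swop_ops)
  have sw2: "swop (Y1 \<star> Y1 - 3 *\<^sub>R ((oneA + L) \<star> (KY \<star> KY))) = Y1 \<star> Y1 - 3 *\<^sub>R ((oneA + L) \<star> (KY \<star> KY))"
    by (simp only: swl_diff swl_scaleR swop_conv[of Y1 Y1] swop_conv[of "oneA + L" "KY \<star> KY"] sw sym)
  have sw3: "swop (oneA + 2 *\<^sub>R Y1 + (Y1 \<star> Y1 - 3 *\<^sub>R ((oneA + L) \<star> (KY \<star> KY)))) = oneA + 2 *\<^sub>R Y1 + (Y1 \<star> Y1 - 3 *\<^sub>R ((oneA + L) \<star> (KY \<star> KY)))"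
    by (subst swl_add, subst swl_add, simp only: sw2 swl_scaleR sym sw)
  have sw4: "swop (W0A + (V + W0mul Y)) = W0A + (V + W0mul Y)" by (subst swl_add, simp only: sw)
  have sw5: "swop ((oneA + N) \<star> ((oneA + 2 *\<^sub>R Y1 + (Y1 \<star> Y1 - 3 *\<^sub>R ((oneA + L) \<star> (KY \<star> KY)))) \<star> (W0A + (V + W0mul Y))))
     = (oneA + N) \<star> ((oneA + 2 *\<^sub>R Y1 + (Y1 \<star> Y1 - 3 *\<^sub>R ((oneA + L) \<star> (KY \<star> KY)))) \<star> (W0A + (V + W0mul Y)))"
    by (simp only: swop_conv sw sw3 sw4)
  have gg: "val g s x t = 3 * (La * k2) - 4 * (Nv * ((v + 2 * sn * y) + 2 * (y1 * (- cs)))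
      + (1 + Nv) * (2 * (y1 * (v + 2 * sn * y)) + (y1 * y1 - 3 * ((1 + La) * (- ky\<^sup>2))) * (- cs + (v + 2 * sn * y)))
      - (3 * \<epsilon>) * (((1 + Nv) * ((1 + 2 * y1 + (y1 * y1 - 3 * ((1 + La) * (- ky\<^sup>2)))) * (- cs + (v + 2 * sn * y))))
         * ((1 + La) * (Tv * Tv)))) - 4 * (Nv * (- cs))"
    apply (subst g_eq)
    apply (simp only: val_diff[OF s] val_add[OF s] val_scaleR[OF s] val_conv[OF sw5 s] val_conv[OF sw3 s] val_conv[OF sw2 s]
       val_conv[OF sw(2) s] val_conv[OF sw(3) s] val_conv[OF sym(3) s] val_conv[OF sym(5) s] val_conv[OF sym(6) s] val_conv[OF sym(7) s]
       val_conv_anti[OF sym_KY s] val_consts val_L val_N val_W0mul[OF s] clt)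
    apply (simp only: defs defs2)
    done
  have om: "om2 s = 3 * (1 + La)" by (simp add: defs2)
  show ?thesis
    unfolding wtt wxx aa bb ww gg t_def[symmetric] om defs2(2,3)[symmetric]
    by (simp add: algebra_simps power2_eq_square)
qed

lemma FC_period: "FC c s (x + 2 * pi, t) = FC c s (x, t)" "FS c s (x + 2 * pi, t) = FS c s (x, t)"
proof -
  have e: "cos (kd n * (x + 2 * pi)) = cos (kd n * x) \<and> sin (kd n * (x + 2 * pi)) = sin (kd n * x)" for n
  proof -
    have k: "kd n * (x + 2 * pi) = kd n * x + 2 * pi * real_of_int (int (fst n) - int (snd n))"
      by (simp add: kd_def algebra_simps)
    show ?thesis unfolding k sin_add cos_add cos_int_2pin sin_int_2pin by simp
  qed
  show "FC c s (x + 2 * pi, t) = FC c s (x, t)" "FS c s (x + 2 * pi, t) = FS c s (x, t)"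
    unfolding FC_def FS_def fst_conv snd_conv e[THEN conjunct1] e[THEN conjunct2] by (rule refl)+
qed

lemma FC_parity: "FC c s (- x, t) = FC c s (x, t)"
  by (simp add: FC_def)

lemma FS_parity: "pbd S c \<Longrightarrow> t \<in> S \<Longrightarrow> FS c s (- x, t) = - FS c s (x, t)"
  using suminf_minus[OF F_summable(2)[OF _ s, of S c "(x, t)"]] by (simp add: FS_def)

theorem strip_solution:
  assumes l: "l > 0" "\<epsilon> = 1 / l\<^sup>2"
  shows "strip_sol (sqrt (om2 s)) (4 * (1 + Nn s) / om2 s) l (Xz s) (Yz s) (az s) (bz s) (bxz s) (btz s)
    (Wz s) (Wxz s) (Wtz s) (Wxxz s) (Wxtz s) (Wttz s)"
proof
  have o: "(sqrt (om2 s))\<^sup>2 = om2 s" using om2_bounds by simp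
  show "sqrt (om2 s) > 0" "(sqrt (om2 s))\<^sup>2 \<le> 4" using om2_bounds by (simp_all only: o real_sqrt_gt_0_iff)
  have "1 + Nn s > 0" using small_vals(4) by linarith
  then show "4 * (1 + Nn s) / om2 s > 0" using om2_bounds by (intro divide_pos_pos) auto
  show "l > 0" by fact
  have cE: "continuous_on II (\<lambda>\<theta>. h \<bar>\<theta>\<bar>)" if "continuous_on {0..pi/2} h" for h :: "real \<Rightarrow> real"
    by (rule continuous_on_compose2[OF that]) (auto intro!: continuous_intros simp: abs_le_iff)
  have cI: "continuous_on II f" if "\<And>\<theta>. \<theta> \<in> II \<Longrightarrow> (f has_real_derivative f' \<theta>) (at \<theta> within II)" for f f'
    by (rule DERIV_continuous_on[OF that])
  have cVdd: "continuous_on {0..pi/2} (Vdd n)" and cYdd: "continuous_on {0..pi/2} (Ydd n)" for n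
    unfolding Vdd_def[abs_def] Ydd_def[abs_def] by (intro continuous_intros)+
  have cw2: "continuous_on {0..pi/2} (wh2 n)" for n
    unfolding wh2_def[abs_def] by (intro continuous_intros cVdd cYdd)
  show "continuous_on strip (bxz s)"
    unfolding bxz_def[abs_def]
    by (intro continuous_intros FC_cont(1)[OF _ s] pbd_mult pbd_kd ext_pbd cI[OF ext_derivs(3)])
  show "continuous_on strip (btz s)"
    unfolding btz_def[abs_def]
    by (intro continuous_intros FC_cont(2)[OF _ s] pbd_mult pbd_kd ext_pbd cI[OF ext_derivs(4)])
  show "continuous_on strip (Wxxz s)"
    unfolding Wxxz_def[abs_def]
    by (intro continuous_intros FC_cont(1)[OF _ s] pbd_mult pbd_kd ext_pbd cI[OF ext_derivs(1)])
  show "continuous_on strip (Wxtz s)"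
    unfolding Wxtz_def[abs_def]
    by (intro continuous_intros FC_cont(2)[OF _ s] pbd_mult pbd_kd ext_pbd cI[OF ext_derivs(2)])
  show "continuous_on strip (Wttz s)"
    unfolding Wttz_def[abs_def]
    by (intro continuous_intros FC_cont(1)[OF _ s] ext_pbd cE cw2)
  fix z assume z: "z \<in> strip"
  obtain x \<theta> where zz: "z = (x, \<theta>)" and th: "\<theta> \<in> II" using z by (cases z) auto
  show "(Xz s has_derivative (\<lambda>h. az s z * fst h + - (sqrt (om2 s))\<^sup>2 * bz s z * snd h)) (at z within strip)"
    unfolding o by (rule d_X[OF s z])
  show "(Yz s has_derivative (\<lambda>h. bz s z * fst h + az s z * snd h)) (at z within strip)" by (rule d_Y[OF s z])
  show "(az s has_derivative (\<lambda>h. btz s z * fst h + - (sqrt (om2 s))\<^sup>2 * bxz s z * snd h)) (at z within strip)"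
    unfolding o by (rule d_a[OF s z])
  show "(bz s has_derivative (\<lambda>h. bxz s z * fst h + btz s z * snd h)) (at z within strip)" by (rule d_b[OF s z])
  show "\<bar>az s z - 1\<bar> \<le> 1/100" unfolding zz az_eq[OF s] using small_vals(1)[of x "\<bar>\<theta>\<bar>"] by simp
  show "\<bar>bz s z\<bar> \<le> 1/100" unfolding zz bz_eq[OF s th] abs_mult using small_vals(2)[of x "\<bar>\<theta>\<bar>"] by (simp add: abs_sgn_eq)
  show "(Wz s has_derivative (\<lambda>h. Wxz s z * fst h + Wtz s z * snd h)) (at z within strip)" by (rule d_W[OF s z])
  show "(Wxz s has_derivative (\<lambda>h. Wxxz s z * fst h + Wxtz s z * snd h)) (at z within strip)" by (rule d_Wx[OF s z])
  show "(Wtz s has_derivative (\<lambda>h. Wxtz s z * fst h + Wttz s z * snd h)) (at z within strip)" by (rule d_Wt[OF s z])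
  show "Wttz s z + (sqrt (om2 s))\<^sup>2 * Wxxz s z + 4 * (1 + Nn s) / om2 s * (sqrt (om2 s))\<^sup>2 * ((az s z)\<^sup>2 + (sqrt (om2 s))\<^sup>2 * (bz s z)\<^sup>2)
      / (cosh (sqrt (om2 s) * Yz s z / l))\<^sup>2 * Wz s z = 0"
  proof -
    have th': "\<bar>\<theta>\<bar> \<in> {0..pi/2}" using th by (auto simp: abs_le_iff)
    have "sqrt (\<epsilon> * om2 s) = sqrt (om2 s) / l" using l by (simp add: real_sqrt_mult real_sqrt_divide)
    then have "cosh (sqrt (om2 s) * Yz s z / l) = cosh (sqrt (\<epsilon> * om2 s) * (\<bar>\<theta>\<bar> + val Y s x \<bar>\<theta>\<bar>))"
      unfolding zz sinh_cosh_step[OF th] using cosh_minus[of "sqrt (om2 s) * (\<bar>\<theta>\<bar> + val Y s x \<bar>\<theta>\<bar>) / l"] val_0[of Y x]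
      by (simp add: sgn_if mult_ac Y_0)
    then have "1 / (cosh (sqrt (om2 s) * Yz s z / l))\<^sup>2 = 1 - \<epsilon> * om2 s * (val T s x \<bar>\<theta>\<bar>)\<^sup>2"
      by (simp only: T_tanh[OF th', of x])
    then have e: "A / (cosh (sqrt (om2 s) * Yz s z / l))\<^sup>2 = A * (1 - \<epsilon> * om2 s * (val T s x \<bar>\<theta>\<bar>)\<^sup>2)" for A
      by (metis mult.commute mult_1 times_divide_eq_left)
    have n: "4 * (1 + Nn s) / om2 s * om2 s = 4 * (1 + Nn s)" using om2_bounds by simp
    show ?thesis unfolding e o n using pde_at[OF th, of x] unfolding zz .
  qed
next
  fix x t :: real
  show "Xz s (x + 2 * pi, t) = Xz s (x, t) + 2 * pi" "Yz s (x + 2 * pi, t) = Yz s (x, t)" "Wz s (x + 2 * pi, t) = Wz s (x, t)"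
    by (simp_all add: Xz_def Yz_def Wz_def FC_period)
  have pA: "pbd UNIV (\<lambda>n \<theta>. cf A n \<bar>\<theta>\<bar>)" for A
    by (rule pbdI[where A="norm A" and p=0]) (simp add: cf_norm)
  have pU: "pbd UNIV xe" "pbd UNIV (\<lambda>n \<theta>. sgn \<theta> * cf Y n \<bar>\<theta>\<bar>)"
    unfolding xe_def[abs_def] by (rule pbd_mult[OF pbd_inv_kd pA] pbd_mult[OF pbd_trig(3) pA])+
  show "Xz s (x, - t) = Xz s (x, t)" by (simp add: Xz_def FS_def xe_def)
  show "Yz s (x, - t) = - Yz s (x, t)"
    using suminf_minus[OF F_summable(1)[OF pU(2) s UNIV_I, of "(x, t)"]] by (simp add: Yz_def FC_def sgn_minus)
  show "Xz s (- x, t) = - Xz s (x, t)" by (simp add: Xz_def FS_parity[OF pU(1) UNIV_I])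
  show "Yz s (- x, t) = Yz s (x, t)" by (simp add: Yz_def FC_parity)
  assume t: "\<bar>t\<bar> = pi/2"
  have z: "wh0 n \<bar>t\<bar> = 0" "wh1 n \<bar>t\<bar> = 0" for n unfolding t by (rule zero_at_end)+
  have "t = pi/2 \<or> t = - (pi/2)" using t by linarith
  then have "2 * t = pi \<or> 2 * t = - pi" by linarith
  then have cs: "cos (2 * t) = -1" "sin (2 * t) = 0"
    using cos_pi sin_pi cos_minus[of pi] sin_minus[of pi] by (metis, metis minus_zero)
  show "Wz s (x, t) = 1" "Wxz s (x, t) = 0" "Wtz s (x, t) = 0"
    unfolding Wz_def Wxz_def Wtz_def FC_def FS_def snd_conv z cs by simp_all
qed

end

end

end

subsection \<open>From the strip to the cylinder\<close>

text \<open>A version valid at boundary points of \<open>S\<close>: the expansion bound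
  \<open>K\<close> takes the place of continuity of the inverse, and no neighbourhood of
  \<open>x\<close> inside \<open>S\<close> is required.\<close>

lemma has_derivative_inverse_lipschitz_within:
  fixes f :: "'a::real_normed_vector \<Rightarrow> 'b::real_normed_vector"
  assumes f: "(f has_derivative f') (at x within S)" and x: "x \<in> S"
    and g': "bounded_linear g'" "\<And>h. g' (f' h) = h"
    and K: "\<And>z. z \<in> S \<Longrightarrow> norm (z - x) \<le> K * norm (f z - f x)"
    and g: "\<And>z. z \<in> S \<Longrightarrow> g (f z) = z"
  shows "(g has_derivative g') (at (f x) within f ` S)"
  unfolding has_derivative_within_alt
proof (intro conjI allI impI g'(1))
  fix e :: real assume e: "e > 0"
  interpret g': bounded_linear g' by fact
  obtain B where B: "B > 0" "\<And>h. norm (g' h) \<le> norm h * B" using g'.pos_bounded by blast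
  define K' where "K' = max K 1"
  have K': "K' > 0" "\<And>z. z \<in> S \<Longrightarrow> norm (z - x) \<le> K' * norm (f z - f x)"
  proof -
    show "K' > 0" by (simp add: K'_def)
    show "norm (z - x) \<le> K' * norm (f z - f x)" if "z \<in> S" for z
      using K[OF that] mult_right_mono[of K K' "norm (f z - f x)"] by (simp add: K'_def)
  qed
  have "e / (B * K') > 0" using e B K' by simp
  then obtain d where d: "d > 0" "\<And>z. z \<in> S \<Longrightarrow> norm (z - x) < d \<Longrightarrow> norm (f z - f x - f' (z - x)) \<le> e / (B * K') * norm (z - x)"
    using f unfolding has_derivative_within_alt by blast
  show "\<exists>d>0. \<forall>y\<in>f ` S. norm (y - f x) < d \<longrightarrow> norm (g y - g (f x) - g' (y - f x)) \<le> e * norm (y - f x)"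
  proof (intro exI[of _ "d / K'"] conjI ballI impI)
    show "d / K' > 0" using d K' by simp
    fix y assume "y \<in> f ` S" and yd: "norm (y - f x) < d / K'"
    then obtain z where z: "z \<in> S" "y = f z" by blast
    have "norm (z - x) \<le> K' * norm (y - f x)" using K'(2)[OF z(1)] z by simp
    also have "\<dots> < d" using yd K'(1) by (simp add: field_simps)
    finally have *: "norm (f z - f x - f' (z - x)) \<le> e / (B * K') * norm (z - x)" by (rule d(2)[OF z(1)])
    have "g y - g (f x) - g' (y - f x) = - g' (f z - f x - f' (z - x))"
      using g[OF z(1)] g[OF x] z by (simp add: g'.diff g'(2))
    then have "norm (g y - g (f x) - g' (y - f x)) \<le> norm (f z - f x - f' (z - x)) * B" using B(2) by simp
    also have "\<dots> \<le> (e / (B * K') * norm (z - x)) * B" using * B by (intro mult_right_mono) auto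
    also have "\<dots> = e / K' * norm (z - x)" using B by simp
    also have "\<dots> \<le> e / K' * (K' * norm (y - f x))" using K'(2)[OF z(1)] z e K' by (intro mult_left_mono) auto
    finally show "norm (g y - g (f x) - g' (y - f x)) \<le> e * norm (y - f x)" using K' by simp
  qed
qed

lemma abs_diff_bound: "\<bar>a - d\<bar> \<le> e \<Longrightarrow> \<bar>d\<bar> \<le> \<bar>a\<bar> + (e::real)" by linarith
lemma tenth_bound: "D \<le> A + 1/10 * (D + T) \<Longrightarrow> 0 \<le> A \<Longrightarrow> 0 \<le> T \<Longrightarrow> D \<le> 2 * A + (T::real)"
  by (simp add: field_simps)

locale planar_sol =
  fixes mu :: real and H :: "real \<Rightarrow> real" and w wx wv wxx wxv wvx wvv :: "real \<times> real \<Rightarrow> real"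
  assumes H_per: "\<And>x. H (x + 2 * pi) = H x" and H_pos: "\<And>x. H x > 0" and H_cont: "continuous_on UNIV H"
    and w_per: "\<And>x v. \<bar>v\<bar> \<le> H x \<Longrightarrow> w (x + 2 * pi, v) = w (x, v) \<and> wx (x + 2 * pi, v) = wx (x, v) \<and> wv (x + 2 * pi, v) = wv (x, v)"
    and dw: "\<And>p. \<bar>snd p\<bar> \<le> H (fst p) \<Longrightarrow> (w has_derivative (\<lambda>h. wx p * fst h + wv p * snd h)) (at p within {p. \<bar>snd p\<bar> \<le> H (fst p)})"
    and cw: "continuous_on {p. \<bar>snd p\<bar> \<le> H (fst p)} wx" "continuous_on {p. \<bar>snd p\<bar> \<le> H (fst p)} wv"
    and dwx: "\<And>p. \<bar>snd p\<bar> < H (fst p) \<Longrightarrow> (wx has_derivative (\<lambda>h. wxx p * fst h + wxv p * snd h)) (at p)"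
    and dwv: "\<And>p. \<bar>snd p\<bar> < H (fst p) \<Longrightarrow> (wv has_derivative (\<lambda>h. wvx p * fst h + wvv p * snd h)) (at p)"
    and cww: "continuous_on {p. \<bar>snd p\<bar> < H (fst p)} wxx" "continuous_on {p. \<bar>snd p\<bar> < H (fst p)} wxv"
      "continuous_on {p. \<bar>snd p\<bar> < H (fst p)} wvx" "continuous_on {p. \<bar>snd p\<bar> < H (fst p)} wvv"
    and pde: "\<And>p. \<bar>snd p\<bar> < H (fst p) \<Longrightarrow> wxx p + wvv p + mu / (cosh (snd p))\<^sup>2 * w p = 0"
    and bc: "\<And>p. \<bar>snd p\<bar> = H (fst p) \<Longrightarrow> w p = 1 \<and> wx p = 0 \<and> wv p = 0"

context strip_sol
begin

definition Phi where "Phi z = (X z, y z)"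

lemma convex_strip: "convex strip" by (intro convex_Times) auto

lemma norm_le_sum: "norm (z :: real \<times> real) \<le> \<bar>fst z\<bar> + \<bar>snd z\<bar>"
  using norm_Pair_le[of "fst z" "snd z"] by simp

lemma comp_le_norm: "\<bar>fst (z :: real \<times> real)\<bar> \<le> norm z" "\<bar>snd (z :: real \<times> real)\<bar> \<le> norm z"
  using norm_fst_le[of "fst z" "snd z"] norm_snd_le[of "snd z" "fst z"] by auto

text \<open>The derivative of \<open>Phi - id\<close> has entries at most \<open>1/100\<close>,
  except for \<open>om^2 b\<close>, which is at most \<open>4/100\<close>; together they give
  \<open>7/100\<close>. All further properties of the map follow from this closeness to the
  identity.\<close>

lemma Phi_lip:
  assumes "z \<in> strip" "z' \<in> strip"
  shows "norm (Phi z - z - (Phi z' - z')) \<le> 1/10 * norm (z - z')"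
proof (rule differentiable_bound[OF convex_strip _ _ assms])
  fix z assume z: "z \<in> strip"
  show "((\<lambda>z. Phi z - z) has_derivative (\<lambda>h. (a z * fst h + (- om\<^sup>2 * b z) * snd h, b z * fst h + a z * snd h) - h)) (at z within strip)"
    unfolding Phi_def[abs_def] by (intro has_derivative_diff has_derivative_Pair dX[OF z] dy[OF z] has_derivative_ident)
  show "onorm (\<lambda>h. (a z * fst h + (- om\<^sup>2 * b z) * snd h, b z * fst h + a z * snd h) - h) \<le> 1/10"
  proof (rule onorm_le)
    fix h :: "real \<times> real"
    have ob: "\<bar>om\<^sup>2 * b z\<bar> \<le> 4 * (1/100)" unfolding abs_mult using om small_b[OF z] by (intro mult_mono) auto
    have "norm ((a z * fst h + (- om\<^sup>2 * b z) * snd h, b z * fst h + a z * snd h) - h)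
      \<le> \<bar>(a z - 1) * fst h - (om\<^sup>2 * b z) * snd h\<bar> + \<bar>b z * fst h + (a z - 1) * snd h\<bar>"
      using norm_le_sum[of "(a z * fst h + (- om\<^sup>2 * b z) * snd h, b z * fst h + a z * snd h) - h"] by (simp add: algebra_simps)
    also have "\<dots> \<le> (\<bar>a z - 1\<bar> * \<bar>fst h\<bar> + \<bar>om\<^sup>2 * b z\<bar> * \<bar>snd h\<bar>) + (\<bar>b z\<bar> * \<bar>fst h\<bar> + \<bar>a z - 1\<bar> * \<bar>snd h\<bar>)"
      by (intro add_mono order_trans[OF abs_triangle_ineq4] order_trans[OF abs_triangle_ineq]) (simp_all add: abs_mult)
    also have "\<dots> \<le> (1/100 * norm h + 4 * (1/100) * norm h) + (1/100 * norm h + 1/100 * norm h)"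
      by (intro add_mono mult_mono small_a[OF z] small_b[OF z] ob comp_le_norm) auto
    also have "\<dots> \<le> 1/10 * norm h" by simp
    finally show "norm ((a z * fst h + (- om\<^sup>2 * b z) * snd h, b z * fst h + a z * snd h) - h) \<le> 1/10 * norm h" .
  qed
qed

lemma Phi_expand:
  assumes "z \<in> strip" "z' \<in> strip"
  shows "norm (z - z') \<le> 2 * norm (Phi z - Phi z')"
proof -
  have "norm (z - z') \<le> norm (Phi z - Phi z') + norm (Phi z - z - (Phi z' - z'))"
    using norm_triangle_ineq4[of "Phi z - Phi z'" "Phi z - z - (Phi z' - z')"] by (simp add: algebra_simps)
  with Phi_lip[OF assms] norm_ge_zero[of "Phi z - Phi z'"] show ?thesis by linarith
qed

lemma Phi_inj: "inj_on Phi strip"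
proof (rule inj_onI)
  fix z z' assume "z \<in> strip" "z' \<in> strip" "Phi z = Phi z'"
  then show "z = z'" using Phi_expand[of z z'] by simp
qed

lemma X_lip:
  assumes "z \<in> strip" "z' \<in> strip"
  shows "\<bar>X z - X z' - (fst z - fst z')\<bar> \<le> 1/10 * (\<bar>fst z - fst z'\<bar> + \<bar>snd z - snd z'\<bar>)"
    and "\<bar>y z - y z' - (snd z - snd z')\<bar> \<le> 1/10 * (\<bar>fst z - fst z'\<bar> + \<bar>snd z - snd z'\<bar>)"
  using Phi_lip[OF assms] comp_le_norm[of "Phi z - z - (Phi z' - z')"] norm_le_sum[of "z - z'"]
  by (simp_all add: Phi_def algebra_simps)

lemma X_cont: "continuous_on strip X" and y_cont: "continuous_on strip y"
  by (rule has_derivative_continuous_on[OF dX], assumption, rule has_derivative_continuous_on[OF dy], assumption)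

lemma fiber:
  assumes "\<theta> \<in> {- (pi/2)..pi/2}"
  shows "\<exists>!\<xi>. X (\<xi>, \<theta>) = x"
proof -
  have c: "continuous_on S (\<lambda>\<xi>. X (\<xi>, \<theta>))" for S
    by (rule continuous_on_compose2[OF X_cont]) (use assms in \<open>auto intro!: continuous_intros\<close>)
  have l: "\<bar>X (\<xi>, \<theta>) - X (\<xi>', \<theta>) - (\<xi> - \<xi>')\<bar> \<le> 1/10 * \<bar>\<xi> - \<xi>'\<bar>" for \<xi> \<xi>'
    using X_lip(1)[of "(\<xi>, \<theta>)" "(\<xi>', \<theta>)"] assms by simp
  \<comment> \<open>Along a level line \<open>X\<close> changes at rate at least
    \<open>9/10\<close>, so this radius overshoots \<open>x\<close> on both sides and the
    intermediate value theorem applies.\<close>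
  define R where "R = 2 * \<bar>x - X (0, \<theta>)\<bar>"
  have R: "R \<ge> 0" "x - X (0, \<theta>) \<le> R / 2" "X (0, \<theta>) - x \<le> R / 2" by (auto simp: R_def)
  have "\<bar>X (- R, \<theta>) - X (0, \<theta>) + R\<bar> \<le> 1/10 * R" "\<bar>X (R, \<theta>) - X (0, \<theta>) - R\<bar> \<le> 1/10 * R"
    using l[of "-R" 0] l[of R 0] R(1) by simp_all
  then have "X (- R, \<theta>) \<le> x" "x \<le> X (R, \<theta>)" using R by (simp_all only: abs_le_iff) linarith+
  then obtain \<xi> where "X (\<xi>, \<theta>) = x"
    using IVT'[of "\<lambda>\<xi>. X (\<xi>, \<theta>)" "-R" x R] c by (auto simp: R_def)
  moreover have "\<xi> = \<xi>'" if "X (\<xi>, \<theta>) = x" "X (\<xi>', \<theta>) = x" for \<xi> \<xi>'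
  proof -
    have "\<bar>\<xi> - \<xi>'\<bar> \<le> 1/10 * \<bar>\<xi> - \<xi>'\<bar>" using l[of \<xi> \<xi>'] that by (simp add: abs_minus_commute)
    then show ?thesis by simp
  qed
  ultimately show ?thesis by blast
qed

definition chi where "chi x \<theta> = (THE \<xi>. X (\<xi>, \<theta>) = x)"

lemma chi: "\<theta> \<in> {- (pi/2)..pi/2} \<Longrightarrow> X (chi x \<theta>, \<theta>) = x"
  unfolding chi_def by (rule theI'[OF fiber])

lemma chi_eq: "\<theta> \<in> {- (pi/2)..pi/2} \<Longrightarrow> X (\<xi>, \<theta>) = x \<Longrightarrow> chi x \<theta> = \<xi>"
  using fiber chi by blast

lemma chi_lip:
  assumes "\<theta> \<in> {- (pi/2)..pi/2}" "\<theta>' \<in> {- (pi/2)..pi/2}"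
  shows "\<bar>chi x \<theta> - chi x' \<theta>'\<bar> \<le> 2 * \<bar>x - x'\<bar> + \<bar>\<theta> - \<theta>'\<bar>"
proof -
  have "\<bar>x - x' - (chi x \<theta> - chi x' \<theta>')\<bar> \<le> 1/10 * (\<bar>chi x \<theta> - chi x' \<theta>'\<bar> + \<bar>\<theta> - \<theta>'\<bar>)"
    using X_lip(1)[of "(chi x \<theta>, \<theta>)" "(chi x' \<theta>', \<theta>')"] assms by (simp add: chi)
  from tenth_bound[OF abs_diff_bound[OF this]] show ?thesis by simp
qed

text \<open>The image of the level line \<theta> is a graph over the first coordinate, and this is
  its height; the edge \<open>pi/2\<close> gives the boundary curve \<open>Hs\<close>.\<close>

definition yf where "yf x \<theta> = y (chi x \<theta>, \<theta>)"
definition Hs where "Hs x = yf x (pi/2)"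

text \<open>At fixed \<open>x\<close>, raising \<theta> by \<open>d\<close> moves \<open>chi\<close>
  by at most \<open>d\<close>; so \<open>y\<close> rises by \<open>d\<close> up to an error of
  \<open>2 d / 10\<close>.\<close>

lemma yf_mono:
  assumes "\<theta> \<in> {- (pi/2)..pi/2}" "\<theta>' \<in> {- (pi/2)..pi/2}" "\<theta> < \<theta>'"
  shows "yf x \<theta> < yf x \<theta>'"
proof -
  have "\<bar>yf x \<theta>' - yf x \<theta> - (\<theta>' - \<theta>)\<bar> \<le> 1/10 * (\<bar>chi x \<theta>' - chi x \<theta>\<bar> + \<bar>\<theta>' - \<theta>\<bar>)"
    using X_lip(2)[of "(chi x \<theta>', \<theta>')" "(chi x \<theta>, \<theta>)"] assms(1,2) by (simp add: yf_def)
  also have "\<dots> \<le> 1/10 * ((\<theta>' - \<theta>) + (\<theta>' - \<theta>))"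
    using chi_lip[OF assms(2,1), of x x] assms(3) by simp
  finally have "\<theta>' - \<theta> - (yf x \<theta>' - yf x \<theta>) \<le> 1/10 * ((\<theta>' - \<theta>) + (\<theta>' - \<theta>))" by linarith
  then have "(\<theta>' - \<theta>) * 8 \<le> (yf x \<theta>' - yf x \<theta>) * 10" by (simp add: field_simps)
  moreover have "0 < (\<theta>' - \<theta>) * 8" using assms(3) by simp
  ultimately have "0 < (yf x \<theta>' - yf x \<theta>) * 10" by (rule less_le_trans[rotated])
  then show ?thesis by simp
qed

lemma yf_cont: "continuous_on (UNIV \<times> {- (pi/2)..pi/2}) (\<lambda>(x, \<theta>). yf x \<theta>)"
proof -
  have "continuous_on (UNIV \<times> {- (pi/2)..pi/2}) (\<lambda>p. chi (fst p) (snd p))"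
  proof (rule lipschitz_on_continuous_on[of 3], rule lipschitz_onI)
    fix p q :: "real \<times> real" assume "p \<in> UNIV \<times> {- (pi/2)..pi/2}" "q \<in> UNIV \<times> {- (pi/2)..pi/2}"
    then have "\<bar>chi (fst p) (snd p) - chi (fst q) (snd q)\<bar> \<le> 2 * \<bar>fst p - fst q\<bar> + \<bar>snd p - snd q\<bar>"
      by (intro chi_lip) auto
    then show "dist (chi (fst p) (snd p)) (chi (fst q) (snd q)) \<le> 3 * dist p q"
      using comp_le_norm[of "p - q"] by (simp add: dist_norm)
  qed simp
  then have "continuous_on (UNIV \<times> {- (pi/2)..pi/2}) (\<lambda>p. y (chi (fst p) (snd p), snd p))"
    by (intro continuous_on_compose2[OF y_cont]) (auto intro!: continuous_intros)
  then show ?thesis by (simp add: yf_def case_prod_beta)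
qed

lemma chi_symm: "chi x (- \<theta>) = chi x \<theta>" "chi (- x) \<theta> = - chi x \<theta>" "chi (x + 2 * pi) \<theta> = chi x \<theta> + 2 * pi"
  if "\<theta> \<in> {- (pi/2)..pi/2}"
  by (rule chi_eq; use that chi[OF that] par per in simp)+

lemma yf_symm: "yf x (- \<theta>) = - yf x \<theta>" "yf (- x) \<theta> = yf x \<theta>" "yf (x + 2 * pi) \<theta> = yf x \<theta>"
  if "\<theta> \<in> {- (pi/2)..pi/2}"
  using that by (simp_all add: yf_def chi_symm par per)

lemma Hs_symm: "Hs (- x) = Hs x" "Hs (x + 2 * pi) = Hs x"
  by (simp_all add: Hs_def yf_symm)

lemma Hs_pos: "Hs x > 0"
proof -
  have "yf x 0 = 0" using yf_symm(1)[of 0 x] by simp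
  then show ?thesis using yf_mono[of 0 "pi/2" x] by (simp add: Hs_def)
qed

lemma Hs_cont: "continuous_on UNIV Hs"
proof -
  have "continuous_on UNIV (\<lambda>x. (\<lambda>(x, \<theta>). yf x \<theta>) (x, pi/2))"
    by (rule continuous_on_compose2[OF yf_cont]) (auto intro!: continuous_intros)
  then show ?thesis by (simp add: Hs_def[abs_def])
qed

lemma y_strip: 
  assumes "z \<in> strip"
  shows "\<bar>y z\<bar> \<le> Hs (X z)" "\<bar>y z\<bar> = Hs (X z) \<longleftrightarrow> \<bar>snd z\<bar> = pi/2"
proof -
  have th: "snd z \<in> {- (pi/2)..pi/2}" using assms by auto
  have yz: "y z = yf (X z) (snd z)" using chi_eq[OF th, of "fst z" "X z"] by (simp add: yf_def)
  have m: "yf (X z) (- (pi/2)) = - Hs (X z)" using yf_symm(1)[of "pi/2" "X z"] by (simp add: Hs_def)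
  consider "snd z = pi/2" | "snd z = - (pi/2)" | "\<bar>snd z\<bar> < pi/2" using th by fastforce
  then have "\<bar>y z\<bar> \<le> Hs (X z) \<and> (\<bar>y z\<bar> = Hs (X z) \<longleftrightarrow> \<bar>snd z\<bar> = pi/2)"
  proof cases
    case 3
    then have "yf (X z) (- (pi/2)) < y z" "y z < yf (X z) (pi/2)" unfolding yz by (auto intro!: yf_mono)
    then show ?thesis using m 3 by (auto simp: Hs_def)
  next
    case 1
    then have "y z = Hs (X z)" using yz by (simp only: Hs_def)
    then show ?thesis using Hs_pos[of "X z"] by (simp add: 1)
  next
    case 2
    then have "y z = - Hs (X z)" using yz m by (simp only:)
    then show ?thesis using Hs_pos[of "X z"] by (simp add: 2)
  qed
  then show "\<bar>y z\<bar> \<le> Hs (X z)" "\<bar>y z\<bar> = Hs (X z) \<longleftrightarrow> \<bar>snd z\<bar> = pi/2" by auto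
qed

text \<open>For fixed \<open>x\<close> the height \<open>yf x\<close> runs continuously from
  \<open>- Hs x\<close> to \<open>Hs x\<close>, so every point between the boundary curves is
  attained.\<close>

lemma Phi_image: "Phi ` strip = {p. \<bar>snd p\<bar> \<le> Hs (fst p)}"
proof (intro set_eqI iffI)
  fix p assume "p \<in> Phi ` strip"
  then show "p \<in> {p. \<bar>snd p\<bar> \<le> Hs (fst p)}" using y_strip(1) by (auto simp: Phi_def)
next
  fix p assume "p \<in> {p. \<bar>snd p\<bar> \<le> Hs (fst p)}"
  then obtain x v where p: "p = (x, v)" "\<bar>v\<bar> \<le> Hs x" by (cases p) auto
  have "continuous_on {- (pi/2)..pi/2} (\<lambda>\<theta>. (\<lambda>(x, \<theta>). yf x \<theta>) (x, \<theta>))"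
    by (rule continuous_on_compose2[OF yf_cont]) (auto intro!: continuous_intros)
  moreover have "yf x (- (pi/2)) \<le> v" "v \<le> yf x (pi/2)"
    using p(2) yf_symm(1)[of "pi/2" x] by (auto simp: Hs_def)
  ultimately obtain \<theta> where th: "\<theta> \<in> {- (pi/2)..pi/2}" "yf x \<theta> = v"
    using IVT'[of "yf x" "- (pi/2)" v "pi/2"] by auto
  then have "Phi (chi x \<theta>, \<theta>) = p" by (simp add: Phi_def chi p yf_def)
  then show "p \<in> Phi ` strip" using th by (metis SigmaI UNIV_I imageI)
qed

definition zeta where "zeta = inv_into strip Phi"

lemma zeta: "\<bar>snd p\<bar> \<le> Hs (fst p) \<Longrightarrow> zeta p \<in> strip \<and> Phi (zeta p) = p"
  unfolding zeta_def using Phi_image inv_into_into[of p Phi strip] f_inv_into_f[of p Phi strip] by auto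

lemma zeta_Phi: "z \<in> strip \<Longrightarrow> zeta (Phi z) = z"
  unfolding zeta_def using Phi_inj by simp

text \<open>The conformal factor, and at the same time the Jacobian determinant of
  \<open>Phi\<close>; it is the denominator of all transformed derivatives.\<close>

definition PP where "PP z = (a z)\<^sup>2 + om\<^sup>2 * (b z)\<^sup>2"

lemma PP_pos: "z \<in> strip \<Longrightarrow> PP z > 0"
proof -
  assume "z \<in> strip"
  then have "a z \<noteq> 0" using small_a[of z] by auto
  then show ?thesis unfolding PP_def by (intro add_pos_nonneg) auto
qed

lemma zeta_deriv:
  assumes "\<bar>snd p\<bar> \<le> Hs (fst p)"
  defines "z \<equiv> zeta p"
  shows "(zeta has_derivative (\<lambda>h. ((a z * fst h + om\<^sup>2 * b z * snd h) / PP z, (- b z * fst h + a z * snd h) / PP z)))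
    (at p within {p. \<bar>snd p\<bar> \<le> Hs (fst p)})"
proof -
  have z: "z \<in> strip" "Phi z = p" using zeta[OF assms(1)] by (auto simp: z_def)
  have "(Phi has_derivative (\<lambda>h. (a z * fst h + (- om\<^sup>2 * b z) * snd h, b z * fst h + a z * snd h))) (at z within strip)"
    unfolding Phi_def[abs_def] by (intro has_derivative_Pair dX[OF z(1)] dy[OF z(1)])
  then have "(zeta has_derivative (\<lambda>h. ((a z * fst h + om\<^sup>2 * b z * snd h) / PP z, (- b z * fst h + a z * snd h) / PP z))) (at (Phi z) within Phi ` strip)"
  proof (rule has_derivative_inverse_lipschitz_within[OF _ z(1), where K=2 and g=zeta and f'="\<lambda>h. (a z * fst h + (- om\<^sup>2 * b z) * snd h, b z * fst h + a z * snd h)"])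
    show "bounded_linear (\<lambda>h. ((a z * fst h + om\<^sup>2 * b z * snd h) / PP z, (- b z * fst h + a z * snd h) / PP z))"
      by (intro bounded_linear_Pair bounded_linear_compose[OF bounded_linear_divide] bounded_linear_add bounded_linear_const_mult bounded_linear_fst bounded_linear_snd)
    fix h :: "real \<times> real"
    let ?h' = "(a z * fst h + (- om\<^sup>2 * b z) * snd h, b z * fst h + a z * snd h)"
    show "((a z * fst ?h' + om\<^sup>2 * b z * snd ?h') / PP z, (- b z * fst ?h' + a z * snd ?h') / PP z) = h"
    proof -
      have "a z * fst ?h' + om\<^sup>2 * b z * snd ?h' = PP z * fst h" "- b z * fst ?h' + a z * snd ?h' = PP z * snd h"
        by (simp_all add: PP_def algebra_simps power2_eq_square)
      then show ?thesis using PP_pos[OF z(1)] by (simp add: prod_eq_iff)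
    qed
    show "norm (z' - z) \<le> 2 * norm (Phi z' - Phi z)" if "z' \<in> strip" for z' by (rule Phi_expand[OF that z(1)])
    show "zeta (Phi z') = z'" if "z' \<in> strip" for z' by (rule zeta_Phi[OF that])
  qed
  then show ?thesis unfolding z(2) Phi_image .
qed

end

section \<open>The equation under the conformal change of variables\<close>

context strip_sol
begin

text \<open>Given the strip partials of a function, \<open>gx\<close> and \<open>gv\<close> are its
  partials in the cylinder coordinates divided by \<open>l\<close>; the powers of \<open>om\<close>
  come from \<open>v = om y / l\<close>.\<close>

definition gx where "gx Fx Ft z = (a z * Fx z - b z * Ft z) / PP z"
definition gv where "gv Fx Ft z = (om * b z * Fx z + a z * Ft z / om) / PP z"

definition "PPx z = 2 * a z * bt z + 2 * om\<^sup>2 * (b z * bx z)"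
definition "PPt z = - 2 * om\<^sup>2 * (a z * bx z) + 2 * om\<^sup>2 * (b z * bt z)"

text \<open>\<open>px\<close>, \<open>pt\<close> and \<open>qx\<close>, \<open>qt\<close> are the
  strip partials of the two transformed first derivatives. Feeding them into \<open>gx\<close> and
  \<open>gv\<close> again yields the second derivatives on the cylinder.\<close>

definition "px z = (bt z * Wx z + a z * Wxx z - bx z * Wt z - b z * Wxt z - gx Wx Wt z * PPx z) / PP z"
definition "pt z = (- om\<^sup>2 * bx z * Wx z + a z * Wxt z - bt z * Wt z - b z * Wtt z - gx Wx Wt z * PPt z) / PP z"
definition "qx z = (om * bx z * Wx z + om * b z * Wxx z + bt z * Wt z / om + a z * Wxt z / om - gv Wx Wt z * PPx z) / PP z"
definition "qt z = (om * bt z * Wx z + om * b z * Wxt z - om * bx z * Wt z + a z * Wtt z / om - gv Wx Wt z * PPt z) / PP z"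

lemma has_derivative_quotient:
  fixes N D :: "real \<times> real \<Rightarrow> real"
  assumes "(N has_derivative N') (at z within S)" "(D has_derivative D') (at z within S)" "D z \<noteq> 0"
  shows "((\<lambda>z. N z / D z) has_derivative (\<lambda>h. (N' h - N z / D z * D' h) / D z)) (at z within S)"
  by (rule has_derivative_eq_rhs[OF has_derivative_divide'[OF assms]]) (use assms(3) in \<open>auto simp: field_simps\<close>)

lemma has_derivative_divide_const: "(F has_derivative F') (at z within S) \<Longrightarrow> ((\<lambda>z. F z / c :: real) has_derivative (\<lambda>h. F' h / c)) (at z within S)" for c :: real
  unfolding divide_inverse by (rule has_derivative_mult_left)

lemma dPP: "z \<in> strip \<Longrightarrow> (PP has_derivative (\<lambda>h. PPx z * fst h + PPt z * snd h)) (at z within strip)"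
proof -
  assume z: "z \<in> strip"
  have "((\<lambda>z. a z * a z + om\<^sup>2 * (b z * b z)) has_derivative (\<lambda>h. PPx z * fst h + PPt z * snd h)) (at z within strip)"
    by (rule has_derivative_eq_rhs[OF has_derivative_add[OF has_derivative_mult[OF da[OF z] da[OF z]]
        has_derivative_mult_right[OF has_derivative_mult[OF db[OF z] db[OF z]]]]])
      (auto simp: PPx_def PPt_def algebra_simps)
  then show ?thesis by (simp add: PP_def[abs_def] power2_eq_square)
qed

lemma dp: assumes z: "z \<in> strip"
  shows "(gx Wx Wt has_derivative (\<lambda>h. px z * fst h + pt z * snd h)) (at z within strip)"
  unfolding gx_def[abs_def]
  by (rule has_derivative_eq_rhs[OF has_derivative_quotient[OF has_derivative_diff[OF has_derivative_mult[OF da[OF z] dWx[OF z]]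
        has_derivative_mult[OF db[OF z] dWt[OF z]]] dPP[OF z]]])
    (use PP_pos[OF z] in \<open>auto simp: px_def pt_def gx_def add_divide_distrib diff_divide_distrib algebra_simps\<close>)

lemma dq: assumes z: "z \<in> strip"
  shows "(gv Wx Wt has_derivative (\<lambda>h. qx z * fst h + qt z * snd h)) (at z within strip)"
  unfolding gv_def[abs_def] mult.assoc times_divide_eq_right[symmetric]
  by (rule has_derivative_eq_rhs[OF has_derivative_quotient[OF has_derivative_add[OF 
        has_derivative_mult[OF has_derivative_const has_derivative_mult[OF db[OF z] dWx[OF z]]]
        has_derivative_mult[OF da[OF z] has_derivative_divide_const[OF dWt[OF z]]] ] dPP[OF z]]])
    (use PP_pos[OF z] om(1) in \<open>auto simp: qx_def qt_def gv_def add_divide_distrib diff_divide_distrib algebra_simps power2_eq_square\<close>)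

text \<open>Conformal covariance of the Laplacian. Solving for \<open>Wx\<close> and
  \<open>Wt\<close> in terms of the transformed derivatives \<open>p\<close>, \<open>q\<close> turns
  the claim into a polynomial identity in which the derivatives of \<open>PP\<close> cancel.\<close>

lemma divergence_id:
  assumes z: "z \<in> strip"
  shows "gx px pt z + gv qx qt z = (Wtt z + om\<^sup>2 * Wxx z) / (om\<^sup>2 * PP z)"
proof -
  have P: "PP z \<noteq> 0" "om \<noteq> 0" using PP_pos[OF z] om by auto
  define p q where "p = gx Wx Wt z" and "q = gv Wx Wt z"
  have pq: "Wx z = a z * p + om * b z * q" "Wt z = om * a z * q - om\<^sup>2 * b z * p"
  proof -
    have *: "PP z * p = a z * Wx z - b z * Wt z" "om * PP z * q = om\<^sup>2 * b z * Wx z + a z * Wt z"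
      using P by (simp_all add: p_def q_def gx_def gv_def field_simps power2_eq_square)
    have "PP z * Wx z = PP z * (a z * p + om * b z * q)"
    proof -
      have "PP z * (a z * p + om * b z * q) = a z * (PP z * p) + b z * (om * PP z * q)" by (simp add: algebra_simps)
      also have "\<dots> = PP z * Wx z" unfolding * by (simp add: PP_def algebra_simps power2_eq_square)
      finally show ?thesis by (rule sym)
    qed
    then show "Wx z = a z * p + om * b z * q" using P(1) by (simp only: mult_cancel_left simp_thms)
    have "PP z * (om * a z * q - om\<^sup>2 * b z * p) = a z * (om * PP z * q) - om\<^sup>2 * b z * (PP z * p)" by (simp add: algebra_simps)
    also have "\<dots> = PP z * Wt z" unfolding * by (simp add: PP_def algebra_simps power2_eq_square)
    finally show "Wt z = om * a z * q - om\<^sup>2 * b z * p" using P(1) by (simp only: mult_cancel_left simp_thms)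
  qed
  have 1: "px z * PP z = bt z * Wx z + a z * Wxx z - bx z * Wt z - b z * Wxt z - p * PPx z"
    "pt z * PP z = - om\<^sup>2 * bx z * Wx z + a z * Wxt z - bt z * Wt z - b z * Wtt z - p * PPt z"
    using P by (simp_all add: px_def pt_def p_def)
  have 2: "om * qx z * PP z = om\<^sup>2 * bx z * Wx z + om\<^sup>2 * b z * Wxx z + bt z * Wt z + a z * Wxt z - om * q * PPx z"
    "om * qt z * PP z = om\<^sup>2 * bt z * Wx z + om\<^sup>2 * b z * Wxt z - om\<^sup>2 * bx z * Wt z + a z * Wtt z - om * q * PPt z"
    using P by (simp_all add: qx_def qt_def q_def field_simps power2_eq_square)
  have "om\<^sup>2 * PP z * PP z * (gx px pt z + gv qx qt z)
    = om\<^sup>2 * a z * (px z * PP z) - om\<^sup>2 * b z * (pt z * PP z) + om\<^sup>2 * b z * (om * qx z * PP z) + a z * (om * qt z * PP z)"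
    using P by (simp add: gx_def gv_def field_simps power2_eq_square)
  also have "\<dots> = PP z * (Wtt z + om\<^sup>2 * Wxx z)"
    unfolding 1 2 pq by (simp add: PPx_def PPt_def PP_def algebra_simps power2_eq_square)
  finally have "PP z * (om\<^sup>2 * PP z * (gx px pt z + gv qx qt z)) = PP z * (Wtt z + om\<^sup>2 * Wxx z)" by (simp only: mult_ac)
  then have "om\<^sup>2 * PP z * (gx px pt z + gv qx qt z) = Wtt z + om\<^sup>2 * Wxx z" using P(1) by (simp only: mult_cancel_left simp_thms)
  then show ?thesis using P by (simp add: eq_divide_eq mult.commute)
qed

text \<open>The conformal partner of \<open>X\<close> is \<open>om y\<close>; dividing both by
  \<open>l\<close> gives the unscaled cylinder coordinates, and \<open>sc\<close> is the way
  back.\<close>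

definition "sc p = (l * fst p, l * snd p / om)"
definition "Zp p = zeta (sc p)"
definition "Hp x = om * Hs (l * x) / l"
abbreviation "RR \<equiv> {p. \<bar>snd p\<bar> \<le> Hp (fst p)}"

lemma sc_region: "\<bar>snd (sc p)\<bar> \<le> Hs (fst (sc p)) \<longleftrightarrow> \<bar>snd p\<bar> \<le> Hp (fst p)"
  "\<bar>snd (sc p)\<bar> = Hs (fst (sc p)) \<longleftrightarrow> \<bar>snd p\<bar> = Hp (fst p)"
  using om l_pos by (auto simp: sc_def Hp_def field_simps abs_mult)

lemma Zp: "\<bar>snd p\<bar> \<le> Hp (fst p) \<Longrightarrow> Zp p \<in> strip \<and> Phi (Zp p) = sc p"
  unfolding Zp_def using zeta sc_region by blast


lemma Zp_deriv:
  assumes p: "p \<in> RR"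
  shows "(Zp has_derivative (\<lambda>h. (l * (a (Zp p) * fst h + om * b (Zp p) * snd h) / PP (Zp p), l * (- b (Zp p) * fst h + a (Zp p) * snd h / om) / PP (Zp p)))) (at p within RR)"
proof -
  have s: "(sc has_derivative sc) (at p within RR)"
    by (rule bounded_linear_imp_has_derivative) (auto simp: sc_def[abs_def] intro!: bounded_linear_Pair bounded_linear_compose[OF bounded_linear_divide] bounded_linear_const_mult bounded_linear_fst bounded_linear_snd)
  have "(zeta has_derivative (\<lambda>h. ((a (Zp p) * fst h + om\<^sup>2 * b (Zp p) * snd h) / PP (Zp p), (- b (Zp p) * fst h + a (Zp p) * snd h) / PP (Zp p))))
    (at (sc p) within sc ` RR)"
    unfolding Zp_def by (rule has_derivative_subset[OF zeta_deriv]) (use p sc_region in auto)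
  from has_derivative_in_compose[OF s this] show ?thesis
    unfolding Zp_def[abs_def, symmetric] 
    by (rule has_derivative_eq_rhs) (use om l_pos in \<open>auto simp: sc_def field_simps power2_eq_square\<close>)
qed

lemma Zp_cont: "continuous_on RR Zp"
  by (rule has_derivative_continuous_on[OF Zp_deriv])

lemma chain:
  assumes F: "\<And>z. z \<in> strip \<Longrightarrow> (F has_derivative (\<lambda>h. Fx z * fst h + Ft z * snd h)) (at z within strip)"
    and p: "p \<in> RR"
  shows "((\<lambda>p. F (Zp p)) has_derivative (\<lambda>h. l * gx Fx Ft (Zp p) * fst h + l * gv Fx Ft (Zp p) * snd h)) (at p within RR)"
proof -
  have z: "Zp p \<in> strip" using Zp[of p] p by simp
  have "(F has_derivative (\<lambda>h. Fx (Zp p) * fst h + Ft (Zp p) * snd h)) (at (Zp p) within Zp ` RR)"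
    by (rule has_derivative_subset[OF F[OF z]]) (use Zp in \<open>force simp: image_subset_iff\<close>)
  from has_derivative_in_compose[OF Zp_deriv[OF p] this] show ?thesis
    by (rule has_derivative_eq_rhs) (use PP_pos[OF z] om in \<open>auto simp: gx_def gv_def field_simps\<close>)
qed

lemma conts: "continuous_on strip a" "continuous_on strip b" "continuous_on strip Wx" "continuous_on strip Wt"
  by (rule has_derivative_continuous_on, erule da db dWx dWt)+

lemma continuous_on_PP_divide: "continuous_on strip F \<Longrightarrow> continuous_on strip (\<lambda>z. F z / PP z)"
proof -
  assume F: "continuous_on strip F"
  have "continuous_on strip PP" unfolding PP_def[abs_def]
    by (intro continuous_on_add continuous_on_mult continuous_on_power continuous_on_const conts)
  moreover have "\<forall>z\<in>strip. PP z \<noteq> 0" using PP_pos by (metis less_irrefl)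
  ultimately show ?thesis by (rule continuous_on_divide[OF F])
qed

lemma continuous_on_divide_const: "continuous_on strip F \<Longrightarrow> continuous_on strip (\<lambda>z. F z / om)"
  unfolding divide_inverse by (intro continuous_on_mult continuous_on_const)

lemmas strip_cont = continuous_on_PP_divide continuous_on_divide_const continuous_on_add continuous_on_diff continuous_on_mult continuous_on_const
  continuous_on_minus conts

lemma g_cont: assumes "continuous_on strip Fx" "continuous_on strip Ft"
  shows "continuous_on strip (gx Fx Ft)" "continuous_on strip (gv Fx Ft)"
  unfolding gx_def[abs_def] gv_def[abs_def] by (intro strip_cont assms)+

lemma pq_cont: "continuous_on strip px" "continuous_on strip pt" "continuous_on strip qx" "continuous_on strip qt"
proof -
  have d: "continuous_on strip PPx" "continuous_on strip PPt"
    unfolding PPx_def[abs_def] PPt_def[abs_def] by (intro strip_cont cb)+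
  note g = g_cont[OF conts(3,4)]
  show "continuous_on strip px" "continuous_on strip pt" "continuous_on strip qx" "continuous_on strip qt"
    unfolding px_def[abs_def] pt_def[abs_def] qx_def[abs_def] qt_def[abs_def]
    by (intro strip_cont d g cb cW)+
qed

lemma Zp_comp_cont: "continuous_on strip F \<Longrightarrow> continuous_on RR (\<lambda>p. F (Zp p))"
  by (rule continuous_on_compose2[OF _ Zp_cont]) (use Zp in \<open>force simp: image_subset_iff\<close>)+

lemma Hp_cont: "continuous_on UNIV Hp"
  unfolding Hp_def[abs_def] by (intro continuous_intros continuous_on_compose2[OF Hs_cont]) (use l_pos in auto)

lemma per_nat: 
  assumes "\<And>x. f (x + 2 * pi) = (f x :: real)"
  shows "f (x + real n * (2 * pi)) = f x"
proof (induction n)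
  case (Suc n)
  have "x + real (Suc n) * (2 * pi) = (x + real n * (2 * pi)) + 2 * pi" by (simp add: algebra_simps)
  then show ?case using assms Suc by (simp only:)
qed simp

lemma interior_RR: "{p. \<bar>snd p\<bar> < Hp (fst p)} \<subseteq> interior RR"
proof (rule interior_maximal)
  have "continuous_on UNIV (\<lambda>p::real\<times>real. Hp (fst p))" by (intro continuous_on_compose2[OF Hp_cont]) (auto intro!: continuous_intros)
  then show "open {p. \<bar>snd p\<bar> < Hp (fst p)}" by (intro open_Collect_less continuous_intros)
qed auto

lemma at_interior: "\<bar>snd p\<bar> < Hp (fst p) \<Longrightarrow> at p within RR = at p"
  using interior_RR by (intro at_within_interior) auto

lemma X_per_nat: "X (x + real n * (2 * pi), t) = X (x, t) + real n * (2 * pi)"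
proof (induction n)
  case (Suc n)
  have "x + real (Suc n) * (2 * pi) = (x + real n * (2 * pi)) + 2 * pi" by (simp add: algebra_simps)
  then show ?case unfolding \<open>x + real (Suc n) * (2 * pi) = _\<close> per(1) Suc by (simp add: algebra_simps)
qed simp

text \<open>One turn in longitude is \<open>l\<close> periods of the strip, which is where
  \<open>l\<close> has to be a natural number.\<close>

lemma Zp_per:
  assumes n: "l = real n" and v: "\<bar>v\<bar> \<le> Hp x"
  shows "Zp (x + 2 * pi, v) = Zp (x, v) + (real n * (2 * pi), 0)"
proof -
  have Z: "Zp (x, v) \<in> strip" "Phi (Zp (x, v)) = sc (x, v)" using Zp[of "(x, v)"] v by auto
  obtain \<xi> \<theta> where zt: "Zp (x, v) = (\<xi>, \<theta>)" by fastforce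
  have "Phi (\<xi> + real n * (2 * pi), \<theta>) = sc (x + 2 * pi, v)"
    using Z(2) per_nat[of "\<lambda>x. y (x, \<theta>)", OF per(2), of \<xi> n]
    by (simp add: zt Phi_def sc_def X_per_nat) (simp add: n algebra_simps)
  moreover have "(\<xi> + real n * (2 * pi), \<theta>) \<in> strip" using Z(1) by (simp add: zt)
  ultimately have "zeta (sc (x + 2 * pi, v)) = (\<xi> + real n * (2 * pi), \<theta>)" using zeta_Phi by metis
  then show ?thesis using zt by (simp add: Zp_def)
qed

theorem planar:
  assumes n: "l = real n"
  shows "planar_sol (l\<^sup>2 * m) Hp (\<lambda>p. W (Zp p)) (\<lambda>p. l * gx Wx Wt (Zp p)) (\<lambda>p. l * gv Wx Wt (Zp p))
    (\<lambda>p. l * (l * gx px pt (Zp p))) (\<lambda>p. l * (l * gv px pt (Zp p))) (\<lambda>p. l * (l * gx qx qt (Zp p))) (\<lambda>p. l * (l * gv qx qt (Zp p)))"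
proof
  have lp: "l * (x + 2 * pi) = l * x + real n * (2 * pi)" for x by (simp add: n algebra_simps)
  show Hp_per: "Hp (x + 2 * pi) = Hp x" for x unfolding Hp_def lp by (simp add: per_nat[of Hs, OF Hs_symm(2)])
  show "Hp x > 0" for x unfolding Hp_def using Hs_pos l_pos om by simp
  show "continuous_on UNIV Hp" by (rule Hp_cont)
  show "((\<lambda>p. W (Zp p)) has_derivative (\<lambda>h. l * gx Wx Wt (Zp p) * fst h + l * gv Wx Wt (Zp p) * snd h)) (at p within RR)" if "\<bar>snd p\<bar> \<le> Hp (fst p)" for p
    by (rule chain[OF dW]) (use that in auto)
  show bcs: "W (Zp p) = 1 \<and> l * gx Wx Wt (Zp p) = 0 \<and> l * gv Wx Wt (Zp p) = 0" if "\<bar>snd p\<bar> = Hp (fst p)" for p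
  proof -
    have Z: "Zp p \<in> strip" "Phi (Zp p) = sc p" using Zp[of p] that by auto
    have "\<bar>y (Zp p)\<bar> = Hs (X (Zp p))" using that Z(2) sc_region(2)[of p] by (simp add: Phi_def prod_eq_iff)
    then have "\<bar>snd (Zp p)\<bar> = pi/2" using y_strip(2)[OF Z(1)] by blast
    then show ?thesis using bc[of "snd (Zp p)" "fst (Zp p)"] by (simp add: gx_def gv_def)
  qed
  have dd: "((\<lambda>p. l * F (Zp p)) has_derivative (\<lambda>h. l * (l * gx Fx Ft (Zp p)) * fst h + l * (l * gv Fx Ft (Zp p)) * snd h)) (at p)"
    if "\<bar>snd p\<bar> < Hp (fst p)" and F: "\<And>z. z \<in> strip \<Longrightarrow> (F has_derivative (\<lambda>h. Fx z * fst h + Ft z * snd h)) (at z within strip)" for p F Fx Ft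
    unfolding at_interior[OF that(1), symmetric]
    by (rule has_derivative_eq_rhs[OF has_derivative_mult_right[OF chain[OF F]]]) (use that(1) in \<open>auto simp: algebra_simps\<close>)
  show "((\<lambda>p. l * gx Wx Wt (Zp p)) has_derivative (\<lambda>h. l * (l * gx px pt (Zp p)) * fst h + l * (l * gv px pt (Zp p)) * snd h)) (at p)"
    "((\<lambda>p. l * gv Wx Wt (Zp p)) has_derivative (\<lambda>h. l * (l * gx qx qt (Zp p)) * fst h + l * (l * gv qx qt (Zp p)) * snd h)) (at p)"
    if "\<bar>snd p\<bar> < Hp (fst p)" for p using dd[OF that dp] dd[OF that dq] by simp_all
  show "continuous_on RR (\<lambda>p. l * gx Wx Wt (Zp p))" "continuous_on RR (\<lambda>p. l * gv Wx Wt (Zp p))"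
    by (intro continuous_intros Zp_comp_cont g_cont conts)+
  have sub: "{p. \<bar>snd p\<bar> < Hp (fst p)} \<subseteq> RR" by auto
  show "continuous_on {p. \<bar>snd p\<bar> < Hp (fst p)} (\<lambda>p. l * (l * gx px pt (Zp p)))" "continuous_on {p. \<bar>snd p\<bar> < Hp (fst p)} (\<lambda>p. l * (l * gv px pt (Zp p)))"
    "continuous_on {p. \<bar>snd p\<bar> < Hp (fst p)} (\<lambda>p. l * (l * gx qx qt (Zp p)))" "continuous_on {p. \<bar>snd p\<bar> < Hp (fst p)} (\<lambda>p. l * (l * gv qx qt (Zp p)))"
    by (intro continuous_intros continuous_on_subset[OF Zp_comp_cont sub] g_cont pq_cont)+
  show "l * (l * gx px pt (Zp p)) + l * (l * gv qx qt (Zp p)) + l\<^sup>2 * m / (cosh (snd p))\<^sup>2 * W (Zp p) = 0" if "\<bar>snd p\<bar> < Hp (fst p)" for p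
  proof -
    have Z: "Zp p \<in> strip" "Phi (Zp p) = sc p" using Zp[of p] that by auto
    have "om * y (Zp p) / l = snd p" using Z(2) om l_pos by (simp add: Phi_def sc_def)
    with pde[OF Z(1)] have *: "Wtt (Zp p) + om\<^sup>2 * Wxx (Zp p) = - m * om\<^sup>2 * PP (Zp p) / (cosh (snd p))\<^sup>2 * W (Zp p)"
      unfolding PP_def by (simp add: eq_neg_iff_add_eq_0)
    have "l * (l * gx px pt (Zp p)) + l * (l * gv qx qt (Zp p)) = l\<^sup>2 * (gx px pt (Zp p) + gv qx qt (Zp p))"
      by (simp add: algebra_simps power2_eq_square)
    also have "\<dots> = l\<^sup>2 * (- m / (cosh (snd p))\<^sup>2 * W (Zp p))" unfolding divergence_id[OF Z(1)] * 
      using PP_pos[OF Z(1)] om by (simp add: field_simps)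
    finally show ?thesis by simp
  qed
  show "W (Zp (x + 2 * pi, v)) = W (Zp (x, v)) \<and> l * gx Wx Wt (Zp (x + 2 * pi, v)) = l * gx Wx Wt (Zp (x, v)) \<and>
    l * gv Wx Wt (Zp (x + 2 * pi, v)) = l * gv Wx Wt (Zp (x, v))" if v: "\<bar>v\<bar> \<le> Hp x" for x v
  proof -
    have Wper: "W (Zp (p + (2 * pi, 0))) = W (Zp p)" if "p \<in> RR" for p
    proof -
      have "Zp (p + (2 * pi, 0)) = Zp p + (real n * (2 * pi), 0)" using Zp_per[OF n, of "snd p" "fst p"] that by (simp add: plus_prod_def)
      then show ?thesis using per_nat[of "\<lambda>x. W (x, snd (Zp p))", OF per(3), of "fst (Zp p)" n] by (simp add: plus_prod_def)
    qed
    show ?thesis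
    \<comment> \<open>On the boundary both derivatives are 0. Inside, periodicity of
      \<open>W\<close> passes to its derivative, because derivatives at interior points are
      unique.\<close>
    proof (cases "\<bar>v\<bar> = Hp x")
      case True
      then show ?thesis using bcs[of "(x, v)"] bcs[of "(x + 2 * pi, v)"] Hp_per[of x] by auto
    next
      case False
      let ?G = "\<lambda>p h. l * gx Wx Wt (Zp p) * fst h + l * gv Wx Wt (Zp p) * snd h"
      have in': "\<bar>v\<bar> < Hp x" using False v by simp
      have d: "((\<lambda>p. W (Zp p)) has_derivative ?G p) (at p)" if "\<bar>snd p\<bar> < Hp (fst p)" for p
        unfolding at_interior[OF that(1), symmetric] by (rule chain[OF dW]) (use that in auto)
      have d1: "((\<lambda>p. W (Zp p)) has_derivative ?G (x, v)) (at (x, v))" by (rule d) (use in' in simp)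
      have d2: "((\<lambda>p. W (Zp (p + (2 * pi, 0)))) has_derivative ?G (x + 2 * pi, v)) (at (x, v))"
      proof -
        have s: "((\<lambda>p. p + (2 * pi, 0 :: real)) has_derivative (\<lambda>h. h)) (at (x, v))" by (auto intro!: derivative_eq_intros)
        have "((\<lambda>p. W (Zp p)) has_derivative ?G (x + 2 * pi, v)) (at ((x, v) + (2 * pi, 0)))"
          using d[of "(x + 2 * pi, v)"] in' Hp_per[of x] by simp
        from has_derivative_compose[OF s this] show ?thesis by simp
      qed
      have "((\<lambda>p. W (Zp p)) has_derivative ?G (x + 2 * pi, v)) (at (x, v))"
        by (rule has_derivative_transform_within_open[OF d2 open_interior[of RR]])
          (use in' interior_RR interior_subset[of RR] Wper in auto)
      from has_derivative_unique[OF d1 this] have eq: "?G (x, v) h = ?G (x + 2 * pi, v) h" for h by metis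
      show ?thesis using eq[of "(1, 0)"] eq[of "(0, 1)"] Wper[of "(x, v)"] v by auto
    qed
  qed
qed

end

subsection \<open>Geographic coordinates on the sphere\<close>

definition rad2 :: "real ^ 3 \<Rightarrow> real" where "rad2 p = (p $ 1)\<^sup>2 + (p $ 2)\<^sup>2"
definition Jr :: "real ^ 3 \<Rightarrow> real ^ 3" where "Jr p = vector [- (p $ 2), p $ 1, 0]"
definition Qr :: "real ^ 3 \<Rightarrow> real ^ 3" where "Qr p = vector [p $ 1, p $ 2, 0]"
text \<open>\<open>Av\<close> and \<open>Bv\<close> are the ambient vectors of the gradients of
  longitude and of \<open>lat\<close> on the sphere. They are tangent, orthogonal and of equal
  length, since the coordinates are isothermal.\<close>

definition Av :: "real ^ 3 \<Rightarrow> real ^ 3" where "Av p = (1 / rad2 p) *\<^sub>R Jr p"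
definition Bv :: "real ^ 3 \<Rightarrow> real ^ 3" where "Bv p = axis 3 1 - (p $ 3 / rad2 p) *\<^sub>R Qr p"

definition emb :: "real \<times> real \<Rightarrow> real ^ 3" where
  "emb z = vector [cos (fst z) / cosh (snd z), sin (fst z) / cosh (snd z), tanh (snd z)]"

text \<open>The isometric (Mercator) latitude: its \<open>tanh\<close> is the height
  \<open>p $ 3\<close> and its Gudermannian is the geographic latitude.\<close>

definition lat :: "real ^ 3 \<Rightarrow> real" where "lat p = arsinh (p $ 3 / sqrt (rad2 p))"
text \<open>Some choice of longitude, with no continuity intended; it is only used inside functions
  of period \<open>2 pi\<close>, which see just its sine and cosine.\<close>

definition lon :: "real ^ 3 \<Rightarrow> real" where "lon p = (SOME x. cos x = p $ 1 / sqrt (rad2 p) \<and> sin x = p $ 2 / sqrt (rad2 p))"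

definition rr :: "real \<Rightarrow> real ^ 3 \<Rightarrow> real" where "rr x0 p = p $ 1 * cos x0 + p $ 2 * sin x0"
definition qq :: "real \<Rightarrow> real ^ 3 \<Rightarrow> real" where "qq x0 p = p $ 2 * cos x0 - p $ 1 * sin x0"
text \<open>A smooth branch of the longitude on the half of the sphere with
  \<open>rr x0 p > 0\<close>. It differs from \<open>lon\<close> by a multiple of
  \<open>2 pi\<close>, so periodic functions do not distinguish the two.\<close>

definition chart :: "real \<Rightarrow> real ^ 3 \<Rightarrow> real \<times> real" where
  "chart x0 p = (x0 + arctan (qq x0 p / rr x0 p), lat p)"

lemma ev3 [simp]: "emb z $ 1 = cos (fst z) / cosh (snd z)" "emb z $ 2 = sin (fst z) / cosh (snd z)" "emb z $ 3 = tanh (snd z)"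
  "Jr p $ 1 = - (p $ 2)" "Jr p $ 2 = p $ 1" "Jr p $ 3 = 0" "Qr p $ 1 = p $ 1" "Qr p $ 2 = p $ 2" "Qr p $ 3 = 0"
  by (simp_all add: emb_def Jr_def Qr_def)

lemma Av_comp [simp]: "Av p $ 1 = - (p $ 2) / rad2 p" "Av p $ 2 = p $ 1 / rad2 p" "Av p $ 3 = 0"
  by (simp_all add: Av_def)

lemma Bv_comp [simp]: "Bv p $ 1 = - (p $ 3) * p $ 1 / rad2 p" "Bv p $ 2 = - (p $ 3) * p $ 2 / rad2 p" "Bv p $ 3 = 1"
  by (simp_all add: Bv_def axis_def)

lemma inner3: "(a :: real ^ 3) \<bullet> b = a $ 1 * b $ 1 + a $ 2 * b $ 2 + a $ 3 * b $ 3"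
  by (simp add: inner_vec_def sum_3)

lemma S2_iff: "p \<in> S2 \<longleftrightarrow> rad2 p + (p $ 3)\<^sup>2 = 1"
  by (simp add: norm_eq_sqrt_inner inner3 rad2_def power2_eq_square)

lemma qq_rr: "(rr x0 p)\<^sup>2 + (qq x0 p)\<^sup>2 = rad2 p"
proof -
  have "(rr x0 p)\<^sup>2 + (qq x0 p)\<^sup>2 = ((p $ 1)\<^sup>2 + (p $ 2)\<^sup>2) * ((cos x0)\<^sup>2 + (sin x0)\<^sup>2)"
    unfolding rr_def qq_def by algebra
  then show ?thesis by (simp add: rad2_def)
qed

lemma rad2_pos: "rr x0 p > 0 \<Longrightarrow> rad2 p > 0"
  using qq_rr[of x0 p] by (metis add_pos_nonneg zero_le_power2 zero_less_power)

lemma cosh_lat: "rad2 p > 0 \<Longrightarrow> p \<in> S2 \<Longrightarrow> cosh (lat p) = 1 / sqrt (rad2 p)"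
proof -
  assume R: "rad2 p > 0" and "p \<in> S2"
  then have *: "rad2 p + (p $ 3)\<^sup>2 = 1" by (simp only: S2_iff)
  have "(cosh (lat p))\<^sup>2 = 1 + (p $ 3 / sqrt (rad2 p))\<^sup>2" by (simp add: cosh_square_eq lat_def)
  also have "\<dots> = (1 / sqrt (rad2 p))\<^sup>2"
  proof -
    have "(p $ 3)\<^sup>2 = 1 - rad2 p" using * by simp
    then show ?thesis using R by (simp add: power_divide diff_divide_distrib)
  qed
  finally show ?thesis by (rule power2_eq_imp_eq) (simp_all add: R less_imp_le)
qed

lemma tanh_lat: "rad2 p > 0 \<Longrightarrow> p \<in> S2 \<Longrightarrow> tanh (lat p) = p $ 3"
  by (simp add: tanh_def cosh_lat) (simp add: lat_def)

lemma lon: "rad2 p > 0 \<Longrightarrow> cos (lon p) = p $ 1 / sqrt (rad2 p) \<and> sin (lon p) = p $ 2 / sqrt (rad2 p)"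
proof -
  assume R: "rad2 p > 0"
  then have "(p $ 1 / sqrt (rad2 p))\<^sup>2 + (p $ 2 / sqrt (rad2 p))\<^sup>2 = 1"
    by (simp add: power_divide add_divide_distrib[symmetric]) (simp add: rad2_def)
  from sincos_total_2pi[OF this] obtain t where "p $ 1 / sqrt (rad2 p) = cos t" "p $ 2 / sqrt (rad2 p) = sin t" by blast
  then show ?thesis unfolding lon_def by (intro someI_ex[where P="\<lambda>x. cos x = p $ 1 / sqrt (rad2 p) \<and> sin x = p $ 2 / sqrt (rad2 p)"]) auto
qed

lemma vec3_eq: "(a :: real ^ 3) = b \<longleftrightarrow> a $ 1 = b $ 1 \<and> a $ 2 = b $ 2 \<and> a $ 3 = b $ 3"
  by (simp add: vec_eq_iff forall_3)

lemma emb_lon_lat: "rad2 p > 0 \<Longrightarrow> p \<in> S2 \<Longrightarrow> emb (lon p, lat p) = p"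
  by (simp only: vec3_eq ev3 fst_conv snd_conv cosh_lat tanh_lat lon) simp

lemma rad2_emb: "rad2 (emb z) = 1 / (cosh (snd z))\<^sup>2"
  by (simp add: rad2_def power_divide add_divide_distrib[symmetric])

lemma emb_S2: "emb z \<in> S2" "rad2 (emb z) > 0"
proof -
  show "rad2 (emb z) > 0" unfolding rad2_emb by simp
  have "(cosh (snd z))\<^sup>2 \<noteq> 0" by simp
  then have "1 / (cosh (snd z))\<^sup>2 + (sinh (snd z) / cosh (snd z))\<^sup>2 = 1"
    by (simp add: power_divide add_divide_distrib[symmetric] cosh_square_eq)
  then show "emb z \<in> S2" unfolding S2_iff rad2_emb by (simp add: tanh_def)
qed

lemma lat_emb: "lat (emb z) = snd z"
  unfolding lat_def rad2_emb by (simp add: real_sqrt_divide tanh_def arsinh_sinh_real)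

lemma chart_trig:
  assumes "rr x0 p > 0"
  shows "cos (fst (chart x0 p)) = p $ 1 / sqrt (rad2 p)" "sin (fst (chart x0 p)) = p $ 2 / sqrt (rad2 p)"
proof -
  have "sqrt (1 + (qq x0 p / rr x0 p)\<^sup>2) = sqrt (rad2 p / (rr x0 p)\<^sup>2)"
    using assms qq_rr[of x0 p] by (simp add: power_divide divide_simps)
  also have "\<dots> = sqrt (rad2 p) / rr x0 p" using assms by (simp add: real_sqrt_divide)
  finally have *: "cos (arctan (qq x0 p / rr x0 p)) = rr x0 p / sqrt (rad2 p)" "sin (arctan (qq x0 p / rr x0 p)) = qq x0 p / sqrt (rad2 p)"
    using assms by (simp_all add: cos_arctan sin_arctan)
  have 1: "cos x0 * rr x0 p - sin x0 * qq x0 p = p $ 1 * ((cos x0)\<^sup>2 + (sin x0)\<^sup>2)"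
    "sin x0 * rr x0 p + cos x0 * qq x0 p = p $ 2 * ((cos x0)\<^sup>2 + (sin x0)\<^sup>2)"
    unfolding rr_def qq_def by algebra+
  show "cos (fst (chart x0 p)) = p $ 1 / sqrt (rad2 p)" "sin (fst (chart x0 p)) = p $ 2 / sqrt (rad2 p)"
    using 1 by (simp_all add: chart_def cos_add sin_add * diff_divide_distrib[symmetric] add_divide_distrib[symmetric])
qed

lemma snd_chart [simp]: "snd (chart x0 p) = lat p" by (simp add: chart_def)

lemma rr_lon: "rad2 p > 0 \<Longrightarrow> rr (lon p) p > 0"
proof -
  assume R: "rad2 p > 0"
  have "rr (lon p) p = ((p $ 1)\<^sup>2 + (p $ 2)\<^sup>2) / sqrt (rad2 p)"
    using lon[OF R] by (simp add: rr_def add_divide_distrib power2_eq_square)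
  also have "\<dots> > 0" using R by (simp add: rad2_def)
  finally show ?thesis .
qed

lemma angle_cong:
  assumes "\<And>x. f (x + 2 * pi) = f x" "cos x = cos x'" "sin x = sin x'"
  shows "f x = f x'"
proof -
  obtain k :: int where k: "x = x' + 2 * pi * k" using assms(2,3) sin_cos_eq_iff[of x x'] by auto
  have n: "f (y + real n * (2 * pi)) = f y" for y n
  proof (induction n)
    case (Suc n)
    have "y + real (Suc n) * (2 * pi) = (y + real n * (2 * pi)) + 2 * pi" by (simp add: algebra_simps)
    then show ?case using Suc assms(1) by (simp only:)
  qed simp
  show ?thesis
  proof (cases "k \<ge> 0")
    case True
    then have "x = x' + real (nat k) * (2 * pi)" using k by (simp add: mult_ac)
    then show ?thesis using n by simp
  next
    case False
    then have "x' = x + real (nat (- k)) * (2 * pi)" using k by (simp add: mult_ac)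
    then show ?thesis using n by simp
  qed
qed

lemma nth_has_derivative [derivative_intros]: "((\<lambda>p::real^3. p $ i) has_derivative (\<lambda>h. h $ i)) F"
  by (rule bounded_linear_imp_has_derivative[OF bounded_linear_vec_nth])

lemma rad2_has_derivative: "(rad2 has_derivative (\<lambda>h. 2 * (Qr p \<bullet> h))) (at p within S)"
  unfolding rad2_def[abs_def] by (auto intro!: derivative_eq_intros simp: inner3)

lemma chart_has_derivative:
  assumes r: "rr x0 p > 0" and p: "p \<in> S2"
  shows "(chart x0 has_derivative (\<lambda>h. (Av p \<bullet> h, Bv p \<bullet> h))) (at p within S)"
proof -
  have R: "rad2 p > 0" by (rule rad2_pos[OF r])
  have S: "rad2 p + (p $ 3)\<^sup>2 = 1" using p by (simp only: S2_iff)
  have rq: "(rr x0 has_derivative rr x0) (at p within S)" "(qq x0 has_derivative qq x0) (at p within S)"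
    unfolding rr_def[abs_def] qq_def[abs_def] by (auto intro!: derivative_eq_intros)
  have d: "((\<lambda>p. qq x0 p / rr x0 p) has_derivative (\<lambda>h. (qq x0 h * rr x0 p - qq x0 p * rr x0 h) / (rr x0 p * rr x0 p))) (at p within S)"
    by (rule has_derivative_divide'[OF rq(2) rq(1)]) (use r in simp)
  have num: "qq x0 h * rr x0 p - qq x0 p * rr x0 h = Jr p \<bullet> h" for h
  proof -
    have "qq x0 h * rr x0 p - qq x0 p * rr x0 h = (Jr p \<bullet> h) * ((cos x0)\<^sup>2 + (sin x0)\<^sup>2)"
      unfolding rr_def qq_def inner3 ev3 by algebra
    then show ?thesis by simp
  qed
  have 1: "((\<lambda>p. arctan (qq x0 p / rr x0 p)) has_derivative (\<lambda>h. Av p \<bullet> h)) (at p within S)"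
  proof (rule has_derivative_eq_rhs[OF DERIV_compose_FDERIV[OF DERIV_arctan d]], rule ext)
    fix h
    have "rr x0 p * rr x0 p * (1 + (qq x0 p / rr x0 p)\<^sup>2) = rad2 p"
      using r qq_rr[of x0 p] by (simp add: power_divide field_simps power2_eq_square)
    then show "(qq x0 h * rr x0 p - qq x0 p * rr x0 h) / (rr x0 p * rr x0 p) * inverse (1 + (qq x0 p / rr x0 p)\<^sup>2) = Av p \<bullet> h"
      unfolding num by (simp add: Av_def divide_inverse flip: inverse_mult_distrib)
  qed
  have s: "((\<lambda>p. sqrt (rad2 p)) has_derivative (\<lambda>h. 2 * (Qr p \<bullet> h) * (inverse (sqrt (rad2 p)) / 2))) (at p within S)"
    by (rule DERIV_compose_FDERIV[OF DERIV_real_sqrt[OF R] rad2_has_derivative])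
  have sR: "sqrt (rad2 p) * sqrt (rad2 p) = rad2 p" "sqrt (rad2 p) > 0" using R by auto
  have d2: "((\<lambda>p. p $ 3 / sqrt (rad2 p)) has_derivative (\<lambda>h. (Bv p \<bullet> h) / sqrt (rad2 p))) (at p within S)"
    by (rule has_derivative_eq_rhs[OF has_derivative_divide'[OF nth_has_derivative s]])
      (use sR in \<open>auto simp: Bv_def inner_diff_left field_simps inner_axis' fun_eq_iff\<close>)
  have "(lat has_derivative (\<lambda>h. (Bv p \<bullet> h) / sqrt (rad2 p) * (1 / sqrt ((p $ 3 / sqrt (rad2 p))\<^sup>2 + 1)))) (at p within S)"
    unfolding lat_def[abs_def] by (rule DERIV_compose_FDERIV[OF arsinh_real_has_field_derivative d2])
  \<comment> \<open>Membership in the sphere enters here; in general this product is the norm of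
    \<open>p\<close>, and the gradient of \<open>lat\<close> would be \<open>Bv\<close> divided by
    it.\<close>
  moreover have "sqrt (rad2 p) * sqrt ((p $ 3 / sqrt (rad2 p))\<^sup>2 + 1) = 1"
    using R S by (simp add: real_sqrt_mult[symmetric] power_divide field_simps)
  ultimately have 2: "(lat has_derivative (\<lambda>h. Bv p \<bullet> h)) (at p within S)"
    by (simp add: divide_divide_eq_left)
  show ?thesis unfolding chart_def[abs_def] 
    by (rule has_derivative_Pair[OF has_derivative_eq_rhs[OF has_derivative_add[OF has_derivative_const 1]] 2]) simp
qed

definition "DAv p v = (1 / rad2 p) *\<^sub>R Jr v - (2 * (Qr p \<bullet> v) / (rad2 p)\<^sup>2) *\<^sub>R Jr p"
definition "DBv p v = (2 * (Qr p \<bullet> v) * p $ 3 / (rad2 p)\<^sup>2) *\<^sub>R Qr p - (v $ 3 / rad2 p) *\<^sub>R Qr p - (p $ 3 / rad2 p) *\<^sub>R Qr v"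

lemma linear_JQ: "bounded_linear Jr" "bounded_linear Qr"
  by (simp_all add: linear_conv_bounded_linear[symmetric] linear_iff vec3_eq)

lemma AB_has_derivative:
  assumes R: "rad2 p > 0"
  shows "(Av has_derivative DAv p) (at p within S)" "(Bv has_derivative DBv p) (at p within S)"
proof -
  have i: "((\<lambda>p. 1 / rad2 p) has_derivative (\<lambda>h. - (2 * (Qr p \<bullet> h) / (rad2 p)\<^sup>2))) (at p within S)"
    by (rule has_derivative_eq_rhs[OF has_derivative_divide'[OF has_derivative_const rad2_has_derivative]])
      (use R in \<open>auto simp: power2_eq_square\<close>)
  show "(Av has_derivative DAv p) (at p within S)" unfolding Av_def[abs_def]
    by (rule has_derivative_eq_rhs[OF has_derivative_scaleR[OF i bounded_linear_imp_has_derivative[OF linear_JQ(1)]]])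
      (auto simp: DAv_def fun_eq_iff)
  have j: "((\<lambda>p. p $ 3 / rad2 p) has_derivative (\<lambda>h. h $ 3 / rad2 p - 2 * (Qr p \<bullet> h) * p $ 3 / (rad2 p)\<^sup>2)) (at p within S)"
    by (rule has_derivative_eq_rhs[OF has_derivative_divide'[OF nth_has_derivative rad2_has_derivative]])
      (use R in \<open>auto simp: power2_eq_square fun_eq_iff field_simps\<close>)
  show "(Bv has_derivative DBv p) (at p within S)" unfolding Bv_def[abs_def]
    by (rule has_derivative_eq_rhs[OF has_derivative_diff[OF has_derivative_const has_derivative_scaleR[OF j bounded_linear_imp_has_derivative[OF linear_JQ(2)]]]])
      (auto simp: DBv_def fun_eq_iff algebra_simps)
qed

lemma AB_inner:
  assumes "rad2 p > 0" "p \<in> S2"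
  shows "Av p \<bullet> Av p = 1 / rad2 p" "Bv p \<bullet> Bv p = 1 / rad2 p" "Av p \<bullet> Bv p = 0" "Av p \<bullet> p = 0" "Bv p \<bullet> p = 0"
proof -
  have S: "rad2 p + (p $ 3)\<^sup>2 = 1" using assms by (simp only: S2_iff)
  show "Av p \<bullet> Av p = 1 / rad2 p" 
  proof -
    have "Av p \<bullet> Av p = ((p $ 1)\<^sup>2 + (p $ 2)\<^sup>2) / (rad2 p * rad2 p)"
      by (simp add: inner3 power2_eq_square add_divide_distrib add.commute)
    then show ?thesis using assms(1) by (simp add: rad2_def[symmetric])
  qed
  have "Bv p \<bullet> Bv p = (p $ 3)\<^sup>2 * ((p $ 1)\<^sup>2 + (p $ 2)\<^sup>2) / (rad2 p * rad2 p) + 1"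
    by (simp add: inner3 power2_eq_square add_divide_distrib algebra_simps)
  also have "\<dots> = 1 / rad2 p" using S assms(1) by (simp add: rad2_def[symmetric] field_simps)
  finally show "Bv p \<bullet> Bv p = 1 / rad2 p" .
  show "Av p \<bullet> Bv p = 0" "Av p \<bullet> p = 0" by (simp_all add: inner3)
  have "Bv p \<bullet> p = p $ 3 - p $ 3 * ((p $ 1)\<^sup>2 + (p $ 2)\<^sup>2) / rad2 p"
    by (simp add: inner3 power2_eq_square add_divide_distrib algebra_simps)
  then show "Bv p \<bullet> p = 0" using assms(1) by (simp add: rad2_def[symmetric])
qed

text \<open>With \<open>P\<close> the tangential projection, the trace of \<open>P D P\<close> is
  that of \<open>D P\<close>, and \<open>P\<close> removes the unit normal \<open>p\<close>, leaving
  the ambient trace minus the normal entry.\<close>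

lemma sphere_divergence_linear:
  assumes "linear D" "p \<in> S2"
  shows "sphere_divergence p D = D (axis 1 1) $ 1 + D (axis 2 1) $ 2 + D (axis 3 1) $ 3 - D p \<bullet> p"
proof -
  interpret linear D by fact
  have n: "p \<bullet> p = 1" using assms(2) by (simp add: norm_eq_sqrt_inner)
  have "p = p $ 1 *\<^sub>R axis 1 1 + p $ 2 *\<^sub>R axis 2 1 + p $ 3 *\<^sub>R axis 3 1" by (simp add: vec3_eq axis_def)
  then have Dp: "D p = p $ 1 *\<^sub>R D (axis 1 1) + p $ 2 *\<^sub>R D (axis 2 1) + p $ 3 *\<^sub>R D (axis 3 1)"
    by (metis add scale)
  have "tangent_proj p (D (tangent_proj p (axis i 1))) $ i
    = D (axis i 1) $ i - p $ i * D p $ i - ((D (axis i 1) \<bullet> p) - p $ i * (D p \<bullet> p)) * p $ i" for i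
    by (simp add: tangent_proj_def diff scale inner_axis' inner_diff_left)
  then have "sphere_divergence p D = (\<Sum>i\<in>UNIV. D (axis i 1) $ i - p $ i * D p $ i - ((D (axis i 1) \<bullet> p) - p $ i * (D p \<bullet> p)) * p $ i)"
    by (simp add: sphere_divergence_def trace_def matrix_def)
  also have "\<dots> = D (axis 1 1) $ 1 + D (axis 2 1) $ 2 + D (axis 3 1) $ 3 - D p \<bullet> p
    - ((p $ 1 *\<^sub>R D (axis 1 1) + p $ 2 *\<^sub>R D (axis 2 1) + p $ 3 *\<^sub>R D (axis 3 1)) \<bullet> p) + (p \<bullet> p) * (D p \<bullet> p)"
    by (simp add: sum_3 inner_add_left inner3 algebra_simps)
  finally show ?thesis by (simp only: Dp[symmetric] n)
qed

lemma has_derivative_local: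
  assumes "(F has_derivative D) (at p within S \<inter> U)" "open U" "p \<in> S" "p \<in> U" "\<And>q. q \<in> S \<inter> U \<Longrightarrow> F q = G q"
  shows "(G has_derivative D) (at p within S)"
proof -
  have "(G has_derivative D) (at p within S \<inter> U)"
    by (rule has_derivative_transform_within[OF assms(1), of 1]) (use assms in auto)
  moreover have "at p within S \<inter> U = at p within S" by (rule at_within_nhd[of p U]) (use assms in auto)
  ultimately show ?thesis by simp
qed

lemma continuous_on_local:
  fixes G :: "'a::metric_space \<Rightarrow> 'b::metric_space"
  assumes "\<And>p. p \<in> S \<Longrightarrow> \<exists>U F. open U \<and> p \<in> U \<and> continuous_on (S \<inter> U) F \<and> (\<forall>q\<in>S \<inter> U. F q = G q)"
  shows "continuous_on S G"
  unfolding continuous_on_eq_continuous_within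
proof
  fix p assume p: "p \<in> S"
  then obtain U F where U: "open U" "p \<in> U" "continuous_on (S \<inter> U) F" "\<forall>q\<in>S \<inter> U. F q = G q" using assms by blast
  have "continuous_on (S \<inter> U) G" using U(3,4) by (metis continuous_on_cong)
  then have "continuous (at p within S \<inter> U) G" using p U by (simp add: continuous_on_eq_continuous_within)
  moreover have "at p within S \<inter> U = at p within S" by (rule at_within_nhd[of p U]) (use U p in auto)
  ultimately show "continuous (at p within S) G" by simp
qed

lemma rr_open: "open {p. rr x0 p > 0}"
  unfolding rr_def by (intro open_Collect_less continuous_intros)

section \<open>Transplanting the solution from the cylinder to the sphere\<close>

context planar_sol
begin

lemma H_cong: "cos x = cos x' \<Longrightarrow> sin x = sin x' \<Longrightarrow> H x = H x'"
  by (rule angle_cong[of H, OF H_per])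

lemma per_cong:
  assumes "\<And>x. R v (H x) \<Longrightarrow> f (x + 2 * pi, v) = (f (x, v) :: real)" "cos x = cos x'" "sin x = sin x'" "R v (H x)"
  shows "f (x, v) = f (x', v)"
proof -
  have "(if R v (H x) then f (x, v) else 0) = (if R v (H x') then f (x', v) else 0)"
    by (rule angle_cong[OF _ assms(2,3)]) (simp add: assms(1) H_per)
  then show ?thesis using assms(4) H_cong[OF assms(2,3)] by simp
qed

lemma emb_image:
  "p \<in> emb ` {z. R (snd z) (H (fst z))} \<longleftrightarrow> p \<in> S2 \<and> rad2 p > 0 \<and> R (lat p) (H (lon p))"
proof
  assume "p \<in> emb ` {z. R (snd z) (H (fst z))}"
  then obtain z where z: "p = emb z" "R (snd z) (H (fst z))" by blast
  have "cosh (snd z) > 0" by simp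
  then have "cos (lon p) = cos (fst z) \<and> sin (lon p) = sin (fst z)"
    using lon[of p] unfolding z(1) rad2_emb by (simp add: emb_S2 real_sqrt_divide)
  then have "H (lon p) = H (fst z)" by (intro H_cong) auto
  then show "p \<in> S2 \<and> rad2 p > 0 \<and> R (lat p) (H (lon p))" using z emb_S2[of z] by (simp add: lat_emb)
next
  assume "p \<in> S2 \<and> rad2 p > 0 \<and> R (lat p) (H (lon p))"
  then show "p \<in> emb ` {z. R (snd z) (H (fst z))}"
    by (intro image_eqI[of _ _ "(lon p, lat p)"]) (auto simp: emb_lon_lat)
qed

definition "Kc = emb ` {z. \<bar>snd z\<bar> \<le> H (fst z)}"
definition "Ko = emb ` {z. \<bar>snd z\<bar> < H (fst z)}"

lemma Kc_iff: "p \<in> Kc \<longleftrightarrow> p \<in> S2 \<and> rad2 p > 0 \<and> \<bar>lat p\<bar> \<le> H (lon p)"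
  unfolding Kc_def by (rule emb_image[where R="\<lambda>v H. \<bar>v\<bar> \<le> H"])

lemma Ko_iff: "p \<in> Ko \<longleftrightarrow> p \<in> S2 \<and> rad2 p > 0 \<and> \<bar>lat p\<bar> < H (lon p)"
  unfolding Ko_def by (rule emb_image[where R="\<lambda>v H. \<bar>v\<bar> < H"])

lemma Ko_Kc: "Ko \<subseteq> Kc" by (auto simp: Ko_iff Kc_iff)

lemma chart_cong: "rr x0 p > 0 \<Longrightarrow> cos (lon p) = cos (fst (chart x0 p)) \<and> sin (lon p) = sin (fst (chart x0 p))"
  using chart_trig[of x0 p] lon[of p] rad2_pos[of x0 p] by simp

lemma H_chart: "rr x0 p > 0 \<Longrightarrow> H (fst (chart x0 p)) = H (lon p)"
  using chart_cong by (intro H_cong) auto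

lemma f_chart:
  assumes "\<And>x v. R v (H x) \<Longrightarrow> f (x + 2 * pi, v) = (f (x, v) :: real)" "rr x0 p > 0" "R (lat p) (H (lon p))"
  shows "f (chart x0 p) = f (lon p, lat p)"
proof -
  have "f (lon p, lat p) = f (fst (chart x0 p), lat p)"
    by (rule per_cong[of R]) (use assms chart_cong in auto)
  then show ?thesis by (simp add: chart_def)
qed

lemma w_chart: "rr x0 p > 0 \<Longrightarrow> p \<in> Kc \<Longrightarrow> w (chart x0 p) = w (lon p, lat p) \<and> wx (chart x0 p) = wx (lon p, lat p) \<and> wv (chart x0 p) = wv (lon p, lat p)"
  using f_chart[where R="\<lambda>v H. \<bar>v\<bar> \<le> H"] w_per by (auto simp: Kc_iff)

definition wsol :: "real ^ 3 \<Rightarrow> real" where "wsol p = w (lon p, lat p)"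
definition Gf :: "real ^ 3 \<Rightarrow> real ^ 3" where "Gf p = wx (lon p, lat p) *\<^sub>R Av p + wv (lon p, lat p) *\<^sub>R Bv p"
text \<open>The product rule for \<open>wx Av + wv Bv\<close> through a chart. The coordinate
  \<open>u\<close> is a separate argument, so that the same formula can be read at a smooth chart
  value or at \<open>(lon p, lat p)\<close>.\<close>

definition Gl :: "real ^ 3 \<Rightarrow> real \<times> real \<Rightarrow> real ^ 3 \<Rightarrow> real ^ 3" where "Gl p u v = (wxx u * (Av p \<bullet> v) + wxv u * (Bv p \<bullet> v)) *\<^sub>R Av p + (wvx u * (Av p \<bullet> v) + wvv u * (Bv p \<bullet> v)) *\<^sub>R Bv p
  + wx u *\<^sub>R DAv p v + wv u *\<^sub>R DBv p v"
definition DGf :: "real ^ 3 \<Rightarrow> ((real ^ 3) \<Rightarrow>\<^sub>L (real ^ 3))" where "DGf p = Blinfun (Gl p (lon p, lat p))"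

lemma ab_lin: "bounded_linear (DAv p)" "bounded_linear (DBv p)"
  unfolding DAv_def[abs_def] DBv_def[abs_def]
  by (intro bounded_linear_sub bounded_linear_add bounded_linear_const_scaleR linear_JQ bounded_linear_scaleR_const
      bounded_linear_compose[OF bounded_linear_divide] bounded_linear_mult_const bounded_linear_const_mult bounded_linear_inner_right bounded_linear_vec_nth)+

lemma Gl_lin: "bounded_linear (Gl p u)"
  unfolding Gl_def[abs_def]
  by (intro bounded_linear_add bounded_linear_const_scaleR bounded_linear_scaleR_const ab_lin bounded_linear_const_mult bounded_linear_inner_right)

lemma DGf_apply: "blinfun_apply (DGf p) = Gl p (lon p, lat p)"
  unfolding DGf_def by (rule bounded_linear_Blinfun_apply[OF Gl_lin])

lemma interior_open: "open {z. \<bar>snd z\<bar> < H (fst z)}"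
proof -
  have "continuous_on UNIV (\<lambda>p::real\<times>real. H (fst p))" by (intro continuous_on_compose2[OF H_cont]) (auto intro!: continuous_intros)
  then show ?thesis by (intro open_Collect_less continuous_intros)
qed

text \<open>Second derivatives inherit the period from the first ones by uniqueness of derivatives
  at interior points.\<close>

lemma second_per:
  assumes "\<bar>v\<bar> < H x"
  shows "wxx (x + 2 * pi, v) = wxx (x, v) \<and> wxv (x + 2 * pi, v) = wxv (x, v) \<and> wvx (x + 2 * pi, v) = wvx (x, v) \<and> wvv (x + 2 * pi, v) = wvv (x, v)"
proof -
  have gen: "Fx (x + 2 * pi, v) = Fx (x, v) \<and> Ft (x + 2 * pi, v) = Ft (x, v)"
    if F: "\<And>p. \<bar>snd p\<bar> < H (fst p) \<Longrightarrow> (F has_derivative (\<lambda>h. Fx p * fst h + Ft p * snd h)) (at p)"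
      and per: "\<And>x v. \<bar>v\<bar> \<le> H x \<Longrightarrow> F (x + 2 * pi, v) = F (x, v)" for F Fx Ft :: "real \<times> real \<Rightarrow> real"
  proof -
    have s: "((\<lambda>p. p + (2 * pi, 0 :: real)) has_derivative (\<lambda>h. h)) (at (x, v))" by (auto intro!: derivative_eq_intros)
    have "(F has_derivative (\<lambda>h. Fx (x + 2 * pi, v) * fst h + Ft (x + 2 * pi, v) * snd h)) (at ((x, v) + (2 * pi, 0)))"
      using F[of "(x + 2 * pi, v)"] assms H_per[of x] by simp
    from has_derivative_compose[OF s this]
    have d: "((\<lambda>p. F (p + (2 * pi, 0))) has_derivative (\<lambda>h. Fx (x + 2 * pi, v) * fst h + Ft (x + 2 * pi, v) * snd h)) (at (x, v))" by simp
    have d1: "(F has_derivative (\<lambda>h. Fx (x + 2 * pi, v) * fst h + Ft (x + 2 * pi, v) * snd h)) (at (x, v))"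
      by (rule has_derivative_transform_within_open[OF d interior_open]) (use assms per in \<open>auto simp: less_imp_le\<close>)
    have d2: "(F has_derivative (\<lambda>h. Fx (x, v) * fst h + Ft (x, v) * snd h)) (at (x, v))" using F[of "(x, v)"] assms by simp
    have eq: "Fx (x + 2 * pi, v) * fst h + Ft (x + 2 * pi, v) * snd h = Fx (x, v) * fst h + Ft (x, v) * snd h" for h
      by (rule fun_cong[OF has_derivative_unique[OF d1 d2]])
    show ?thesis using eq[of "(1, 0)"] eq[of "(0, 1)"] by simp
  qed
  show ?thesis using gen[OF dwx] gen[OF dwv] w_per by blast
qed

lemma second_chart: "rr x0 p > 0 \<Longrightarrow> p \<in> Ko \<Longrightarrow> wxx (chart x0 p) = wxx (lon p, lat p) \<and> wxv (chart x0 p) = wxv (lon p, lat p)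
   \<and> wvx (chart x0 p) = wvx (lon p, lat p) \<and> wvv (chart x0 p) = wvv (lon p, lat p)"
  using f_chart[where R="\<lambda>v H. \<bar>v\<bar> < H"] second_per by (auto simp: Ko_iff)

lemma chart_mem: 
  "p \<in> Kc \<Longrightarrow> rr x0 p > 0 \<Longrightarrow> \<bar>snd (chart x0 p)\<bar> \<le> H (fst (chart x0 p))"
  "p \<in> Ko \<Longrightarrow> rr x0 p > 0 \<Longrightarrow> \<bar>snd (chart x0 p)\<bar> < H (fst (chart x0 p))"
  by (simp_all add: Kc_iff Ko_iff H_chart)

text \<open>Near \<open>p\<close> the function is \<open>w\<close> composed with a smooth chart, so
  the chain rule applies; the result is tangent because \<open>Av\<close> and \<open>Bv\<close> are
  orthogonal to \<open>p\<close>.\<close>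

lemma gradient:
  assumes p: "p \<in> Kc"
  shows "has_sphere_gradient Kc wsol p (Gf p)"
proof -
  define x0 where "x0 = lon p"
  have R: "rad2 p > 0" "p \<in> S2" using p by (auto simp: Kc_iff)
  have r: "rr x0 p > 0" unfolding x0_def by (rule rr_lon[OF R(1)])
  let ?U = "{p. rr x0 p > 0}"
  let ?c = "chart x0"
  have "(w has_derivative (\<lambda>h. wx (?c p) * fst h + wv (?c p) * snd h)) (at (?c p) within ?c ` (Kc \<inter> ?U))"
    by (rule has_derivative_subset[OF dw]) (use p r chart_mem(1) in auto)
  from has_derivative_in_compose[OF chart_has_derivative[OF r R(2)] this]
  have "((\<lambda>p. w (?c p)) has_derivative (\<lambda>h. wx (?c p) * (Av p \<bullet> h) + wv (?c p) * (Bv p \<bullet> h))) (at p within Kc \<inter> ?U)" by simp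
  then have "(wsol has_derivative (\<lambda>h. wx (?c p) * (Av p \<bullet> h) + wv (?c p) * (Bv p \<bullet> h))) (at p within Kc)"
    by (rule has_derivative_local[OF _ rr_open]) (use p r w_chart in \<open>auto simp: wsol_def\<close>)
  then show ?thesis using w_chart[OF r p] AB_inner[OF R]
    by (simp add: has_sphere_gradient_def Gf_def inner_add_left)
qed

lemma chart_continuous: "S \<subseteq> S2 \<inter> {p. rr x0 p > 0} \<Longrightarrow> continuous_on S (chart x0)"
  by (rule has_derivative_continuous_on[OF chart_has_derivative]) auto

lemma AB_continuous: "S \<subseteq> {p. rad2 p > 0} \<Longrightarrow> continuous_on S Av" "S \<subseteq> {p. rad2 p > 0} \<Longrightarrow> continuous_on S Bv"
  by (rule has_derivative_continuous_on[OF AB_has_derivative(1)]; auto) (rule has_derivative_continuous_on[OF AB_has_derivative(2)]; auto)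

lemma Gf_continuous: "continuous_on Kc Gf"
proof (rule continuous_on_local)
  fix p assume p: "p \<in> Kc"
  define x0 where "x0 = lon p"
  let ?U = "{p. rr x0 p > 0}"
  have S: "Kc \<inter> ?U \<subseteq> S2 \<inter> ?U" "Kc \<inter> ?U \<subseteq> {p. rad2 p > 0}" by (auto simp: Kc_iff)
  have "continuous_on (Kc \<inter> ?U) (\<lambda>p. wx (chart x0 p) *\<^sub>R Av p + wv (chart x0 p) *\<^sub>R Bv p)"
    by (intro continuous_intros AB_continuous[OF S(2)] continuous_on_compose2[OF cw(1) chart_continuous[OF S(1)]]
       continuous_on_compose2[OF cw(2) chart_continuous[OF S(1)]]) (use chart_mem(1) in auto)
  moreover have "p \<in> ?U" using rr_lon p by (simp add: x0_def Kc_iff)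
  ultimately show "\<exists>U F. open U \<and> p \<in> U \<and> continuous_on (Kc \<inter> U) F \<and> (\<forall>q\<in>Kc \<inter> U. F q = Gf q)"
    by (intro exI[of _ ?U] exI[of _ "\<lambda>p. wx (chart x0 p) *\<^sub>R Av p + wv (chart x0 p) *\<^sub>R Bv p"])
      (use rr_open w_chart in \<open>auto simp: Gf_def\<close>)
qed

lemma Gf_deriv:
  assumes p: "p \<in> Ko"
  shows "(Gf has_derivative blinfun_apply (DGf p)) (at p within Ko)"
proof -
  define x0 where "x0 = lon p"
  have R: "rad2 p > 0" "p \<in> S2" using p by (auto simp: Ko_iff)
  have r: "rr x0 p > 0" unfolding x0_def by (rule rr_lon[OF R(1)])
  let ?U = "{p. rr x0 p > 0}"
  let ?c = "chart x0"
  have i: "\<bar>snd (?c p)\<bar> < H (fst (?c p))" by (rule chart_mem(2)[OF p r])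
  note c = chart_has_derivative[OF r R(2), of "Ko \<inter> ?U"]
  have "((\<lambda>p. wx (?c p)) has_derivative (\<lambda>h. wxx (?c p) * (Av p \<bullet> h) + wxv (?c p) * (Bv p \<bullet> h))) (at p within Ko \<inter> ?U)"
    "((\<lambda>p. wv (?c p)) has_derivative (\<lambda>h. wvx (?c p) * (Av p \<bullet> h) + wvv (?c p) * (Bv p \<bullet> h))) (at p within Ko \<inter> ?U)"
    using has_derivative_in_compose[OF c has_derivative_at_withinI[OF dwx[OF i]]] has_derivative_in_compose[OF c has_derivative_at_withinI[OF dwv[OF i]]] by simp_all
  from has_derivative_add[OF has_derivative_scaleR[OF this(1) AB_has_derivative(1)[OF R(1)]] has_derivative_scaleR[OF this(2) AB_has_derivative(2)[OF R(1)]]]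
  have "((\<lambda>p. wx (?c p) *\<^sub>R Av p + wv (?c p) *\<^sub>R Bv p) has_derivative Gl p (?c p)) (at p within Ko \<inter> ?U)"
    by (rule has_derivative_eq_rhs) (auto simp: Gl_def fun_eq_iff algebra_simps)
  then have "(Gf has_derivative Gl p (?c p)) (at p within Ko)"
    by (rule has_derivative_local[OF _ rr_open]) (use p r w_chart Ko_Kc in \<open>auto simp: Gf_def\<close>)
  then show ?thesis unfolding DGf_apply Gl_def[abs_def] using second_chart[OF r p] w_chart[OF r] p Ko_Kc by auto
qed

lemma Gl_continuous: "continuous_on Ko (\<lambda>p. Gl p (lon p, lat p) v)"
proof (rule continuous_on_local)
  fix p assume p: "p \<in> Ko"
  define x0 where "x0 = lon p"
  let ?U = "{p. rr x0 p > 0}"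
  have S: "Ko \<inter> ?U \<subseteq> S2 \<inter> ?U" "Ko \<inter> ?U \<subseteq> {p. rad2 p > 0}" by (auto simp: Ko_iff)
  have cc: "continuous_on (Ko \<inter> ?U) (\<lambda>p. f (chart x0 p))" if "continuous_on {p. \<bar>snd p\<bar> < H (fst p)} f" for f :: "real \<times> real \<Rightarrow> real"
    by (rule continuous_on_compose2[OF that chart_continuous[OF S(1)]]) (use chart_mem(2) in auto)
  have sub: "{p. \<bar>snd p\<bar> < H (fst p)} \<subseteq> {p. \<bar>snd p\<bar> \<le> H (fst p)}" by auto
  have rc: "continuous_on (Ko \<inter> ?U) rad2" unfolding rad2_def[abs_def] by (intro continuous_intros)
  have JQ: "continuous_on (Ko \<inter> ?U) Jr" "continuous_on (Ko \<inter> ?U) Qr" using linear_JQ by (auto intro: linear_continuous_on)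
  have nz: "\<forall>p\<in>Ko \<inter> ?U. rad2 p \<noteq> 0" "\<forall>p\<in>Ko \<inter> ?U. (rad2 p)\<^sup>2 \<noteq> 0" using S(2) by auto
  have D: "continuous_on (Ko \<inter> ?U) (\<lambda>p. DAv p v)" "continuous_on (Ko \<inter> ?U) (\<lambda>p. DBv p v)"
    unfolding DAv_def DBv_def by (intro continuous_on_diff continuous_on_scaleR continuous_on_divide continuous_on_mult continuous_on_inner continuous_on_power continuous_on_const nz rc JQ
       continuous_on_component continuous_on_id)+
  have "continuous_on (Ko \<inter> ?U) (\<lambda>p. Gl p (chart x0 p) v)"
    unfolding Gl_def by (intro continuous_on_add continuous_on_scaleR continuous_on_mult continuous_on_inner continuous_on_const AB_continuous[OF S(2)] D cc cww 
      continuous_on_subset[OF cw(1) sub] continuous_on_subset[OF cw(2) sub])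
  moreover have "p \<in> ?U" using rr_lon p by (simp add: x0_def Ko_iff)
  moreover have "Gl q (chart x0 q) v = Gl q (lon q, lat q) v" if "q \<in> Ko \<inter> ?U" for q
    using that second_chart[of x0 q] w_chart[of x0 q] Ko_Kc unfolding Gl_def by auto
  ultimately show "\<exists>U F. open U \<and> p \<in> U \<and> continuous_on (Ko \<inter> U) F \<and> (\<forall>q\<in>Ko \<inter> U. F q = Gl q (lon q, lat q) v)"
    using rr_open[of x0] by blast
qed

lemma DGf_continuous: "continuous_on Ko DGf"
  by (rule continuous_on_blinfun_componentwise) (simp add: DGf_apply Gl_continuous)

text \<open>The fields \<open>Av\<close> and \<open>Bv\<close> are divergence free, orthogonal and
  of squared length \<open>1 / rad2\<close>, so the Laplacian is \<open>(wxx + wvv) / rad2\<close>;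
  and \<open>rad2\<close> is \<open>1 / cosh^2\<close> of the isometric latitude, the weight of the
  planar equation.\<close>

lemma laplace:
  assumes p: "p \<in> Ko"
  shows "sphere_divergence p (blinfun_apply (DGf p)) + mu * wsol p = 0"
proof -
  have R: "rad2 p > 0" "p \<in> S2" using p by (auto simp: Ko_iff)
  let ?u = "(lon p, lat p)"
  note ab = AB_inner[OF R]
  have ax: "Av p \<bullet> axis i 1 = Av p $ i" "Bv p \<bullet> axis i 1 = Bv p $ i" "Qr p \<bullet> axis i 1 = Qr p $ i" for i by (simp_all add: inner_axis)
  have tA: "DAv p (axis 1 1) $ 1 + DAv p (axis 2 1) $ 2 + DAv p (axis 3 1) $ 3 = 0"
    by (simp add: DAv_def ax) (simp add: axis_def)
  have tB: "DBv p (axis 1 1) $ 1 + DBv p (axis 2 1) $ 2 + DBv p (axis 3 1) $ 3 = 0"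
  proof -
    have "DBv p (axis 1 1) $ 1 + DBv p (axis 2 1) $ 2 + DBv p (axis 3 1) $ 3 = 2 * p $ 3 * ((p $ 1)\<^sup>2 + (p $ 2)\<^sup>2) / (rad2 p)\<^sup>2 - 2 * p $ 3 / rad2 p"
      by (simp add: DBv_def ax power2_eq_square add_divide_distrib algebra_simps) (simp add: axis_def)
    also have "\<dots> = 0" using R(1) unfolding rad2_def[symmetric] by (simp add: power2_eq_square)
    finally show ?thesis .
  qed
  have Qp: "Qr p \<bullet> p = rad2 p" by (simp add: inner3 rad2_def power2_eq_square)
  have Dp: "DAv p p \<bullet> p = 0" "DBv p p \<bullet> p = 0"
    unfolding DAv_def DBv_def inner_diff_left inner_scaleR_left Qp inner3[of "Jr p" p] using R(1) by (simp_all add: power2_eq_square)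
  have "sphere_divergence p (Gl p ?u) = wxx ?u * (Av p \<bullet> Av p) + wxv ?u * (Av p \<bullet> Bv p) + wvx ?u * (Av p \<bullet> Bv p) + wvv ?u * (Bv p \<bullet> Bv p)
    + wx ?u * (DAv p (axis 1 1) $ 1 + DAv p (axis 2 1) $ 2 + DAv p (axis 3 1) $ 3)
    + wv ?u * (DBv p (axis 1 1) $ 1 + DBv p (axis 2 1) $ 2 + DBv p (axis 3 1) $ 3) - Gl p ?u p \<bullet> p"
    unfolding sphere_divergence_linear[OF bounded_linear.linear[OF Gl_lin] R(2)]
    by (simp only: Gl_def ax vector_add_component vector_scaleR_component inner3[of "Av p" "Av p"] inner3[of "Av p" "Bv p"] inner3[of "Bv p" "Bv p"] real_scaleR_def)
      (simp only: algebra_simps)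
  also have "Gl p ?u p \<bullet> p = 0" by (simp add: Gl_def inner_add_left ab Dp)
  finally have "sphere_divergence p (Gl p ?u) = (wxx ?u + wvv ?u) / rad2 p"
    by (simp only: ab tA tB) (simp add: add_divide_distrib)
  moreover have "wxx ?u + wvv ?u + mu * rad2 p * w ?u = 0"
    using pde[of ?u] p cosh_lat[OF R] R(1) by (simp add: Ko_iff power_divide)
  moreover have "rad2 p * ((wxx ?u + wvv ?u) / rad2 p) = wxx ?u + wvv ?u" using R(1) by simp
  ultimately have "rad2 p * (sphere_divergence p (Gl p ?u) + mu * w ?u) = 0" by (simp only: distrib_left mult_ac)
  then show ?thesis unfolding DGf_apply wsol_def using R(1) by simp
qed

lemma Ko_openin: "openin (top_of_set S2) Ko"
proof (subst openin_subopen, rule ballI)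
  fix p assume p: "p \<in> Ko"
  define x0 where "x0 = lon p"
  let ?U = "{p. rr x0 p > 0}"
  let ?T = "S2 \<inter> ?U \<inter> chart x0 -` {z. \<bar>snd z\<bar> < H (fst z)}"
  have r: "p \<in> ?U" using rr_lon p by (simp add: x0_def Ko_iff)
  have o: "openin (top_of_set S2) (S2 \<inter> ?U)" by (intro openin_open_Int rr_open)
  have "continuous_on (S2 \<inter> ?U) (chart x0)" by (rule chart_continuous) auto
  from continuous_openin_preimage_gen[OF this interior_open] o
  have "openin (top_of_set S2) ?T" by (rule openin_trans)
  moreover have "p \<in> ?T" using p r chart_mem(2)[OF p, of x0] by (auto simp: Ko_iff)
  moreover have "?T \<subseteq> Ko"
  proof
    fix q assume q: "q \<in> ?T"
    then show "q \<in> Ko" using H_chart[of x0 q] rad2_pos[of x0 q] by (simp add: Ko_iff)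
  qed
  ultimately show "\<exists>T. openin (top_of_set S2) T \<and> p \<in> T \<and> T \<subseteq> Ko" by blast
qed

text \<open>Periodicity reduces the longitude to one period, which makes the set a continuous image
  of a compact one.\<close>

lemma Kc_closed: "closed Kc"
proof -
  have "compact (H ` {0..2 * pi})" by (intro compact_continuous_image continuous_on_subset[OF H_cont]) auto
  then obtain B where B: "\<And>x. x \<in> {0..2 * pi} \<Longrightarrow> H x \<le> B" 
    using compact_imp_bounded[of "H ` {0..2 * pi}"] unfolding bounded_real by (metis abs_le_D1 image_eqI)
  let ?D = "({0..2 * pi} \<times> {-B..B}) \<inter> {z. \<bar>snd z\<bar> \<le> H (fst z)}"
  have "continuous_on UNIV (\<lambda>p::real\<times>real. H (fst p))" by (intro continuous_on_compose2[OF H_cont]) (auto intro!: continuous_intros)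
  then have "closed {z. \<bar>snd z\<bar> \<le> H (fst z)}" by (intro closed_Collect_le continuous_intros)
  then have "compact ?D" by (intro compact_Int_closed compact_Times) auto
  moreover have "continuous_on ?D emb"
  proof -
    have "emb = (\<lambda>z. (cos (fst z) / cosh (snd z)) *\<^sub>R axis 1 1 + (sin (fst z) / cosh (snd z)) *\<^sub>R axis 2 1 + tanh (snd z) *\<^sub>R axis 3 1)"
      by (simp add: fun_eq_iff vec3_eq axis_def)
    moreover have "continuous_on ?D (\<lambda>z. (cos (fst z) / cosh (snd z)) *\<^sub>R axis 1 1 + (sin (fst z) / cosh (snd z)) *\<^sub>R axis 2 1 + tanh (snd z) *\<^sub>R axis 3 1 :: real ^ 3)"
      by (intro continuous_intros; simp)
    ultimately show ?thesis by metis
  qed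
  ultimately have "compact (emb ` ?D)" by (rule compact_continuous_image[rotated])
  moreover have "Kc = emb ` ?D"
  proof
    show "emb ` ?D \<subseteq> Kc" by (auto simp: Kc_def)
    show "Kc \<subseteq> emb ` ?D"
    proof
      fix p assume "p \<in> Kc"
      then obtain x v where z: "p = emb (x, v)" "\<bar>v\<bar> \<le> H x" by (auto simp: Kc_def)
      obtain t where t: "0 \<le> t" "t < 2 * pi" "cos x = cos t" "sin x = sin t" 
        using sincos_total_2pi[of "cos x" "sin x"] by auto
      have "H x = H t" by (rule H_cong[OF t(3,4)])
      then have "(t, v) \<in> ?D" using t z(2) B[of t] by auto
      moreover have "p = emb (t, v)" using z t by (simp add: emb_def)
      ultimately show "p \<in> emb ` ?D" by blast
    qed
  qed
  ultimately show ?thesis by (simp add: compact_imp_closed)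
qed

text \<open>The Gudermannian function, which turns the isometric latitude of the boundary into the
  geographic latitude that parametrises the domain.\<close>

definition "hh x = arctan (sinh (H x))"

lemma domain_eq: "sphere_domain hh = Ko"
proof -
  have h: "0 < hh x" "hh x < pi/2" for x
    using H_pos[of x] arctan_ubound[of "sinh (H x)"] by (simp_all add: hh_def)
  have cs: "cos (arctan (sinh v)) = 1 / cosh v" "sin (arctan (sinh v)) = tanh v" for v :: real
  proof -
    have "sqrt (1 + (sinh v)\<^sup>2) = cosh v" using cosh_square_eq[of v] by (metis add.commute cosh_real_nonneg real_sqrt_unique)
    then show "cos (arctan (sinh v)) = 1 / cosh v" "sin (arctan (sinh v)) = tanh v" by (simp_all add: cos_arctan sin_arctan tanh_def)
  qed
  show ?thesis
  proof
    show "sphere_domain hh \<subseteq> Ko"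
    proof
      fix p assume "p \<in> sphere_domain hh"
      then obtain x t where p: "p = vector [cos x * cos (hh x * t), sin x * cos (hh x * t), sin (hh x * t)]" "\<bar>t\<bar> < 1"
        by (auto simp: sphere_domain_def)
      define v where "v = arsinh (tan (hh x * t))"
      have lt: "\<bar>hh x * t\<bar> < hh x" using h[of x] p(2) by (simp add: abs_mult)
      then have b: "- (pi/2) < hh x * t" "hh x * t < pi/2" using h(2)[of x] by auto
      then have a: "arctan (sinh v) = hh x * t" by (simp add: v_def arctan_tan)
      have "arctan (sinh v) < arctan (sinh (H x))" "arctan (sinh (- H x)) < arctan (sinh v)"
        using lt by (auto simp: a hh_def arctan_minus)
      then have "\<bar>v\<bar> < H x" by (simp only: arctan_less_iff sinh_real_less_iff abs_less_iff) (simp add: minus_less_iff)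
      moreover have "p = emb (x, v)" unfolding p(1) a[symmetric] cs emb_def by simp
      ultimately show "p \<in> Ko" by (auto simp: Ko_def)
    qed
    show "Ko \<subseteq> sphere_domain hh"
    proof
      fix p assume "p \<in> Ko"
      then obtain x v where z: "p = emb (x, v)" "\<bar>v\<bar> < H x" by (auto simp: Ko_def)
      define t where "t = arctan (sinh v) / hh x"
      have t: "hh x * t = arctan (sinh v)" using h(1)[of x] by (simp add: t_def)
      have "v < H x" "- H x < v" using z(2) by auto
      then have "arctan (sinh v) < arctan (sinh (H x))" "arctan (sinh (- H x)) < arctan (sinh v)"
        by (simp_all only: arctan_less_iff sinh_real_less_iff)
      then have "\<bar>arctan (sinh v)\<bar> < hh x" by (auto simp: hh_def arctan_minus)
      then have "\<bar>t\<bar> < 1" using h(1)[of x] by (simp add: t_def abs_divide)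
      moreover have "p = vector [cos x * cos (hh x * t), sin x * cos (hh x * t), sin (hh x * t)]"
        unfolding t cs z emb_def by simp
      ultimately show "p \<in> sphere_domain hh" unfolding sphere_domain_def by blast
    qed
  qed
qed

theorem sphere_solution: "classical_solution mu (sphere_domain hh) wsol"
proof -
  have cl: "closure Ko \<subseteq> Kc" by (rule closure_minimal[OF Ko_Kc Kc_closed])
  have "wsol p = 1 \<and> norm (Gf p) = 0" if p: "p \<in> sphere_boundary Ko" for p
  proof -
    have "p \<in> (top_of_set S2) closure_of Ko" "p \<notin> Ko" using p unfolding sphere_boundary_def frontier_of_openin[OF Ko_openin] by auto
    then have "p \<in> Kc" "p \<notin> Ko" using cl closure_of_subtopology_subset[of euclidean S2 Ko] by auto
    then have "\<bar>lat p\<bar> = H (lon p)" by (auto simp: Kc_iff Ko_iff)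
    then show ?thesis using bc[of "(lon p, lat p)"] by (simp add: wsol_def Gf_def)
  qed
  moreover have "has_sphere_gradient (closure Ko) wsol p (Gf p)" if "p \<in> closure Ko" for p
    using gradient[of p] that cl unfolding has_sphere_gradient_def by (meson has_derivative_subset subsetD)
  ultimately show ?thesis unfolding classical_solution_def domain_eq
    using Gf_deriv DGf_continuous laplace continuous_on_subset[OF Gf_continuous cl] by blast
qed

end

subsection \<open>Smooth functions of two variables\<close>

text \<open>Partial derivatives are existentially quantified, so their values off \<open>U\<close>
  are free, and the closure rules become inductions that merely exhibit suitable partials.\<close>

fun Cn :: "nat \<Rightarrow> (real \<times> real) set \<Rightarrow> (real \<times> real \<Rightarrow> real) \<Rightarrow> bool" where
  "Cn 0 U u = continuous_on U u"
| "Cn (Suc n) U u = (\<exists>u1 u2. (\<forall>p\<in>U. (u has_derivative (\<lambda>h. u1 p * fst h + u2 p * snd h)) (at p)) \<and> Cn n U u1 \<and> Cn n U u2)"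

lemma CnI: "(\<And>p. p \<in> U \<Longrightarrow> (u has_derivative (\<lambda>h. u1 p * fst h + u2 p * snd h)) (at p)) \<Longrightarrow> Cn n U u1 \<Longrightarrow> Cn n U u2 \<Longrightarrow> Cn (Suc n) U u"
  unfolding Cn.simps by blast

lemma Cn_cong: assumes "open U" "\<And>p. p \<in> U \<Longrightarrow> u p = v p" "Cn n U u" shows "Cn n U v"
proof (cases n)
  case 0
  then show ?thesis using assms by (metis Cn.simps(1) continuous_on_cong)
next
  case (Suc m)
  then obtain u1 u2 where u: "\<And>p. p \<in> U \<Longrightarrow> (u has_derivative (\<lambda>h. u1 p * fst h + u2 p * snd h)) (at p)" "Cn m U u1" "Cn m U u2"
    using assms(3) by auto
  show ?thesis unfolding Suc
    by (rule CnI[OF _ u(2,3)]) (rule has_derivative_transform_within_open[OF u(1) assms(1)], use assms(2) in auto)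
qed

lemma Cn_continuous: "Cn n U u \<Longrightarrow> continuous_on U u"
proof (cases n)
  case (Suc m)
  assume "Cn n U u"
  from this[unfolded Suc] obtain u1 u2 where "\<And>p. p \<in> U \<Longrightarrow> (u has_derivative (\<lambda>h. u1 p * fst h + u2 p * snd h)) (at p)" by auto
  then show ?thesis by (rule has_derivative_continuous_on[OF has_derivative_at_withinI])
qed simp

lemma Cn_Suc: "Cn (Suc n) U u \<Longrightarrow> Cn n U u"
proof (induction n arbitrary: u)
  case 0
  then show ?case using Cn_continuous[OF 0] by simp
next
  case (Suc n)
  from Suc.prems obtain u1 u2 where u: "\<And>p. p \<in> U \<Longrightarrow> (u has_derivative (\<lambda>h. u1 p * fst h + u2 p * snd h)) (at p)" "Cn (Suc n) U u1" "Cn (Suc n) U u2"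
    by auto
  show ?case by (rule CnI[OF u(1) Suc.IH[OF u(2)] Suc.IH[OF u(3)]])
qed

lemma Cn_const: "Cn n U (\<lambda>p. c)"
  by (induction n arbitrary: c) (auto intro!: continuous_intros CnI[of _ _ "\<lambda>p. 0" "\<lambda>p. 0"] derivative_eq_intros simp del: Cn.simps(2))

lemma Cn_fst: "Cn n U fst" and Cn_snd: "Cn n U snd"
proof -
  show "Cn n U fst"
  proof (cases n)
    case (Suc m)
    then show ?thesis by (auto intro!: CnI[OF _ Cn_const[of _ _ 1] Cn_const[of _ _ 0]] derivative_eq_intros simp del: Cn.simps(2))
  qed (auto intro: continuous_intros)
  show "Cn n U snd"
  proof (cases n)
    case (Suc m)
    then show ?thesis by (auto intro!: CnI[OF _ Cn_const[of _ _ 0] Cn_const[of _ _ 1]] derivative_eq_intros simp del: Cn.simps(2))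
  qed (auto intro: continuous_intros)
qed

lemma Cn_add: "Cn n U u \<Longrightarrow> Cn n U v \<Longrightarrow> Cn n U (\<lambda>p. u p + v p)"
proof (induction n arbitrary: u v)
  case 0 then show ?case by (auto intro: continuous_intros)
next
  case (Suc n)
  from Suc.prems(1) obtain u1 u2 where u: "\<And>p. p \<in> U \<Longrightarrow> (u has_derivative (\<lambda>h. u1 p * fst h + u2 p * snd h)) (at p)" "Cn n U u1" "Cn n U u2" by auto
  from Suc.prems(2) obtain v1 v2 where v: "\<And>p. p \<in> U \<Longrightarrow> (v has_derivative (\<lambda>h. v1 p * fst h + v2 p * snd h)) (at p)" "Cn n U v1" "Cn n U v2" by auto
  show ?case
    by (rule CnI[OF _ Suc.IH[OF u(2) v(2)] Suc.IH[OF u(3) v(3)]])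
      (rule has_derivative_eq_rhs[OF has_derivative_add[OF u(1) v(1)]], auto simp: algebra_simps)
qed

lemma Cn_mult: "Cn n U u \<Longrightarrow> Cn n U v \<Longrightarrow> Cn n U (\<lambda>p. u p * v p)"
proof (induction n arbitrary: u v)
  case 0 then show ?case by (auto intro: continuous_intros)
next
  case (Suc n)
  note uv = Cn_Suc[OF Suc.prems(1)] Cn_Suc[OF Suc.prems(2)]
  from Suc.prems(1) obtain u1 u2 where u: "\<And>p. p \<in> U \<Longrightarrow> (u has_derivative (\<lambda>h. u1 p * fst h + u2 p * snd h)) (at p)" "Cn n U u1" "Cn n U u2" by auto
  from Suc.prems(2) obtain v1 v2 where v: "\<And>p. p \<in> U \<Longrightarrow> (v has_derivative (\<lambda>h. v1 p * fst h + v2 p * snd h)) (at p)" "Cn n U v1" "Cn n U v2" by auto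
  show ?case
    by (rule CnI[OF _ Cn_add[OF Suc.IH[OF uv(1) v(2)] Suc.IH[OF u(2) uv(2)]] Cn_add[OF Suc.IH[OF uv(1) v(3)] Suc.IH[OF u(3) uv(2)]]])
      (rule has_derivative_eq_rhs[OF has_derivative_mult[OF u(1) v(1)]], auto simp: algebra_simps)
qed

lemma Cn_minus: "Cn n U u \<Longrightarrow> Cn n U (\<lambda>p. - u p)"
  using Cn_mult[OF Cn_const[of n U "-1"], of u] by simp

lemma Cn_outer_deriv:
  assumes "\<And>p. p \<in> U \<Longrightarrow> (u has_derivative (\<lambda>h. u1 p * fst h + u2 p * snd h)) (at p)" "Cn n U u1" "Cn n U u2"
    and "\<And>p. p \<in> U \<Longrightarrow> (f has_real_derivative f' p) (at (u p))" "Cn n U f'"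
  shows "Cn (Suc n) U (\<lambda>p. f (u p))"
  by (rule CnI[OF _ Cn_mult[OF assms(2,5)] Cn_mult[OF assms(3,5)]])
     (rule has_derivative_eq_rhs[OF DERIV_compose_FDERIV[OF assms(4) assms(1)]], auto simp: algebra_simps)

lemma Cn_inverse: "Cn n U u \<Longrightarrow> (\<And>p. p \<in> U \<Longrightarrow> u p \<noteq> 0) \<Longrightarrow> Cn n U (\<lambda>p. inverse (u p))"
proof (induction n)
  case 0 then show ?case by (auto intro!: continuous_intros)
next
  case (Suc n)
  have i: "Cn n U (\<lambda>p. inverse (u p))" by (rule Suc.IH[OF Cn_Suc[OF Suc.prems(1)] Suc.prems(2)])
  from Suc.prems(1) obtain u1 u2 where u: "\<And>p. p \<in> U \<Longrightarrow> (u has_derivative (\<lambda>h. u1 p * fst h + u2 p * snd h)) (at p)" "Cn n U u1" "Cn n U u2" by auto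
  show ?case
    by (rule Cn_outer_deriv[OF u _ Cn_minus[OF Cn_mult[OF i i]]])
      (use DERIV_inverse[OF Suc.prems(2)] in \<open>auto simp: power2_eq_square numeral_2_eq_2\<close>)
qed

lemma Cn_sqrt: "Cn n U u \<Longrightarrow> (\<And>p. p \<in> U \<Longrightarrow> u p > 0) \<Longrightarrow> Cn n U (\<lambda>p. sqrt (u p))"
proof (induction n)
  case 0 then show ?case by (auto intro!: continuous_intros)
next
  case (Suc n)
  have "sqrt (u p) \<noteq> 0" if "p \<in> U" for p using Suc.prems(2)[OF that] by simp
  then have i: "Cn n U (\<lambda>p. inverse (sqrt (u p)) * (1/2))" 
    by (intro Cn_mult Cn_const Cn_inverse Suc.IH[OF Cn_Suc[OF Suc.prems(1)] Suc.prems(2)])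
  from Suc.prems(1) obtain u1 u2 where u: "\<And>p. p \<in> U \<Longrightarrow> (u has_derivative (\<lambda>h. u1 p * fst h + u2 p * snd h)) (at p)" "Cn n U u1" "Cn n U u2" by auto
  show ?case
    by (rule Cn_outer_deriv[OF u _ i]) (use DERIV_real_sqrt[OF Suc.prems(2)] in auto)
qed

lemma Cn_cosh_sinh: "Cn n U u \<Longrightarrow> Cn n U (\<lambda>p. cosh (u p)) \<and> Cn n U (\<lambda>p. sinh (u p))"
proof (induction n)
  case 0 then show ?case by (auto intro!: continuous_intros)
next
  case (Suc n)
  note i = Suc.IH[OF Cn_Suc[OF Suc.prems(1)]]
  from Suc.prems(1) obtain u1 u2 where u: "\<And>p. p \<in> U \<Longrightarrow> (u has_derivative (\<lambda>h. u1 p * fst h + u2 p * snd h)) (at p)" "Cn n U u1" "Cn n U u2" by auto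
  show ?case
    by (intro conjI Cn_outer_deriv[OF u _ conjunct1[OF i]] Cn_outer_deriv[OF u _ conjunct2[OF i]]) (auto intro!: derivative_eq_intros)
qed

lemma gd_has_derivative: "((\<lambda>v. arctan (sinh v)) has_real_derivative inverse (cosh v)) (at (v::real))"
proof -
  have "1 + (sinh v)\<^sup>2 = (cosh v)\<^sup>2" by (simp add: cosh_square_eq)
  then show ?thesis by (auto intro!: derivative_eq_intros simp: power2_eq_square)
qed

lemma Cn_gd: "Cn n U u \<Longrightarrow> Cn n U (\<lambda>p. arctan (sinh (u p)))"
proof (cases n)
  case 0 
  assume "Cn n U u"
  with 0 show ?thesis by (auto intro!: continuous_intros)
next
  case (Suc m)
  assume a: "Cn n U u"
  have i: "Cn m U (\<lambda>p. inverse (cosh (u p)))" 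
    by (rule Cn_inverse[OF conjunct1[OF Cn_cosh_sinh[OF Cn_Suc[OF a[unfolded Suc]]]]]) simp
  from a[unfolded Suc] obtain u1 u2 where u: "\<And>p. p \<in> U \<Longrightarrow> (u has_derivative (\<lambda>h. u1 p * fst h + u2 p * snd h)) (at p)" "Cn m U u1" "Cn m U u2" by auto
  show ?thesis unfolding Suc by (rule Cn_outer_deriv[OF u gd_has_derivative i])
qed

lemma Cn_comp: "Cn n U u \<Longrightarrow> Cn n V f \<Longrightarrow> Cn n V g \<Longrightarrow> (\<And>p. p \<in> V \<Longrightarrow> (f p, g p) \<in> U) \<Longrightarrow> Cn n V (\<lambda>p. u (f p, g p))"
proof (induction n arbitrary: u)
  case 0 
  then show ?case by (auto intro!: continuous_on_compose2[of U u V] continuous_intros)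
next
  case (Suc n)
  from Suc.prems(1) obtain u1 u2 where u: "\<And>p. p \<in> U \<Longrightarrow> (u has_derivative (\<lambda>h. u1 p * fst h + u2 p * snd h)) (at p)" "Cn n U u1" "Cn n U u2" by auto
  from Suc.prems(2) obtain f1 f2 where f: "\<And>p. p \<in> V \<Longrightarrow> (f has_derivative (\<lambda>h. f1 p * fst h + f2 p * snd h)) (at p)" "Cn n V f1" "Cn n V f2" by auto
  from Suc.prems(3) obtain g1 g2 where g: "\<And>p. p \<in> V \<Longrightarrow> (g has_derivative (\<lambda>h. g1 p * fst h + g2 p * snd h)) (at p)" "Cn n V g1" "Cn n V g2" by auto
  have i: "Cn n V (\<lambda>p. u1 (f p, g p))" "Cn n V (\<lambda>p. u2 (f p, g p))"
    by (rule Suc.IH[OF u(2) Cn_Suc[OF Suc.prems(2)] Cn_Suc[OF Suc.prems(3)]], erule Suc.prems(4),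
      rule Suc.IH[OF u(3) Cn_Suc[OF Suc.prems(2)] Cn_Suc[OF Suc.prems(3)]], erule Suc.prems(4))
  show ?case
  proof (rule CnI[where ?u1.0="\<lambda>p. u1 (f p, g p) * f1 p + u2 (f p, g p) * g1 p" and ?u2.0="\<lambda>p. u1 (f p, g p) * f2 p + u2 (f p, g p) * g2 p"])
    fix p assume p: "p \<in> V"
    show "((\<lambda>p. u (f p, g p)) has_derivative (\<lambda>h. (u1 (f p, g p) * f1 p + u2 (f p, g p) * g1 p) * fst h + (u1 (f p, g p) * f2 p + u2 (f p, g p) * g2 p) * snd h)) (at p)"
      by (rule has_derivative_eq_rhs[OF has_derivative_compose[OF has_derivative_Pair[OF f(1)[OF p] g(1)[OF p]] u(1)[OF Suc.prems(4)[OF p]]]])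
        (auto simp: algebra_simps)
  next
    show "Cn n V (\<lambda>p. u1 (f p, g p) * f1 p + u2 (f p, g p) * g1 p)" "Cn n V (\<lambda>p. u1 (f p, g p) * f2 p + u2 (f p, g p) * g2 p)"
      by (rule Cn_add[OF Cn_mult[OF i(1) f(2)] Cn_mult[OF i(2) g(2)]], rule Cn_add[OF Cn_mult[OF i(1) f(3)] Cn_mult[OF i(2) g(3)]])
  qed
qed

lemma deriv_coeff_unique:
  assumes "(u has_derivative (\<lambda>h. a * fst h + b * snd h)) (at (p :: real \<times> real))" "(u has_derivative (\<lambda>h. c * fst h + d * snd h)) (at p)"
  shows "a = (c::real)" "b = d"
  using fun_cong[OF has_derivative_unique[OF assms], of "(1,0)"] fun_cong[OF has_derivative_unique[OF assms], of "(0,1)"] by simp_all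

definition smooth2 where "smooth2 U u \<longleftrightarrow> (\<forall>n. Cn n U u)"

text \<open>Each order of differentiability supplies its own partials; on an open set they agree
  with those of order one, which are therefore of every order.\<close>

lemma smooth2_partials:
  assumes "smooth2 U u" "open U"
  obtains u1 u2 where "\<And>p. p \<in> U \<Longrightarrow> (u has_derivative (\<lambda>h. u1 p * fst h + u2 p * snd h)) (at p)" "smooth2 U u1" "smooth2 U u2"
proof -
  from assms(1) have "Cn (Suc 0) U u" by (simp add: smooth2_def)
  then obtain u1 u2 where u: "\<And>p. p \<in> U \<Longrightarrow> (u has_derivative (\<lambda>h. u1 p * fst h + u2 p * snd h)) (at p)" by auto
  have "Cn n U u1 \<and> Cn n U u2" for n
  proof -
    from assms(1) have "Cn (Suc n) U u" unfolding smooth2_def by blast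
    then obtain v1 v2 where v: "\<And>p. p \<in> U \<Longrightarrow> (u has_derivative (\<lambda>h. v1 p * fst h + v2 p * snd h)) (at p)" "Cn n U v1" "Cn n U v2" by auto
    have "v1 p = u1 p" "v2 p = u2 p" if "p \<in> U" for p using deriv_coeff_unique[OF v(1)[OF that] u[OF that]] by auto
    then show ?thesis using Cn_cong[OF assms(2) _ v(2)] Cn_cong[OF assms(2) _ v(3)] by blast
  qed
  then have "smooth2 U u1" "smooth2 U u2" by (simp_all add: smooth2_def)
  with u show ?thesis by (rule that)
qed

lemma smooth2_const: "smooth2 U (\<lambda>p. c)"
  and smooth2_fst: "smooth2 U fst"
  and smooth2_snd: "smooth2 U snd"
  by (simp_all add: smooth2_def Cn_const Cn_fst Cn_snd)

lemma smooth2_add: "smooth2 U u \<Longrightarrow> smooth2 U v \<Longrightarrow> smooth2 U (\<lambda>p. u p + v p)"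
  by (simp add: smooth2_def Cn_add)

lemma smooth2_mult: "smooth2 U u \<Longrightarrow> smooth2 U v \<Longrightarrow> smooth2 U (\<lambda>p. u p * v p)"
  by (simp add: smooth2_def Cn_mult)

lemma smooth2_inverse: "smooth2 U u \<Longrightarrow> (\<And>p. p \<in> U \<Longrightarrow> u p \<noteq> 0) \<Longrightarrow> smooth2 U (\<lambda>p. inverse (u p))"
  unfolding smooth2_def using Cn_inverse by blast

lemma smooth2_sqrt: "smooth2 U u \<Longrightarrow> (\<And>p. p \<in> U \<Longrightarrow> u p > 0) \<Longrightarrow> smooth2 U (\<lambda>p. sqrt (u p))"
  unfolding smooth2_def using Cn_sqrt by blast

lemma smooth2_gd: "smooth2 U u \<Longrightarrow> smooth2 U (\<lambda>p. arctan (sinh (u p)))"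
  by (simp add: smooth2_def Cn_gd)

lemma smooth2_comp: "smooth2 U u \<Longrightarrow> smooth2 V f \<Longrightarrow> smooth2 V g \<Longrightarrow> (\<And>p. p \<in> V \<Longrightarrow> (f p, g p) \<in> U) \<Longrightarrow> smooth2 V (\<lambda>p. u (f p, g p))"
  unfolding smooth2_def by (intro allI Cn_comp) auto

lemma smooth2_continuous: "smooth2 U u \<Longrightarrow> continuous_on U u"
  unfolding smooth2_def using Cn_continuous by blast

text \<open>The global expansion bound in the second variable gives continuity of \<open>g\<close>,
  and then differentiability. The partials of \<open>g\<close> are rational in the partials of
  \<open>X\<close> along \<open>(fst p, g p)\<close>, so regularity bootstraps by induction.\<close>

lemma smooth2_implicit:
  assumes U: "U = I \<times> UNIV" "open I" and X: "smooth2 U X"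
    and dX: "\<And>p. p \<in> U \<Longrightarrow> (X has_derivative (\<lambda>h. X1 p * fst h + X2 p * snd h)) (at p)" "\<And>p. p \<in> U \<Longrightarrow> X2 p \<noteq> 0"
    and ex: "\<And>s x y. s \<in> I \<Longrightarrow> \<bar>x - y\<bar> \<le> K * \<bar>X (s, x) - X (s, y)\<bar>"
    and g: "\<And>p. p \<in> U \<Longrightarrow> X (fst p, g p) = snd p"
  shows "smooth2 U g"
proof -
  have oU: "open U" using U by (simp add: open_Times)
  obtain Y1 Y2 where Y: "\<And>p. p \<in> U \<Longrightarrow> (X has_derivative (\<lambda>h. Y1 p * fst h + Y2 p * snd h)) (at p)" "smooth2 U Y1" "smooth2 U Y2"
    using smooth2_partials[OF X oU] by blast
  have YX: "Y2 p \<noteq> 0" if "p \<in> U" for p using deriv_coeff_unique(2)[OF Y(1)[OF that] dX(1)[OF that]] dX(2)[OF that] by simp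
  have mem: "p \<in> U \<Longrightarrow> (fst p, x) \<in> U" for p x using U by auto
  have cX: "continuous_on U X" by (rule smooth2_continuous[OF X])
  have cg: "isCont g p" if p: "p \<in> U" for p
  proof -
    have b: "\<bar>g q - g p\<bar> \<le> K * \<bar>snd q - X (fst q, g p)\<bar>" if "q \<in> U" for q
    proof -
      have "fst q \<in> I" using that U by auto
      from ex[OF this, of "g q" "g p"] show ?thesis using g[OF that] by simp
    qed
    have X': "isCont X (fst p, g p)" using cX oU mem[OF p] by (simp add: continuous_on_eq_continuous_at)
    have "isCont (\<lambda>q. (fst q, g p)) p" by (intro continuous_intros)
    from isCont_o2[OF this X'] have "((\<lambda>q. X (fst q, g p)) \<longlongrightarrow> X (fst p, g p)) (at p)" by (simp add: isCont_def)
    then have "((\<lambda>q. K * \<bar>snd q - X (fst q, g p)\<bar>) \<longlongrightarrow> K * \<bar>snd p - X (fst p, g p)\<bar>) (at p)"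
      by (intro tendsto_intros)
    then have z: "((\<lambda>q. K * \<bar>snd q - X (fst q, g p)\<bar>) \<longlongrightarrow> 0) (at p)" using g[OF p] by simp
    have ev: "\<forall>\<^sub>F q in at p. norm (g q - g p) \<le> K * \<bar>snd q - X (fst q, g p)\<bar>"
      unfolding eventually_at_topological using b oU p by (intro exI[of _ U]) simp
    have "((\<lambda>q. g q - g p) \<longlongrightarrow> 0) (at p)" by (rule Lim_null_comparison[OF ev z])
    then show ?thesis by (simp add: isCont_def LIM_zero_iff)
  qed
  define g1 where "g1 p = - Y1 (fst p, g p) * inverse (Y2 (fst p, g p))" for p
  define g2 where "g2 p = inverse (Y2 (fst p, g p))" for p
  have dg: "(g has_derivative (\<lambda>h. g1 p * fst h + g2 p * snd h)) (at p)" if p: "p \<in> U" for p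
  proof -
    let ?G = "\<lambda>p. (fst p, g p)"
    have "((\<lambda>p. (fst p, X p)) has_derivative (\<lambda>h. (fst h, Y1 (?G p) * fst h + Y2 (?G p) * snd h))) (at (?G p))"
      by (intro has_derivative_Pair Y(1) mem p has_derivative_fst has_derivative_ident)
    then have "(?G has_derivative (\<lambda>h. (fst h, g1 p * fst h + g2 p * snd h))) (at p)"
    proof (rule has_derivative_inverse_basic[where T=U])
      show "bounded_linear (\<lambda>h. (fst h, g1 p * fst h + g2 p * snd h))"
        by (intro bounded_linear_Pair bounded_linear_add bounded_linear_const_mult bounded_linear_fst bounded_linear_snd)
      show "(\<lambda>h. (fst h, g1 p * fst h + g2 p * snd h)) \<circ> (\<lambda>h. (fst h, Y1 (?G p) * fst h + Y2 (?G p) * snd h)) = id"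
        using YX[OF mem[OF p]] by (auto simp: fun_eq_iff g1_def g2_def field_simps)
      show "continuous (at p) ?G" using cg[OF p] by (intro continuous_intros)
      show "(fst (?G q), X (?G q)) = q" if "q \<in> U" for q using g[OF that] by simp
    qed (use p oU in auto)
    from has_derivative_snd[OF this] show ?thesis by simp
  qed
  have "Cn n U g" for n
  proof (induction n)
    case 0
    show ?case using cg oU by (simp add: continuous_on_eq_continuous_at)
  next
    case (Suc n)
    have Y': "Cn n U (\<lambda>p. Y1 (fst p, g p))" "Cn n U (\<lambda>p. Y2 (fst p, g p))"
      by (rule Cn_comp[OF Y(2)[unfolded smooth2_def, rule_format] Cn_fst Suc mem], assumption,
        rule Cn_comp[OF Y(3)[unfolded smooth2_def, rule_format] Cn_fst Suc mem], assumption)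
    have i: "Cn n U (\<lambda>p. inverse (Y2 (fst p, g p)))" by (rule Cn_inverse[OF Y'(2) YX[OF mem]])
    have "Cn n U g1" "Cn n U g2" unfolding g1_def[abs_def] g2_def[abs_def] by (intro Cn_mult Cn_minus Y' i)+
    from CnI[OF dg this] show ?case by simp
  qed
  then show ?thesis by (simp add: smooth2_def)
qed

text \<open>Symmetry of mixed partials: the second difference over a small square is evaluated by
  the mean value theorem in both orders.\<close>

lemma smooth2_mixed:
  fixes u u1 u2 u11 u12 u21 u22 :: "real \<times> real \<Rightarrow> real"
  assumes U: "open U" "p \<in> U"
    and u: "\<And>p. p \<in> U \<Longrightarrow> (u has_derivative (\<lambda>h. u1 p * fst h + u2 p * snd h)) (at p)"
    and u1: "\<And>p. p \<in> U \<Longrightarrow> (u1 has_derivative (\<lambda>h. u11 p * fst h + u12 p * snd h)) (at p)"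
    and u2: "\<And>p. p \<in> U \<Longrightarrow> (u2 has_derivative (\<lambda>h. u21 p * fst h + u22 p * snd h)) (at p)"
    and c: "continuous_on U u12" "continuous_on U u21"
  shows "u12 p = u21 p"
proof (rule ccontr)
  assume ne: "u12 p \<noteq> u21 p"
  define e where "e = \<bar>u12 p - u21 p\<bar> / 2"
  have e: "e > 0" using ne by (simp add: e_def)
  have "\<exists>d>0. \<forall>q. dist q p < d \<longrightarrow> q \<in> U \<and> \<bar>u12 q - u12 p\<bar> < e \<and> \<bar>u21 q - u21 p\<bar> < e"
  proof -
    obtain d0 where d0: "d0 > 0" "\<forall>q. dist q p < d0 \<longrightarrow> q \<in> U" using U by (metis open_dist)
    have ex: "\<exists>d>0. \<forall>q. dist q p < d \<longrightarrow> \<bar>F q - F p\<bar> < e" if "continuous_on U F" for F :: "real \<times> real \<Rightarrow> real"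
    proof -
      have "isCont F p" using that U by (simp add: continuous_on_eq_continuous_at)
      then show ?thesis using e by (auto simp: continuous_at_eps_delta dist_real_def)
    qed
    from ex[OF c(1)] obtain d1 where "d1 > 0" "\<forall>q. dist q p < d1 \<longrightarrow> \<bar>u12 q - u12 p\<bar> < e" by blast
    moreover from ex[OF c(2)] obtain d2 where "d2 > 0" "\<forall>q. dist q p < d2 \<longrightarrow> \<bar>u21 q - u21 p\<bar> < e" by blast
    ultimately show ?thesis using d0 by (intro exI[of _ "min d0 (min d1 d2)"]) auto
  qed
  then obtain d where d: "d > 0" "\<And>q. dist q p < d \<Longrightarrow> q \<in> U \<and> \<bar>u12 q - u12 p\<bar> < e \<and> \<bar>u21 q - u21 p\<bar> < e" by blast
  obtain a b where ab: "p = (a, b)" by fastforce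
  define k where "k = d / 3"
  have k: "k > 0" using d by (simp add: k_def)
  have near: "dist (a + x, b + y) p < d" if "0 \<le> x" "x \<le> k" "0 \<le> y" "y \<le> k" for x y
  proof -
    have "dist (a + x, b + y) p \<le> \<bar>x\<bar> + \<bar>y\<bar>" using norm_Pair_le[of x y] by (simp add: ab dist_norm)
    then show ?thesis using that k by (simp add: k_def)
  qed
  note nU = d(2)[OF near]
  have l1: "((\<lambda>x. (a + x, c)) has_derivative (\<lambda>h. (h, 0))) (at x)" and l2: "((\<lambda>y. (c, b + y)) has_derivative (\<lambda>h. (0, h))) (at x)" for c x :: real
    by (auto intro!: derivative_eq_intros)
  have D1: "((\<lambda>x. F (a + x, c)) has_real_derivative F1 (a + x, c)) (at x)"
    if "(F has_derivative (\<lambda>h. F1 (a + x, c) * fst h + F2 * snd h)) (at (a + x, c))" for F F1 :: "real \<times> real \<Rightarrow> real" and F2 c x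
    using has_derivative_compose[OF l1 that] by (simp add: has_field_derivative_def)
  have D2: "((\<lambda>y. F (c, b + y)) has_real_derivative F2 (c, b + y)) (at y)"
    if "(F has_derivative (\<lambda>h. F1 * fst h + F2 (c, b + y) * snd h)) (at (c, b + y))" for F F2 :: "real \<times> real \<Rightarrow> real" and F1 c y
    using has_derivative_compose[OF l2 that] by (simp add: has_field_derivative_def)
  let ?D = "u (a + k, b + k) - u (a + k, b) - u (a, b + k) + u (a, b)"
  have "\<exists>z. 0 < z \<and> z < k \<and> (u (a + k, b + k) - u (a + k, b)) - (u (a + 0, b + k) - u (a + 0, b)) = (k - 0) * (u1 (a + z, b + k) - u1 (a + z, b))"
    by (rule MVT2[of 0 k "\<lambda>x. u (a + x, b + k) - u (a + x, b)" "\<lambda>x. u1 (a + x, b + k) - u1 (a + x, b)"])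
      (use k nU[of _ k] nU[of _ 0] in \<open>auto intro!: DERIV_diff D1 u\<close>)
  then obtain z where z: "0 < z" "z < k" "?D = k * (u1 (a + z, b + k) - u1 (a + z, b + 0))" by (auto simp: algebra_simps)
  have "\<exists>y. 0 < y \<and> y < k \<and> u1 (a + z, b + k) - u1 (a + z, b + 0) = (k - 0) * u12 (a + z, b + y)"
    by (rule MVT2[of 0 k "\<lambda>y. u1 (a + z, b + y)" "\<lambda>y. u12 (a + z, b + y)"]) (use k z nU[of z] in \<open>auto intro!: D2 u1\<close>)
  then obtain y where y: "0 < y" "y < k" "?D = k * (k * u12 (a + z, b + y))" using z by auto
  have "\<exists>z. 0 < z \<and> z < k \<and> (u (a + k, b + k) - u (a, b + k)) - (u (a + k, b + 0) - u (a, b + 0)) = (k - 0) * (u2 (a + k, b + z) - u2 (a, b + z))"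
    by (rule MVT2[of 0 k "\<lambda>y. u (a + k, b + y) - u (a, b + y)" "\<lambda>y. u2 (a + k, b + y) - u2 (a, b + y)"])
      (use k nU[of k] nU[of 0] in \<open>auto intro!: DERIV_diff D2 u\<close>)
  then obtain z' where z': "0 < z'" "z' < k" "?D = k * (u2 (a + k, b + z') - u2 (a + 0, b + z'))" by (auto simp: algebra_simps)
  have "\<exists>y. 0 < y \<and> y < k \<and> u2 (a + k, b + z') - u2 (a + 0, b + z') = (k - 0) * u21 (a + y, b + z')"
    by (rule MVT2[of 0 k "\<lambda>x. u2 (a + x, b + z')" "\<lambda>x. u21 (a + x, b + z')"]) (use k z' nU[of _ z'] in \<open>auto intro!: D1 u2\<close>)
  then obtain y' where y': "0 < y'" "y' < k" "?D = k * (k * u21 (a + y', b + z'))" using z' by auto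
  have "k * (k * u12 (a + z, b + y)) = k * (k * u21 (a + y', b + z'))" using y(3) y'(3) by (rule trans[OF sym])
  then have "u12 (a + z, b + y) = u21 (a + y', b + z')" using k by simp
  moreover have "\<bar>u12 (a + z, b + y) - u12 p\<bar> < e" "\<bar>u21 (a + y', b + z') - u21 p\<bar> < e"
    using nU[of z y] nU[of y' z'] z y z' y' by auto
  ultimately show False unfolding e_def by (simp add: abs_if split: if_splits)
qed

section \<open>Smooth periodic families as smooth curves in the Hoelder space\<close>

definition perf :: "real set \<Rightarrow> (real \<times> real \<Rightarrow> real) \<Rightarrow> bool" where
  "perf I u \<longleftrightarrow> smooth2 (I \<times> UNIV) u \<and> (\<forall>s\<in>I. \<forall>x. u (s, x + 2 * pi) = u (s, x))"

definition pder :: "real set \<Rightarrow> (real \<times> real \<Rightarrow> real) \<Rightarrow> (real \<times> real \<Rightarrow> real) \<Rightarrow> (real \<times> real \<Rightarrow> real) \<Rightarrow> bool" where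
  "pder I u u1 u2 \<longleftrightarrow> (\<forall>p\<in>I \<times> UNIV. (u has_derivative (\<lambda>h. u1 p * fst h + u2 p * snd h)) (at p))"

lemma pderD: "pder I u u1 u2 \<Longrightarrow> s \<in> I \<Longrightarrow> (u has_derivative (\<lambda>h. u1 (s, x) * fst h + u2 (s, x) * snd h)) (at (s, x))"
  by (simp add: pder_def)

lemma pder_unique: "pder I u u1 u2 \<Longrightarrow> pder I u v1 v2 \<Longrightarrow> p \<in> I \<times> UNIV \<Longrightarrow> u1 p = v1 p \<and> u2 p = v2 p"
  unfolding pder_def using deriv_coeff_unique[of u "u1 p" "u2 p" p "v1 p" "v2 p"] by blast

text \<open>Used with \<open>c = 1\<close>, \<open>d = 2 * pi\<close> to pass periodicity to the
  partials, and with \<open>c = -1\<close>, \<open>d = 0\<close> to pass evenness to the derivative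
  in \<open>s\<close>.\<close>

lemma partial_reflect:
  assumes I: "open I" and s: "s \<in> I" and u: "\<And>s x. s \<in> I \<Longrightarrow> u (s, c * x + d) = (u (s, x) :: real)"
    and du: "pder I u u1 u2"
  shows "u1 (s, c * x + d) = u1 (s, x)" "c * u2 (s, c * x + d) = u2 (s, x)"
proof -
  have f: "((\<lambda>p. (fst p, c * snd p + d)) has_derivative (\<lambda>h. (fst h, c * snd h))) (at (s, x))"
    by (auto intro!: derivative_eq_intros)
  have "(u has_derivative (\<lambda>h. u1 (s, c * x + d) * fst h + u2 (s, c * x + d) * snd h)) (at (fst (s, x), c * snd (s, x) + d))"
    using pderD[OF du s] by simp
  from has_derivative_compose[OF f this]
  have g: "((\<lambda>p. u (fst p, c * snd p + d)) has_derivative (\<lambda>h. u1 (s, c * x + d) * fst h + c * u2 (s, c * x + d) * snd h)) (at (s, x))"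
    by (simp add: mult_ac)
  have "(u has_derivative (\<lambda>h. u1 (s, c * x + d) * fst h + c * u2 (s, c * x + d) * snd h)) (at (s, x))"
    by (rule has_derivative_transform_within_open[OF g open_Times[OF I open_UNIV]]) (use u s in auto)
  from deriv_coeff_unique[OF this pderD[OF du s]] show "u1 (s, c * x + d) = u1 (s, x)" "c * u2 (s, c * x + d) = u2 (s, x)" by auto
qed

lemma perf_partials:
  assumes "perf I u" and I: "open I"
  shows "\<exists>u1 u2. pder I u u1 u2 \<and> perf I u1 \<and> perf I u2"
proof -
  have u: "smooth2 (I \<times> UNIV) u" "\<And>s x. s \<in> I \<Longrightarrow> u (s, 1 * x + 2 * pi) = u (s, x)" using assms by (auto simp: perf_def)
  have "\<exists>u1 u2. pder I u u1 u2 \<and> smooth2 (I \<times> UNIV) u1 \<and> smooth2 (I \<times> UNIV) u2"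
    unfolding pder_def by (rule smooth2_partials[OF u(1) open_Times[OF I open_UNIV]]) blast
  then obtain u1 u2 where d: "pder I u u1 u2" "smooth2 (I \<times> UNIV) u1" "smooth2 (I \<times> UNIV) u2" by blast
  have "perf I u1" "perf I u2" using d(2,3) partial_reflect[OF I _ u(2) d(1)] by (auto simp: perf_def)
  with d(1) show ?thesis by blast
qed

lemma perf_bounded:
  assumes "perf I u" "{a..b} \<subseteq> I"
  shows "\<exists>B\<ge>0. \<forall>s\<in>{a..b}. \<forall>x. \<bar>u (s, x)\<bar> \<le> B"
proof -
  have "continuous_on ({a..b} \<times> {0..2 * pi}) u"
    by (rule continuous_on_subset[OF smooth2_continuous[of "I \<times> UNIV"]]) (use assms in \<open>auto simp: perf_def\<close>)
  from compact_continuous_image[OF this compact_Times[OF compact_Icc compact_Icc]]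
  have "bounded (u ` ({a..b} \<times> {0..2 * pi}))" by (rule compact_imp_bounded)
  then obtain B where B: "\<And>z. z \<in> {a..b} \<times> {0..2 * pi} \<Longrightarrow> \<bar>u z\<bar> \<le> B" unfolding bounded_real by blast
  show ?thesis
  proof (intro exI[of _ "max B 0"] conjI ballI allI)
    fix s x assume s: "s \<in> {a..b}"
    obtain t where t: "0 \<le> t" "t < 2 * pi" "cos x = cos t" "sin x = sin t" using sincos_total_2pi[of "cos x" "sin x"] by auto
    have "u (s, x) = u (s, t)" by (rule angle_cong[of "\<lambda>x. u (s, x)"]) (use s assms t in \<open>auto simp: perf_def\<close>)
    then show "\<bar>u (s, x)\<bar> \<le> max B 0" using B[of "(s, t)"] s t by auto
  qed simp
qed

lemma slice_derivs:
  assumes "pder I u u1 u2" "s \<in> I"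
  shows "((\<lambda>s. u (s, x)) has_real_derivative u1 (s, x)) (at s)" "((\<lambda>x. u (s, x)) has_real_derivative u2 (s, x)) (at x)"
proof -
  have l: "((\<lambda>s. (s, x)) has_derivative (\<lambda>h. (h, 0))) (at s)" "((\<lambda>x. (s, x)) has_derivative (\<lambda>h. (0, h))) (at x)"
    by (auto intro!: derivative_eq_intros)
  show "((\<lambda>s. u (s, x)) has_real_derivative u1 (s, x)) (at s)" "((\<lambda>x. u (s, x)) has_real_derivative u2 (s, x)) (at x)"
    using has_derivative_compose[OF l(1) pderD[OF assms]] has_derivative_compose[OF l(2) pderD[OF assms]]
    by (simp_all add: has_field_derivative_def)
qed

lemma Icc_in_open: "open I \<Longrightarrow> s \<in> (I :: real set) \<Longrightarrow> \<exists>d>0. {s - d..s + d} \<subseteq> I"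
  by (metis open_contains_cball cball_eq_atLeastAtMost)

text \<open>Taylor's estimate with a bound on the second derivative in \<open>s\<close>; periodicity
  in \<open>x\<close> makes that bound, and hence the convergence, uniform on the line.\<close>

lemma difference_quotient_bound:
  assumes u: "perf I u" and I: "open I" and s: "s \<in> I" and du: "pder I u u1 u2"
  shows "\<exists>B\<ge>0. \<exists>d>0. \<forall>k. k \<noteq> 0 \<longrightarrow> \<bar>k\<bar> \<le> d \<longrightarrow> s + k \<in> I \<and> (\<forall>x. \<bar>(u (s + k, x) - u (s, x)) / k - u1 (s, x)\<bar> \<le> B * \<bar>k\<bar>)"
proof -
  obtain v1 v2 where v: "pder I u v1 v2" "perf I v1" "perf I v2" using perf_partials[OF u I] by blast
  have v1u: "v1 (s, x) = u1 (s, x)" if "s \<in> I" for s x using pder_unique[OF v(1) du, of "(s, x)"] that by simp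
  obtain v11 v12 where v1: "pder I v1 v11 v12" "perf I v11" "perf I v12" using perf_partials[OF v(2) I] by blast
  obtain d where d: "d > 0" "{s - d..s + d} \<subseteq> I" using Icc_in_open[OF I s] by blast
  obtain B where B: "B \<ge> 0" "\<forall>t\<in>{s - d..s + d}. \<forall>x. \<bar>v11 (t, x)\<bar> \<le> B" using perf_bounded[OF v1(2) d(2)] by blast
  show ?thesis
  proof (rule exI[of _ B], rule conjI[OF B(1)], rule exI[of _ d], rule conjI[OF d(1)], intro allI impI conjI)
    show "s + k \<in> I" if "\<bar>k\<bar> \<le> d" for k
      by (rule subsetD[OF d(2)]) (use that in auto)
    fix k x :: real assume k: "k \<noteq> 0" "\<bar>k\<bar> \<le> d"
    let ?S = "{s - \<bar>k\<bar>..s + \<bar>k\<bar>}"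
    have S: "?S \<subseteq> I" "?S \<subseteq> {s - d..s + d}" using k d by auto
    have 1: "\<bar>v1 (t, x) - v1 (s, x)\<bar> \<le> B * \<bar>k\<bar>" if t: "t \<in> ?S" for t
    proof -
      have "norm (v1 (t, x) - v1 (s, x)) \<le> B * norm (t - s)"
        by (rule field_differentiable_bound[of ?S "\<lambda>t. v1 (t, x)" "\<lambda>t. v11 (t, x)"])
          (use S B(2) t in \<open>auto intro!: has_field_derivative_at_within slice_derivs[OF v1(1)]\<close>)
      also have "\<dots> \<le> B * \<bar>k\<bar>" using t B(1) by (intro mult_left_mono) auto
      finally show ?thesis by simp
    qed
    have "norm ((u (s + k, x) - (s + k) * v1 (s, x)) - (u (s, x) - s * v1 (s, x))) \<le> (B * \<bar>k\<bar>) * norm (s + k - s)"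
    proof (rule field_differentiable_bound[of ?S "\<lambda>t. u (t, x) - t * v1 (s, x)" "\<lambda>t. v1 (t, x) - v1 (s, x)"])
      fix t assume t: "t \<in> ?S"
      have tI: "t \<in> I" by (rule subsetD[OF S(1) t])
      have l: "((\<lambda>t. t * v1 (s, x)) has_real_derivative v1 (s, x)) (at t)"
        using DERIV_cmult_right[OF DERIV_ident, of "v1 (s, x)"] by simp
      show "((\<lambda>t. u (t, x) - t * v1 (s, x)) has_real_derivative v1 (t, x) - v1 (s, x)) (at t within ?S)"
        by (rule has_field_derivative_at_within[OF DERIV_diff[OF slice_derivs(1)[OF v(1) tI] l]])
      show "norm (v1 (t, x) - v1 (s, x)) \<le> B * \<bar>k\<bar>" using 1[OF t] by simp
    qed (use k in auto)
    then have "\<bar>(u (s + k, x) - u (s, x)) - k * v1 (s, x)\<bar> \<le> B * \<bar>k\<bar> * \<bar>k\<bar>" by (simp add: algebra_simps)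
    moreover have "(u (s + k, x) - u (s, x)) / k - u1 (s, x) = ((u (s + k, x) - u (s, x)) - k * v1 (s, x)) / k"
      using k v1u[OF s] by (simp add: diff_divide_distrib)
    ultimately show "\<bar>(u (s + k, x) - u (s, x)) / k - u1 (s, x)\<bar> \<le> B * \<bar>k\<bar>"
      using k by (simp add: abs_divide divide_le_eq)
  qed
qed

text \<open>At distance at most 1 the Lipschitz bound is the stronger one; beyond that the bound on
  \<open>f\<close> itself suffices.\<close>

lemma Hoelder_interpolation:
  fixes f :: "real \<Rightarrow> real"
  assumes a: "0 < \<alpha>" "\<alpha> < 1" and B: "\<And>x. \<bar>f x\<bar> \<le> B" "\<And>x. (f has_real_derivative f' x) (at x)" "\<And>x. \<bar>f' x\<bar> \<le> B"
  shows "\<bar>f x - f y\<bar> \<le> 2 * B * \<bar>x - y\<bar> powr \<alpha>"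
proof (cases "\<bar>x - y\<bar> \<le> 1")
  case True
  have B0: "B \<ge> 0" using B(1)[of 0] by linarith
  have "norm (f x - f y) \<le> B * norm (x - y)"
    by (rule field_differentiable_bound[of UNIV f f']) (use B in auto)
  also have "\<dots> \<le> B * \<bar>x - y\<bar> powr \<alpha>"
  proof (cases "x = y")
    case False
    have "\<bar>x - y\<bar> powr 1 \<le> \<bar>x - y\<bar> powr \<alpha>" using a True False by (intro powr_mono') auto
    then show ?thesis using B0 False by (intro mult_left_mono) auto
  qed simp
  also have "\<dots> \<le> 2 * B * \<bar>x - y\<bar> powr \<alpha>" using B0 by (intro mult_right_mono) auto
  finally show ?thesis by simp
next
  case False
  have B0: "B \<ge> 0" using B(1)[of 0] by linarith
  have "\<bar>f x - f y\<bar> \<le> 2 * B * 1" using B(1)[of x] B(1)[of y] by linarith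
  also have "\<dots> \<le> 2 * B * \<bar>x - y\<bar> powr \<alpha>" using a False B0 by (intro mult_left_mono ge_one_powr_ge_zero) auto
  finally show ?thesis .
qed

text \<open>Three sup norms and a seminorm of at most \<open>2 B\<close> give 5. The sets under the
  suprema are shown to be bounded first, since a real supremum carries no information
  otherwise.\<close>

lemma C2_Hoelder_norm_bound:
  assumes a: "0 < \<alpha>" "\<alpha> < 1"
    and d: "\<And>x. (g has_real_derivative g1 x) (at x)" "\<And>x. (g1 has_real_derivative g2 x) (at x)" "\<And>x. (g2 has_real_derivative g3 x) (at x)"
    and B: "\<And>x. \<bar>g x\<bar> \<le> B" "\<And>x. \<bar>g1 x\<bar> \<le> B" "\<And>x. \<bar>g2 x\<bar> \<le> B" "\<And>x. \<bar>g3 x\<bar> \<le> B"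
  shows "0 \<le> C2_Hoelder_norm \<alpha> g" "C2_Hoelder_norm \<alpha> g \<le> 5 * B"
proof -
  have d1: "deriv g = g1" and d2: "deriv g1 = g2" using d DERIV_imp_deriv by blast+
  have sn: "0 \<le> sup_norm f \<and> sup_norm f \<le> B" if "\<And>x. \<bar>f x\<bar> \<le> B" for f
  proof
    have "bdd_above (range (\<lambda>x. \<bar>f x\<bar>))" using that by (intro bdd_aboveI[of _ B]) auto
    from cSUP_upper[OF _ this, of 0] show "0 \<le> sup_norm f" unfolding sup_norm_def by (rule order_trans[OF abs_ge_zero]) simp
    show "sup_norm f \<le> B" unfolding sup_norm_def by (rule cSUP_least) (use that in auto)
  qed
  let ?q = "\<lambda>z. \<bar>g2 (fst z) - g2 (snd z)\<bar> / \<bar>fst z - snd z\<bar> powr \<alpha>"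
  have hs: "Hoelder_seminorm \<alpha> g2 = (SUP z \<in> {z. fst z \<noteq> snd z}. ?q z)"
    unfolding Hoelder_seminorm_def by (simp add: case_prod_unfold)
  have q: "?q z \<le> 2 * B" if "z \<in> {z. fst z \<noteq> snd z}" for z
    using Hoelder_interpolation[OF a B(3) d(3) B(4), of "fst z" "snd z"] that by (simp add: divide_le_eq)
  have m: "(0, 1) \<in> {z :: real \<times> real. fst z \<noteq> snd z}" by simp
  have bd: "bdd_above (?q ` {z. fst z \<noteq> snd z})" using q by (intro bdd_aboveI[of _ "2 * B"]) auto
  have "?q (0, 1) \<le> Hoelder_seminorm \<alpha> g2" unfolding hs by (rule cSUP_upper[OF m bd])
  moreover have "0 \<le> ?q (0, 1)" by simp
  moreover have "Hoelder_seminorm \<alpha> g2 \<le> 2 * B" unfolding hs by (rule cSUP_least[OF _ q]) (use m in blast)+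
  ultimately show "0 \<le> C2_Hoelder_norm \<alpha> g" "C2_Hoelder_norm \<alpha> g \<le> 5 * B"
    unfolding C2_Hoelder_norm_def d1 d2 using sn[of g, OF B(1)] sn[of g1, OF B(2)] sn[of g2, OF B(3)] by linarith+
qed

lemma slice_in_space:
  assumes a: "0 < \<alpha>" "\<alpha> < 1" and u: "perf I u" and I: "open I" and s: "s \<in> I" and ev: "\<And>x. u (s, - x) = u (s, x)"
  shows "(\<lambda>x. u (s, x)) \<in> C2_Hoelder_per_even \<alpha>"
proof -
  obtain u1 u2 where d: "pder I u u1 u2" "perf I u1" "perf I u2" using perf_partials[OF u I] by blast
  obtain u21 u22 where d2: "pder I u2 u21 u22" "perf I u21" "perf I u22" using perf_partials[OF d(3) I] by blast
  obtain u221 u222 where d22: "pder I u22 u221 u222" "perf I u221" "perf I u222" using perf_partials[OF d2(3) I] by blast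
  note D = slice_derivs(2)[OF d(1) s] slice_derivs(2)[OF d2(1) s] slice_derivs(2)[OF d22(1) s]
  have dd: "deriv (\<lambda>x. u (s, x)) = (\<lambda>x. u2 (s, x))" "deriv (\<lambda>x. u2 (s, x)) = (\<lambda>x. u22 (s, x))"
    using D(1,2) DERIV_imp_deriv by blast+
  have ss: "{s..s} \<subseteq> I" using s by simp
  obtain B where B: "B \<ge> 0" "\<forall>t\<in>{s..s}. \<forall>x. \<bar>u22 (t, x)\<bar> \<le> B" using perf_bounded[OF d2(3) ss] by blast
  obtain B' where B': "B' \<ge> 0" "\<forall>t\<in>{s..s}. \<forall>x. \<bar>u222 (t, x)\<bar> \<le> B'" using perf_bounded[OF d22(3) ss] by blast
  have "\<bar>u22 (s, x) - u22 (s, y)\<bar> \<le> 2 * (B + B') * \<bar>x - y\<bar> powr \<alpha>" for x y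
    by (rule Hoelder_interpolation[OF a _ D(3)]) (use B B' in \<open>auto intro: add_increasing add_increasing2\<close>)
  moreover have "(\<lambda>x. u (s, x)) differentiable at x" "(\<lambda>x. u2 (s, x)) differentiable at x" for x
    using D(1,2) real_differentiable_def by blast+
  moreover have "u (s, x + 2 * pi) = u (s, x)" for x using u s by (simp add: perf_def)
  ultimately show ?thesis unfolding C2_Hoelder_per_even_def mem_Collect_eq dd using ev by blast
qed

text \<open>\<open>G\<close> is the derivative of \<open>F\<close> in the parameter. The relation is
  inherited by the derivatives in \<open>x\<close> because mixed partials commute, which is what
  convergence in a norm of second derivatives requires.\<close>

definition spair :: "real set \<Rightarrow> (real \<times> real \<Rightarrow> real) \<Rightarrow> (real \<times> real \<Rightarrow> real) \<Rightarrow> bool" where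
  "spair I F G \<longleftrightarrow> perf I F \<and> perf I G \<and> (\<exists>F2. pder I F G F2)"

lemma spair_step:
  assumes "spair I F G" "open I"
  shows "\<exists>F2 G1 G2. pder I F G F2 \<and> pder I G G1 G2 \<and> spair I F2 G2"
proof -
  have F: "perf I F" "perf I G" using assms by (auto simp: spair_def)
  obtain F2' where F2': "pder I F G F2'" using assms by (auto simp: spair_def)
  obtain F1 F2 where d: "pder I F F1 F2" "perf I F1" "perf I F2" using perf_partials[OF F(1) assms(2)] by blast
  have d': "pder I F G F2" using d(1) F2' pder_unique[OF d(1) F2'] unfolding pder_def by simp
  obtain G1 G2 where G: "pder I G G1 G2" "perf I G1" "perf I G2" using perf_partials[OF F(2) assms(2)] by blast
  obtain F21 F22 where d2: "pder I F2 F21 F22" "perf I F21" "perf I F22" using perf_partials[OF d(3) assms(2)] by blast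
  have o: "open (I \<times> (UNIV :: real set))" using assms(2) by (intro open_Times) auto
  have "G2 p = F21 p" if "p \<in> I \<times> UNIV" for p
    by (rule smooth2_mixed[OF o that d'[unfolded pder_def, rule_format] G(1)[unfolded pder_def, rule_format] d2(1)[unfolded pder_def, rule_format]])
      (use G(3) d2(2) smooth2_continuous in \<open>auto simp: perf_def\<close>)
  then have "pder I F2 G2 F22" using d2(1) unfolding pder_def by simp
  then show ?thesis using d' G d(3) unfolding spair_def by blast
qed

text \<open>The difference quotient estimate is applied to \<open>u\<close> and to its first three
  derivatives in \<open>x\<close>; the third one controls the Hoelder seminorm of the
  second.\<close>

lemma curve_derivative:
  assumes a: "0 < \<alpha>" "\<alpha> < 1" and u: "spair I u u1" and I: "open I" and s: "s \<in> I"
    and d1: "(\<lambda>x. u1 (s, x)) \<in> C2_Hoelder_per_even \<alpha>"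
  shows "has_C2_Hoelder_derivative \<alpha> (\<lambda>s x. u (s, x)) (\<lambda>x. u1 (s, x)) s"
proof -
  obtain u2 v1 v2 where 1: "pder I u u1 u2" "pder I u1 v1 v2" "spair I u2 v2" using spair_step[OF u I] by blast
  obtain u22 v21 v22 where 2: "pder I u2 v2 u22" "pder I v2 v21 v22" "spair I u22 v22" using spair_step[OF 1(3) I] by blast
  obtain u222 v221 v222 where 3: "pder I u22 v22 u222" "pder I v22 v221 v222" "spair I u222 v222" using spair_step[OF 2(3) I] by blast
  obtain u2222 where 4: "pder I u222 v222 u2222" using 3(3) by (auto simp: spair_def)
  have P: "perf I u" "perf I u2" "perf I u22" "perf I u222" using u 1 2 3 by (auto simp: spair_def)
  obtain B1 e1 where B1: "B1 \<ge> 0" "e1 > 0" "\<forall>k. k \<noteq> 0 \<longrightarrow> \<bar>k\<bar> \<le> e1 \<longrightarrow> s + k \<in> I \<and> (\<forall>x. \<bar>(u (s + k, x) - u (s, x)) / k - u1 (s, x)\<bar> \<le> B1 * \<bar>k\<bar>)"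
    using difference_quotient_bound[OF P(1) I s 1(1)] by blast
  obtain B2 e2 where B2: "B2 \<ge> 0" "e2 > 0" "\<forall>k. k \<noteq> 0 \<longrightarrow> \<bar>k\<bar> \<le> e2 \<longrightarrow> s + k \<in> I \<and> (\<forall>x. \<bar>(u2 (s + k, x) - u2 (s, x)) / k - v2 (s, x)\<bar> \<le> B2 * \<bar>k\<bar>)"
    using difference_quotient_bound[OF P(2) I s 2(1)] by blast
  obtain B3 e3 where B3: "B3 \<ge> 0" "e3 > 0" "\<forall>k. k \<noteq> 0 \<longrightarrow> \<bar>k\<bar> \<le> e3 \<longrightarrow> s + k \<in> I \<and> (\<forall>x. \<bar>(u22 (s + k, x) - u22 (s, x)) / k - v22 (s, x)\<bar> \<le> B3 * \<bar>k\<bar>)"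
    using difference_quotient_bound[OF P(3) I s 3(1)] by blast
  obtain B4 e4 where B4: "B4 \<ge> 0" "e4 > 0" "\<forall>k. k \<noteq> 0 \<longrightarrow> \<bar>k\<bar> \<le> e4 \<longrightarrow> s + k \<in> I \<and> (\<forall>x. \<bar>(u222 (s + k, x) - u222 (s, x)) / k - v222 (s, x)\<bar> \<le> B4 * \<bar>k\<bar>)"
    using difference_quotient_bound[OF P(4) I s 4] by blast
  define B where "B = B1 + B2 + B3 + B4"
  define e where "e = min (min e1 e2) (min e3 e4)"
  have Bs: "B1 \<le> B" "B2 \<le> B" "B3 \<le> B" "B4 \<le> B" "B \<ge> 0" using B1(1) B2(1) B3(1) B4(1) by (auto simp: B_def)
  have e: "e > 0" "e \<le> e1" "e \<le> e2" "e \<le> e3" "e \<le> e4" using B1(2) B2(2) B3(2) B4(2) by (auto simp: e_def)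
  have bnd: "\<bar>C2_Hoelder_norm \<alpha> (\<lambda>x. (u (s + k, x) - u (s, x)) / k - u1 (s, x))\<bar> \<le> 5 * B * \<bar>k\<bar>" if k: "k \<noteq> 0" "\<bar>k\<bar> \<le> e" for k
  proof -
    have ke: "\<bar>k\<bar> \<le> e1" "\<bar>k\<bar> \<le> e2" "\<bar>k\<bar> \<le> e3" "\<bar>k\<bar> \<le> e4" using k(2) e by auto
    have sk: "s + k \<in> I" using B1(3) k ke by blast
    have D: "((\<lambda>x. (F (s + k, x) - F (s, x)) / k - G (s, x)) has_real_derivative (F2 (s + k, x) - F2 (s, x)) / k - G2 (s, x)) (at x)"
      if "pder I F G F2" "pder I G G1 G2" for F G F2 G1 G2 x
      by (intro DERIV_diff DERIV_cdivide slice_derivs(2)[OF that(1)] slice_derivs(2)[OF that(2)] sk s)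
    have b: "\<bar>t\<bar> \<le> B * \<bar>k\<bar>" if "\<bar>t\<bar> \<le> B' * \<bar>k\<bar>" "B' \<le> B" for t B'
      by (rule order_trans[OF that(1)]) (use that(2) in \<open>auto intro: mult_right_mono\<close>)
    have bb: "\<bar>(u (s + k, x) - u (s, x)) / k - u1 (s, x)\<bar> \<le> B * \<bar>k\<bar>" "\<bar>(u2 (s + k, x) - u2 (s, x)) / k - v2 (s, x)\<bar> \<le> B * \<bar>k\<bar>"
      "\<bar>(u22 (s + k, x) - u22 (s, x)) / k - v22 (s, x)\<bar> \<le> B * \<bar>k\<bar>" "\<bar>(u222 (s + k, x) - u222 (s, x)) / k - v222 (s, x)\<bar> \<le> B * \<bar>k\<bar>" for x
      using B1(3) B2(3) B3(3) B4(3) k(1) ke by - (rule b[OF _ Bs(1)], blast, rule b[OF _ Bs(2)], blast, rule b[OF _ Bs(3)], blast, rule b[OF _ Bs(4)], blast)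
    from C2_Hoelder_norm_bound[OF a D[OF 1(1,2)] D[OF 2(1,2)] D[OF 3(1,2)] bb] show ?thesis by simp
  qed
  have "((\<lambda>k. 5 * B * \<bar>k\<bar>) \<longlongrightarrow> 5 * B * \<bar>0\<bar>) (at 0)" by (intro tendsto_intros)
  then have z: "((\<lambda>k. 5 * B * \<bar>k\<bar>) \<longlongrightarrow> 0) (at 0)" by simp
  have "\<forall>\<^sub>F k in at 0. norm (C2_Hoelder_norm \<alpha> (\<lambda>x. (u (s + k, x) - u (s, x)) / k - u1 (s, x))) \<le> 5 * B * \<bar>k\<bar>"
    unfolding eventually_at using e(1) bnd by (intro exI[of _ e]) (auto simp: dist_real_def)
  from Lim_null_comparison[OF this z] d1 show ?thesis unfolding has_C2_Hoelder_derivative_def by blast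
qed

theorem smooth_curve:
  assumes a: "0 < \<alpha>" "\<alpha> < 1" and u: "perf I u" and I: "open I" and ev: "\<And>s x. s \<in> I \<Longrightarrow> u (s, - x) = u (s, x)"
  shows "smooth_C2_Hoelder_curve \<alpha> I (\<lambda>s x. u (s, x))"
proof -
  \<comment> \<open>A fixed choice of parameter derivative, so that iteration gives a single
    sequence \<open>D\<close> in which each member is the derivative of the previous one.\<close>
  define pd where "pd v = (SOME v1. spair I v v1)" for v
  have pd: "spair I v (pd v)" if "perf I v" for v
  proof -
    have "\<exists>v1. spair I v v1" using perf_partials[OF that I] that unfolding spair_def by blast
    then show ?thesis unfolding pd_def by (rule someI_ex)
  qed
  define D where "D n = (pd ^^ n) u" for n
  have D: "perf I (D n) \<and> (\<forall>s\<in>I. \<forall>x. D n (s, - x) = D n (s, x))" for n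
  proof (induction n)
    case 0
    show ?case using u ev by (simp add: D_def)
  next
    case (Suc n)
    have s: "spair I (D n) (D (Suc n))" using pd[of "D n"] Suc by (simp add: D_def)
    then obtain F2 where F2: "pder I (D n) (D (Suc n)) F2" by (auto simp: spair_def)
    have "D (Suc n) (s, - x) = D (Suc n) (s, x)" if "s \<in> I" for s x
      using partial_reflect(1)[OF I that, of "D n" "-1" 0, OF _ F2] Suc by simp
    then show ?case using s by (simp add: spair_def)
  qed
  have sp: "(\<lambda>x. D n (s, x)) \<in> C2_Hoelder_per_even \<alpha>" if "s \<in> I" for n s
    by (rule slice_in_space[OF a _ I that]) (use D that in auto)
  have "has_C2_Hoelder_derivative \<alpha> (\<lambda>s x. D n (s, x)) (\<lambda>x. D (Suc n) (s, x)) s" if "s \<in> I" for n s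
    by (rule curve_derivative[OF a _ I that sp[OF that]]) (use pd[of "D n"] D in \<open>simp add: D_def\<close>)
  then show ?thesis unfolding smooth_C2_Hoelder_curve_def using sp[of _ 0]
    by (intro conjI exI[of _ "\<lambda>n s x. D n (s, x)"]) (auto simp: D_def)
qed

subsection \<open>Smooth dependence on the parameter\<close>

text \<open>The exponent is a truncated difference; terms of order below \<open>j\<close> only occur with coefficient 0 in derivatives.\<close>

definition TC :: "(nat \<times> nat \<Rightarrow> real) \<Rightarrow> nat \<Rightarrow> real \<times> real \<Rightarrow> real" where
  "TC c j z = (\<Sum>m. c (prod_decode m) * (fst z ^ (dg (prod_decode m) - j) * cos (kd (prod_decode m) * snd z)))"
definition TS :: "(nat \<times> nat \<Rightarrow> real) \<Rightarrow> nat \<Rightarrow> real \<times> real \<Rightarrow> real" where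
  "TS c j z = (\<Sum>m. c (prod_decode m) * (fst z ^ (dg (prod_decode m) - j) * sin (kd (prod_decode m) * snd z)))"

abbreviation "hstrip \<equiv> {-(1/2)<..<1/2::real} \<times> (UNIV :: real set)"

lemma T_term:
  assumes "pbd UNIV (\<lambda>n (_::real). c n)"
  shows "\<exists>M. summable M \<and> (\<forall>m s x. \<bar>s\<bar> \<le> 1/2 \<longrightarrow> \<bar>x\<bar> \<le> 1 \<longrightarrow> \<bar>c (prod_decode m) * (s ^ (dg (prod_decode m) - j) * x)\<bar> \<le> M m)"
proof -
  obtain A p where A: "A \<ge> 0" "\<And>n. \<bar>c n\<bar> \<le> A * (1 + real (dg n)) ^ p"
    using assms unfolding pbd_def by blast
  show ?thesis
  proof (intro exI[of _ "\<lambda>m. (A * 2 ^ j) * mw p (prod_decode m)"] conjI allI impI)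
    show "summable (\<lambda>m. (A * 2 ^ j) * mw p (prod_decode m))" by (intro summable_mult mw_summable)
    fix m and s x :: real assume s: "\<bar>s\<bar> \<le> 1/2" and x: "\<bar>x\<bar> \<le> 1"
    let ?n = "prod_decode m"
    have "\<bar>s ^ (dg ?n - j)\<bar> \<le> (1/2) ^ (dg ?n - j)" unfolding power_abs using s by (intro power_mono) auto
    \<comment> \<open>Lowering the exponent by \<open>j\<close> costs at most \<open>2 ^ j\<close>;
      where the difference is truncated to 0, the right-hand side is at least 1.\<close>
    also have "\<dots> \<le> 2 ^ j * (1/2) ^ dg ?n"
    proof (cases "j \<le> dg ?n")
      case True
      then have "(1/2::real) ^ dg ?n = (1/2) ^ j * (1/2) ^ (dg ?n - j)" by (metis le_add_diff_inverse power_add)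
      then show ?thesis by (simp add: power_one_over)
    next
      case False
      then have "(2::real) ^ dg ?n \<le> 2 ^ j" by (intro power_increasing) auto
      then show ?thesis using False by (simp add: power_one_over field_simps)
    qed
    finally have "\<bar>s ^ (dg ?n - j) * x\<bar> \<le> (2 ^ j * (1/2) ^ dg ?n) * 1" unfolding abs_mult using x by (intro mult_mono) auto
    from mult_mono[OF A(2)[of ?n] this] A(1)
    show "\<bar>c ?n * (s ^ (dg ?n - j) * x)\<bar> \<le> (A * 2 ^ j) * mw p ?n" by (simp add: abs_mult mw_def mult_ac)
  qed
qed

lemma pbd_dg: "pbd S (\<lambda>n (_::real). real (dg n - j))"
proof (rule pbdI[where A=1 and p=1])
  fix n
  have "real (dg n - j) \<le> real (dg n)" by simp
  then show "\<bar>real (dg n - j)\<bar> \<le> 1 * (1 + real (dg n)) ^ 1" by simp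
qed

lemma T_deriv:
  assumes c: "pbd UNIV (\<lambda>n (_::real). c n)" and z: "z \<in> hstrip"
  shows "(TC c j has_derivative (\<lambda>h. TC (\<lambda>n. c n * real (dg n - j)) (Suc j) z * fst h + TS (\<lambda>n. - (kd n * c n)) j z * snd h)) (at z)"
    and "(TS c j has_derivative (\<lambda>h. TS (\<lambda>n. c n * real (dg n - j)) (Suc j) z * fst h + TC (\<lambda>n. kd n * c n) j z * snd h)) (at z)"
proof -
  have p: "pbd UNIV (\<lambda>n (_::real). c n * real (dg n - j))" "pbd UNIV (\<lambda>n (_::real). - (kd n * c n))" "pbd UNIV (\<lambda>n (_::real). kd n * c n)"
    using pbd_mult[OF c pbd_dg] pbd_mult[OF pbd_const[of UNIV "-1"] pbd_mult[OF pbd_kd c]] pbd_mult[OF pbd_kd c] by simp_all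
  obtain M1 where M1: "summable M1" "\<And>m s x. \<bar>s\<bar> \<le> 1/2 \<Longrightarrow> \<bar>x\<bar> \<le> 1 \<Longrightarrow> \<bar>c (prod_decode m) * (s ^ (dg (prod_decode m) - j) * x)\<bar> \<le> M1 m"
    using T_term[OF c, of j] by blast
  obtain M2 where M2: "summable M2" "\<And>m s x. \<bar>s\<bar> \<le> 1/2 \<Longrightarrow> \<bar>x\<bar> \<le> 1 \<Longrightarrow> \<bar>c (prod_decode m) * real (dg (prod_decode m) - j) * (s ^ (dg (prod_decode m) - Suc j) * x)\<bar> \<le> M2 m"
    using T_term[OF p(1), of "Suc j"] by blast
  obtain M3 where M3: "summable M3" "\<And>m s x. \<bar>s\<bar> \<le> 1/2 \<Longrightarrow> \<bar>x\<bar> \<le> 1 \<Longrightarrow> \<bar>kd (prod_decode m) * c (prod_decode m) * (s ^ (dg (prod_decode m) - j) * x)\<bar> \<le> M3 m"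
    using T_term[OF p(3), of j] by blast
  define M where "M m = \<bar>M1 m\<bar> + \<bar>M2 m\<bar> + \<bar>M3 m\<bar>" for m
  have nn: "0 \<le> M1 m" "0 \<le> M2 m" "0 \<le> M3 m" for m
    using M1(2)[of 0 0 m] M2(2)[of 0 0 m] M3(2)[of 0 0 m] by simp_all
  have M: "summable M" unfolding M_def[abs_def] using M1(1) M2(1) M3(1) nn by (intro summable_add) simp_all
  have le: "M1 m \<le> M m" "M2 m \<le> M m" "M3 m \<le> M m" for m using nn by (auto simp: M_def)
  have cS: "convex hstrip" by (intro convex_Times) auto
  have a: "at z within hstrip = at z" using z by (intro at_within_open open_Times) auto
  have hs: "\<bar>fst z\<bar> \<le> 1/2" if "z \<in> hstrip" for z using that by auto
  show "(TC c j has_derivative (\<lambda>h. TC (\<lambda>n. c n * real (dg n - j)) (Suc j) z * fst h + TS (\<lambda>n. - (kd n * c n)) j z * snd h)) (at z)"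
    unfolding TC_def TS_def a[symmetric]
  proof (rule series_has_derivative_2d[OF cS _ _ _ _ M z])
    fix m z assume z: "z \<in> hstrip"
    let ?n = "prod_decode m"
    show "((\<lambda>z. c ?n * (fst z ^ (dg ?n - j) * cos (kd ?n * snd z))) has_derivative
      (\<lambda>h. c ?n * real (dg ?n - j) * (fst z ^ (dg ?n - Suc j) * cos (kd ?n * snd z)) * fst h + - (kd ?n * c ?n) * (fst z ^ (dg ?n - j) * sin (kd ?n * snd z)) * snd h)) (at z within hstrip)"
      by (auto intro!: derivative_eq_intros simp: algebra_simps)
    show "\<bar>c ?n * (fst z ^ (dg ?n - j) * cos (kd ?n * snd z))\<bar> \<le> M m"
      "\<bar>c ?n * real (dg ?n - j) * (fst z ^ (dg ?n - Suc j) * cos (kd ?n * snd z))\<bar> \<le> M m"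
      by (rule order_trans[OF M1(2)[OF hs[OF z]] le(1)], simp, rule order_trans[OF M2(2)[OF hs[OF z]] le(2)], simp)
    have "\<bar>kd ?n * c ?n * (fst z ^ (dg ?n - j) * sin (kd ?n * snd z))\<bar> \<le> M m"
      by (rule order_trans[OF M3(2)[OF hs[OF z]] le(3)], simp)
    then show "\<bar>- (kd ?n * c ?n) * (fst z ^ (dg ?n - j) * sin (kd ?n * snd z))\<bar> \<le> M m" by simp
  qed
  show "(TS c j has_derivative (\<lambda>h. TS (\<lambda>n. c n * real (dg n - j)) (Suc j) z * fst h + TC (\<lambda>n. kd n * c n) j z * snd h)) (at z)"
    unfolding TC_def TS_def a[symmetric]
  proof (rule series_has_derivative_2d[OF cS _ _ _ _ M z])
    fix m z assume z: "z \<in> hstrip"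
    let ?n = "prod_decode m"
    show "((\<lambda>z. c ?n * (fst z ^ (dg ?n - j) * sin (kd ?n * snd z))) has_derivative
      (\<lambda>h. c ?n * real (dg ?n - j) * (fst z ^ (dg ?n - Suc j) * sin (kd ?n * snd z)) * fst h + kd ?n * c ?n * (fst z ^ (dg ?n - j) * cos (kd ?n * snd z)) * snd h)) (at z within hstrip)"
      by (auto intro!: derivative_eq_intros simp: algebra_simps)
    show "\<bar>c ?n * (fst z ^ (dg ?n - j) * sin (kd ?n * snd z))\<bar> \<le> M m"
      "\<bar>c ?n * real (dg ?n - j) * (fst z ^ (dg ?n - Suc j) * sin (kd ?n * snd z))\<bar> \<le> M m"
      "\<bar>kd ?n * c ?n * (fst z ^ (dg ?n - j) * cos (kd ?n * snd z))\<bar> \<le> M m"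
      by (rule order_trans[OF M1(2)[OF hs[OF z]] le(1)], simp, rule order_trans[OF M2(2)[OF hs[OF z]] le(2)], simp,
          rule order_trans[OF M3(2)[OF hs[OF z]] le(3)], simp)
  qed
qed

lemma T_smooth:
  assumes "pbd UNIV (\<lambda>n (_::real). c n)"
  shows "smooth2 hstrip (TC c j)" "smooth2 hstrip (TS c j)"
proof -
  have "Cn n hstrip (TC c j) \<and> Cn n hstrip (TS c j)" for n using assms
  proof (induction n arbitrary: c j)
    case 0
    have "continuous_on hstrip (TC c j)" "continuous_on hstrip (TS c j)"
      by (rule has_derivative_continuous_on[OF has_derivative_at_withinI[OF T_deriv(1)[OF 0]]], assumption,
          rule has_derivative_continuous_on[OF has_derivative_at_withinI[OF T_deriv(2)[OF 0]]], assumption)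
    then show ?case by simp
  next
    case (Suc n)
    have p: "pbd UNIV (\<lambda>n (_::real). c n * real (dg n - j))" "pbd UNIV (\<lambda>n (_::real). - (kd n * c n))" "pbd UNIV (\<lambda>n (_::real). kd n * c n)"
      using pbd_mult[OF Suc.prems pbd_dg] pbd_mult[OF pbd_const[of UNIV "-1"] pbd_mult[OF pbd_kd Suc.prems]] pbd_mult[OF pbd_kd Suc.prems] by simp_all
    show ?case
      using CnI[OF T_deriv(1)[OF Suc.prems], where n=n] CnI[OF T_deriv(2)[OF Suc.prems], where n=n] Suc.IH[OF p(1)] Suc.IH[OF p(2)] Suc.IH[OF p(3)] by blast
  qed
  then show "smooth2 hstrip (TC c j)" "smooth2 hstrip (TS c j)" by (auto simp: smooth2_def)
qed

text \<open>At \<open>s = 0\<close> only terms with exponent 0 survive. For \<open>j = 1\<close>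
  truncation gives exponent 0 to the index \<open>(0,0)\<close> as well, hence the condition on that
  coefficient.\<close>

lemma T_at_0:
  "TC c 0 (0, x) = c (0, 0)" "TS c 0 (0, x) = 0"
  "c (0, 0) = 0 \<Longrightarrow> TC c (Suc 0) (0, x) = (c (Suc 0, 0) + c (0, Suc 0)) * cos x"
proof -
  have fin: "suminf f = f (prod_encode (0, 0)) + f (prod_encode (Suc 0, 0)) + f (prod_encode (0, Suc 0))"
    if "\<And>m. dg (prod_decode m) > 1 \<Longrightarrow> f m = 0" for f :: "nat \<Rightarrow> real"
  proof -
    have "suminf f = sum f {prod_encode (0, 0), prod_encode (Suc 0, 0), prod_encode (0, Suc 0)}"
    proof (rule suminf_finite)
      fix m assume "m \<notin> {prod_encode (0, 0), prod_encode (Suc 0, 0), prod_encode (0, Suc 0)}"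
      then have "prod_decode m \<notin> {(0, 0), (Suc 0, 0), (0, Suc 0)}" by (metis insert_iff prod_decode_inverse empty_iff)
      then have "dg (prod_decode m) > 1" by (cases "prod_decode m") (auto simp: dg_def)
      then show "f m = 0" by (rule that)
    qed simp
    also have "\<dots> = f (prod_encode (0, 0)) + f (prod_encode (Suc 0, 0)) + f (prod_encode (0, Suc 0))"
      by (simp add: prod_encode_eq)
    finally show ?thesis .
  qed
  show "TC c 0 (0, x) = c (0, 0)" unfolding TC_def by (rule trans[OF fin]) (auto simp: dg_def kd_def)
  show "TS c 0 (0, x) = 0" unfolding TS_def by (rule trans[OF fin]) (auto simp: dg_def kd_def)
  show "TC c (Suc 0) (0, x) = (c (Suc 0, 0) + c (0, Suc 0)) * cos x" if "c (0, 0) = 0"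
    unfolding TC_def by (rule trans[OF fin]) (use that in \<open>auto simp: dg_def kd_def algebra_simps\<close>)
qed

lemma expanding_deriv_nonzero:
  assumes "\<And>x y. \<bar>x - y\<bar> \<le> 2 * \<bar>f x - f y :: real\<bar>" "(f has_real_derivative D) (at x)"
  shows "D \<noteq> 0"
proof
  assume "D = 0"
  with assms(2) have "(f has_derivative (\<lambda>h. 0)) (at x)" by (simp add: has_field_derivative_def mult_zero_left[abs_def])
  then obtain d where d: "d > 0" "\<And>y. norm (y - x) < d \<Longrightarrow> norm (f y - f x - 0) \<le> 1/4 * norm (y - x)"
    unfolding has_derivative_within_alt by (metis UNIV_I zero_less_divide_1_iff zero_less_numeral)
  have "\<bar>f (x + d/2) - f x\<bar> \<le> 1/4 * (d/2)" using d(2)[of "x + d/2"] d(1) by simp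
  moreover have "\<bar>x + d/2 - x\<bar> \<le> 2 * \<bar>f (x + d/2) - f x\<bar>" by (rule assms(1))
  ultimately show False using d(1) by simp
qed

lemma smooth_real_curve_of_smooth2:
  assumes u: "smooth2 (I \<times> UNIV) u" and I: "open I" and f: "\<And>s. s \<in> I \<Longrightarrow> f s = u (s, 0)"
  shows "smooth_real_curve I f"
proof -
  have o: "open (I \<times> (UNIV :: real set))" using I by (intro open_Times) auto
  have step: "\<exists>w. smooth2 (I \<times> UNIV) w \<and> (\<forall>s\<in>I. (g has_real_derivative w (s, 0)) (at s))"
    if v: "smooth2 (I \<times> UNIV) v" "\<forall>s\<in>I. g s = v (s, 0)" for v g
  proof -
    have "\<exists>u1 u2. pder I v u1 u2 \<and> smooth2 (I \<times> UNIV) u1" unfolding pder_def by (rule smooth2_partials[OF v(1) o]) blast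
    then obtain u1 u2 where d: "pder I v u1 u2" "smooth2 (I \<times> UNIV) u1" by blast
    have "(g has_real_derivative u1 (s, 0)) (at s)" if "s \<in> I" for s
      by (rule has_field_derivative_transform_within_open[OF slice_derivs(1)[OF d(1) that] I that]) (use v(2) in auto)
    then show ?thesis using d(2) by blast
  qed
  have "\<exists>v. smooth2 (I \<times> UNIV) v \<and> (\<forall>s\<in>I. (deriv ^^ n) f s = v (s, 0))" for n
  proof (induction n)
    case 0 then show ?case using u f by auto
  next
    case (Suc n)
    then obtain v where "smooth2 (I \<times> UNIV) v" "\<forall>s\<in>I. (deriv ^^ n) f s = v (s, 0)" by blast
    from step[OF this] obtain w where "smooth2 (I \<times> UNIV) w" "\<forall>s\<in>I. ((deriv ^^ n) f has_real_derivative w (s, 0)) (at s)" by blast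
    then show ?case by (intro exI[of _ w]) (auto intro: DERIV_imp_deriv)
  qed
  then have "(deriv ^^ n) f differentiable_on I" for n
    using step[of _ "(deriv ^^ n) f"] unfolding differentiable_on_def
    by (meson differentiable_at_withinI real_differentiable_def)
  then show ?thesis by (simp add: smooth_real_curve_def)
qed

lemma pbd_at: "pbd S c \<Longrightarrow> \<theta> \<in> S \<Longrightarrow> pbd UNIV (\<lambda>n (_::real). c n \<theta>)"
  unfolding pbd_def by blast

lemma smooth2_divide: "smooth2 U u \<Longrightarrow> smooth2 U v \<Longrightarrow> (\<And>p. p \<in> U \<Longrightarrow> v p \<noteq> 0) \<Longrightarrow> smooth2 U (\<lambda>p. u p / v p)"
  using smooth2_mult[OF _ smooth2_inverse] by (simp add: divide_inverse)

lemma hstrip_fst: "p \<in> hstrip \<Longrightarrow> \<bar>fst p\<bar> \<le> 1/2" "p \<in> hstrip \<Longrightarrow> fst p \<in> {-(1/2)<..<1/2}" by auto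

section \<open>Smoothness and first order expansion of the boundary curves\<close>

context mode_sol
begin

definition "Xb z = snd z + TS (\<lambda>n. xe n (pi/2)) 0 z"
definition "Yb z = pi/2 + TC (\<lambda>n. cf Y n (pi/2)) 0 z"
definition "omf s = sqrt (3 * (1 + Lam s))"
definition "muf l s = l\<^sup>2 * (4 * (1 + Nn s) / (3 * (1 + Lam s)))"
text \<open>The inverse of the first component of the map on the edge \<open>pi/2\<close>: it tells
  which strip point lies on the boundary over a given scaled longitude.\<close>

definition "psi p = strip_sol.chi (Xz (fst p)) (snd p) (pi/2)"
definition "hf l p = arctan (sinh (omf (fst p) * Yb (fst p, psi (fst p, l * snd p)) / l))"

lemma Xb: "Xz s (\<xi>, pi/2) = Xb (s, \<xi>)" by (simp add: Xz_def Xb_def FS_def TS_def)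

lemma Yb: "Yz s (\<xi>, pi/2) = Yb (s, \<xi>)"
  by (simp add: Yz_def Yb_def FC_def TC_def)

lemma Lam_TC: "Lam s = TC (\<lambda>n. cf L n 0) 0 (s, \<xi>)" and Nn_TC: "Nn s = TC (\<lambda>n. cf N n 0) 0 (s, \<xi>)"
  using val_L[of s \<xi> 0] val_N[of s \<xi> 0] by (simp_all add: val_def FC_def TC_def)

lemma pbd_b: "pbd UNIV (\<lambda>n (_::real). xe n (pi/2))" "pbd UNIV (\<lambda>n (_::real). cf A n \<theta>)"
  by (rule pbd_at[OF pbd_xe(1)], simp, rule pbd_at[OF pbd_cf[of UNIV]], simp)

lemma smooth_b: "smooth2 hstrip Xb" "smooth2 hstrip Yb" "smooth2 hstrip (\<lambda>z. Lam (fst z))" "smooth2 hstrip (\<lambda>z. Nn (fst z))"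
proof -
  show "smooth2 hstrip Xb" "smooth2 hstrip Yb" unfolding Xb_def[abs_def] Yb_def[abs_def]
    by (rule smooth2_add[OF smooth2_snd T_smooth(2)[OF pbd_b(1)]], rule smooth2_add[OF smooth2_const T_smooth(1)[OF pbd_b(2)]])
  have "(\<lambda>z. Lam (fst z)) = TC (\<lambda>n. cf L n 0) 0" "(\<lambda>z. Nn (fst z)) = TC (\<lambda>n. cf N n 0) 0"
    using Lam_TC Nn_TC by (simp_all add: fun_eq_iff)
  then show "smooth2 hstrip (\<lambda>z. Lam (fst z))" "smooth2 hstrip (\<lambda>z. Nn (fst z))" by (simp_all only: T_smooth[OF pbd_b(2)])
qed

lemma Yb_pder: "pder {-(1/2)<..<1/2} Yb (TC (\<lambda>n. cf Y n (pi/2) * real (dg n - 0)) (Suc 0)) (TS (\<lambda>n. - (kd n * cf Y n (pi/2))) 0)"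
  unfolding pder_def Yb_def[abs_def]
  by (intro ballI has_derivative_eq_rhs[OF has_derivative_add[OF has_derivative_const T_deriv(1)[OF pbd_b(2)]]]) auto

text \<open>The factor 2 collects the two coefficients \<open>\<kappa>^3\<close> at
  \<open>(1,0)\<close> and \<open>(0,1)\<close>, the only ones of degree one.\<close>

lemma Y_at_0: "Yb (0, x) = pi/2" "TC (\<lambda>n. cf Y n (pi/2) * real (dg n - 0)) (Suc 0) (0, x) = 2 * \<kappa>^3 * cos x"
  "TS (\<lambda>n. - (kd n * cf Y n (pi/2))) 0 (0, x) = 0"
proof -
  have "cf Y (0, 0) (pi/2) = 0" by (rule Y_0(2)) (simp add: kd_def)
  then show "Yb (0, x) = pi/2" by (simp add: Yb_def T_at_0)
  show "TC (\<lambda>n. cf Y n (pi/2) * real (dg n - 0)) (Suc 0) (0, x) = 2 * \<kappa>^3 * cos x"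
    by (subst T_at_0(3)) (simp_all add: dg_def Y_0)
  show "TS (\<lambda>n. - (kd n * cf Y n (pi/2))) 0 (0, x) = 0" by (rule T_at_0(2))
qed

text \<open>\<open>L\<close> is diagonal and so has no coefficients of degree one.\<close>

lemma Lam_deriv_0: "(Lam has_real_derivative 0) (at 0)"
proof -
  have "pder {-(1/2)<..<1/2} (TC (\<lambda>n. cf L n 0) 0) (TC (\<lambda>n. cf L n 0 * real (dg n - 0)) (Suc 0)) (TS (\<lambda>n. - (kd n * cf L n 0)) 0)"
    unfolding pder_def by (intro ballI T_deriv(1)[OF pbd_b(2)])
  from slice_derivs(1)[OF this, of 0 0]
  have "((\<lambda>s. TC (\<lambda>n. cf L n 0) 0 (s, 0)) has_real_derivative TC (\<lambda>n. cf L n 0 * real (dg n - 0)) (Suc 0) (0, 0)) (at 0)" by simp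
  moreover have "(\<lambda>s. TC (\<lambda>n. cf L n 0) 0 (s, 0)) = Lam" using Lam_TC[of _ 0] by (simp add: fun_eq_iff)
  moreover have "TC (\<lambda>n. cf L n 0 * real (dg n - 0)) (Suc 0) (0, 0) = 0"
    by (subst T_at_0(3)) (simp_all add: dg_def diag(2))
  ultimately show ?thesis by simp
qed

context
  fixes l :: real
  assumes d1: "\<delta> * Mz \<le> 1/100" and d2: "4 * \<delta> * ((1 + norm thA) * Mz)\<^sup>2 < 1" and l: "l > 0" "\<epsilon> = 1 / l\<^sup>2"
begin

lemma strip_at: "\<bar>s\<bar> \<le> 1/2 \<Longrightarrow> strip_sol (omf s) (4 * (1 + Nn s) / (3 * (1 + Lam s))) l (Xz s) (Yz s) (az s) (bz s) (bxz s) (btz s)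
    (Wz s) (Wxz s) (Wtz s) (Wxxz s) (Wxtz s) (Wttz s)"
  unfolding omf_def by (rule strip_solution[OF _ d1 d2 l])

lemma om_pos: "\<bar>s\<bar> \<le> 1/2 \<Longrightarrow> omf s > 0" "\<bar>s\<bar> \<le> 1/2 \<Longrightarrow> 3 * (1 + Lam s) > 0" "\<bar>s\<bar> \<le> 1/2 \<Longrightarrow> omf s \<le> 2"
proof -
  assume s: "\<bar>s\<bar> \<le> 1/2"
  interpret strip_sol "omf s" "4 * (1 + Nn s) / (3 * (1 + Lam s))" l "Xz s" "Yz s" "az s" "bz s" "bxz s" "btz s"
    "Wz s" "Wxz s" "Wtz s" "Wxxz s" "Wxtz s" "Wttz s" by (rule strip_at[OF s])
  show "omf s > 0" by (rule om(1))
  then show "3 * (1 + Lam s) > 0" by (simp add: omf_def)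
  have "(2::real)\<^sup>2 = 4" by simp
  with om(2) have "(omf s)\<^sup>2 \<le> 2\<^sup>2" by (simp only:)
  then show "omf s \<le> 2" by (rule power2_le_imp_le) simp
qed

lemma psi: "\<bar>s\<bar> \<le> 1/2 \<Longrightarrow> Xb (s, psi (s, x)) = x"
proof -
  assume s: "\<bar>s\<bar> \<le> 1/2"
  show ?thesis using strip_sol.chi[OF strip_at[OF s], of "pi/2" x] unfolding Xb psi_def by simp
qed

lemma Xb_expand: "\<bar>s\<bar> \<le> 1/2 \<Longrightarrow> \<bar>x - y\<bar> \<le> 2 * \<bar>Xb (s, x) - Xb (s, y)\<bar>"
proof -
  assume s: "\<bar>s\<bar> \<le> 1/2"
  have "\<bar>Xb (s, x) - Xb (s, y) - (x - y)\<bar> \<le> 1/10 * \<bar>x - y\<bar>"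
    using strip_sol.X_lip(1)[OF strip_at[OF s], of "(x, pi/2)" "(y, pi/2)"] by (simp add: Xb)
  from abs_diff_bound[OF this] show ?thesis using tenth_bound[of "\<bar>x - y\<bar>" "\<bar>Xb (s, x) - Xb (s, y)\<bar>" 0] by simp
qed

lemma smooth_psi: "smooth2 hstrip psi"
proof -
  have "open hstrip" by (intro open_Times) auto
  then have "\<exists>X1 X2. pder {-(1/2)<..<1/2} Xb X1 X2" unfolding pder_def by (rule smooth2_partials[OF smooth_b(1)]) blast
  then obtain X1 X2 where X: "pder {-(1/2)<..<1/2} Xb X1 X2" by blast
  show ?thesis
  proof (rule smooth2_implicit[where I="{-(1/2)<..<1/2}" and K=2, OF refl _ smooth_b(1)])
    show "(Xb has_derivative (\<lambda>h. X1 p * fst h + X2 p * snd h)) (at p)" if "p \<in> hstrip" for p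
      by (rule X[unfolded pder_def, rule_format, OF that])
    show "X2 p \<noteq> 0" if "p \<in> hstrip" for p
      using expanding_deriv_nonzero[OF Xb_expand[OF hstrip_fst(1)[OF that]] slice_derivs(2)[OF X hstrip_fst(2)[OF that]], of "snd p"] by simp
    show "\<bar>x - y\<bar> \<le> 2 * \<bar>Xb (s, x) - Xb (s, y)\<bar>" if "s \<in> {-(1/2)<..<1/2}" for s x y by (rule Xb_expand) (use that in auto)
    show "Xb (fst p, psi p) = snd p" if "p \<in> hstrip" for p using psi[of "fst p" "snd p"] that by auto
  qed auto
qed

lemma smooth_om: "smooth2 hstrip (\<lambda>p. omf (fst p))"
  unfolding omf_def
  by (rule smooth2_sqrt[OF smooth2_mult[OF smooth2_const smooth2_add[OF smooth2_const smooth_b(3)]]]) (use om_pos(2) in auto)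

lemma smooth_mu: "smooth2 hstrip (\<lambda>p. muf l (fst p))"
proof -
  have "3 * (1 + Lam (fst p)) \<noteq> 0" if "p \<in> hstrip" for p using om_pos(2)[OF hstrip_fst(1)[OF that]] by simp
  then show ?thesis unfolding muf_def
    by (intro smooth2_mult smooth2_add smooth2_const smooth_b smooth2_divide)
qed

lemma smooth_hf: "smooth2 hstrip (hf l)"
proof -
  have g: "smooth2 hstrip (\<lambda>p. psi (fst p, l * snd p))"
    by (rule smooth2_comp[OF smooth_psi smooth2_fst smooth2_mult[OF smooth2_const smooth2_snd]]) auto
  have "smooth2 hstrip (\<lambda>p. Yb (fst p, psi (fst p, l * snd p)))"
    by (rule smooth2_comp[OF smooth_b(2) smooth2_fst g]) auto
  then show ?thesis unfolding hf_def[abs_def]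
    by (intro smooth2_gd smooth2_mult smooth_om smooth2_const smooth2_divide) (use l(1) in simp_all)
qed

lemma psi_0: "psi (0, x) = x"
  using psi[of 0 x] by (simp add: Xb_def T_at_0)

lemma hf_0: "hf l (0, x) = arctan (sinh (omf 0 * (pi/2) / l))"
  by (simp add: hf_def Y_at_0)

text \<open>To first order neither \<open>om\<close> nor the reparametrisation \<open>psi\<close>
  contributes: the derivative of \<open>omf\<close> vanishes, and at \<open>s = 0\<close> the height
  \<open>Yb\<close> does not depend on \<xi>. Only the explicit derivative of \<open>Yb\<close>
  remains.\<close>

lemma hf_deriv_0:
  "((\<lambda>s. hf l (s, x)) has_real_derivative inverse (cosh (omf 0 * (pi/2) / l)) * (omf 0 * (2 * \<kappa>^3) / l) * cos (l * x)) (at 0)"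
proof -
  have o: "open hstrip" by (intro open_Times) auto
  have "\<exists>p1 p2. pder {-(1/2)<..<1/2} psi p1 p2" unfolding pder_def by (rule smooth2_partials[OF smooth_psi o]) blast
  then obtain p1 p2 where p: "pder {-(1/2)<..<1/2} psi p1 p2" by blast
  have d1: "((\<lambda>s. psi (s, l * x)) has_derivative (\<lambda>h. p1 (0, l * x) * h)) (at 0)"
    using slice_derivs(1)[OF p, of 0 "l * x"] by (simp add: has_field_derivative_def)
  have Y: "(Yb has_derivative (\<lambda>h. 2 * \<kappa>^3 * cos (l * x) * fst h + 0 * snd h)) (at (0, psi (0, l * x)))"
    using pderD[OF Yb_pder, of 0 "psi (0, l * x)"] unfolding psi_0 Y_at_0 by simp
  have Yd: "((\<lambda>s. Yb (s, psi (s, l * x))) has_real_derivative 2 * \<kappa>^3 * cos (l * x)) (at 0)"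
    unfolding has_field_derivative_def
    by (rule has_derivative_eq_rhs[OF has_derivative_compose[OF has_derivative_Pair[OF has_derivative_ident d1] Y]]) auto
  have om: "(omf has_real_derivative 0) (at 0)" unfolding omf_def[abs_def]
    by (rule DERIV_cong[OF DERIV_chain2[OF DERIV_real_sqrt[OF om_pos(2)] DERIV_cmult[OF DERIV_add[OF DERIV_const Lam_deriv_0]]]]) auto
  have e: "((\<lambda>s. omf s * Yb (s, psi (s, l * x)) / l) has_real_derivative omf 0 * (2 * \<kappa>^3 * cos (l * x)) / l) (at 0)"
    by (rule DERIV_cong[OF DERIV_cdivide[OF DERIV_mult[OF om Yd]]]) simp
  have "((\<lambda>s. arctan (sinh (omf s * Yb (s, psi (s, l * x)) / l))) has_real_derivative
    inverse (cosh (omf 0 * Yb (0, psi (0, l * x)) / l)) * (omf 0 * (2 * \<kappa>^3 * cos (l * x)) / l)) (at 0)"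
    by (rule DERIV_chain2[OF gd_has_derivative e])
  then show ?thesis by (simp add: hf_def Y_at_0 mult_ac)
qed

lemma hf_solution:
  assumes s: "\<bar>s\<bar> \<le> 1/2" and n: "l = real n"
  shows "\<exists>w. classical_solution (muf l s) (sphere_domain (\<lambda>x. hf l (s, x))) w"
    and "hf l (s, x + 2 * pi) = hf l (s, x)" "hf l (s, - x) = hf l (s, x)" "0 < hf l (s, x)" "hf l (s, x) < pi/2" "muf l s > 0"
proof -
  interpret S: strip_sol "omf s" "4 * (1 + Nn s) / (3 * (1 + Lam s))" l "Xz s" "Yz s" "az s" "bz s" "bxz s" "btz s"
    "Wz s" "Wxz s" "Wtz s" "Wxxz s" "Wxtz s" "Wttz s" by (rule strip_at[OF s])
  have Hp: "S.Hp x = omf s * Yb (s, psi (s, l * x)) / l" for x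
    by (simp add: S.Hp_def S.Hs_def S.yf_def Yb psi_def)
  have h: "planar_sol.hh S.Hp = (\<lambda>x. hf l (s, x))"
    by (simp add: fun_eq_iff planar_sol.hh_def[OF S.planar[OF n]] hf_def Hp)
  note P = S.planar[OF n]
  show "\<exists>w. classical_solution (muf l s) (sphere_domain (\<lambda>x. hf l (s, x))) w"
    using planar_sol.sphere_solution[OF P] unfolding h muf_def by blast
  show "hf l (s, x + 2 * pi) = hf l (s, x)"
    using planar_sol.H_per[OF P, of x] unfolding hf_def fst_conv snd_conv Hp by (simp only:)
  have "S.Hp (- x) = S.Hp x" by (simp add: S.Hp_def S.Hs_symm)
  then show "hf l (s, - x) = hf l (s, x)" unfolding hf_def fst_conv snd_conv Hp by (simp only:)
  have "S.Hp x > 0" by (rule planar_sol.H_pos[OF P])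
  then show "0 < hf l (s, x)" "hf l (s, x) < pi/2" unfolding hf_def fst_conv snd_conv Hp[symmetric]
    using arctan_ubound[of "sinh (S.Hp x)"] by simp_all
  show "muf l s > 0" unfolding muf_def using S.m_pos l(1) by (intro mult_pos_pos) simp_all
qed

end

end

section \<open>Choice of the constants and assembly of the curve\<close>

lemma gd_le: assumes "0 \<le> v" shows "arctan (sinh v) \<le> v"
proof -
  have "norm (arctan (sinh v) - arctan (sinh 0)) \<le> 1 * norm (v - 0)"
  proof (rule field_differentiable_bound[of UNIV])
    show "((\<lambda>v. arctan (sinh v)) has_real_derivative inverse (cosh x)) (at x within UNIV)" for x by (rule gd_has_derivative)
    show "norm (inverse (cosh x)) \<le> 1" for x :: real using cosh_real_ge_1[of x] by (simp add: inverse_le_1_iff)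
  qed auto
  then show ?thesis using assms by simp
qed

lemma uniform_limit_of_difference_quotient:
  assumes u: "perf I u" and I: "open I" "0 \<in> I" and c: "\<And>x. u (0, x) = c"
    and d: "\<And>x. ((\<lambda>s. u (s, x)) has_real_derivative g x) (at 0)"
  shows "uniform_limit UNIV (\<lambda>s x. (u (s, x) - (c + s * g x)) / s) (\<lambda>x. 0) (at 0)"
proof (rule uniform_limitI)
  fix e :: real assume e: "e > 0"
  obtain u1 u2 where u1: "pder I u u1 u2" using perf_partials[OF u I(1)] by blast
  obtain B d where B: "B \<ge> 0" "d > 0" "\<forall>k. k \<noteq> 0 \<longrightarrow> \<bar>k\<bar> \<le> d \<longrightarrow> 0 + k \<in> I \<and> (\<forall>x. \<bar>(u (0 + k, x) - u (0, x)) / k - u1 (0, x)\<bar> \<le> B * \<bar>k\<bar>)"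
    using difference_quotient_bound[OF u I u1] by blast
  have g: "u1 (0, x) = g x" for x by (rule DERIV_unique[OF slice_derivs(1)[OF u1 I(2)] d])
  show "\<forall>\<^sub>F s in at 0. \<forall>x\<in>UNIV. dist ((u (s, x) - (c + s * g x)) / s) 0 < e"
    unfolding eventually_at
  proof (intro exI[of _ "min d (e / (B + 1))"] conjI ballI impI)
    show "0 < min d (e / (B + 1))" using B e by simp
    fix s x :: real assume s: "s \<noteq> 0 \<and> dist s 0 < min d (e / (B + 1))"
    then have s': "s \<noteq> 0" "\<bar>s\<bar> \<le> d" "\<bar>s\<bar> * (B + 1) < e" using B(1) by (auto simp: pos_less_divide_eq)
    have "(u (s, x) - (c + s * g x)) / s = (u (0 + s, x) - u (0, x)) / s - u1 (0, x)"
      using s'(1) by (simp add: c g field_simps)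
    then have "\<bar>(u (s, x) - (c + s * g x)) / s\<bar> \<le> B * \<bar>s\<bar>" using B(3) s'(1,2) by simp
    also have "\<dots> \<le> \<bar>s\<bar> * (B + 1)" by (simp add: distrib_left mult.commute)
    finally show "dist ((u (s, x) - (c + s * g x)) / s) 0 < e" using s'(3) by simp
  qed
qed

theorem theorem1p5:
  fixes \<alpha> :: real
  assumes "0 < \<alpha>" and "\<alpha> < 1"
  shows "\<forall>lam0 :: real. 0 < lam0 \<and> lam0 < 1 \<longrightarrow>
    (\<exists>l\<^sub>0 :: nat. \<forall>l :: nat. l \<ge> l\<^sub>0 \<longrightarrow>
      (\<exists>(\<epsilon> :: real) (\<mu> :: real \<Rightarrow> real) (\<xi> :: real \<Rightarrow> real) (h :: real \<Rightarrow> real \<Rightarrow> real).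
        \<epsilon> > 0 \<and>
        smooth_product_curve \<alpha> {-\<epsilon><..<\<epsilon>} (\<lambda>s. (\<mu> s, \<xi> s, h s)) \<and>
        (\<forall>s \<in> {-\<epsilon><..<\<epsilon>}. (\<mu> s, \<xi> s, h s) \<in> {0<..} \<times> {0<..<lam0} \<times> P_sphere \<alpha>) \<and>
        uniform_limit UNIV (\<lambda>s x. (h s x - (\<xi> s + s * cos (real l * x))) / s) (\<lambda>x. 0) (at 0) \<and>
        (\<forall>s \<in> {-\<epsilon><..<\<epsilon>}. \<exists>w. classical_solution (\<mu> s) (sphere_domain (h s)) w)))"
proof (intro allI impI)
  fix lam0 :: real assume "0 < lam0 \<and> lam0 < 1"
  then have lam0: "0 < lam0" by simp
  \<comment> \<open>Available before any instance of the locale, since \<open>Mz\<close> has no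
    parameters: \<delta> can be fixed first and \<kappa> found from it afterwards.\<close>
  define M where "M = mode_sol.Mz"
  define Q where "Q = ((1 + norm thA) * M)\<^sup>2"
  \<comment> \<open>The two entries serve the two smallness conditions \<open>d1\<close> and
    \<open>d2\<close> in turn; the summands 1 avoid division by zero.\<close>
  define \<delta> where "\<delta> = min (1 / (100 * (1 + \<bar>M\<bar>))) (1 / (8 * (1 + Q)))"
  have Q: "Q \<ge> 0" by (simp add: Q_def)
  have \<delta>: "\<delta> > 0" using Q by (simp add: \<delta>_def add_pos_nonneg)
  have d1: "\<delta> * mode_sol.Mz \<le> 1/100"
  proof -
    have "\<delta> * M \<le> \<delta> * \<bar>M\<bar>" using \<delta> by (intro mult_left_mono) auto
    also have "\<dots> \<le> 1 / (100 * (1 + \<bar>M\<bar>)) * \<bar>M\<bar>" by (intro mult_right_mono) (auto simp: \<delta>_def)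
    also have "\<dots> \<le> 1/100" by (simp add: field_simps)
    finally show ?thesis by (simp add: M_def)
  qed
  have d2: "4 * \<delta> * ((1 + norm thA) * mode_sol.Mz)\<^sup>2 < 1"
  proof -
    have "4 * \<delta> * Q \<le> 4 * (1 / (8 * (1 + Q))) * Q" using Q by (intro mult_right_mono mult_left_mono) (auto simp: \<delta>_def)
    also have "\<dots> < 1" using Q by (simp add: field_simps)
    finally show ?thesis by (simp add: M_def Q_def)
  qed
  obtain \<kappa> where \<kappa>: "\<kappa> > 0" "\<And>\<epsilon>. 0 < \<epsilon> \<Longrightarrow> \<epsilon> \<le> \<kappa>^6 \<Longrightarrow> \<exists>V KV Y KY Y1 g r T N L V1. mode_sol \<kappa> \<epsilon> \<delta> V KV Y KY Y1 g r T N L V1"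
    by (rule mode_sol_exists[OF \<delta>], rule that, assumption, blast)
  \<comment> \<open>The first bound makes \<open>pi / l < lam0\<close>, which suffices since
    \<open>om \<le> 2\<close>; the second makes \<open>1 / l^2 \<le> \<kappa>^6\<close>, the range
    of \<epsilon> in which solutions were found.\<close>
  obtain l0 :: nat where l0: "max (pi / lam0) (1 / \<kappa>^3) < real l0" using reals_Archimedean2 by blast
  show "\<exists>l\<^sub>0 :: nat. \<forall>l :: nat. l \<ge> l\<^sub>0 \<longrightarrow>
      (\<exists>(\<epsilon> :: real) (\<mu> :: real \<Rightarrow> real) (\<xi> :: real \<Rightarrow> real) (h :: real \<Rightarrow> real \<Rightarrow> real).
        \<epsilon> > 0 \<and>
        smooth_product_curve \<alpha> {-\<epsilon><..<\<epsilon>} (\<lambda>s. (\<mu> s, \<xi> s, h s)) \<and>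
        (\<forall>s \<in> {-\<epsilon><..<\<epsilon>}. (\<mu> s, \<xi> s, h s) \<in> {0<..} \<times> {0<..<lam0} \<times> P_sphere \<alpha>) \<and>
        uniform_limit UNIV (\<lambda>s x. (h s x - (\<xi> s + s * cos (real l * x))) / s) (\<lambda>x. 0) (at 0) \<and>
        (\<forall>s \<in> {-\<epsilon><..<\<epsilon>}. \<exists>w. classical_solution (\<mu> s) (sphere_domain (h s)) w))"
  proof (rule exI[of _ l0], intro allI impI)
    fix l :: nat assume "l \<ge> l0"
    then have ll: "pi / lam0 < real l" "1 / \<kappa>^3 < real l" using l0 by auto
    have lpos: "real l > 0" using ll(1) lam0 by (meson divide_pos_pos order_less_trans pi_gt_zero)
    have lam: "pi / real l < lam0" using ll(1) lam0 lpos by (simp add: field_simps)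
    have "1 / (real l)\<^sup>2 \<le> \<kappa>^6"
    proof -
      have "1 / real l < \<kappa>^3" using ll(2) lpos \<kappa>(1) by (simp add: field_simps)
      then have "(1 / real l)\<^sup>2 \<le> (\<kappa>^3)\<^sup>2" using lpos by (intro power_mono) auto
      then show ?thesis by (simp add: power_divide flip: power_mult)
    qed
    with \<kappa>(2)[of "1 / (real l)\<^sup>2"] lpos obtain V KV Y KY Y1 g r T N L V1
      where ms: "mode_sol \<kappa> (1 / (real l)\<^sup>2) \<delta> V KV Y KY Y1 g r T N L V1" by auto
    interpret mode_sol \<kappa> "1 / (real l)\<^sup>2" \<delta> V KV Y KY Y1 g r T N L V1 by (rule ms)
    note A = d1 d2 lpos refl
    have z: "\<bar>0::real\<bar> \<le> 1/2" by simp
    have om0: "omf 0 > 0" "omf 0 \<le> 2" using om_pos(1,3)[OF A z] by auto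
    define y0 where "y0 = omf 0 * (pi/2) / real l"
    \<comment> \<open>The amplitude of the cosine in the first order term. Rescaling the parameter
      by its reciprocal \<gamma> normalises it to 1, and \<open>e\<close> keeps
      \<open>\<gamma> * s\<close> in the range \<open>(-1/2, 1/2)\<close> where the series are
      controlled.\<close>
    define c where "c = inverse (cosh y0) * (omf 0 * (2 * \<kappa>^3) / real l)"
    define \<gamma> where "\<gamma> = 1 / c"
    define e where "e = 1 / (2 * \<gamma>)"
    define u where "u p = hf (real l) (\<gamma> * fst p, snd p)" for p
    define I where "I = {-e<..<e}"
    have c: "c > 0" using om0 \<kappa>(1) lpos by (simp add: c_def)
    have \<gamma>: "\<gamma> > 0" "\<gamma> * c = 1" using c by (simp_all add: \<gamma>_def)
    have e: "e > 0" using \<gamma> by (simp add: e_def)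
    have oI: "open I" "0 \<in> I" using e by (auto simp: I_def)
    have sc: "\<gamma> * s \<in> {-(1/2)<..<1/2}" if "s \<in> I" for s
    proof -
      have "\<bar>\<gamma> * s\<bar> < 1/2" using that \<gamma>(1) by (auto simp: I_def e_def abs_mult abs_less_iff field_simps)
      then show ?thesis by auto
    qed
    then have sc': "\<bar>\<gamma> * s\<bar> \<le> 1/2" if "s \<in> I" for s using sc[OF that] by (auto simp: abs_le_iff)
    note hs = hf_solution[OF A sc' refl]
    have sf: "smooth2 (I \<times> UNIV) (\<lambda>p. F (\<gamma> * fst p, snd p))" if "smooth2 hstrip F" for F
      by (rule smooth2_comp[OF that smooth2_mult[OF smooth2_const smooth2_fst] smooth2_snd]) (use sc in auto)
    have su: "smooth2 (I \<times> UNIV) u" unfolding u_def[abs_def] by (rule sf[OF smooth_hf[OF A]])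
    have pu: "perf I u" using su hs(2) by (simp add: perf_def u_def)
    have curve: "smooth_C2_Hoelder_curve \<alpha> I (\<lambda>s x. u (s, x))"
      by (rule smooth_curve[OF assms pu oI(1)]) (simp add: u_def hs(3))
    have mu: "smooth_real_curve I (\<lambda>s. muf (real l) (\<gamma> * s))"
      by (rule smooth_real_curve_of_smooth2[OF sf[OF smooth_mu[OF A]] oI(1)]) simp
    \<comment> \<open>\<xi> can be taken constant: the curve starts at a constant function, and its
      first order term is the cosine alone.\<close>
    have xi: "smooth_real_curve I (\<lambda>s. arctan (sinh y0))"
      by (rule smooth_real_curve_of_smooth2[OF smooth2_const oI(1)]) simp
    have u0: "u (0, x) = arctan (sinh y0)" for x by (simp add: u_def hf_0[OF A] y0_def)
    have ud: "((\<lambda>s. u (s, x)) has_real_derivative cos (real l * x)) (at 0)" for x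
    proof -
      have 1: "((\<lambda>s. \<gamma> * s) has_real_derivative \<gamma>) (at 0)" by (auto intro!: derivative_eq_intros)
      have 2: "((\<lambda>s. hf (real l) (s, x)) has_real_derivative c * cos (real l * x)) (at (\<gamma> * 0))"
        unfolding mult_zero_right c_def y0_def by (rule hf_deriv_0[OF A])
      have "((\<lambda>s. hf (real l) (\<gamma> * s, x)) has_real_derivative (c * cos (real l * x)) * \<gamma>) (at 0)"
        by (rule DERIV_chain2[OF 2 1])
      moreover have "(c * cos (real l * x)) * \<gamma> = cos (real l * x)" using \<gamma>(2) by (simp add: mult_ac)
      ultimately show ?thesis by (simp add: u_def)
    qed
    have y0: "0 < y0" "y0 < lam0"
    proof -
      show "0 < y0" using om0 lpos by (simp add: y0_def)
      have "y0 \<le> 2 * (pi/2) / real l" unfolding y0_def using om0 lpos by (intro divide_right_mono mult_right_mono) auto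
      then show "y0 < lam0" using lam by simp
    qed
    have xi0: "0 < arctan (sinh y0)" "arctan (sinh y0) < lam0" using y0 gd_le[of y0] by auto
    have "u (s, x) < pi/2 \<and> 0 < u (s, x)" if "s \<in> I" for s x using hs(4,5)[OF that] by (simp add: u_def)
    moreover have "(\<lambda>x. u (s, x)) \<in> C2_Hoelder_per_even \<alpha>" if "s \<in> I" for s
      using curve that unfolding smooth_C2_Hoelder_curve_def by blast
    ultimately have mem: "(\<lambda>x. u (s, x)) \<in> P_sphere \<alpha>" if "s \<in> I" for s using that by (simp add: P_sphere_def)
    show "\<exists>(\<epsilon> :: real) (\<mu> :: real \<Rightarrow> real) (\<xi> :: real \<Rightarrow> real) (h :: real \<Rightarrow> real \<Rightarrow> real).
        \<epsilon> > 0 \<and>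
        smooth_product_curve \<alpha> {-\<epsilon><..<\<epsilon>} (\<lambda>s. (\<mu> s, \<xi> s, h s)) \<and>
        (\<forall>s \<in> {-\<epsilon><..<\<epsilon>}. (\<mu> s, \<xi> s, h s) \<in> {0<..} \<times> {0<..<lam0} \<times> P_sphere \<alpha>) \<and>
        uniform_limit UNIV (\<lambda>s x. (h s x - (\<xi> s + s * cos (real l * x))) / s) (\<lambda>x. 0) (at 0) \<and>
        (\<forall>s \<in> {-\<epsilon><..<\<epsilon>}. \<exists>w. classical_solution (\<mu> s) (sphere_domain (h s)) w)"
    proof (rule exI[of _ e], rule exI[of _ "\<lambda>s. muf (real l) (\<gamma> * s)"], rule exI[of _ "\<lambda>s. arctan (sinh y0)"],
        rule exI[of _ "\<lambda>s x. u (s, x)"], intro conjI ballI)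
      show "e > 0" by fact
      show "smooth_product_curve \<alpha> {-e<..<e} (\<lambda>s. (muf (real l) (\<gamma> * s), arctan (sinh y0), \<lambda>x. u (s, x)))"
        unfolding smooth_product_curve_def using mu xi curve by (simp add: I_def)
      show "uniform_limit UNIV (\<lambda>s x. (u (s, x) - (arctan (sinh y0) + s * cos (real l * x))) / s) (\<lambda>x. 0) (at 0)"
        by (rule uniform_limit_of_difference_quotient[OF pu oI u0 ud])
      fix s assume "s \<in> {-e<..<e}"
      then have s: "s \<in> I" by (simp add: I_def)
      show "(muf (real l) (\<gamma> * s), arctan (sinh y0), \<lambda>x. u (s, x)) \<in> {0<..} \<times> {0<..<lam0} \<times> P_sphere \<alpha>"
        using mem[OF s] hs(6)[OF s] xi0 by simp
      show "\<exists>w. classical_solution (muf (real l) (\<gamma> * s)) (sphere_domain (\<lambda>x. u (s, x))) w"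
        using hs(1)[OF s] by (simp add: u_def)
    qed
  qed
qed

end
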